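(* Let $k,l$ be coprime non-negative integers with $kl(k-l)\neq 0$. For each $i\in\{k+l,l,k\}$ there exist a number $\theta_i>0$ and a continuous one-parameter family of forward complete cohomogeneity one $\mathrm{Spin}(7)$ metrics $\{\gamma^i_\theta \mid \theta\in(0,\theta_i]\}$ on $M^i_{k,l}$ (with principal orbit $N_{k,l}$ and singular orbit $\mathbb{CP}^2$) such that: (1) for every $\theta\in(0,\theta_i)$ the metric $\gamma^i_\theta$ is asymptotically locally conical (ALC), with ALC limit modeled on an $\mathbb{S}^1$-bundle over the $G_2$ cone on the homogeneous nearly K\"ahler $SU(3)/T^2$; (2) the metric $\gamma^i_{\theta_i}$ is asymptotically conical (AC). Moreover, the AC limits of $\gamma^k_{\theta_k}$ and $\gamma^l_{\theta_l}$ are both modeled on one and the same $SU(3)$-homogeneous Einstein metric on $N_{k,l}$, whereas the AC limit of $\gamma^{k+l}_{\theta_{k+l}}$ is modeled on another $SU(3)$-homogeneous Einstein metric on $N_{k,l}$.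
   Context: **Spaces.** $N_{k,l}=SU(3)/U(1)_{k,l}$ is the Aloff--Wallach space, where $U(1)_{k,l}=\{\mathrm{diag}(e^{k\sqrt{-1}t},e^{l\sqrt{-1}t},e^{-(k+l)\sqrt{-1}t})\}$. Put $\Delta=k^2+kl+l^2$. The condition $kl(k-l)\ne0$ is called the generic case; then $N_{k,l}$ admits exactly two $SU(3)$-invariant Einstein metrics up to isometry and scale. Let $K_{k+l},K_l,K_k\cong S(U(2)\times U(1))$ be the subgroups of $SU(3)$ whose $U(2)$-block acts on the coordinates $\{1,2\}$, $\{1,3\}$, $\{2,3\}$ respectively. Each contains $U(1)_{k,l}$, $SU(3)/K_i=\mathbb{CP}^2$ and $K_i/U(1)_{k,l}\cong\mathbb{S}^3/\mathbb{Z}_i$, so $N_{k,l}$ is a lens space bundle $\mathbb{S}^3/\mathbb{Z}_i\hookrightarrow N_{k,l}\to\mathbb{CP}^2$. $M^i_{k,l}$ is the associated $\mathbb{R}^4/\mathbb{Z}_i$-bundle over $\mathbb{CP}^2$, a cohomogeneity one $SU(3)$-orbifold with principal orbit $N_{k,l}$ and singular orbit $\mathbb{CP}^2$. **Metrics.** As a $U(1)_{k,l}$-module, $\mathfrak{su}(3)/\mathfrak{u}(1)_{k,l}=\mathbf{2}_{k-l}\oplus\mathbf{2}_{2k+l}\oplus\mathbf{2}_{k+2l}\oplus\mathbf{1}$ (subscripts are weights), with pairwise inequivalent summands in the generic case. With $E_{pq}$ the elementary matrices, use the basis $E_{12}-E_{21},\sqrt{-1}(E_{12}+E_{21})$ of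 $\mathbf{2}_{k-l}$; $E_{13}-E_{31},\sqrt{-1}(E_{13}+E_{31})$ of $\mathbf{2}_{2k+l}$; $E_{23}-E_{32},\sqrt{-1}(E_{23}+E_{32})$ of $\mathbf{2}_{k+2l}$; and $\sqrt{-1}\,\mathrm{diag}(k+2l,-2k-l,k-l)$ of $\mathbf{1}$. In this basis every $SU(3)$-invariant metric on $N_{k,l}$ is $\mathrm{diag}(a^2,a^2,b^2,b^2,c^2,c^2,f^2)$ with $a,b,c,f>0$. A cohomogeneity one metric is $g=dt^2+g_{N_{k,l}}(t)$, with $a,b,c,f$ functions of $t$. **Spin(7) metrics.** $g$ is a cohomogeneity one $\mathrm{Spin}(7)$ metric if, for one choice of sign, it satisfies $$\frac{\dot a}{a}=\frac{b}{ac}+\frac{c}{ab}-\frac{a}{bc}\mp\frac{k+l}{2\Delta}\frac{f}{a^2},\quad \frac{\dot b}{b}=\frac{c}{ab}+\frac{a}{bc}-\frac{b}{ac}\pm\frac{l}{2\Delta}\frac{f}{b^2},$$ $$\frac{\dot c}{c}=\frac{a}{bc}+\frac{b}{ac}-\frac{c}{ab}\pm\frac{k}{2\Delta}\frac{f}{c^2},\quad \frac{\dot f}{f}=\pm\frac{k+l}{2\Delta}\frac{f}{a^2}\mp\frac{l}{2\Delta}\frac{f}{b^2}\mp\frac{k}{2\Delta}\frac{f}{c^2}$$ (upper signs throughout or lower signs throughout; the two choices are the two chiralities). The metric is on $M^i_{k,l}$ if it extends over the singular orbit at $t=0$, where the initial condition $\lim_{t\to0}(a,b,c,f,\dot a,\dot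 b,\dot c,\dot f)$ is $(0,a_0,a_0,0,1,0,0,\tfrac{2\Delta}{k+l})$ for $i=k+l$; $(b_0,0,b_0,0,0,1,0,\tfrac{2\Delta}{l})$ for $i=l$; $(c_0,c_0,0,0,0,0,1,\tfrac{2\Delta}{k})$ for $i=k$, with $a_0,b_0,c_0>0$. It is forward complete if it is defined for all $t\in[0,\infty)$. A family is continuous if the metric depends continuously on $\theta$. **Asymptotics.** The metric is AC, with AC limit modeled on an invariant Einstein metric $h$ on $N_{k,l}$, if as $t\to\infty$ the functions $a/t,b/t,c/t,f/t$ converge to positive constants which are the components of $h$, so that $g$ is asymptotic to the cone $dt^2+t^2h$ (with $h$ scaled so that this cone is Ricci-flat). The metric is ALC with limit an $\mathbb{S}^1$-bundle over the $G_2$ cone on the nearly K\"ahler $SU(3)/T^2$ if as $t\to\infty$ one has $a/t,b/t,c/t\to1$ and $f$ converges to a positive constant (the metric $a=b=c=t$ on $(0,\infty)\times SU(3)/T^2$ is the $G_2$ cone over the homogeneous nearly K\"ahler metric). *)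

theory Defs
  imports "HOL-Analysis.Analysis"
begin

text \<open>
  Throughout, \<open>k\<close> and \<open>l\<close> are integers and the principal orbit is the Aloff--Wallach space
  \<open>N = SU(3)/U(1)\<close>, where \<open>U(1)\<close> is generated by \<open>i diag(k, l, -(k+l))\<close>.
\<close>

definition aw_Delta :: "int \<Rightarrow> int \<Rightarrow> int" where
  "aw_Delta k l = k^2 + k * l + l^2"


section \<open>The Lie algebra of SU(3) and its decomposition\<close>

type_synonym cmat3 = "complex^3^3"

definition cscale :: "complex \<Rightarrow> cmat3 \<Rightarrow> cmat3" where
  "cscale z M = (\<chi> p q. z * M $ p $ q)"

definition elementary :: "3 \<Rightarrow> 3 \<Rightarrow> cmat3" where
  "elementary p q = (\<chi> p' q'. if p' = p \<and> q' = q then 1 else 0)"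

definition idiag :: "int \<Rightarrow> int \<Rightarrow> int \<Rightarrow> cmat3" where
  "idiag x y z = cscale \<i> (cscale (of_int x) (elementary 1 1)
     + cscale (of_int y) (elementary 2 2) + cscale (of_int z) (elementary 3 3))"

definition lie :: "cmat3 \<Rightarrow> cmat3 \<Rightarrow> cmat3" where
  "lie X Y = X ** Y - Y ** X"

definition su3 :: "cmat3 set" where
  "su3 = {X. (\<forall>p q. X $ p $ q = - cnj (X $ q $ p)) \<and> trace X = 0}"

definition u1 :: "int \<Rightarrow> int \<Rightarrow> cmat3 set" where
  "u1 k l = span {idiag k l (- (k + l))}"

definition aw_basis :: "int \<Rightarrow> int \<Rightarrow> nat \<Rightarrow> cmat3" where
  "aw_basis k l j =
     [elementary 1 2 - elementary 2 1, cscale \<i> (elementary 1 2 + elementary 2 1),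
      elementary 1 3 - elementary 3 1, cscale \<i> (elementary 1 3 + elementary 3 1),
      elementary 2 3 - elementary 3 2, cscale \<i> (elementary 2 3 + elementary 3 2),
      idiag (k + 2 * l) (- 2 * k - l) (k - l)] ! j"

definition aw_m :: "int \<Rightarrow> int \<Rightarrow> cmat3 set" where
  "aw_m k l = span (aw_basis k l ` {..<7})"

text \<open>
  The basis vectors are pairwise orthogonal for the Ad-invariant inner product
  \<open>-tr(XY)\<close> on \<open>su3\<close>, and orthogonal to \<open>u1 k l\<close>.  Hence \<open>su3 = u1 k l \<oplus> aw_m k l\<close> is a
  reductive decomposition, and \<open>aw_coord\<close>, \<open>proj_m\<close> give the coordinates and the projection
  along \<open>u1 k l\<close>.
\<close>

definition trace_form :: "cmat3 \<Rightarrow> cmat3 \<Rightarrow> real" where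
  "trace_form X Y = - Re (trace (X ** Y))"

definition aw_coord :: "int \<Rightarrow> int \<Rightarrow> nat \<Rightarrow> cmat3 \<Rightarrow> real" where
  "aw_coord k l j X =
     trace_form X (aw_basis k l j) / trace_form (aw_basis k l j) (aw_basis k l j)"

definition proj_m :: "int \<Rightarrow> int \<Rightarrow> cmat3 \<Rightarrow> cmat3" where
  "proj_m k l X = (\<Sum>j<7. aw_coord k l j X *\<^sub>R aw_basis k l j)"


section \<open>Invariant metrics on the Aloff--Wallach space and their Ricci curvature\<close>

text \<open>
  An invariant metric \<open>diag(a\<^sup>2, a\<^sup>2, b\<^sup>2, b\<^sup>2, c\<^sup>2, c\<^sup>2, f\<^sup>2)\<close> is represented by its coefficients
  \<open>(a, b, c, f)\<close>, which are required to be positive.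
\<close>

type_synonym aw_coeffs = "real \<times> real \<times> real \<times> real"

definition pos_coeffs :: "aw_coeffs \<Rightarrow> bool" where
  "pos_coeffs h \<longleftrightarrow> (case h of (a, b, c, f) \<Rightarrow> a > 0 \<and> b > 0 \<and> c > 0 \<and> f > 0)"

definition metric_entry :: "aw_coeffs \<Rightarrow> nat \<Rightarrow> real" where
  "metric_entry h j = (case h of (a, b, c, f) \<Rightarrow> [a^2, a^2, b^2, b^2, c^2, c^2, f^2] ! j)"

text \<open>The metric, extended to \<open>su3\<close> as a degenerate form with kernel \<open>u1 k l\<close>.\<close>

definition aw_metric :: "int \<Rightarrow> int \<Rightarrow> aw_coeffs \<Rightarrow> cmat3 \<Rightarrow> cmat3 \<Rightarrow> real" where
  "aw_metric k l h X Y = (\<Sum>j<7. metric_entry h j * aw_coord k l j X * aw_coord k l j Y)"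

text \<open>
  The Levi-Civita connection of a reductive homogeneous space (Nomizu):
  \<open>\<Lambda>(X)Y = 1/2 [X,Y]\<^sub>m + U(X,Y)\<close> with \<open>2 h(U(X,Y),Z) = h([Z,X]\<^sub>m,Y) + h(X,[Z,Y]\<^sub>m)\<close>, and its
  curvature \<open>R(X,Y) = [\<Lambda>(X),\<Lambda>(Y)] - \<Lambda>([X,Y]\<^sub>m) - ad([X,Y]\<^sub>u\<^sub>1)\<close>, for \<open>X, Y\<close> in \<open>aw_m k l\<close>.
\<close>

definition aw_U :: "int \<Rightarrow> int \<Rightarrow> aw_coeffs \<Rightarrow> cmat3 \<Rightarrow> cmat3 \<Rightarrow> cmat3" where
  "aw_U k l h X Y =
     (\<Sum>j<7. ((aw_metric k l h (lie (aw_basis k l j) X) Y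
              + aw_metric k l h X (lie (aw_basis k l j) Y)) / (2 * metric_entry h j))
             *\<^sub>R aw_basis k l j)"

definition aw_nabla :: "int \<Rightarrow> int \<Rightarrow> aw_coeffs \<Rightarrow> cmat3 \<Rightarrow> cmat3 \<Rightarrow> cmat3" where
  "aw_nabla k l h X Y = (1/2) *\<^sub>R proj_m k l (lie X Y) + aw_U k l h X Y"

definition aw_curvature ::
  "int \<Rightarrow> int \<Rightarrow> aw_coeffs \<Rightarrow> cmat3 \<Rightarrow> cmat3 \<Rightarrow> cmat3 \<Rightarrow> cmat3" where
  "aw_curvature k l h X Y Z =
     aw_nabla k l h X (aw_nabla k l h Y Z) - aw_nabla k l h Y (aw_nabla k l h X Z)
     - aw_nabla k l h (proj_m k l (lie X Y)) Z
     - lie (lie X Y - proj_m k l (lie X Y)) Z"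

definition aw_ricci :: "int \<Rightarrow> int \<Rightarrow> aw_coeffs \<Rightarrow> cmat3 \<Rightarrow> cmat3 \<Rightarrow> real" where
  "aw_ricci k l h Y Z =
     (\<Sum>j<7. aw_coord k l j (aw_curvature k l h (aw_basis k l j) Y Z))"

definition einstein_with_constant :: "int \<Rightarrow> int \<Rightarrow> real \<Rightarrow> aw_coeffs \<Rightarrow> bool" where
  "einstein_with_constant k l E h \<longleftrightarrow> pos_coeffs h \<and>
     (\<forall>X\<in>aw_m k l. \<forall>Y\<in>aw_m k l. aw_ricci k l h X Y = E * aw_metric k l h X Y)"

text \<open>
  Two invariant metrics agree up to scale and an isometry induced by an automorphism of \<open>SU(3)\<close>
  preserving \<open>U(1)\<close>.  Since \<open>SU(3)\<close> is simply connected, such automorphisms are given by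
  automorphisms of the Lie algebra preserving \<open>u1 k l\<close>.  Equality is the case \<open>\<phi> = id\<close>,
  \<open>s = 1\<close>.
\<close>

definition equivariantly_homothetic :: "int \<Rightarrow> int \<Rightarrow> aw_coeffs \<Rightarrow> aw_coeffs \<Rightarrow> bool" where
  "equivariantly_homothetic k l h h' \<longleftrightarrow>
     (\<exists>\<phi> s. s > 0 \<and> linear \<phi> \<and> bij_betw \<phi> su3 su3 \<and>
        (\<forall>X\<in>su3. \<forall>Y\<in>su3. \<phi> (lie X Y) = lie (\<phi> X) (\<phi> Y)) \<and>
        \<phi> ` u1 k l = u1 k l \<and>
        (\<forall>X\<in>su3. \<forall>Y\<in>su3. aw_metric k l h' (\<phi> X) (\<phi> Y) = s * aw_metric k l h X Y))"


section \<open>Cohomogeneity one Spin(7) metrics\<close>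

text \<open>
  The cohomogeneity one metric \<open>dt\<^sup>2 + g(t)\<close> is represented by the curve \<open>t \<mapsto> (a, b, c, f)(t)\<close>;
  only its values at \<open>t > 0\<close> matter.  The sign \<open>\<epsilon> = 1\<close> gives the upper signs (first
  chirality), \<open>\<epsilon> = -1\<close> the lower ones.
\<close>

type_synonym aw_path = "real \<Rightarrow> aw_coeffs"

definition spin7_rhs :: "int \<Rightarrow> int \<Rightarrow> real \<Rightarrow> aw_coeffs \<Rightarrow> aw_coeffs" where
  "spin7_rhs k l \<epsilon> h = (case h of (a, b, c, f) \<Rightarrow>
     (a * (b/(a*c) + c/(a*b) - a/(b*c) - \<epsilon> * (real_of_int (k + l) / (2 * real_of_int (aw_Delta k l))) * (f / a^2)),
      b * (c/(a*b) + a/(b*c) - b/(a*c) + \<epsilon> * (real_of_int l / (2 * real_of_int (aw_Delta k l))) * (f / b^2)),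
      c * (a/(b*c) + b/(a*c) - c/(a*b) + \<epsilon> * (real_of_int k / (2 * real_of_int (aw_Delta k l))) * (f / c^2)),
      f * (\<epsilon> * (real_of_int (k + l) / (2 * real_of_int (aw_Delta k l))) * (f / a^2)
           - \<epsilon> * (real_of_int l / (2 * real_of_int (aw_Delta k l))) * (f / b^2)
           - \<epsilon> * (real_of_int k / (2 * real_of_int (aw_Delta k l))) * (f / c^2))))"

definition spin7_solution_on :: "int \<Rightarrow> int \<Rightarrow> real set \<Rightarrow> aw_path \<Rightarrow> bool" where
  "spin7_solution_on k l S g \<longleftrightarrow>
     (\<forall>t\<in>S. pos_coeffs (g t)) \<and>
     (\<exists>\<epsilon>\<in>{1, -1}. \<forall>t\<in>S. (g has_vector_derivative spin7_rhs k l \<epsilon> (g t)) (at t))"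

definition jet :: "aw_path \<Rightarrow> real \<Rightarrow> aw_coeffs \<times> aw_coeffs" where
  "jet g t = (g t, vector_derivative g (at t))"

text \<open>
  The metric closes up along a singular orbit \<open>CP\<^sup>2\<close> at \<open>t = 0\<close>, i.e. it lives on the
  \<open>R\<^sup>4/Z\<^sub>i\<close>-bundle with index \<open>i\<close>.  In the generic case with \<open>k, l > 0\<close>, the numbers
  \<open>k + l\<close>, \<open>l\<close>, \<open>k\<close> are distinct, so \<open>i\<close> determines the bundle.
\<close>

definition extends_over_orbit :: "int \<Rightarrow> int \<Rightarrow> int \<Rightarrow> aw_path \<Rightarrow> bool" where
  "extends_over_orbit k l i g \<longleftrightarrow>
     (i = k + l \<and> (\<exists>a0>0. (jet g \<longlongrightarrow>
        ((0, a0, a0, 0), (1, 0, 0, 2 * real_of_int (aw_Delta k l) / real_of_int (k + l)))) (at_right 0))) \<or>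
     (i = l \<and> (\<exists>b0>0. (jet g \<longlongrightarrow>
        ((b0, 0, b0, 0), (0, 1, 0, 2 * real_of_int (aw_Delta k l) / real_of_int l))) (at_right 0))) \<or>
     (i = k \<and> (\<exists>c0>0. (jet g \<longlongrightarrow>
        ((c0, c0, 0, 0), (0, 0, 1, 2 * real_of_int (aw_Delta k l) / real_of_int k))) (at_right 0)))"

definition forward_complete_spin7_metric :: "int \<Rightarrow> int \<Rightarrow> int \<Rightarrow> aw_path \<Rightarrow> bool" where
  "forward_complete_spin7_metric k l i g \<longleftrightarrow>
     spin7_solution_on k l {0<..} g \<and> extends_over_orbit k l i g"

text \<open>
  Continuous dependence on the parameter: convergence in \<open>C\<^sup>1\<close> on compact subsets of
  \<open>[0, \<infinity>)\<close>, where the values at \<open>t = 0\<close> are the limits for \<open>t \<rightarrow> 0\<close>.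
\<close>

definition continuous_family :: "real set \<Rightarrow> (real \<Rightarrow> aw_path) \<Rightarrow> bool" where
  "continuous_family \<Theta> \<gamma> \<longleftrightarrow>
     (\<forall>\<theta>0\<in>\<Theta>. \<forall>T>0.
        uniform_limit {0<..T} (\<lambda>\<theta>. jet (\<gamma> \<theta>)) (jet (\<gamma> \<theta>0)) (at \<theta>0 within \<Theta>))"


section \<open>Asymptotics\<close>

definition ALC_over_nearly_Kaehler :: "aw_path \<Rightarrow> bool" where
  "ALC_over_nearly_Kaehler g \<longleftrightarrow>
     (\<exists>f0>0.
        ((\<lambda>t. case g t of (a, b, c, f) \<Rightarrow> (a / t, b / t, c / t, f)) \<longlongrightarrow> (1, 1, 1, f0)) at_top)"

text \<open>
  The cone \<open>dt\<^sup>2 + t\<^sup>2 h\<close> over the 7-dimensional \<open>h\<close> is Ricci-flat iff \<open>Ric h = 6 h\<close>.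
\<close>

definition AC_with_limit :: "int \<Rightarrow> int \<Rightarrow> aw_path \<Rightarrow> aw_coeffs \<Rightarrow> bool" where
  "AC_with_limit k l g h \<longleftrightarrow>
     einstein_with_constant k l 6 h \<and>
     ((\<lambda>t. case g t of (a, b, c, f) \<Rightarrow> (a / t, b / t, c / t, f / t)) \<longlongrightarrow> h) at_top"

end

theory Submission
  imports Defs
begin

text \<open>
  Let \<open>p\<close> be the coefficient of the collapsing plane, \<open>q\<close>, \<open>w\<close> those of the other two planes and \<open>f\<close> that
  of the fibre.  Up to scaling \<open>f\<close> and exchanging the planes, the equations depend on one number \<open>C < 1/2\<close>.
  In the scale-invariant variables \<open>u = q\<^sup>2/p\<^sup>2\<close>, \<open>v = w\<^sup>2/p\<^sup>2\<close>, \<open>r = f p/(q w)\<close> and the parameter \<open>ds = (p/(q w)) dt\<close>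
  (rescaled by \<open>\<theta>\<close>) they become an autonomous system for three functions, with a regular singular point at the singular orbit;
  it is solved as a fixed point of a Volterra equation, continuously in \<open>\<theta>\<close>, down to the explicit degenerate case \<open>\<theta> = 0\<close>.

  There are two disjoint open invariant regions, a good one in which \<open>(u, v, r) \<rightarrow> (1, 1, 0)\<close> (the ALC case) and a bad one.
  Orbits are good for small \<open>\<theta>\<close> and bad for \<open>\<theta> > 1\<close>, so the supremum of the initial interval of good parameters yields an orbit
  in neither region.  Such an orbit stays bounded; the Lyapunov function \<open>ln r - 2 ln u - 2 ln v + 7 ln H\<close>, where \<open>H\<close> is
  the trace of the logarithmic derivative of the metric, forces it to a critical point, i.e. to a cone.
  Elimination shows that the critical point is unique.  For the lower sign the indices \<open>k\<close> and \<open>l\<close> give the same cone equation, hence the same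
  limit.  The first and second planes are ordered oppositely by size in the two cones, while an automorphism preserving \<open>U(1)\<close>
  preserves each plane and rescales all of them by one factor, so the two cones are not homothetic.
\<close>

section \<open>Singular integral equations\<close>

text \<open>For \<open>C < 0\<close> the first and third planes play the same role: (C, u, v, r) ->
  (1/C, u/v, 1/v, -C r v) is a symmetry up to reparametrisation. It produces the second half of the
  bad region and many of the bounds. The Lyapunov function is the logarithm of (orbit volume) * H^7
  in scale-invariant form, 7 being the dimension of the orbit. On a Ricci-flat metric H satisfies a
  Riccati equation, so the function decreases by the Cauchy-Schwarz deficit of the seven principal
  curvatures, which vanishes only if they all agree, as on a cone. The singular problem has one free
  coefficient \<kappa>, the slope of y = r v at s = 0; rescaling s multiplies \<kappa> and e by the
  same factor. The choice \<kappa> = \<theta> - 1, e = \<theta> covers every ratio \<kappa> / e < 1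
  and stays regular at \<theta> = 0. There the base is infinitely large and the fibre satisfies the
  Taub-NUT equations p' = 2 - f/p, f' = (f/p)^2, so y decays. This is why small \<theta> gives good
  orbits, whereas \<kappa> > 0 pushes y above 1 at once, which is bad.\<close>

lemma mult_unit_mem:
  fixes s \<tau> S :: real
  assumes "s \<in> {0..S}" "\<tau> \<in> {0..1}" shows "s * \<tau> \<in> {0..S}"
  using assms mult_left_le[of \<tau> s] by auto

text \<open>Integrating the weight exp (k s) gains a factor 1/k. With k twice the Lipschitz
  constant, the Volterra operator contracts by 1/2 in the weighted norm, on intervals of any
  length.\<close>

lemma weighted_integral_bound:
  fixes h h' :: "real \<Rightarrow> 'a::euclidean_space"
  assumes "0 < k" "0 \<le> s" "0 \<le> c"
    and h: "continuous_on {0..1} h" and h': "continuous_on {0..1} h'"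
    and le: "\<And>\<tau>. 0 \<le> \<tau> \<Longrightarrow> \<tau> \<le> 1 \<Longrightarrow> norm (h \<tau> - h' \<tau>) \<le> c * exp (k * (s * \<tau>))"
  shows "norm (s *\<^sub>R integral {0..1} h - s *\<^sub>R integral {0..1} h') \<le> c / k * exp (k * s)"
proof -
  have "((\<lambda>\<tau>. s * (c * exp (k * (s * \<tau>)))) has_integral
      (c / k * exp (k * (s * 1)) - c / k * exp (k * (s * 0)))) {0..1}"
    by (rule fundamental_theorem_of_calculus)
      (use assms in \<open>auto intro!: derivative_eq_intros
        simp: has_real_derivative_iff_has_vector_derivative[symmetric]\<close>)
  then have I: "integral {0..1} (\<lambda>\<tau>. s * (c * exp (k * (s * \<tau>)))) = c / k * exp (k * s) - c / k"
    by (intro integral_unique) simp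
  have "norm (integral {0..1} (\<lambda>\<tau>. s *\<^sub>R (h \<tau> - h' \<tau>))) \<le> integral {0..1} (\<lambda>\<tau>. s * (c * exp (k * (s * \<tau>))))"
    by (rule integral_norm_bound_integral)
      (use assms in \<open>auto intro!: integrable_continuous_real continuous_intros mult_left_mono\<close>)
  moreover have "integral {0..1} (\<lambda>\<tau>. s *\<^sub>R (h \<tau> - h' \<tau>)) = s *\<^sub>R integral {0..1} h - s *\<^sub>R integral {0..1} h'"
    using integral_diff[of "\<lambda>\<tau>. s *\<^sub>R h \<tau>" "{0..1}" "\<lambda>\<tau>. s *\<^sub>R h' \<tau>"]
    by (simp add: integrable_continuous_real h h' scaleR_diff_right continuous_intros)
  ultimately have "norm (s *\<^sub>R integral {0..1} h - s *\<^sub>R integral {0..1} h') \<le> c / k * exp (k * s) - c / k"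
    by (simp only: I)
  moreover have "0 \<le> c / k" using assms(1,3) by simp
  ultimately show ?thesis by linarith
qed

text \<open>
  The singular initial value problem \<open>s z' = - \<Lambda> (z - z0) + s F s z\<close> with a positive semidefinite
  diagonal matrix \<open>\<Lambda>\<close> is treated as a Volterra equation with kernel \<open>K \<tau> = \<tau> powr \<Lambda>\<close>.
\<close>

locale kernel =
  fixes K :: "real \<Rightarrow> 'a::euclidean_space \<Rightarrow> 'a"
  assumes K_diff: "K \<tau> (x - y) = K \<tau> x - K \<tau> y"
    and K_norm: "0 \<le> \<tau> \<Longrightarrow> \<tau> \<le> 1 \<Longrightarrow> norm (K \<tau> x) \<le> norm x"
    and K_cont: "continuous_on UNIV (\<lambda>(\<tau>, x). K \<tau> x)"
begin

text \<open>For K \<tau> = \<tau>^m this is s^(-m) times the integral of \<sigma>^m G over [0, s],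
  after the substitution \<sigma> = s \<tau>. On the fixed interval [0, 1] the point s = 0 is no
  longer exceptional.\<close>

definition volterra :: "(real \<Rightarrow> 'a \<Rightarrow> 'a) \<Rightarrow> (real \<Rightarrow> 'a) \<Rightarrow> real \<Rightarrow> 'a" where
  "volterra G z s = s *\<^sub>R integral {0..1} (\<lambda>\<tau>. K \<tau> (G (s * \<tau>) (z (s * \<tau>))))"

definition ksol :: "(real \<Rightarrow> 'a \<Rightarrow> 'a) \<Rightarrow> real \<Rightarrow> 'a \<Rightarrow> (real \<Rightarrow> 'a) \<Rightarrow> bool" where
  "ksol G S z0 z \<longleftrightarrow> continuous_on {0..S} z \<and> (\<forall>s\<in>{0..S}. z s = z0 + volterra G z s)"

lemma integrand_continuous:
  assumes G: "continuous_on UNIV (case_prod G)" and z: "continuous_on {0..S} z"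
  shows "continuous_on ({0..S} \<times> {0..1}) (\<lambda>(s, \<tau>). K \<tau> (G (s * \<tau>) (z (s * \<tau>))))"
proof -
  have m: "(\<lambda>x. fst x * snd x) ` ({0..S} \<times> {0..1}) \<subseteq> {0..S}"
    using mult_unit_mem by fastforce
  have zz: "continuous_on ({0..S} \<times> {0..1}) (\<lambda>x. z (fst x * snd x))"
    by (rule continuous_on_compose2[OF z _ m]) (intro continuous_intros)
  have gg: "continuous_on ({0..S} \<times> {0..1}) (\<lambda>x. (case_prod G) (fst x * snd x, z (fst x * snd x)))"
    by (rule continuous_on_compose2[OF G]) (auto intro!: continuous_intros zz)
  have "continuous_on ({0..S} \<times> {0..1}) (\<lambda>x. (case_prod K) (snd x, (case_prod G) (fst x * snd x, z (fst x * snd x))))"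
    by (rule continuous_on_compose2[OF K_cont]) (auto intro!: continuous_intros gg[simplified])
  then show ?thesis by (simp add: case_prod_beta)
qed

lemma integrand_continuous1:
  assumes G: "continuous_on UNIV (case_prod G)" and z: "continuous_on {0..S} z" and s: "s \<in> {0..S}"
  shows "continuous_on {0..1} (\<lambda>\<tau>. K \<tau> (G (s * \<tau>) (z (s * \<tau>))))"
proof -
  have "continuous_on {0..1} (\<lambda>\<tau>. (\<lambda>(s, \<tau>). K \<tau> (G (s * \<tau>) (z (s * \<tau>)))) (s, \<tau>))"
    by (rule continuous_on_compose2[OF integrand_continuous[OF G z]]) (use s in \<open>auto intro!: continuous_intros\<close>)
  then show ?thesis by simp
qed

lemma volterra_continuous:
  assumes G: "continuous_on UNIV (case_prod G)" and z: "continuous_on {0..S} z"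
  shows "continuous_on {0..S} (volterra G z)"
  unfolding volterra_def
  using integral_continuous_on_param[of "{0..S}" 0 1 "\<lambda>s \<tau>. K \<tau> (G (s * \<tau>) (z (s * \<tau>)))"]
    integrand_continuous[OF G z] by (auto intro!: continuous_intros)

lemma volterra_diff:
  assumes G: "continuous_on UNIV (case_prod G)" and z: "continuous_on {0..S} z" "continuous_on {0..S} z'"
    and L: "\<And>s x y. norm (G s x - G s y) \<le> L * norm (x - y)" and L0: "0 < L"
    and s: "s \<in> {0..S}" and D: "\<And>s. s \<in> {0..S} \<Longrightarrow> norm (z s - z' s) \<le> D * exp (2 * L * s)" and D0: "0 \<le> D"
  shows "norm (volterra G z s - volterra G z' s) \<le> D / 2 * exp (2 * L * s)"
proof -
  have "norm (volterra G z s - volterra G z' s) \<le> (L * D) / (2 * L) * exp (2 * L * s)"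
    unfolding volterra_def
  proof (rule weighted_integral_bound)
    fix \<tau> :: real assume t: "0 \<le> \<tau>" "\<tau> \<le> 1"
    have st: "s * \<tau> \<in> {0..S}" using s t mult_unit_mem by auto
    have "norm (K \<tau> (G (s * \<tau>) (z (s * \<tau>))) - K \<tau> (G (s * \<tau>) (z' (s * \<tau>)))) \<le>
        norm (G (s * \<tau>) (z (s * \<tau>)) - G (s * \<tau>) (z' (s * \<tau>)))"
      by (metis K_diff K_norm t)
    also have "\<dots> \<le> L * norm (z (s * \<tau>) - z' (s * \<tau>))" by (rule L)
    also have "\<dots> \<le> L * (D * exp (2 * L * (s * \<tau>)))" using D[OF st] L0 by (intro mult_left_mono) auto
    finally show "norm (K \<tau> (G (s * \<tau>) (z (s * \<tau>))) - K \<tau> (G (s * \<tau>) (z' (s * \<tau>)))) \<le> L * D * exp (2 * L * (s * \<tau>))"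
      by simp
  qed (use L0 D0 s integrand_continuous1[OF G z(1) s] integrand_continuous1[OF G z(2) s] in auto)
  then show ?thesis using L0 by simp
qed

text \<open>A Gronwall estimate without differentiation: the difference weighted by exp (- 2 L s)
  attains a maximum on the compact interval, and at that point \<open>volterra_diff\<close> bounds
  it by the initial difference plus half of itself.\<close>

lemma ksol_stable:
  assumes G: "continuous_on UNIV (case_prod G)"
    and L: "\<And>s x y. norm (G s x - G s y) \<le> L * norm (x - y)" and L0: "0 < L"
    and z: "ksol G S z0 z" and z': "ksol G S z1 z'" and s: "s \<in> {0..S}"
  shows "norm (z s - z' s) \<le> 2 * norm (z0 - z1) * exp (2 * L * s)"
proof -
  have c: "continuous_on {0..S} z" "continuous_on {0..S} z'" using z z' by (auto simp: ksol_def)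
  define q where "q s = exp (- (2 * L * s)) * norm (z s - z' s)" for s
  have "continuous_on {0..S} q" unfolding q_def by (intro continuous_intros c)
  moreover have "{0..S} \<noteq> {}" using s by auto
  ultimately obtain x where x: "x \<in> {0..S}" "\<And>y. y \<in> {0..S} \<Longrightarrow> q y \<le> q x"
    using continuous_attains_sup[of "{0..S}" q] by auto
  have q0: "0 \<le> q x" by (simp add: q_def)
  have e: "norm (z y - z' y) = q y * exp (2 * L * y)" for y
    by (simp add: q_def exp_minus field_simps)
  have D: "norm (z y - z' y) \<le> q x * exp (2 * L * y)" if "y \<in> {0..S}" for y
    using x(2)[OF that] by (simp add: e)
  have "norm (volterra G z x - volterra G z' x) \<le> q x / 2 * exp (2 * L * x)"
    by (rule volterra_diff[OF G c L L0 x(1) D q0])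
  moreover have "z x - z' x = (z0 - z1) + (volterra G z x - volterra G z' x)"
    using z z' x(1) by (auto simp: ksol_def)
  ultimately have "norm (z x - z' x) \<le> norm (z0 - z1) + q x / 2 * exp (2 * L * x)"
    by (metis norm_triangle_mono order_refl)
  then have "q x \<le> exp (- (2 * L * x)) * norm (z0 - z1) + q x / 2"
    unfolding e[of x] by (simp add: exp_minus field_simps)
  moreover have "exp (- (2 * L * x)) * norm (z0 - z1) \<le> 1 * norm (z0 - z1)"
    using x(1) L0 by (intro mult_right_mono) auto
  ultimately have "q x \<le> 2 * norm (z0 - z1)" by simp
  then have "norm (z s - z' s) \<le> 2 * norm (z0 - z1) * exp (2 * L * s)"
    using D[OF s] by (meson exp_ge_zero mult_right_mono order_trans)
  then show ?thesis .
qed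

text \<open>Banach's fixed point theorem for the rescaled unknown exp (- k s) z(s) in the space of
  bounded continuous functions. Boundedness of \<open>G\<close> keeps the image bounded, and the
  weight makes the map contract on the whole half-line at once.\<close>

lemma ksol_global:
  assumes G: "continuous_on UNIV (case_prod G)"
    and L: "\<And>s x y. norm (G s x - G s y) \<le> L * norm (x - y)" and L0: "0 < L"
    and M: "\<And>s x. norm (G s x) \<le> M"
  obtains z where "\<And>S. ksol G S z0 z"
proof -
  define k where "k = 2 * L"
  have k: "0 < k" using L0 by (simp add: k_def)
  define E where "E \<zeta> s = exp (k * s) *\<^sub>R apply_bcontfun \<zeta> s" for \<zeta> :: "real \<Rightarrow>\<^sub>C 'a" and s
  \<comment> \<open>The functions in the Banach space live on the whole line; \<open>max 0 s\<close>
    extends the image by its constant value z0 to negative s.\<close>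
  define T where "T \<zeta> s = exp (- (k * max 0 s)) *\<^sub>R (z0 + volterra G (E \<zeta>) (max 0 s))" for \<zeta> s
  have Ec: "continuous_on A (E \<zeta>)" for A \<zeta> unfolding E_def by (intro continuous_intros) auto
  have T_in: "T \<zeta> \<in> bcontfun" for \<zeta>
  proof -
    have "continuous_on {0..} (volterra G (E \<zeta>))"
      unfolding continuous_on_eq_continuous_within
    proof
      fix x :: real assume "x \<in> {0..}"
      then have "continuous (at x within {0..x+1}) (volterra G (E \<zeta>))"
        using volterra_continuous[OF G Ec[of "{0..x+1}" \<zeta>]] by (auto simp: continuous_on_eq_continuous_within)
      moreover have "at x within {0..x+1} = at x within {0..}"
        by (rule at_within_nhd[of x "{x-1<..<x+1}"]) auto
      ultimately show "continuous (at x within {0..}) (volterra G (E \<zeta>))" by simp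
    qed
    then have "continuous_on UNIV (\<lambda>s. volterra G (E \<zeta>) (max 0 s))"
      by (rule continuous_on_compose2) (auto intro!: continuous_intros)
    then have "continuous_on UNIV (T \<zeta>)" unfolding T_def by (intro continuous_intros)
    moreover have "norm (T \<zeta> s) \<le> norm z0 + \<bar>M\<bar> / k" for s
    proof -
      let ?s = "max 0 s"
      have ic: "continuous_on {0..1} (\<lambda>\<tau>. K \<tau> (G (?s * \<tau>) (E \<zeta> (?s * \<tau>))))"
        by (rule integrand_continuous1[OF G Ec[of "{0..?s}"]]) auto
      have "norm (integral {0..1} (\<lambda>\<tau>. K \<tau> (G (?s * \<tau>) (E \<zeta> (?s * \<tau>))))) \<le> integral {0..1::real} (\<lambda>\<tau>. \<bar>M\<bar>)"
      proof (rule integral_norm_bound_integral)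
        fix \<tau> :: real assume "\<tau> \<in> {0..1}"
        then show "norm (K \<tau> (G (?s * \<tau>) (E \<zeta> (?s * \<tau>)))) \<le> \<bar>M\<bar>"
          by (metis K_norm M abs_ge_self atLeastAtMost_iff order_trans)
      qed (use ic in \<open>auto intro!: integrable_continuous_real\<close>)
      then have v: "norm (volterra G (E \<zeta>) ?s) \<le> ?s * \<bar>M\<bar>"
        by (auto simp: volterra_def intro!: mult_left_mono)
      have "k * ?s \<le> exp (k * ?s)" using exp_ge_add_one_self[of "k * ?s"] by linarith
      then have b: "exp (- (k * ?s)) * ?s \<le> 1 / k" using k by (simp add: exp_minus field_simps)
      have e1: "exp (- (k * ?s)) \<le> 1" using k by simp
      have "norm (T \<zeta> s) \<le> exp (- (k * ?s)) * (norm z0 + ?s * \<bar>M\<bar>)"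
        unfolding T_def by (simp add: order_trans[OF norm_triangle_ineq] v)
      also have "\<dots> = exp (- (k * ?s)) * norm z0 + (exp (- (k * ?s)) * ?s) * \<bar>M\<bar>" by (simp add: algebra_simps)
      also have "\<dots> \<le> 1 * norm z0 + 1 / k * \<bar>M\<bar>"
        using e1 b by (intro add_mono mult_right_mono) auto
      finally show ?thesis by simp
    qed
    then have "bounded (range (T \<zeta>))" by (auto simp: bounded_iff)
    ultimately show ?thesis by (simp add: bcontfun_def)
  qed
  define B where "B \<zeta> = Bcontfun (T \<zeta>)" for \<zeta>
  have Bv: "apply_bcontfun (B \<zeta>) s = T \<zeta> s" for \<zeta> s
    by (simp add: B_def Bcontfun_inverse T_in)
  have "dist (B f) (B g) \<le> 1 / 2 * dist f g" for f g
  proof (rule dist_bound)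
    fix s :: real
    let ?s = "max 0 s"
    have "norm (volterra G (E f) ?s - volterra G (E g) ?s) \<le> dist f g / 2 * exp (2 * L * ?s)"
    proof (rule volterra_diff[OF G Ec Ec L L0, of ?s ?s])
      fix x :: real
      have "norm (E f x - E g x) = exp (2 * L * x) * dist (apply_bcontfun f x) (apply_bcontfun g x)"
        by (simp add: E_def k_def dist_norm scaleR_diff_right[symmetric])
      then show "norm (E f x - E g x) \<le> dist f g * exp (2 * L * x)"
        using dist_bounded[of f x g] by (simp add: mult.commute mult_left_mono)
    qed auto
    then have "exp (- (k * ?s)) * norm (volterra G (E f) ?s - volterra G (E g) ?s) \<le>
        exp (- (k * ?s)) * (dist f g / 2 * exp (k * ?s))"
      by (intro mult_left_mono) (auto simp: k_def)
    also have "\<dots> = dist f g / 2" by (simp add: exp_minus)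
    finally have "exp (- (k * ?s)) * norm (volterra G (E f) ?s - volterra G (E g) ?s) \<le> dist f g / 2" .
    then show "dist (apply_bcontfun (B f) s) (apply_bcontfun (B g) s) \<le> 1 / 2 * dist f g"
      by (simp add: Bv T_def dist_norm scaleR_diff_right[symmetric])
  qed
  then obtain \<zeta> where z: "B \<zeta> = \<zeta>"
    using banach_fix_type[of "1/2" B] by auto
  have "ksol G S z0 (E \<zeta>)" for S
    unfolding ksol_def
  proof (intro conjI ballI)
    show "continuous_on {0..S} (E \<zeta>)" by (rule Ec)
    fix s assume s: "s \<in> {0..S}"
    have "apply_bcontfun \<zeta> s = T \<zeta> s" using Bv z by metis
    then show "E \<zeta> s = z0 + volterra G (E \<zeta>) s"
      using s by (simp add: E_def T_def exp_minus max_def)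
  qed
  then show ?thesis using that by blast
qed

text \<open>Only values of the field along the curve enter the equation. A field and its truncation
  therefore have the same solutions among the curves that stay where the two agree.\<close>

lemma ksol_cong:
  assumes "\<And>s x. 0 \<le> s \<Longrightarrow> s \<le> S \<Longrightarrow> x = z s \<Longrightarrow> G s x = F s x"
  shows "ksol G S z0 z \<longleftrightarrow> ksol F S z0 z"
proof -
  have "volterra G z s = volterra F z s" if "s \<in> {0..S}" for s
    unfolding volterra_def
  proof (rule arg_cong[where f="\<lambda>x. s *\<^sub>R x"], rule integral_cong)
    fix \<tau> :: real assume "\<tau> \<in> {0..1}"
    then have "s * \<tau> \<in> {0..S}" using mult_unit_mem that by blast
    then show "K \<tau> (G (s * \<tau>) (z (s * \<tau>))) = K \<tau> (F (s * \<tau>) (z (s * \<tau>)))"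
      using assms[of "s * \<tau>"] by simp
  qed
  then show ?thesis by (simp add: ksol_def)
qed

lemma ksol_mono: "ksol F S z0 z \<Longrightarrow> S' \<le> S \<Longrightarrow> ksol F S' z0 z"
  unfolding ksol_def using continuous_on_subset[of "{0..S}" z "{0..S'}"] by auto

lemma ksol_init: "ksol F S z0 z \<Longrightarrow> 0 \<le> S \<Longrightarrow> z 0 = z0"
proof -
  assume "ksol F S z0 z" "0 \<le> S"
  then have "z 0 = z0 + volterra F z 0" unfolding ksol_def by (meson atLeastAtMost_iff order_refl)
  also have "volterra F z 0 = 0" unfolding volterra_def by (rule scaleR_zero_left)
  finally show "z 0 = z0" by (rule trans) (rule add_0_right)
qed

end

text \<open>The existence theory above is for bounded, globally Lipschitz fields, while the field of
  interest is polynomial. The assumption supplies, for every \<open>n\<close>, a field of the former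
  kind that agrees with \<open>F\<close> for times and norms up to \<open>n\<close>.\<close>

locale kernel_ivp = kernel K for K :: "real \<Rightarrow> 'a::euclidean_space \<Rightarrow> 'a" +
  fixes F :: "real \<Rightarrow> 'a \<Rightarrow> 'a"
  assumes F_truncation: "\<And>n::real. 0 < n \<Longrightarrow> \<exists>G L M. 0 < L \<and> continuous_on UNIV (case_prod G) \<and>
    (\<forall>s x y. norm (G s x - G s y) \<le> L * norm (x - y)) \<and> (\<forall>s x. norm (G s x) \<le> M) \<and>
    (\<forall>s x. 0 \<le> s \<longrightarrow> s \<le> n \<longrightarrow> norm x \<le> n \<longrightarrow> G s x = F s x)"
begin

lemma ksol_bounded:
  assumes "ksol F S z0 z"
  obtains M where "0 < M" "\<And>s. s \<in> {0..S} \<Longrightarrow> norm (z s) \<le> M"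
proof -
  have "continuous_on {0..S} z" using assms unfolding ksol_def by blast
  then have "bounded (z ` {0..S})"
    by (intro compact_imp_bounded compact_continuous_image compact_Icc)
  then show ?thesis using that unfolding bounded_pos by auto
qed

text \<open>Truncate one unit above the bound of the given solution. The truncated problem is
  solvable for every initial value, and by \<open>ksol_stable\<close> the solution stays within
  distance 1, hence below the truncation level, so it solves the original problem.\<close>

lemma ksol_continuous:
  assumes z: "ksol F S z0 z" and e: "0 < e"
  obtains \<delta> where "0 < \<delta>"
    "\<And>z1. norm (z0 - z1) < \<delta> \<Longrightarrow> \<exists>z'. ksol F S z1 z' \<and> (\<forall>s\<in>{0..S}. norm (z s - z' s) < e)"
proof (cases "0 \<le> S")
  case False
  then show ?thesis using that[of 1] by (auto simp: ksol_def)
next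
  case S: True
  obtain M where M: "0 < M" "\<And>s. s \<in> {0..S} \<Longrightarrow> norm (z s) \<le> M"
    using ksol_bounded[OF z] by blast
  define n where "n = M + S + 1"
  have n: "0 < n" "S \<le> n" "M + 1 \<le> n" using M S by (auto simp: n_def)
  obtain G L M' where G: "0 < L" "continuous_on UNIV (case_prod G)"
    "\<And>s x y. norm (G s x - G s y) \<le> L * norm (x - y)" "\<And>s x. norm (G s x) \<le> M'"
    "\<And>s x. 0 \<le> s \<Longrightarrow> s \<le> n \<Longrightarrow> norm x \<le> n \<Longrightarrow> G s x = F s x"
    using F_truncation[OF n(1)] by blast
  have zG: "ksol G S z0 z"
  proof (rule ksol_cong[THEN iffD2, OF _ z])
    fix s x assume "0 \<le> s" "s \<le> S" "x = z s"
    then show "G s x = F s x" using G(5)[of s x] M(2)[of s] n by simp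
  qed
  define \<delta> where "\<delta> = min e 1 / (4 * exp (2 * L * S))"
  have d: "0 < \<delta>" using e by (simp add: \<delta>_def)
  have "\<exists>z'. ksol F S z1 z' \<and> (\<forall>s\<in>{0..S}. norm (z s - z' s) < e)" if z1: "norm (z0 - z1) < \<delta>" for z1
  proof -
    obtain z' where z': "\<And>S. ksol G S z1 z'" using ksol_global[OF G(2,3,1,4)] by blast
    have b: "norm (z s - z' s) < min e 1" if s: "s \<in> {0..S}" for s
    proof -
      have "norm (z s - z' s) \<le> 2 * norm (z0 - z1) * exp (2 * L * s)"
        by (rule ksol_stable[OF G(2,3,1) zG z' s])
      also have "\<dots> \<le> 2 * \<delta> * exp (2 * L * S)"
        using z1 s G(1) d by (intro mult_mono) auto
      also have "\<dots> = min e 1 / 2" by (simp add: \<delta>_def)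
      finally show ?thesis using e by auto
    qed
    have "ksol F S z1 z'"
    proof (rule ksol_cong[THEN iffD1, OF _ z'[of S]])
      fix s x assume s: "0 \<le> s" "s \<le> S" "x = z' s"
      have "norm (z' s) \<le> norm (z s) + norm (z s - z' s)" by (metis norm_minus_commute norm_triangle_sub)
      then have "norm x \<le> n" using b[of s] M(2)[of s] s n by auto
      then show "G s x = F s x" using G(5) s n by auto
    qed
    then show ?thesis using b by auto
  qed
  then show ?thesis using that d by blast
qed

lemma ksol_unique:
  assumes z: "ksol F S z0 z" and z': "ksol F S z0 z'" and s: "s \<in> {0..S}"
  shows "z s = z' s"
proof -
  obtain M where M: "0 < M" "\<And>s. s \<in> {0..S} \<Longrightarrow> norm (z s) \<le> M"
    using ksol_bounded[OF z] by blast
  obtain M' where M': "0 < M'" "\<And>s. s \<in> {0..S} \<Longrightarrow> norm (z' s) \<le> M'"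
    using ksol_bounded[OF z'] by blast
  define n where "n = M + M' + S"
  have n: "0 < n" "S \<le> n" "M \<le> n" "M' \<le> n" using M M' s by (auto simp: n_def)
  obtain G L M'' where G: "0 < L" "continuous_on UNIV (case_prod G)"
    "\<And>s x y. norm (G s x - G s y) \<le> L * norm (x - y)" "\<And>s x. norm (G s x) \<le> M''"
    "\<And>s x. 0 \<le> s \<Longrightarrow> s \<le> n \<Longrightarrow> norm x \<le> n \<Longrightarrow> G s x = F s x"
    using F_truncation[OF n(1)] by blast
  have "ksol G S z0 z"
  proof (rule ksol_cong[THEN iffD2, OF _ z])
    fix s x assume "0 \<le> s" "s \<le> S" "x = z s"
    then show "G s x = F s x" using G(5)[of s x] M(2)[of s] n by simp
  qed
  moreover have "ksol G S z0 z'"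
  proof (rule ksol_cong[THEN iffD2, OF _ z'])
    fix s x assume "0 \<le> s" "s \<le> S" "x = z' s"
    then show "G s x = F s x" using G(5)[of s x] M'(2)[of s] n by simp
  qed
  ultimately show ?thesis using ksol_stable[OF G(2,3,1) _ _ s, of z0 z z0 z'] by simp
qed

text \<open>An a priori bound yields existence. Follow the truncated solution to the first time at
  which its norm is \<open>M + 1 / 2\<close>: up to that time it solves the original equation, so
  the a priori bound \<open>M\<close> holds strictly before it and, by continuity, also at it, a
  contradiction.\<close>

lemma ksol_extends:
  assumes z0: "norm z0 \<le> M" and S0: "0 \<le> S0"
    and ap: "\<And>S z s. 0 < S \<Longrightarrow> S \<le> S0 \<Longrightarrow> ksol F S z0 z \<Longrightarrow> 0 < s \<Longrightarrow> s < S \<Longrightarrow> norm (z s) \<le> M"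
  shows "\<exists>z. ksol F S0 z0 z"
proof -
  define n where "n = M + S0 + 1"
  have "0 \<le> M" using z0 norm_ge_zero order_trans by blast
  then have n: "0 < n" "S0 \<le> n" "M + 1 \<le> n" using S0 by (auto simp: n_def)
  obtain G L M' where G: "0 < L" "continuous_on UNIV (case_prod G)"
    "\<And>s x y. norm (G s x - G s y) \<le> L * norm (x - y)" "\<And>s x. norm (G s x) \<le> M'"
    "\<And>s x. 0 \<le> s \<Longrightarrow> s \<le> n \<Longrightarrow> norm x \<le> n \<Longrightarrow> G s x = F s x"
    using F_truncation[OF n(1)] by blast
  obtain z where z: "\<And>S. ksol G S z0 z" using ksol_global[OF G(2,3,1,4)] by blast
  have zc: "continuous_on {0..S0} (\<lambda>s. norm (z s))" using z[of S0] by (auto simp: ksol_def intro!: continuous_intros)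
  have "norm (z s) \<le> n" if s: "s \<in> {0..S0}" for s
  proof (rule ccontr)
    assume no: "\<not> norm (z s) \<le> n"
    have zz: "z 0 = z0" using ksol_init[OF z[of 0]] by simp
    have "\<exists>x\<ge>0. x \<le> s \<and> norm (z x) = M + 1 / 2"
      by (rule IVT') (use zz z0 no n s in \<open>auto intro: continuous_on_subset[OF zc]\<close>)
    then obtain x1 where x1: "0 \<le> x1" "x1 \<le> s" "norm (z x1) = M + 1/2" by auto
    define A where "A = {x\<in>{0..S0}. norm (z x) = M + 1 / 2}"
    have "closed ({0..S0} \<inter> (\<lambda>s. norm (z s)) -` {M + 1/2})"
      by (rule continuous_closed_preimage[OF zc]) auto
    moreover have "{0..S0} \<inter> (\<lambda>s. norm (z s)) -` {M + 1/2} = {0..S0} \<inter> A" "A \<subseteq> {0..S0}" by (auto simp: A_def)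
    ultimately have A: "compact A"
      using compact_Int_closed[of "{0..S0}" "{0..S0} \<inter> A"] by (simp add: Int_absorb1 Int_absorb2)
    have "x1 \<in> A" using x1 s by (auto simp: A_def)
    then obtain x2 where x2: "x2 \<in> A" "\<And>x. x \<in> A \<Longrightarrow> x2 \<le> x"
      using compact_attains_inf[OF A] by auto
    have x20: "0 < x2" using x2(1) zz z0 by (cases "x2 = 0") (auto simp: A_def)
    have le: "norm (z y) \<le> M + 1/2" if y: "0 \<le> y" "y \<le> x2" for y
    proof (rule ccontr)
      assume "\<not> norm (z y) \<le> M + 1/2"
      then have "\<exists>x\<ge>0. x \<le> y \<and> norm (z x) = M + 1 / 2"
        by (intro IVT') (use zz z0 y x2 in \<open>auto intro: continuous_on_subset[OF zc] simp: A_def\<close>)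
      then obtain x where x: "0 \<le> x" "x \<le> y" "norm (z x) = M + 1/2" by auto
      then have "x \<in> A" using y x2 by (auto simp: A_def)
      then have "x = y" using x x2(2) y by fastforce
      then show False using x \<open>\<not> norm (z y) \<le> M + 1/2\<close> by simp
    qed
    have x2S: "x2 \<le> S0" "norm (z x2) = M + 1/2" using x2 by (auto simp: A_def)
    have "ksol F x2 z0 z"
    proof (rule ksol_cong[THEN iffD1, OF _ z[of x2]])
      fix s x assume "0 \<le> s" "s \<le> x2" "x = z s"
      then show "G s x = F s x" using G(5)[of s x] le[of s] x2S n by auto
    qed
    then have lt: "norm (z y) \<le> M" if "0 < y" "y < x2" for y using ap[of x2 z y] x20 x2S that by auto
    have "continuous_on {0..x2} (\<lambda>s. norm (z s))" by (rule continuous_on_subset[OF zc]) (use x2S in auto)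
    then have t: "((\<lambda>s. norm (z s)) \<longlongrightarrow> norm (z x2)) (at_left x2)"
      using x20 by (metis continuous_on_Icc_at_leftD)
    have ev: "\<forall>\<^sub>F s in at_left x2. norm (z s) \<le> M"
      unfolding eventually_at_left_field using x20 lt by blast
    have "norm (z x2) \<le> M"
      by (rule tendsto_upperbound[OF t ev]) simp
    then show False using x2S by simp
  qed
  then have eq: "G s x = F s x" if "0 \<le> s" "s \<le> S0" "x = z s" for s x
    using G(5)[of s x] n that by auto
  have "ksol F S0 z0 z"
    by (rule ksol_cong[THEN iffD1, OF _ z[of S0]]) (rule eq)
  then show ?thesis by blast
qed

lemma ksol_local: "\<exists>S>0. \<exists>z. ksol F S z0 z"
proof -
  define n where "n = norm z0 + 1"
  have n: "0 < n" "norm z0 < n" by (auto simp: n_def add_nonneg_pos)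
  obtain G L M' where G: "0 < L" "continuous_on UNIV (case_prod G)"
    "\<And>s x y. norm (G s x - G s y) \<le> L * norm (x - y)" "\<And>s x. norm (G s x) \<le> M'"
    "\<And>s x. 0 \<le> s \<Longrightarrow> s \<le> n \<Longrightarrow> norm x \<le> n \<Longrightarrow> G s x = F s x"
    using F_truncation[OF n(1)] by blast
  obtain z where z: "\<And>S. ksol G S z0 z" using ksol_global[OF G(2,3,1,4)] by blast
  have "continuous_on {0..1} (\<lambda>s. norm (z s))" using z[of 1] by (auto simp: ksol_def intro!: continuous_intros)
  then have "((\<lambda>s. norm (z s)) \<longlongrightarrow> norm (z 0)) (at_right 0)"
    using continuous_on_Icc_at_rightD[of 0 1 "\<lambda>s. norm (z s)"] by simp
  then have t: "((\<lambda>s. norm (z s)) \<longlongrightarrow> norm z0) (at_right 0)" using ksol_init[OF z[of 0]] by simp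
  obtain b where b: "0 < b" "\<And>s. 0 < s \<Longrightarrow> s < b \<Longrightarrow> norm (z s) < n"
    using order_tendstoD(2)[OF t n(2)] unfolding eventually_at_right_field by auto
  have z0: "z 0 = z0" using ksol_init[OF z[of 0]] by simp
  define S where "S = min (b / 2) n"
  have S: "0 < S" "S < b" "S \<le> n" using b n by (auto simp: S_def)
  have "norm (z s) \<le> n" if "0 \<le> s" "s \<le> S" for s
    using b(2)[of s] z0 n S that by (cases "s = 0") auto
  then have eq: "G s x = F s x" if "0 \<le> s" "s \<le> S" "x = z s" for s x
    using G(5)[of s x] S that by auto
  have "ksol F S z0 z"
    by (rule ksol_cong[THEN iffD1, OF _ z[of S]]) (rule eq)
  then show ?thesis using S by blast
qed

end

section \<open>Bounded Lipschitz functions and truncation\<close>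

definition blip :: "('a::metric_space \<Rightarrow> real) \<Rightarrow> bool" where
  "blip g \<longleftrightarrow> (\<exists>M. \<forall>x. \<bar>g x\<bar> \<le> M) \<and> (\<exists>L. L-lipschitz_on UNIV g)"

lemma blipI: "(\<And>x. \<bar>g x\<bar> \<le> M) \<Longrightarrow> L-lipschitz_on UNIV g \<Longrightarrow> blip g"
  by (auto simp: blip_def)

lemma blipE:
  assumes "blip g"
  obtains M L where "\<And>x. \<bar>g x\<bar> \<le> M" "L-lipschitz_on UNIV g" "0 \<le> M" "0 \<le> L"
  using assms unfolding blip_def by (metis abs_ge_zero lipschitz_on_nonneg order_trans)

lemma blip_const: "blip (\<lambda>x. c)"
  by (rule blipI[of _ "\<bar>c\<bar>" 0]) (auto intro: lipschitz_on_constant)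

lemma blip_add:
  assumes "blip f" "blip g" shows "blip (\<lambda>x. f x + g x)"
proof -
  obtain M L where f: "\<And>x. \<bar>f x\<bar> \<le> M" "L-lipschitz_on UNIV f" using blipE[OF assms(1)] by metis
  obtain M' L' where g: "\<And>x. \<bar>g x\<bar> \<le> M'" "L'-lipschitz_on UNIV g" using blipE[OF assms(2)] by metis
  show ?thesis
    by (rule blipI[of _ "M + M'" "L + L'"])
      (use f g in \<open>auto intro: lipschitz_on_add abs_triangle_ineq[THEN order_trans] add_mono\<close>)
qed

text \<open>This is where boundedness enters: a product of Lipschitz functions is Lipschitz only if
  both factors are bounded. With it, every polynomial in truncated coordinates belongs to the
  class.\<close>

lemma blip_mult:
  assumes "blip f" "blip g" shows "blip (\<lambda>x. f x * g x)"
proof -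
  obtain M L where f: "\<And>x. \<bar>f x\<bar> \<le> M" "L-lipschitz_on UNIV f" "0 \<le> M" "0 \<le> L" using blipE[OF assms(1)] by metis
  obtain M' L' where g: "\<And>x. \<bar>g x\<bar> \<le> M'" "L'-lipschitz_on UNIV g" "0 \<le> M'" "0 \<le> L'" using blipE[OF assms(2)] by metis
  show ?thesis
  proof (rule blipI[of _ "M * M'" "M * L' + M' * L"])
    show "\<bar>f x * g x\<bar> \<le> M * M'" for x using f g by (simp add: abs_mult mult_mono)
    show "(M * L' + M' * L)-lipschitz_on UNIV (\<lambda>x. f x * g x)"
    proof (rule lipschitz_onI)
      fix x y
      have "\<bar>f x * g x - f y * g y\<bar> = \<bar>f x * (g x - g y) + g y * (f x - f y)\<bar>" by (simp add: algebra_simps)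
      also have "\<dots> \<le> \<bar>f x\<bar> * \<bar>g x - g y\<bar> + \<bar>g y\<bar> * \<bar>f x - f y\<bar>"
        by (metis abs_mult abs_triangle_ineq)
      also have "\<dots> \<le> M * (L' * dist x y) + M' * (L * dist x y)"
        using f(1,3) g(1,3) lipschitz_onD[OF f(2), of x y] lipschitz_onD[OF g(2), of x y]
        by (intro add_mono mult_mono) (auto simp: dist_real_def)
      finally show "dist (f x * g x) (f y * g y) \<le> (M * L' + M' * L) * dist x y"
        by (simp add: dist_real_def algebra_simps)
    qed (use f g in auto)
  qed
qed

lemma blip_uminus: "blip f \<Longrightarrow> blip (\<lambda>x. - f x)"
  using blip_mult[OF blip_const[of "-1"], of f] by simp

lemma blip_diff: "blip f \<Longrightarrow> blip g \<Longrightarrow> blip (\<lambda>x. f x - g x)"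
  using blip_add[of f "\<lambda>x. - g x"] blip_uminus[of g] by simp

lemma blip_power2: "blip f \<Longrightarrow> blip (\<lambda>x. (f x)\<^sup>2)"
  unfolding power2_eq_square by (rule blip_mult)

lemmas blip_intros = blip_const blip_add blip_mult blip_diff blip_uminus blip_power2

definition trunc :: "real \<Rightarrow> real \<Rightarrow> real" where "trunc n t = max (- n) (min n t)"

lemma trunc_id: "\<bar>t\<bar> \<le> n \<Longrightarrow> trunc n t = t"
  by (auto simp: trunc_def)

lemma blip_trunc:
  assumes "0 < n" "\<And>x y. \<bar>h x - h y\<bar> \<le> dist x y"
  shows "blip (\<lambda>x. trunc n (h x))"
proof (rule blipI[of _ n 1])
  show "\<bar>trunc n (h x)\<bar> \<le> n" for x using assms(1) by (auto simp: trunc_def)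
  show "1-lipschitz_on UNIV (\<lambda>x. trunc n (h x))"
  proof (rule lipschitz_onI)
    fix x y
    have "\<bar>trunc n (h x) - trunc n (h y)\<bar> \<le> \<bar>h x - h y\<bar>" by (auto simp: trunc_def)
    then show "dist (trunc n (h x)) (trunc n (h y)) \<le> 1 * dist x y"
      using assms(2)[of x y] by (simp add: dist_real_def)
  qed auto
qed

section \<open>The desingularised vector field\<close>

type_synonym state = "real \<times> real \<times> real \<times> real"

text \<open>The exponents 0, 2, 4, 0 are the eigenvalues of the singular linear part at s = 0. The
  first coordinate has exponent 0 and carries the free initial slope. The last one is the constant
  parameter e, kept as part of the state so that continuity in the initial value includes continuity
  in the parameter.\<close>

definition K4 :: "real \<Rightarrow> state \<Rightarrow> state" where
  "K4 \<tau> x = (case x of (p, n, d, e) \<Rightarrow> (p, \<tau>\<^sup>2 * n, \<tau>^4 * d, e))"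

lemma norm_state: "norm (p, n, d, e :: real) = sqrt (p\<^sup>2 + n\<^sup>2 + d\<^sup>2 + e\<^sup>2)"
  by (simp add: norm_Pair power2_eq_square[symmetric] add.assoc)

interpretation K4: kernel K4
proof
  show "K4 \<tau> (x - y) = K4 \<tau> x - K4 \<tau> y" for \<tau> x y
    by (cases x; cases y) (simp add: K4_def algebra_simps)
  show "norm (K4 \<tau> x) \<le> norm x" if "0 \<le> \<tau>" "\<tau> \<le> 1" for \<tau> x
  proof -
    obtain p n d e where x: "x = (p, n, d, e)" by (cases x)
    have "(\<tau>\<^sup>2 * n)\<^sup>2 \<le> n\<^sup>2" "(\<tau>^4 * d)\<^sup>2 \<le> d\<^sup>2"
      using that by (auto simp: power_mult_distrib power_le_one mult_left_le_one_le)
    then show ?thesis by (simp add: x K4_def norm_state)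
  qed
  show "continuous_on UNIV (\<lambda>(\<tau>, x). K4 \<tau> x)"
    unfolding K4_def case_prod_beta by (intro continuous_intros)
qed

text \<open>The right-hand side is y0 + s^(-m) times the integral of \<sigma>^m g over [0, s];
  differentiating the power produces the singular term - m (y - y0) / s.\<close>

lemma regular_component_deriv:
  fixes g y :: "real \<Rightarrow> real"
  assumes g: "continuous_on {0..S} g"
    and y: "\<And>s. s \<in> {0..S} \<Longrightarrow> y s = y0 + s * integral {0..1} (\<lambda>\<tau>. \<tau>^m * g (s * \<tau>))"
    and s: "0 < s" "s < S"
  shows "(y has_real_derivative (g s - m * (y s - y0) / s)) (at s)"
proof -
  define I where "I x = integral {0..x} (\<lambda>\<sigma>. \<sigma>^m * g \<sigma>)" for x
  have c: "continuous_on {0..S} (\<lambda>\<sigma>. \<sigma>^m * g \<sigma>)" by (intro continuous_intros g)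
  have dI: "(I has_real_derivative x^m * g x) (at x within {0..S})" if "x \<in> {0..S}" for x
    unfolding I_def using integral_has_real_derivative[OF c that] .
  have eq: "y x = y0 + I x / x^m" if x: "x \<in> {0<..<S}" for x
  proof -
    have "((\<lambda>\<tau>. x * ((x * \<tau>)^m * g (x * \<tau>))) has_integral (I (x * 1) - I (x * 0))) {0..1}"
    proof (rule fundamental_theorem_of_calculus)
      fix \<tau> :: real assume t: "\<tau> \<in> {0..1}"
      have st: "x * \<tau> \<in> {0..S}" using mult_unit_mem[of x S \<tau>] x t by auto
      have im: "(\<lambda>\<tau>. x * \<tau>) ` {0..1} \<subseteq> {0..S}" using mult_unit_mem[of x S] x by auto
      have "((\<lambda>\<tau>. I (x * \<tau>)) has_real_derivative (x * \<tau>)^m * g (x * \<tau>) * x) (at \<tau> within {0..1})"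
        by (rule DERIV_image_chain[of I _ "\<lambda>\<tau>. x * \<tau>", unfolded o_def])
          (use DERIV_subset[OF dI[OF st] im] in \<open>auto intro!: derivative_eq_intros\<close>)
      then show "((\<lambda>\<tau>. I (x * \<tau>)) has_vector_derivative x * ((x * \<tau>)^m * g (x * \<tau>))) (at \<tau> within {0..1})"
        by (simp add: has_real_derivative_iff_has_vector_derivative mult.commute)
    qed simp
    then have "integral {0..1} (\<lambda>\<tau>. x * ((x * \<tau>)^m * g (x * \<tau>))) = I x"
      by (subst integral_unique) (auto simp: I_def)
    moreover have "(\<lambda>\<tau>. x * ((x * \<tau>)^m * g (x * \<tau>))) = (\<lambda>\<tau>. x^m * (x * (\<tau>^m * g (x * \<tau>))))"
      by (auto simp: power_mult_distrib algebra_simps)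
    ultimately have "x^m * (x * integral {0..1} (\<lambda>\<tau>. \<tau>^m * g (x * \<tau>))) = I x"
      by simp
    then show ?thesis using y[of x] x by (auto simp: field_simps)
  qed
  have sS: "s \<in> {0..S}" using s by simp
  have "at s within {0..S} = at s" by (rule at_within_interior) (use s in simp)
  then have dI': "(I has_real_derivative s^m * g s) (at s)" using dI[OF sS] by simp
  have e: "I s / s^m = y s - y0" using eq[of s] s by simp
  have "((\<lambda>x. I x / x^m) has_real_derivative
      ((s^m * g s) * s^m - I s * (m * s^(m - 1))) / (s^m * s^m)) (at s)"
    by (rule DERIV_divide[OF dI']) (use s DERIV_pow[of m s] in auto)
  then have "((\<lambda>x. y0 + I x / x^m) has_real_derivative
      0 + ((s^m * g s) * s^m - I s * (m * s^(m - 1))) / (s^m * s^m)) (at s)"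
    by (intro DERIV_add DERIV_const)
  moreover have "0 + ((s^m * g s) * s^m - I s * (m * s^(m - 1))) / (s^m * s^m) = g s - m * (I s / s^m) / s"
    using s by (cases m) (auto simp: field_simps)
  ultimately have "((\<lambda>x. y0 + I x / x^m) has_real_derivative (g s - m * (y s - y0) / s)) (at s)"
    by (simp only: e)
  then show ?thesis
    by (rule DERIV_cong_ev[THEN iffD1, OF refl _ refl, rotated])
      (use s eq in \<open>auto simp: eventually_nhds intro!: exI[of _ "{0<..<S}"]\<close>)
qed

text \<open>The value of d = u - v on the singular orbit. With w = R = 1 at s = 0, the equation of d
  has the pole - 3 (d - d0) / s, which must cancel.\<close>

definition d0 :: "real \<Rightarrow> real" where "d0 C = (1 - 2 * C) / 3"
text \<open>\<open>om\<close>, \<open>et\<close>, \<open>de\<close> invert the linear change that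
  diagonalises the singular part, where w = 1 + s * om, R = 1 + s * et and d = d0 + s * de. The
  coordinates are p = om + et, the difference n of the two shifted by a multiple of e, and a shifted
  \<open>de\<close>. The shifts absorb the inhomogeneous terms at s = 0, so that the second and
  third coordinates start at 0.\<close>

definition om :: "real \<Rightarrow> real \<Rightarrow> real \<Rightarrow> real \<Rightarrow> real" where
  "om C p n e = (p + n + e * ((9 + d0 C + 2 * C) / 2)) / 2"
definition et :: "real \<Rightarrow> real \<Rightarrow> real \<Rightarrow> real \<Rightarrow> real" where
  "et C p n e = (p - n - e * ((9 + d0 C + 2 * C) / 2)) / 2"
definition de :: "real \<Rightarrow> real \<Rightarrow> real \<Rightarrow> real \<Rightarrow> real" where
  "de C p \<delta> e = \<delta> + d0 C * (p + e * (1 + d0 C))"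

text \<open>What remains of the equations of \<open>om\<close>, \<open>et\<close> and
  \<open>de\<close> after the singular linear part has been split off. It is polynomial in s and e,
  so s = 0 and e = 0 are ordinary points. \<open>regular_identities\<close> confirms the three
  expressions.\<close>

definition f_om :: "real \<Rightarrow> real \<Rightarrow> real \<Rightarrow> real \<Rightarrow> real \<Rightarrow> real \<Rightarrow> real" where
  "f_om C s \<omega> \<eta> \<delta> e = (let d = d0 C + s * \<delta>; a1 = \<omega> + 2 * e * d; a2 = \<omega> + 2 * e * C;
     m = \<eta> * a1 + \<eta> * a2 + a1 * a2 + s * \<eta> * a1 * a2
   in 2 * e * \<delta> + m + \<omega> * (4 * e + \<eta> + 2 * e * d + 2 * e * C + s * m))"
definition f_et :: "real \<Rightarrow> real \<Rightarrow> real \<Rightarrow> real \<Rightarrow> real \<Rightarrow> real \<Rightarrow> real" where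
  "f_et C s \<omega> \<eta> \<delta> e = (let d = d0 C + s * \<delta>; j = \<eta> + \<omega> + 2 * e * C * d + s * \<eta> * (\<omega> + 2 * e * C * d)
   in e * \<delta> - 2 * e * j + \<eta> * (\<omega> + e * d - 3 * e - 2 * e * (1 + s * j)))"
definition f_de :: "real \<Rightarrow> real \<Rightarrow> real \<Rightarrow> real \<Rightarrow> real \<Rightarrow> real \<Rightarrow> real" where
  "f_de C s \<omega> \<eta> \<delta> e = (let d = d0 C + s * \<delta>; a1 = \<omega> + 2 * e * d;
     h = \<eta> * \<omega> + \<eta> * a1 + \<omega> * a1; Y = \<eta> + \<omega> + a1 + s * h + s\<^sup>2 * \<eta> * \<omega> * a1
   in \<delta> * (4 * e - 4 * \<omega> - 4 * e * d + Y)
      + d0 C * (- 4 * e * \<delta> + 4 * (2 * e * \<delta> + h + s * \<eta> * \<omega> * a1)))"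

definition field4 :: "real \<Rightarrow> real \<Rightarrow> state \<Rightarrow> state" where
  "field4 C s x = (case x of (p, n, d, e) \<Rightarrow>
     let \<omega> = om C p n e; \<eta> = et C p n e; \<delta> = de C p d e;
         F = f_om C s \<omega> \<eta> \<delta> e; G = f_et C s \<omega> \<eta> \<delta> e; H = f_de C s \<omega> \<eta> \<delta> e
     in (F + G, F - G, H - d0 C * (F + G), 0))"

lemma blip_om: "blip p \<Longrightarrow> blip n \<Longrightarrow> blip e \<Longrightarrow> blip (\<lambda>x. om C (p x) (n x) (e x))"
  unfolding om_def divide_inverse by (intro blip_intros)

lemma blip_et: "blip p \<Longrightarrow> blip n \<Longrightarrow> blip e \<Longrightarrow> blip (\<lambda>x. et C (p x) (n x) (e x))"
  unfolding et_def divide_inverse by (intro blip_intros)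

lemma blip_de: "blip p \<Longrightarrow> blip n \<Longrightarrow> blip e \<Longrightarrow> blip (\<lambda>x. de C (p x) (n x) (e x))"
  unfolding de_def by (intro blip_intros)

lemma blip_f:
  assumes "blip s" "blip \<omega>" "blip \<eta>" "blip \<delta>" "blip e"
  shows "blip (\<lambda>x. f_om C (s x) (\<omega> x) (\<eta> x) (\<delta> x) (e x))"
    "blip (\<lambda>x. f_et C (s x) (\<omega> x) (\<eta> x) (\<delta> x) (e x))"
    "blip (\<lambda>x. f_de C (s x) (\<omega> x) (\<eta> x) (\<delta> x) (e x))"
  unfolding f_om_def f_et_def f_de_def Let_def by (intro blip_intros assms)+

text \<open>Each argument is truncated before the polynomial is evaluated; all four components then
  lie in the class \<open>blip\<close>, and below level \<open>N\<close> nothing has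
  changed.\<close>

lemma field4_truncation:
  assumes n: "0 < (N::real)"
  shows "\<exists>G L M. 0 < L \<and> continuous_on UNIV (case_prod G) \<and>
    (\<forall>s x y. norm (G s x - G s y) \<le> L * norm (x - y)) \<and> (\<forall>s x. norm (G s x) \<le> M) \<and>
    (\<forall>s x. 0 \<le> s \<longrightarrow> s \<le> N \<longrightarrow> norm x \<le> N \<longrightarrow> G s x = field4 C s x)"
proof -
  let ?T = "\<lambda>x :: state. (trunc N (fst x), trunc N (fst (snd x)), trunc N (fst (snd (snd x))), trunc N (snd (snd (snd x))))"
  define G where "G s x = field4 C (trunc N s) (?T x)" for s x
  have cmp: "\<bar>p\<bar> \<le> norm (p, n, d, e)" "\<bar>n\<bar> \<le> norm (p, n, d, e)" "\<bar>d\<bar> \<le> norm (p, n, d, e)" "\<bar>e\<bar> \<le> norm (p, n, d, e)"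
    for p n d e :: real
    unfolding norm_state by (auto intro!: real_le_rsqrt simp: add_nonneg_nonneg)
  have base: "blip (\<lambda>x :: real \<times> state. trunc N (fst x))" "blip (\<lambda>x :: real \<times> state. trunc N (fst (snd x)))"
    "blip (\<lambda>x :: real \<times> state. trunc N (fst (snd (snd x))))" "blip (\<lambda>x :: real \<times> state. trunc N (fst (snd (snd (snd x)))))"
    "blip (\<lambda>x :: real \<times> state. trunc N (snd (snd (snd (snd x)))))"
    by ((rule blip_trunc[OF n], fold dist_real_def,
        (rule dist_fst_le[THEN order_trans] dist_snd_le[THEN order_trans] order_refl)+)[1])+
  have comps: "blip (\<lambda>x. fst (case_prod G x))" "blip (\<lambda>x. fst (snd (case_prod G x)))"
    "blip (\<lambda>x. fst (snd (snd (case_prod G x))))" "blip (\<lambda>x. snd (snd (snd (case_prod G x))))"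
    unfolding G_def field4_def Let_def case_prod_beta fst_conv snd_conv
    by (intro blip_intros blip_f blip_om blip_et blip_de base)+
  obtain M1 L1 where 1: "\<And>x. \<bar>fst (case_prod G x)\<bar> \<le> M1" "L1-lipschitz_on UNIV (\<lambda>x. fst (case_prod G x))" "0 \<le> L1"
    using blipE[OF comps(1)] by metis
  obtain M2 L2 where 2: "\<And>x. \<bar>fst (snd (case_prod G x))\<bar> \<le> M2" "L2-lipschitz_on UNIV (\<lambda>x. fst (snd (case_prod G x)))" "0 \<le> L2"
    using blipE[OF comps(2)] by metis
  obtain M3 L3 where 3: "\<And>x. \<bar>fst (snd (snd (case_prod G x)))\<bar> \<le> M3" "L3-lipschitz_on UNIV (\<lambda>x. fst (snd (snd (case_prod G x))))" "0 \<le> L3"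
    using blipE[OF comps(3)] by metis
  obtain M4 L4 where 4: "\<And>x. \<bar>snd (snd (snd (case_prod G x)))\<bar> \<le> M4" "L4-lipschitz_on UNIV (\<lambda>x. snd (snd (snd (case_prod G x))))" "0 \<le> L4"
    using blipE[OF comps(4)] by metis
  have nle: "norm y \<le> \<bar>fst y\<bar> + (\<bar>fst (snd y)\<bar> + (\<bar>fst (snd (snd y))\<bar> + \<bar>snd (snd (snd y))\<bar>))" for y :: state
    by (cases y) (auto intro!: norm_Pair_le[THEN order_trans])
  have lip: "norm (case_prod G x - case_prod G y) \<le> (L1 + (L2 + (L3 + L4))) * dist x y" for x y
  proof -
    have "norm (case_prod G x - case_prod G y) \<le> L1 * dist x y + (L2 * dist x y + (L3 * dist x y + L4 * dist x y))"
      by (rule order_trans[OF nle], unfold fst_diff snd_diff)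
        (intro add_mono lipschitz_onD[OF 1(2) UNIV_I UNIV_I, unfolded dist_real_def]
          lipschitz_onD[OF 2(2) UNIV_I UNIV_I, unfolded dist_real_def]
          lipschitz_onD[OF 3(2) UNIV_I UNIV_I, unfolded dist_real_def]
          lipschitz_onD[OF 4(2) UNIV_I UNIV_I, unfolded dist_real_def])
    then show ?thesis by (simp add: algebra_simps)
  qed
  have "(L1 + (L2 + (L3 + L4)))-lipschitz_on UNIV (case_prod G)"
    by (rule lipschitz_onI) (use lip 1(3) 2(3) 3(3) 4(3) in \<open>auto simp: dist_norm\<close>)
  then have "continuous_on UNIV (case_prod G)" by (rule lipschitz_on_continuous_on)
  moreover have "norm (G s x - G s y) \<le> (L1 + (L2 + (L3 + L4)) + 1) * norm (x - y)" for s x y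
  proof -
    have "norm (G s x - G s y) \<le> (L1 + (L2 + (L3 + L4))) * dist x y"
      using lip[of "(s, x)" "(s, y)"] by (simp add: dist_Pair_Pair)
    also have "\<dots> \<le> (L1 + (L2 + (L3 + L4)) + 1) * norm (x - y)"
      unfolding dist_norm by (intro mult_right_mono) auto
    finally show ?thesis .
  qed
  moreover have "norm (G s x) \<le> M1 + (M2 + (M3 + M4))" for s x
    using 1(1)[of "(s, x)"] 2(1)[of "(s, x)"] 3(1)[of "(s, x)"] 4(1)[of "(s, x)"] nle[of "G s x"] by simp
  moreover have "G s x = field4 C s x" if "0 \<le> s" "s \<le> N" "norm x \<le> N" for s x
  proof -
    obtain p n d e where x: "x = (p, n, d, e)" by (cases x)
    show ?thesis using that cmp(1)[of p n d e] cmp(2)[of n p d e] cmp(3)[of d p n e] cmp(4)[of e p n d]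
      by (simp add: G_def x trunc_id)
  qed
  moreover have "0 < L1 + (L2 + (L3 + L4)) + 1" using 1(3) 2(3) 3(3) 4(3) by simp
  ultimately show ?thesis by blast
qed

interpretation ivp: kernel_ivp K4 "field4 C" for C
  by unfold_locales (rule field4_truncation)

section \<open>Barriers and limits\<close>

lemma first_zero:
  fixes m :: "real \<Rightarrow> real"
  assumes c: "continuous_on {a..b} m" and "0 < m a" "m b \<le> 0" "a \<le> b"
  obtains x where "a < x" "x \<le> b" "m x = 0" "\<And>y. a \<le> y \<Longrightarrow> y < x \<Longrightarrow> 0 < m y"
proof -
  define A where "A = {a..b} \<inter> m -` {..0}"
  have "closed A" unfolding A_def by (rule continuous_closed_preimage[OF c]) auto
  then have "compact A" using compact_Int_closed[of "{a..b}" A] by (auto simp: A_def Int_absorb1)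
  moreover have "b \<in> A" using assms by (auto simp: A_def)
  ultimately obtain x where x: "x \<in> A" "\<And>y. y \<in> A \<Longrightarrow> x \<le> y"
    using compact_attains_inf[of A] by auto
  have pos: "0 < m y" if "a \<le> y" "y < x" for y
    using x(2)[of y] that x(1) by (force simp: A_def)
  have ax: "a < x" using x(1) assms(2) by (cases "a = x") (auto simp: A_def)
  have "m x = 0"
  proof (rule ccontr)
    assume "m x \<noteq> 0"
    then have "m x < 0" using x(1) by (auto simp: A_def)
    have "\<exists>y\<ge>a. y \<le> x \<and> m y = 0"
      by (rule IVT2') (use assms x \<open>m x < 0\<close> continuous_on_subset[OF c, of "{a..x}"] in \<open>auto simp: A_def\<close>)
    then obtain y where "a \<le> y" "y \<le> x" "m y = 0" by auto
    then show False using pos[of y] \<open>m x < 0\<close> by (cases "y = x") auto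
  qed
  then show ?thesis using that ax x(1) pos by (auto simp: A_def)
qed

lemma last_zero:
  fixes m :: "real \<Rightarrow> real"
  assumes c: "continuous_on {a..b} m" and "m a \<le> 0" "0 < m b" "a \<le> b"
  obtains x where "a \<le> x" "x < b" "m x = 0" "\<And>y. x < y \<Longrightarrow> y \<le> b \<Longrightarrow> 0 < m y"
proof -
  have "continuous_on {-b..-a} (\<lambda>x. m (- x))"
    by (rule continuous_on_compose2[OF c]) (auto intro!: continuous_intros)
  then obtain x where x: "- b < x" "x \<le> - a" "m (- x) = 0" "\<And>y. - b \<le> y \<Longrightarrow> y < x \<Longrightarrow> 0 < m (- y)"
    using first_zero[of "-b" "-a" "\<lambda>x. m (- x)"] assms by auto
  show ?thesis by (rule that[of "- x"]) (use x x(4)[of "- y" for y] in auto)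
qed

lemma deriv_imp_continuous_on:
  fixes f f' :: "real \<Rightarrow> real"
  assumes "\<And>s. a \<le> s \<Longrightarrow> s \<le> b \<Longrightarrow> (f has_real_derivative f' s) (at s)"
  shows "continuous_on {a..b} f"
  using assms DERIV_isCont by (metis atLeastAtMost_iff continuous_at_imp_continuous_on)

text \<open>At the first time one of the functions vanishes, all three are still nonnegative, and a
  function that reaches 0 from above has no positive derivative there. At an edge or a corner of the
  region it is enough that one of the vanishing functions is pushed inwards, which is what the
  invariant regions below offer.\<close>

lemma barrier3:
  fixes f g h f' g' h' :: "real \<Rightarrow> real"
  assumes init: "0 < f a" "0 < g a" "0 < h a"
    and der: "\<And>s. a \<le> s \<Longrightarrow> s \<le> b \<Longrightarrow> (f has_real_derivative f' s) (at s)"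
      "\<And>s. a \<le> s \<Longrightarrow> s \<le> b \<Longrightarrow> (g has_real_derivative g' s) (at s)"
      "\<And>s. a \<le> s \<Longrightarrow> s \<le> b \<Longrightarrow> (h has_real_derivative h' s) (at s)"
    and push: "\<And>s. a < s \<Longrightarrow> s \<le> b \<Longrightarrow> 0 \<le> f s \<Longrightarrow> 0 \<le> g s \<Longrightarrow> 0 \<le> h s \<Longrightarrow> f s = 0 \<or> g s = 0 \<or> h s = 0 \<Longrightarrow>
      f s = 0 \<and> 0 < f' s \<or> g s = 0 \<and> 0 < g' s \<or> h s = 0 \<and> 0 < h' s"
    and s: "a \<le> s" "s \<le> b"
  shows "0 < f s \<and> 0 < g s \<and> 0 < h s"
proof (rule ccontr)
  assume no: "\<not> ?thesis"
  define m where "m s = min (f s) (min (g s) (h s))" for s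
  have "continuous_on {a..s} f" "continuous_on {a..s} g" "continuous_on {a..s} h"
    using der s by (meson deriv_imp_continuous_on order_trans)+
  then have "continuous_on {a..s} m" unfolding m_def by (intro continuous_intros)
  moreover have "0 < m a" "m s \<le> 0" using no init by (auto simp: m_def)
  ultimately obtain x where x: "a < x" "x \<le> s" "m x = 0" "\<And>y. a \<le> y \<Longrightarrow> y < x \<Longrightarrow> 0 < m y"
    using first_zero s by metis
  have False if F: "\<And>s. a \<le> s \<Longrightarrow> s \<le> b \<Longrightarrow> (F has_real_derivative F' s) (at s)" "F x = 0" "0 < F' x"
    "\<And>y. m y \<le> F y" for F F'
  proof -
    obtain d where d: "0 < d" "\<And>h. 0 < h \<Longrightarrow> h < d \<Longrightarrow> F (x - h) < F x"
      using DERIV_pos_inc_left[of F "F' x" x] F(1)[of x] F(3) x s by auto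
    define h where "h = min (d / 2) (x - a)"
    have "0 < h" "h < d" "a \<le> x - h" using d(1) x(1) by (auto simp: h_def)
    then show False using d(2)[of h] x(4)[of "x - h"] F(2) F(4)[of "x - h"] by auto
  qed
  moreover have "f x = 0 \<and> 0 < f' x \<or> g x = 0 \<and> 0 < g' x \<or> h x = 0 \<and> 0 < h' x"
    by (rule push) (use x s in \<open>auto simp: m_def min_def split: if_splits\<close>)
  ultimately show False using der
    by (metis m_def min.cobounded1 min.cobounded2 min.coboundedI2)
qed

lemma barrier:
  fixes f f' :: "real \<Rightarrow> real"
  assumes "0 < f a"
    and "\<And>s. a \<le> s \<Longrightarrow> s \<le> b \<Longrightarrow> (f has_real_derivative f' s) (at s)"
    and "\<And>s. a < s \<Longrightarrow> s \<le> b \<Longrightarrow> f s = 0 \<Longrightarrow> 0 < f' s"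
    and "a \<le> s" "s \<le> b"
  shows "0 < f s"
  using barrier3[of f a f f b f' f' f' s] assms by blast

text \<open>With the integrating factor exp (- G), G a primitive of g, the product x exp (- G) is
  constant and so keeps its sign.\<close>

lemma linear_ode_pos:
  fixes x g :: "real \<Rightarrow> real"
  assumes "0 < x a" and der: "\<And>s. a \<le> s \<Longrightarrow> s \<le> b \<Longrightarrow> (x has_real_derivative x s * g s) (at s)"
    and g: "continuous_on {a..b} g" and s: "a \<le> s" "s \<le> b"
  shows "0 < x s"
proof -
  define G where "G t = integral {a..t} g" for t
  have G: "(G has_real_derivative g t) (at t within {a..b})" if "t \<in> {a..b}" for t
    unfolding G_def by (rule integral_has_real_derivative[OF g that])
  have "((\<lambda>t. x t * exp (- G t)) has_real_derivative 0) (at t within {a..b})" if t: "t \<in> {a..b}" for t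
  proof -
    have "(x has_real_derivative x t * g t) (at t within {a..b})"
      using der[of t] t by (auto intro: has_field_derivative_at_within)
    then show ?thesis using G[OF t] by (auto intro!: derivative_eq_intros)
  qed
  then have "\<exists>c. \<forall>t\<in>{a..b}. x t * exp (- G t) = c"
    by (intro has_field_derivative_zero_constant) auto
  then obtain c where c: "\<And>t. t \<in> {a..b} \<Longrightarrow> x t * exp (- G t) = c" by blast
  have "0 < c" using c[of a] assms(1) s by (metis atLeastAtMost_iff exp_gt_zero mult_pos_pos order_refl order_trans)
  then have "0 < x s * exp (- G s)" using c[of s] s by auto
  then show ?thesis by (simp add: zero_less_mult_iff)
qed

lemma decrease_bound:
  fixes f f' :: "real \<Rightarrow> real"
  assumes "a \<le> b" "\<And>s. a \<le> s \<Longrightarrow> s \<le> b \<Longrightarrow> (f has_real_derivative f' s) (at s)"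
    "\<And>s. a < s \<Longrightarrow> s < b \<Longrightarrow> f' s \<le> - c"
  shows "f b \<le> f a - c * (b - a)"
proof (cases "a < b")
  case True
  obtain z where z: "a < z" "z < b" "f b - f a = (b - a) * f' z"
    using MVT2[OF True, of f f'] assms(2) by auto
  have "(b - a) * f' z \<le> (b - a) * (- c)" using assms(3)[OF z(1,2)] True by (intro mult_left_mono) auto
  then show ?thesis using z by (simp add: algebra_simps)
qed (use assms in auto)

text \<open>Above \<open>A\<close> the function falls at a rate of at least \<open>c\<close>, so it
  gets down to \<open>A\<close>. After that it cannot exceed \<open>A\<close> again, since it would
  have to fall from its last time at level \<open>A\<close> onwards.\<close>

lemma eventually_le_of_deriv:
  fixes f f' :: "real \<Rightarrow> real"
  assumes der: "\<And>s. a \<le> s \<Longrightarrow> (f has_real_derivative f' s) (at s)" and c: "0 < c"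
    and dec: "\<And>s. a \<le> s \<Longrightarrow> A \<le> f s \<Longrightarrow> f' s \<le> - c"
  shows "\<forall>\<^sub>F s in at_top. f s \<le> A"
proof -
  have "\<exists>b\<ge>a. f b \<le> A"
  proof (rule ccontr)
    assume "\<not> ?thesis"
    then have no: "A < f s" if "a \<le> s" for s using that by force
    define b where "b = a + (f a - A) / c"
    have ab: "a \<le> b" using no[of a] c by (simp add: b_def)
    have "f b \<le> f a - c * (b - a)"
      by (rule decrease_bound[OF ab]) (use der dec no in \<open>auto simp: less_imp_le\<close>)
    also have "\<dots> = A" using c by (simp add: b_def)
    finally show False using no[OF ab] by simp
  qed
  then obtain b where b: "a \<le> b" "f b \<le> A" by blast
  have "f s \<le> A" if bs: "b \<le> s" for s
  proof (rule ccontr)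
    assume no: "\<not> f s \<le> A"
    have "continuous_on {b..s} (\<lambda>s. f s - A)"
      using der b by (intro continuous_intros deriv_imp_continuous_on[of b s f f']) auto
    then obtain x where x: "b \<le> x" "x < s" "f x - A = 0" "\<And>y. x < y \<Longrightarrow> y \<le> s \<Longrightarrow> 0 < f y - A"
      using last_zero[of b s "\<lambda>s. f s - A"] b no bs by auto
    have "f s \<le> f x - c * (s - x)"
    proof (rule decrease_bound)
      fix t assume "x < t" "t < s"
      then show "f' t \<le> - c" using x(4)[of t] x(1) b dec[of t] by auto
    qed (use x der b in auto)
    moreover have "0 < c * (s - x)" using c x by simp
    ultimately show False using x no by simp
  qed
  then show ?thesis by (auto simp: eventually_at_top_linorder)
qed

text \<open>As soon as |g| < k h / 2, the logistic term dominates whenever x is at distance h or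
  more from 1. The speed is bounded below because x \<ge> l, so x enters the strip of width h about
  1 and stays there.\<close>

lemma logistic_tendsto:
  fixes x g :: "real \<Rightarrow> real"
  assumes der: "\<And>s. a \<le> s \<Longrightarrow> (x has_real_derivative x s * (k * (1 - x s) + g s)) (at s)"
    and k: "0 < k" and l: "0 < l" "\<And>s. a \<le> s \<Longrightarrow> l \<le> x s" and g: "(g \<longlongrightarrow> 0) at_top"
  shows "(x \<longlongrightarrow> 1) at_top"
proof (rule tendstoI)
  fix \<eta> :: real assume \<eta>: "0 < \<eta>"
  define h where "h = \<eta> / 2"
  have h: "0 < h" "h < \<eta>" using \<eta> by (auto simp: h_def)
  have "\<forall>\<^sub>F s in at_top. dist (g s) 0 < k * h / 2" by (rule tendstoD[OF g]) (use k h in auto)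
  then obtain b where b: "\<And>s. b \<le> s \<Longrightarrow> \<bar>g s\<bar> < k * h / 2"
    by (auto simp: eventually_at_top_linorder)
  define b' where "b' = max a b"
  have up: "\<forall>\<^sub>F s in at_top. x s \<le> 1 + h"
  proof (rule eventually_le_of_deriv[of b'])
    fix s assume s: "b' \<le> s"
    then show "(x has_real_derivative x s * (k * (1 - x s) + g s)) (at s)" using der by (auto simp: b'_def)
    assume "1 + h \<le> x s"
    then have "k * (1 - x s) \<le> k * (- h)" using k by (intro mult_left_mono) auto
    then have q: "k * (1 - x s) + g s \<le> - (k * h / 2)" using b[of s] s by (auto simp: b'_def)
    have "x s * (k * (1 - x s) + g s) \<le> x s * (- (k * h / 2))"
      by (rule mult_left_mono[OF q]) (use l(2)[of s] l(1) s in \<open>auto simp: b'_def\<close>)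
    also have "\<dots> \<le> l * (- (k * h / 2))"
      using l(2)[of s] s k h by (intro mult_right_mono_neg) (auto simp: b'_def)
    finally show "x s * (k * (1 - x s) + g s) \<le> - (l * (k * h / 2))" by simp
  qed (use l k h in auto)
  have "\<forall>\<^sub>F s in at_top. - x s \<le> - (1 - h)"
  proof (rule eventually_le_of_deriv[of b'])
    fix s assume s: "b' \<le> s"
    then show "((\<lambda>s. - x s) has_real_derivative - (x s * (k * (1 - x s) + g s))) (at s)"
      using der by (auto simp: b'_def intro!: DERIV_minus)
    assume "- (1 - h) \<le> - x s"
    then have "k * h \<le> k * (1 - x s)" using k by (intro mult_left_mono) auto
    then have q: "k * h / 2 \<le> k * (1 - x s) + g s" using b[of s] s by (auto simp: b'_def)
    have "l * (k * h / 2) \<le> x s * (k * (1 - x s) + g s)"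
      by (rule mult_mono) (use q l(1) l(2)[of s] k h s in \<open>auto simp: b'_def\<close>)
    then show "- (x s * (k * (1 - x s) + g s)) \<le> - (l * (k * h / 2))" by simp
  qed (use l k h in auto)
  with up show "\<forall>\<^sub>F s in at_top. dist (x s) 1 < \<eta>"
    by eventually_elim (use h in \<open>auto simp: dist_real_def abs_if\<close>)
qed

lemma decreasing_tendsto:
  fixes V :: "real \<Rightarrow> real"
  assumes dec: "\<And>s t. a \<le> s \<Longrightarrow> s \<le> t \<Longrightarrow> V t \<le> V s" and lb: "\<And>s. a \<le> s \<Longrightarrow> l \<le> V s"
  shows "\<exists>L. (V \<longlongrightarrow> L) at_top \<and> (\<forall>s\<ge>a. L \<le> V s)"
proof -
  define L where "L = Inf (V ` {a..})"
  have bb: "bdd_below (V ` {a..})" using lb by (auto intro!: bdd_belowI[of _ l])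
  have le: "L \<le> V s" if "a \<le> s" for s unfolding L_def by (rule cInf_lower) (use that bb in auto)
  have "(V \<longlongrightarrow> L) at_top"
  proof (rule tendstoI)
    fix e :: real assume e: "0 < e"
    have "\<exists>x\<in>V ` {a..}. x < L + e"
      using cInf_lessD[of "V ` {a..}" "L + e"] e by (auto simp: L_def)
    then obtain b where b: "a \<le> b" "V b < L + e" by auto
    have "dist (V s) L < e" if "b \<le> s" for s
      using dec[OF b(1) that] le[of s] b that by (auto simp: dist_real_def abs_if)
    then show "\<forall>\<^sub>F s in at_top. dist (V s) L < e" by (auto simp: eventually_at_top_linorder)
  qed
  then show ?thesis using le by blast
qed

text \<open>If f were at least \<eta> at arbitrarily late times, uniform continuity would keep it
  above \<eta> / 2 on intervals of a fixed length h, and each of these costs V a drop of h \<eta> /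
  2. This contradicts the convergence of V.\<close>

lemma barbalat:
  fixes V f :: "real \<Rightarrow> real"
  assumes der: "\<And>s. a \<le> s \<Longrightarrow> (V has_real_derivative - f s) (at s)" and f0: "\<And>s. a \<le> s \<Longrightarrow> 0 \<le> f s"
    and V: "(V \<longlongrightarrow> L) at_top" and uc: "uniformly_continuous_on {a..} f"
  shows "(f \<longlongrightarrow> 0) at_top"
proof (rule tendstoI)
  fix \<eta> :: real assume \<eta>: "0 < \<eta>"
  obtain \<delta> where \<delta>: "0 < \<delta>" "\<And>x y. a \<le> x \<Longrightarrow> a \<le> y \<Longrightarrow> dist x y < \<delta> \<Longrightarrow> dist (f x) (f y) < \<eta> / 2"
    using uc \<eta> unfolding uniformly_continuous_on_def by (metis atLeast_iff half_gt_zero)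
  define h where "h = \<delta> / 2"
  have h: "0 < h" "h < \<delta>" using \<delta> by (auto simp: h_def)
  have "\<forall>\<^sub>F s in at_top. dist (V s) L < h * \<eta> / 4" by (rule tendstoD[OF V]) (use h \<eta> in auto)
  then obtain b where b: "\<And>s. b \<le> s \<Longrightarrow> \<bar>V s - L\<bar> < h * \<eta> / 4"
    by (auto simp: eventually_at_top_linorder dist_real_def)
  have "f s < \<eta>" if s: "max a b \<le> s" for s
  proof (rule ccontr)
    assume "\<not> f s < \<eta>"
    have "V (s + h) \<le> V s - (\<eta> / 2) * (s + h - s)"
    proof (rule decrease_bound)
      fix t assume t: "s < t" "t < s + h"
      then have "dist (f s) (f t) < \<eta> / 2" using s h by (intro \<delta>(2)) (auto simp: dist_real_def)
      then show "- f t \<le> - (\<eta> / 2)" using \<open>\<not> f s < \<eta>\<close> by (auto simp: dist_real_def abs_if split: if_splits)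
    qed (use h s der in auto)
    moreover have "\<bar>V s - L\<bar> < h * \<eta> / 4" "\<bar>V (s + h) - L\<bar> < h * \<eta> / 4" using b[of s] b[of "s + h"] s h by auto
    ultimately show False by (simp add: algebra_simps abs_if split: if_splits)
  qed
  then show "\<forall>\<^sub>F s in at_top. dist (f s) 0 < \<eta>"
    using f0 by (auto simp: eventually_at_top_linorder dist_real_def intro!: exI[of _ "max a b"])
qed

text \<open>Outside a ball around its only zero, W has a positive minimum on the compact set. Once W
  along the path is smaller than this minimum, the path is inside the ball.\<close>

lemma compact_unique_zero_tendsto:
  fixes x :: "real \<Rightarrow> 'a::metric_space" and W :: "'a \<Rightarrow> real"
  assumes K: "compact K" and x: "\<And>s. a \<le> s \<Longrightarrow> x s \<in> K" and W: "continuous_on K W"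
    and lim: "((\<lambda>s. W (x s)) \<longlongrightarrow> 0) at_top"
    and nonneg: "\<And>y. y \<in> K \<Longrightarrow> 0 \<le> W y"
    and uniq: "\<And>y y'. y \<in> K \<Longrightarrow> y' \<in> K \<Longrightarrow> W y = 0 \<Longrightarrow> W y' = 0 \<Longrightarrow> y = y'"
  obtains p where "p \<in> K" "W p = 0" "(x \<longlongrightarrow> p) at_top"
proof -
  have "\<exists>p\<in>K. W p = 0"
  proof (rule ccontr)
    assume no: "\<not> ?thesis"
    have "K \<noteq> {}" using x by auto
    then obtain q where q: "q \<in> K" "\<And>y. y \<in> K \<Longrightarrow> W q \<le> W y"
      using continuous_attains_inf[OF K _ W] by auto
    then have "0 < W q" using no nonneg[of q] by force
    then have "\<forall>\<^sub>F s in at_top. dist (W (x s)) 0 < W q" by (rule tendstoD[OF lim])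
    then obtain b where "\<And>s. b \<le> s \<Longrightarrow> \<bar>W (x s)\<bar> < W q" by (auto simp: eventually_at_top_linorder)
    then have "\<bar>W (x (max a b))\<bar> < W q" by simp
    then show False using q(2)[OF x[of "max a b"]] by simp
  qed
  then obtain p where p: "p \<in> K" "W p = 0" by blast
  have "(x \<longlongrightarrow> p) at_top"
  proof (rule tendstoI)
    fix e :: real assume e: "0 < e"
    define K' where "K' = K - ball p e"
    have K': "compact K'" unfolding K'_def by (intro compact_diff K) auto
    show "\<forall>\<^sub>F s in at_top. dist (x s) p < e"
    proof (cases "K' = {}")
      case True
      then have "dist (x s) p < e" if "a \<le> s" for s using x[OF that] by (auto simp: K'_def dist_commute)
      then show ?thesis by (auto simp: eventually_at_top_linorder)
    next
      case False
      have "continuous_on K' W" by (rule continuous_on_subset[OF W]) (auto simp: K'_def)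
      then obtain q where q: "q \<in> K'" "\<And>y. y \<in> K' \<Longrightarrow> W q \<le> W y"
        using continuous_attains_inf[OF K' False, of W] by auto
      have "W q \<noteq> 0" using uniq[of q p] q(1) p e by (auto simp: K'_def)
      then have "0 < W q" using nonneg[of q] q(1) by (auto simp: K'_def)
      then have "\<forall>\<^sub>F s in at_top. dist (W (x s)) 0 < W q" by (rule tendstoD[OF lim])
      moreover have "\<forall>\<^sub>F s in at_top. a \<le> s" by (rule eventually_ge_at_top)
      ultimately show ?thesis
      proof eventually_elim
        case (elim s)
        have "x s \<notin> K'" using q(2)[of "x s"] elim by (auto simp: dist_real_def)
        then show ?case using x[OF elim(2)] by (auto simp: K'_def dist_commute)
      qed
    qed
  qed
  then show ?thesis using that p by blast
qed

section \<open>The regularised system\<close>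

lemma field4_continuous: "continuous_on UNIV (case_prod (field4 C))"
  unfolding field4_def f_om_def f_et_def f_de_def om_def et_def de_def Let_def case_prod_beta
  by (intro continuous_intros) auto

lemma ksol_component:
  fixes h :: "state \<Rightarrow> real"
  assumes sol: "K4.ksol (field4 C) S z0 z" and h: "bounded_linear h"
    and hK: "\<And>\<tau> x. h (K4 \<tau> x) = \<tau>^m * h x" and s: "s \<in> {0..S}"
  shows "h (z s) = h z0 + s * integral {0..1} (\<lambda>\<tau>. \<tau>^m * h (field4 C (s * \<tau>) (z (s * \<tau>))))"
proof -
  interpret h: bounded_linear h by (rule h)
  have z: "continuous_on {0..S} z" and eq: "z s = z0 + K4.volterra (field4 C) z s"
    using sol s unfolding K4.ksol_def by blast+
  have "integral {0..1} (h \<circ> (\<lambda>\<tau>. K4 \<tau> (field4 C (s * \<tau>) (z (s * \<tau>)))))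
      = h (integral {0..1} (\<lambda>\<tau>. K4 \<tau> (field4 C (s * \<tau>) (z (s * \<tau>)))))"
    by (rule integral_linear[OF integrable_continuous_real[OF K4.integrand_continuous1[OF field4_continuous z s]] h])
  then show ?thesis by (simp only: eq h.add K4.volterra_def h.scaleR o_def hK real_scaleR_def)
qed

lemma ksol_component_deriv:
  fixes h :: "state \<Rightarrow> real"
  assumes sol: "K4.ksol (field4 C) S z0 z" and h: "bounded_linear h"
    and hK: "\<And>\<tau> x. h (K4 \<tau> x) = \<tau>^m * h x" and s: "0 < s" "s < S"
  shows "((\<lambda>s. h (z s)) has_real_derivative h (field4 C s (z s)) - m * (h (z s) - h z0) / s) (at s)"
proof (rule regular_component_deriv[where g = "\<lambda>s. h (field4 C s (z s))" and S = S])
  have z: "continuous_on {0..S} z" using sol unfolding K4.ksol_def by blast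
  have "continuous_on {0..S} (\<lambda>s. case_prod (field4 C) (s, z s))"
    by (rule continuous_on_compose2[OF field4_continuous]) (auto intro!: continuous_intros z)
  then show "continuous_on {0..S} (\<lambda>s. h (field4 C s (z s)))"
    using bounded_linear.continuous_on[OF h] by auto
qed (use ksol_component[OF sol h hK] s in auto)

section \<open>The autonomous system and its regular coordinates\<close>

definition fu :: "real \<Rightarrow> real \<Rightarrow> real \<Rightarrow> real \<Rightarrow> real" where
  "fu C u v r = u * (4 * (1 - u) + 2 * r * v * (u + 1 - C))"
definition fv :: "real \<Rightarrow> real \<Rightarrow> real \<Rightarrow> real \<Rightarrow> real" where
  "fv C u v r = v * (4 * (1 - v) + 2 * r * u * (v + C))"
definition fr :: "real \<Rightarrow> real \<Rightarrow> real \<Rightarrow> real \<Rightarrow> real" where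
  "fr C u v r = r * (u + v - 3 - 2 * r * ((1 - C) * v + C * u))"

definition wf :: "real \<Rightarrow> real \<Rightarrow> state \<Rightarrow> real" where
  "wf C s x = (case x of (p, n, d, e) \<Rightarrow> 1 + s * om C p n e)"
definition Rf :: "real \<Rightarrow> real \<Rightarrow> state \<Rightarrow> real" where
  "Rf C s x = (case x of (p, n, d, e) \<Rightarrow> 1 + s * et C p n e)"
definition df :: "real \<Rightarrow> real \<Rightarrow> state \<Rightarrow> real" where
  "df C s x = (case x of (p, n, d, e) \<Rightarrow> d0 C + s * de C p d e)"

lemma coords_continuous:
  "continuous_on A f \<Longrightarrow> continuous_on A g \<Longrightarrow> continuous_on A (\<lambda>x. wf C (f x) (g x))"
  "continuous_on A f \<Longrightarrow> continuous_on A g \<Longrightarrow> continuous_on A (\<lambda>x. Rf C (f x) (g x))"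
  "continuous_on A f \<Longrightarrow> continuous_on A g \<Longrightarrow> continuous_on A (\<lambda>x. df C (f x) (g x))"
  unfolding wf_def Rf_def df_def om_def et_def de_def case_prod_beta
  by (intro continuous_intros; assumption?; simp)+

lemma mult_eq_imp_eq_divide: "s * x = y \<Longrightarrow> 0 < s \<Longrightarrow> x = y / (s :: real)"
  by (simp add: eq_divide_eq mult.commute)

text \<open>The left sides are s times the derivatives of w, R and d as the Volterra equation
  delivers them, the terms with \<open>n\<close> and the last bracket of the third being the
  singular part. The right sides are the equations of w, R and d obtained from the geometry. Writing
  C through q = d0 makes all three polynomial identities.\<close>

lemma regular_identities:
  fixes C q s \<omega> \<eta> \<delta> e :: real
  assumes q: "d0 C = q" and w_def: "w = 1 + s * \<omega>" and R_def: "R = 1 + s * \<eta>" and d_def: "d = q + s * \<delta>"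
    and n_def: "n = \<omega> - \<eta> - e * ((9 + q + 2 * C) / 2)"
  shows "s * \<omega> + s * s * f_om C s \<omega> \<eta> \<delta> e - s * n
      = w * (1 + 4 * e * s - 2 * w + R * (w + 2 * e * s * d) * (w + 2 * e * s * C))" (is ?w)
    and "s * \<eta> + s * s * f_et C s \<omega> \<eta> \<delta> e + s * n
      = R * (w + e * s * d - 1 - 3 * e * s - 2 * e * s * R * (w + 2 * e * s * C * d))" (is ?R)
    and "s * \<delta> + s * s * f_de C s \<omega> \<eta> \<delta> e - 4 * s * (\<delta> - q * (\<omega> + \<eta> + e * (1 + q)))
      = d * (4 * e * s - 4 * w - 4 * e * s * d + R * w * (w + 2 * e * s * d)) + 3 * q * R * w * (w + 2 * e * s * d)" (is ?d)
proof -
  have C: "C = (1 - 3 * q) / 2" using q by (simp add: d0_def field_simps)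
  show ?w unfolding w_def R_def d_def n_def f_om_def Let_def q
    by (simp add: C field_simps power2_eq_square)
  show ?R unfolding w_def R_def d_def n_def f_et_def Let_def q
    by (simp add: C field_simps power2_eq_square)
  show ?d unfolding w_def R_def d_def n_def f_de_def Let_def q
    by (simp add: C field_simps power2_eq_square)
qed

text \<open>The case e = 0 is included: w, R and d keep their meaning there, while u, v and r, which
  contain the factor 2 e s, are introduced only for e > 0.\<close>

locale orbit0 =
  fixes C \<kappa> e S :: real and z :: "real \<Rightarrow> state"
  assumes C: "C < 1 / 2" and e0: "0 \<le> e" and S: "0 < S"
    and sol: "K4.ksol (field4 C) S (\<kappa>, 0, 0, e) z"
begin

definition "w s = wf C s (z s)"
definition "R s = Rf C s (z s)"
definition "d s = df C s (z s)"

lemma z_cont: "continuous_on {0..S} z"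
  using sol unfolding K4.ksol_def by blast

lemma z_0: "z 0 = (\<kappa>, 0, 0, e)"
  by (rule K4.ksol_init[OF sol]) (use S in simp)

lemma wRd_cont: "continuous_on {0..S} w" "continuous_on {0..S} R" "continuous_on {0..S} d"
  unfolding w_def R_def d_def by (intro coords_continuous z_cont continuous_intros)+

lemma wRd_0: "w 0 = 1" "R 0 = 1" "d 0 = d0 C"
  unfolding w_def R_def d_def wf_def Rf_def df_def case_prod_beta by simp_all

lemma d0_pos: "0 < d0 C"
  using C by (simp add: d0_def)

lemma components:
  obtains p n \<delta> :: "real \<Rightarrow> real" where
    "\<And>s. s \<in> {0..S} \<Longrightarrow> z s = (p s, n s, \<delta> s, e)"
    "\<And>s. 0 < s \<Longrightarrow> s < S \<Longrightarrow> (p has_real_derivative fst (field4 C s (z s))) (at s)"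
    "\<And>s. 0 < s \<Longrightarrow> s < S \<Longrightarrow> (n has_real_derivative fst (snd (field4 C s (z s))) - 2 * n s / s) (at s)"
    "\<And>s. 0 < s \<Longrightarrow> s < S \<Longrightarrow> (\<delta> has_real_derivative fst (snd (snd (field4 C s (z s)))) - 4 * \<delta> s / s) (at s)"
    "p 0 = \<kappa>" "n 0 = 0" "\<delta> 0 = 0"
    "continuous_on {0..S} p" "continuous_on {0..S} n" "continuous_on {0..S} \<delta>"
proof -
  have bl: "bounded_linear (\<lambda>x :: state. fst x)" "bounded_linear (\<lambda>x :: state. fst (snd x))"
    "bounded_linear (\<lambda>x :: state. fst (snd (snd x)))" "bounded_linear (\<lambda>x :: state. snd (snd (snd x)))"
    by (intro bounded_linear_intros)+
  have k: "fst (K4 \<tau> x) = \<tau>^0 * fst x" "fst (snd (K4 \<tau> x)) = \<tau>^2 * fst (snd x)"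
    "fst (snd (snd (K4 \<tau> x))) = \<tau>^4 * fst (snd (snd x))" "snd (snd (snd (K4 \<tau> x))) = \<tau>^0 * snd (snd (snd x))" for \<tau> x
    by (cases x; simp add: K4_def)+
  have e: "snd (snd (snd (z s))) = e" if "s \<in> {0..S}" for s
    using ksol_component[OF sol bl(4) k(4) that] by (simp add: field4_def case_prod_beta Let_def)
  show ?thesis
  proof (rule that[of "\<lambda>s. fst (z s)" "\<lambda>s. fst (snd (z s))" "\<lambda>s. fst (snd (snd (z s)))"])
    show "z s = (fst (z s), fst (snd (z s)), fst (snd (snd (z s))), e)" if "s \<in> {0..S}" for s
      using e[OF that] by (metis prod.collapse)
  qed (use ksol_component_deriv[OF sol bl(1) k(1)] ksol_component_deriv[OF sol bl(2) k(2)]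
      ksol_component_deriv[OF sol bl(3) k(3)] z_cont in \<open>auto simp: z_0 intro!: continuous_intros\<close>)
qed

lemma
  assumes s: "0 < s" "s < S"
  shows w_deriv: "(w has_real_derivative (w s * (1 + 4 * e * s - 2 * w s + R s * (w s + 2 * e * s * d s) * (w s + 2 * e * s * C))) / s) (at s)"
    and R_deriv: "(R has_real_derivative (R s * (w s + e * s * d s - 1 - 3 * e * s - 2 * e * s * R s * (w s + 2 * e * s * C * d s))) / s) (at s)"
    and d_deriv: "(d has_real_derivative (d s * (4 * e * s - 4 * w s - 4 * e * s * d s + R s * w s * (w s + 2 * e * s * d s))
        + 3 * d0 C * R s * w s * (w s + 2 * e * s * d s)) / s) (at s)"
proof -
  obtain p n \<delta> where z: "\<And>s. s \<in> {0..S} \<Longrightarrow> z s = (p s, n s, \<delta> s, e)"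
    and p': "(p has_real_derivative fst (field4 C s (z s))) (at s)"
    and n': "(n has_real_derivative fst (snd (field4 C s (z s))) - 2 * n s / s) (at s)"
    and \<delta>': "(\<delta> has_real_derivative fst (snd (snd (field4 C s (z s)))) - 4 * \<delta> s / s) (at s)"
    using components s by metis
  have ev: "\<forall>\<^sub>F t in nhds s. t \<in> {0<..<S}" using s by (intro eventually_nhds_in_open) auto
  define P where "P = fst (field4 C s (z s))"
  define N where "N = fst (snd (field4 C s (z s)))"
  define D where "D = fst (snd (snd (field4 C s (z s))))"
  define \<omega> \<eta> dl where "\<omega> = om C (p s) (n s) e" and "\<eta> = et C (p s) (n s) e" and "dl = de C (p s) (\<delta> s) e"
  have wR: "w s = 1 + s * \<omega>" "R s = 1 + s * \<eta>" "d s = d0 C + s * dl"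
    using z[of s] s by (auto simp: w_def R_def d_def wf_def Rf_def df_def \<omega>_def \<eta>_def dl_def)
  have F: "P = f_om C s \<omega> \<eta> dl e + f_et C s \<omega> \<eta> dl e" "N = f_om C s \<omega> \<eta> dl e - f_et C s \<omega> \<eta> dl e"
    "D = f_de C s \<omega> \<eta> dl e - d0 C * (f_om C s \<omega> \<eta> dl e + f_et C s \<omega> \<eta> dl e)"
    using z[of s] s by (auto simp: P_def N_def D_def field4_def Let_def \<omega>_def \<eta>_def dl_def)
  have pn: "p s = \<omega> + \<eta>" "n s = \<omega> - \<eta> - e * ((9 + d0 C + 2 * C) / 2)" "\<delta> s = dl - d0 C * (\<omega> + \<eta> + e * (1 + d0 C))"
    by (simp_all add: \<omega>_def \<eta>_def dl_def om_def et_def de_def field_simps)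
  note id = regular_identities[OF refl wR refl, of e]
  have "((\<lambda>s. 1 + s * om C (p s) (n s) e) has_real_derivative \<omega> + s * ((P + (N - 2 * n s / s)) / 2)) (at s)"
    unfolding om_def by (rule derivative_eq_intros p' n' \<delta>' refl | simp add: P_def N_def D_def \<omega>_def \<eta>_def dl_def om_def et_def de_def)+
  moreover have "\<omega> + s * ((P + (N - 2 * n s / s)) / 2) = (w s * (1 + 4 * e * s - 2 * w s + R s * (w s + 2 * e * s * d s) * (w s + 2 * e * s * C))) / s"
  proof -
    have "s * (\<omega> + s * ((P + (N - 2 * n s / s)) / 2)) = s * \<omega> + s * s * f_om C s \<omega> \<eta> dl e - s * (\<omega> - \<eta> - e * ((9 + d0 C + 2 * C) / 2))"
      using s unfolding F pn by (simp add: field_simps)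
    also have "\<dots> = w s * (1 + 4 * e * s - 2 * w s + R s * (w s + 2 * e * s * d s) * (w s + 2 * e * s * C))"
      by (rule id(1))
    finally show ?thesis by (rule mult_eq_imp_eq_divide) (rule s)
  qed
  ultimately have "((\<lambda>s. 1 + s * om C (p s) (n s) e) has_real_derivative (w s * (1 + 4 * e * s - 2 * w s + R s * (w s + 2 * e * s * d s) * (w s + 2 * e * s * C))) / s) (at s)" by (simp only:)
  then show "(w has_real_derivative (w s * (1 + 4 * e * s - 2 * w s + R s * (w s + 2 * e * s * d s) * (w s + 2 * e * s * C))) / s) (at s)"
    by (rule DERIV_cong_ev[THEN iffD1, OF refl _ refl, rotated])
      (rule eventually_mono[OF ev], use z in \<open>auto simp: w_def wf_def\<close>)
  have "((\<lambda>s. 1 + s * et C (p s) (n s) e) has_real_derivative \<eta> + s * ((P - (N - 2 * n s / s)) / 2)) (at s)"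
    unfolding et_def by (rule derivative_eq_intros p' n' \<delta>' refl | simp add: P_def N_def D_def \<omega>_def \<eta>_def dl_def om_def et_def de_def)+
  moreover have "\<eta> + s * ((P - (N - 2 * n s / s)) / 2) = (R s * (w s + e * s * d s - 1 - 3 * e * s - 2 * e * s * R s * (w s + 2 * e * s * C * d s))) / s"
  proof -
    have "s * (\<eta> + s * ((P - (N - 2 * n s / s)) / 2)) = s * \<eta> + s * s * f_et C s \<omega> \<eta> dl e + s * (\<omega> - \<eta> - e * ((9 + d0 C + 2 * C) / 2))"
      using s unfolding F pn by (simp add: field_simps)
    also have "\<dots> = R s * (w s + e * s * d s - 1 - 3 * e * s - 2 * e * s * R s * (w s + 2 * e * s * C * d s))"
      by (rule id(2))
    finally show ?thesis by (rule mult_eq_imp_eq_divide) (rule s)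
  qed
  ultimately have "((\<lambda>s. 1 + s * et C (p s) (n s) e) has_real_derivative (R s * (w s + e * s * d s - 1 - 3 * e * s - 2 * e * s * R s * (w s + 2 * e * s * C * d s))) / s) (at s)" by (simp only:)
  then show "(R has_real_derivative (R s * (w s + e * s * d s - 1 - 3 * e * s - 2 * e * s * R s * (w s + 2 * e * s * C * d s))) / s) (at s)"
    by (rule DERIV_cong_ev[THEN iffD1, OF refl _ refl, rotated])
      (rule eventually_mono[OF ev], use z in \<open>auto simp: R_def Rf_def\<close>)
  have "((\<lambda>s. d0 C + s * de C (p s) (\<delta> s) e) has_real_derivative dl + s * (D - 4 * \<delta> s / s + d0 C * P)) (at s)"
    unfolding de_def by (rule derivative_eq_intros p' n' \<delta>' refl | simp add: P_def N_def D_def \<omega>_def \<eta>_def dl_def om_def et_def de_def)+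
  moreover have "dl + s * (D - 4 * \<delta> s / s + d0 C * P) = (d s * (4 * e * s - 4 * w s - 4 * e * s * d s + R s * w s * (w s + 2 * e * s * d s))
        + 3 * d0 C * R s * w s * (w s + 2 * e * s * d s)) / s"
  proof -
    have "s * (dl + s * (D - 4 * \<delta> s / s + d0 C * P)) = s * dl + s * s * f_de C s \<omega> \<eta> dl e - 4 * s * (dl - d0 C * (\<omega> + \<eta> + e * (1 + d0 C)))"
      using s unfolding F pn by (simp add: field_simps)
    also have "\<dots> = d s * (4 * e * s - 4 * w s - 4 * e * s * d s + R s * w s * (w s + 2 * e * s * d s))
        + 3 * d0 C * R s * w s * (w s + 2 * e * s * d s)"
      by (rule id(3))
    finally show ?thesis by (rule mult_eq_imp_eq_divide) (rule s)
  qed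
  ultimately have "((\<lambda>s. d0 C + s * de C (p s) (\<delta> s) e) has_real_derivative (d s * (4 * e * s - 4 * w s - 4 * e * s * d s + R s * w s * (w s + 2 * e * s * d s))
        + 3 * d0 C * R s * w s * (w s + 2 * e * s * d s)) / s) (at s)" by (simp only:)
  then show "(d has_real_derivative (d s * (4 * e * s - 4 * w s - 4 * e * s * d s + R s * w s * (w s + 2 * e * s * d s))
        + 3 * d0 C * R s * w s * (w s + 2 * e * s * d s)) / s) (at s)"
    by (rule DERIV_cong_ev[THEN iffD1, OF refl _ refl, rotated])
      (rule eventually_mono[OF ev], use z in \<open>auto simp: d_def df_def\<close>)
qed

end

lemma pos_near_0:
  fixes F :: "real \<Rightarrow> real"
  assumes "continuous_on {0..S} F" "0 < F 0" "0 < S"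
  obtains b where "0 < b" "b < S" "\<And>s. 0 < s \<Longrightarrow> s \<le> b \<Longrightarrow> 0 < F s"
proof -
  have "(F \<longlongrightarrow> F 0) (at_right 0)" using assms continuous_on_Icc_at_rightD by blast
  then have "\<forall>\<^sub>F s in at_right 0. 0 < F s" using assms(2) by (rule order_tendstoD(1))
  then obtain b where b: "0 < b" "\<And>s. 0 < s \<Longrightarrow> s < b \<Longrightarrow> 0 < F s"
    unfolding eventually_at_right_field by auto
  show ?thesis by (rule that[of "min (b / 2) (S / 2)"]) (use b assms in auto)
qed

text \<open>A barrier cannot start at s = 0 when f contains u or v, since these blow up there.
  \<open>F\<close> is f cleared of the denominator (or f itself if that is regular); it is
  continuous and positive at 0 and gives the positivity of f for small s, from where
  \<open>barrier\<close> continues.\<close>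

lemma barrier_from_0:
  fixes F f f' :: "real \<Rightarrow> real"
  assumes F: "continuous_on {0..S} F" "0 < F 0" and Ff: "\<And>s. 0 < s \<Longrightarrow> s < S \<Longrightarrow> 0 < F s \<Longrightarrow> 0 < f s"
    and der: "\<And>s. 0 < s \<Longrightarrow> s < S \<Longrightarrow> (f has_real_derivative f' s) (at s)"
    and push: "\<And>s. 0 < s \<Longrightarrow> s < S \<Longrightarrow> f s = 0 \<Longrightarrow> 0 < f' s"
    and s: "0 < s" "s < S"
  shows "0 < f s"
proof -
  obtain b where b: "0 < b" "b < S" "\<And>s. 0 < s \<Longrightarrow> s \<le> b \<Longrightarrow> 0 < F s"
    using pos_near_0[OF F] s by auto
  define a where "a = min b s"
  have a: "0 < a" "a \<le> b" "a \<le> s" using b s by (auto simp: a_def)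
  show ?thesis
    by (rule barrier[of f a s f']) (use a b s der push Ff in auto)
qed

section \<open>Orbits in the variables u, v, r\<close>

locale orbit = orbit0 + assumes e: "0 < e"
begin

definition "v s = w s / (2 * e * s)"
definition "r s = 2 * e * s * R s"
definition "u s = (w s + 2 * e * s * d s) / (2 * e * s)"
text \<open>In terms of the metric this is f w / (p q). Unlike r and v it is regular on the singular
  orbit, with value 1, and both regions are described by it.\<close>

definition "y s = r s * v s"

lemma u_eq: "0 < s \<Longrightarrow> u s = v s + d s"
  using e by (simp add: u_def v_def field_simps)

lemma y_eq: "0 < s \<Longrightarrow> y s = R s * w s"
  using e by (simp add: y_def r_def v_def field_simps)

lemma wRd_eq:
  assumes "0 < s"
  shows "w s = 2 * e * s * v s" "R s = r s / (2 * e * s)" "d s = u s - v s"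
  using assms e by (simp_all add: u_eq r_def v_def field_simps)

lemma v_deriv:
  assumes s: "0 < s" "s < S"
  shows "(v has_real_derivative e * fv C (u s) (v s) (r s)) (at s)"
proof -
  have "(v has_real_derivative
      (w s * (1 + 4 * e * s - 2 * w s + R s * (w s + 2 * e * s * d s) * (w s + 2 * e * s * C)) / s * (2 * e * s) - w s * (2 * e))
       / ((2 * e * s) * (2 * e * s))) (at s)"
    unfolding v_def using s e by (auto intro!: derivative_eq_intros w_deriv)
  moreover have "(w s * (1 + 4 * e * s - 2 * w s + R s * (w s + 2 * e * s * d s) * (w s + 2 * e * s * C)) / s * (2 * e * s) - w s * (2 * e))
       / ((2 * e * s) * (2 * e * s)) = e * fv C (u s) (v s) (r s)"
    unfolding fv_def wRd_eq[OF s(1)] using s e by (simp add: divide_simps) (simp add: algebra_simps)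
  ultimately show ?thesis by simp
qed

lemma r_deriv:
  assumes s: "0 < s" "s < S"
  shows "(r has_real_derivative e * fr C (u s) (v s) (r s)) (at s)"
proof -
  have "(r has_real_derivative 2 * e * R s + 2 * e * s *
      (R s * (w s + e * s * d s - 1 - 3 * e * s - 2 * e * s * R s * (w s + 2 * e * s * C * d s)) / s)) (at s)"
    unfolding r_def using s e by (auto intro!: derivative_eq_intros R_deriv)
  moreover have "2 * e * R s + 2 * e * s *
      (R s * (w s + e * s * d s - 1 - 3 * e * s - 2 * e * s * R s * (w s + 2 * e * s * C * d s)) / s) = e * fr C (u s) (v s) (r s)"
    unfolding fr_def wRd_eq[OF s(1)] using s e by (simp add: divide_simps) (simp add: algebra_simps)
  ultimately show ?thesis by simp
qed

lemma d_deriv':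
  assumes s: "0 < s" "s < S"
  shows "(d has_real_derivative e * (d s * (4 - 4 * (u s + v s) + 2 * r s * u s * v s) + 2 * r s * u s * v s * (3 * d0 C))) (at s)"
proof -
  have "(d s * (4 * e * s - 4 * w s - 4 * e * s * d s + R s * w s * (w s + 2 * e * s * d s))
        + 3 * d0 C * R s * w s * (w s + 2 * e * s * d s)) / s =
    e * (d s * (4 - 4 * (u s + v s) + 2 * r s * u s * v s) + 2 * r s * u s * v s * (3 * d0 C))"
    unfolding wRd_eq[OF s(1)] using s e by (simp add: divide_simps) (simp add: algebra_simps)
  then show ?thesis using d_deriv[OF s] by simp
qed

lemma u_deriv:
  assumes s: "0 < s" "s < S"
  shows "(u has_real_derivative e * fu C (u s) (v s) (r s)) (at s)"
proof -
  have "((\<lambda>s. v s + d s) has_real_derivative e * fv C (u s) (v s) (r s) +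
      e * (d s * (4 - 4 * (u s + v s) + 2 * r s * u s * v s) + 2 * r s * u s * v s * (3 * d0 C))) (at s)"
    by (intro DERIV_add v_deriv d_deriv' s)
  moreover have "e * fv C (u s) (v s) (r s) +
      e * (d s * (4 - 4 * (u s + v s) + 2 * r s * u s * v s) + 2 * r s * u s * v s * (3 * d0 C)) = e * fu C (u s) (v s) (r s)"
    unfolding fu_def fv_def d0_def wRd_eq(3)[OF s(1)] by (simp add: field_simps)
  ultimately have der: "((\<lambda>s. v s + d s) has_real_derivative e * fu C (u s) (v s) (r s)) (at s)" by simp
  have ev: "\<forall>\<^sub>F t in nhds s. t \<in> {0<..}" using s by (intro eventually_nhds_in_open) auto
  show ?thesis
    by (rule DERIV_cong_ev[THEN iffD1, OF refl _ refl der]) (rule eventually_mono[OF ev], simp add: u_eq)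
qed

lemma y_deriv:
  assumes s: "0 < s" "s < S"
  shows "(y has_real_derivative e * (y s * (1 + u s - 3 * v s + 2 * y s * (u s - 1 + C)))) (at s)"
proof -
  have "(y has_real_derivative e * fr C (u s) (v s) (r s) * v s + r s * (e * fv C (u s) (v s) (r s))) (at s)"
    unfolding y_def using DERIV_mult[OF r_deriv[OF s] v_deriv[OF s]] by (simp add: algebra_simps)
  moreover have "e * fr C (u s) (v s) (r s) * v s + r s * (e * fv C (u s) (v s) (r s)) =
      e * (y s * (1 + u s - 3 * v s + 2 * y s * (u s - 1 + C)))"
    unfolding fr_def fv_def y_def by (simp add: algebra_simps)
  ultimately show ?thesis by simp
qed

lemma uvr_cont:
  assumes "0 < a" "b < S"
  shows "continuous_on {a..b} u" "continuous_on {a..b} v" "continuous_on {a..b} r"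
  using assms by (auto intro!: deriv_imp_continuous_on u_deriv v_deriv r_deriv)

text \<open>The equations of u, v, r have the form x' = x g, so these functions keep their sign. For
  d = u - v the source 6 d0 r u v is positive where d = 0.\<close>

lemma pos:
  assumes s: "0 < s" "s < S"
  shows "0 < v s" "0 < r s" "0 < u s" "0 < d s"
proof -
  obtain b where b: "0 < b" "b < S" "\<And>s. 0 < s \<Longrightarrow> s \<le> b \<Longrightarrow> 0 < min (w s) (min (R s) (w s + 2 * e * s * d s))"
    by (rule pos_near_0[of S "\<lambda>s. min (w s) (min (R s) (w s + 2 * e * s * d s))"])
      (use S in \<open>auto intro!: continuous_intros wRd_cont simp: wRd_0\<close>)
  have main: "0 < v s \<and> 0 < r s \<and> 0 < u s" if s: "0 < s" "s < S" for s
  proof -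
    define a where "a = min b s"
    have a: "0 < a" "a \<le> b" "a \<le> s" using b s by (auto simp: a_def)
    note c = uvr_cont[OF a(1) s(2)]
    have "0 < v a" "0 < r a" "0 < u a" using b(3)[of a] a e by (auto simp: v_def r_def u_def)
    moreover have "(v has_real_derivative v t * (e * (4 * (1 - v t) + 2 * r t * u t * (v t + C)))) (at t)"
      "(r has_real_derivative r t * (e * (u t + v t - 3 - 2 * r t * ((1 - C) * v t + C * u t)))) (at t)"
      "(u has_real_derivative u t * (e * (4 * (1 - u t) + 2 * r t * v t * (u t + 1 - C)))) (at t)"
      if "a \<le> t" "t \<le> s" for t
      using v_deriv[of t] r_deriv[of t] u_deriv[of t] that a s by (auto simp: fu_def fv_def fr_def algebra_simps)
    moreover note d = calculation
    have "0 < v s" by (rule linear_ode_pos[OF d(1) d(4)]) (use a in \<open>auto intro!: continuous_intros c\<close>)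
    moreover have "0 < r s" by (rule linear_ode_pos[OF d(2) d(5)]) (use a in \<open>auto intro!: continuous_intros c\<close>)
    moreover have "0 < u s" by (rule linear_ode_pos[OF d(3) d(6)]) (use a in \<open>auto intro!: continuous_intros c\<close>)
    ultimately show ?thesis by blast
  qed
  then show "0 < v s" "0 < r s" "0 < u s" using s by auto
  show "0 < d s"
    by (rule barrier_from_0[OF wRd_cont(3) _ _ d_deriv' _ s]) (use d0_pos e main in \<open>auto simp: wRd_0\<close>)
qed

text \<open>For d = d0 the bracket becomes d0 (4 - 4 u - 4 v + 8 u y). With y \<ge> 1 it is at least
  4 d0 (1 + u - v), and u - v = d0 > 0.\<close>

lemma d_push:
  assumes s: "0 < s" "s < S" and d: "d s = d0 C" and y: "1 \<le> y s"
  shows "0 < e * (d s * (4 - 4 * (u s + v s) + 2 * r s * u s * v s) + 2 * r s * u s * v s * (3 * d0 C))"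
proof -
  note p = pos[OF s]
  have "u s * 1 \<le> u s * y s" using p y by (intro mult_left_mono) auto
  then have "0 < d0 C * (4 - 4 * u s - 4 * v s + 8 * (u s * y s))"
    using d0_pos d u_eq[OF s(1)] by (intro mult_pos_pos) auto
  also have "\<dots> = d s * (4 - 4 * (u s + v s) + 2 * r s * u s * v s) + 2 * r s * u s * v s * (3 * d0 C)"
    by (simp add: d y_def algebra_simps)
  finally show ?thesis using e by (rule mult_pos_pos[rotated])
qed

text \<open>On y = 1 the derivative of y has the sign of d - d0. This is the origin of the threshold
  \<open>d0\<close> in the bad region.\<close>

lemma y_push:
  assumes s: "0 < s" "s < S" and y: "y s = 1"
  shows "e * (y s * (1 + u s - 3 * v s + 2 * y s * (u s - 1 + C))) = e * (3 * (d s - d0 C))"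
proof -
  have "1 + u s - 3 * v s + 2 * 1 * (u s - 1 + C) = 3 * (d s - d0 C)"
    using u_eq[OF s(1)] by (simp add: d0_def field_simps)
  then show ?thesis using y by simp
qed

text \<open>The face y = 1 with d > d0 is crossed inwards by \<open>y_push\<close>. On the face d =
  d0, including the corner where y' = 0, \<open>d_push\<close> applies.\<close>

lemma bad1_invariant:
  assumes s: "0 < s" "s \<le> t" "t < S" and y: "1 < y s" and d: "d0 C < d s"
  shows "1 < y t" "d0 C < d t"
proof -
  let ?y' = "\<lambda>s. e * (y s * (1 + u s - 3 * v s + 2 * y s * (u s - 1 + C)))"
  let ?d' = "\<lambda>s. e * (d s * (4 - 4 * (u s + v s) + 2 * r s * u s * v s) + 2 * r s * u s * v s * (3 * d0 C))"
  have "0 < y t - 1 \<and> 0 < d t - d0 C \<and> 0 < d t - d0 C"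
  proof (rule barrier3[where s=t and a=s and b=t and f="\<lambda>s. y s - 1" and g="\<lambda>s. d s - d0 C" and h="\<lambda>s. d s - d0 C"
        and f'="?y'" and g'="?d'" and h'="?d'"])
    fix x assume x: "s < x" "x \<le> t" "0 \<le> y x - 1" "0 \<le> d x - d0 C" "y x - 1 = 0 \<or> d x - d0 C = 0 \<or> d x - d0 C = 0"
    have xx: "0 < x" "x < S" using x s by auto
    show "y x - 1 = 0 \<and> 0 < ?y' x \<or> d x - d0 C = 0 \<and> 0 < ?d' x \<or> d x - d0 C = 0 \<and> 0 < ?d' x"
    proof (cases "d x = d0 C")
      case True
      then show ?thesis using d_push[OF xx] x by simp
    next
      case False
      then have "y x = 1" "d0 C < d x" using x by auto
      then show ?thesis unfolding y_push[OF xx \<open>y x = 1\<close>] using e by simp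
    qed
  qed (use s y d in \<open>auto intro!: derivative_eq_intros y_deriv d_deriv'\<close>)
  then show "1 < y t" "d0 C < d t" by auto
qed

text \<open>When the first and third planes are exchanged, d = u - v turns into u/v - 1/v, which is
  \<open>E\<close>, and y turns into - C r. The lemmas on \<open>E\<close> mirror those on
  d.\<close>

definition "E s = (u s - 1) / v s"

lemma E_deriv:
  assumes s: "0 < s" "s < S"
  shows "(E has_real_derivative e * (E s * (- 4 * u s - 4 + 4 * v s - 2 * r s * u s * C) + 2 * r s * u s * (2 - C))) (at s)"
proof -
  have v: "0 < v s" by (rule pos[OF s])
  have "(E has_real_derivative (e * fu C (u s) (v s) (r s) * v s - (u s - 1) * (e * fv C (u s) (v s) (r s))) / (v s * v s)) (at s)"
    unfolding E_def using v by (auto intro!: derivative_eq_intros u_deriv v_deriv s)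
  moreover have "(e * fu C (u s) (v s) (r s) * v s - (u s - 1) * (e * fv C (u s) (v s) (r s))) / (v s * v s) =
    e * (E s * (- 4 * u s - 4 + 4 * v s - 2 * r s * u s * C) + 2 * r s * u s * (2 - C))"
    unfolding fu_def fv_def E_def using v by (simp add: divide_simps) (simp add: algebra_simps)
  ultimately show ?thesis by simp
qed

lemma E_push:
  assumes C0: "C < 0" and s: "0 < s" "s < S" and E1: "3 * (- C) * E s = 2 - C" and r1: "1 \<le> - C * r s"
  shows "0 < e * (E s * (- 4 * u s - 4 + 4 * v s - 2 * r s * u s * C) + 2 * r s * u s * (2 - C))"
proof -
  note p = pos[OF s]
  have Ev: "u s = 1 + E s * v s" using p by (simp add: E_def)
  have "0 < (3 * (- C)) * E s" unfolding E1 using C0 by simp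
  then have Ep: "0 < E s" using C0 by (simp add: mult_less_0_iff)
  have "u s * 1 \<le> u s * (- C * r s)" using p r1 by (intro mult_left_mono) auto
  moreover have "0 < E s * v s" using Ep p by simp
  ultimately have "0 < - 4 * u s - 4 + 4 * v s + 8 * (u s * (- C * r s))" using p Ev by linarith
  then have "0 < E s * (- 4 * u s - 4 + 4 * v s + 8 * (u s * (- C * r s)))" using Ep by simp
  also have "\<dots> = E s * (- 4 * u s - 4 + 4 * v s - 2 * r s * u s * C) + 2 * r s * u s * (2 - C)"
    unfolding E1[symmetric] by (simp add: algebra_simps)
  finally show ?thesis using e by simp
qed

lemma r_push:
  assumes s: "0 < s" "s < S" and r1: "- C * r s = 1"
  shows "fr C (u s) (v s) (r s) = r s * ((3 * (- C) * E s - (2 - C)) * v s * r s)"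
proof -
  have Ev: "u s = 1 + E s * v s" using pos[OF s] by (simp add: E_def)
  have cr: "C * r s = -1" using r1 by simp
  have "2 * r s * ((1 - C) * v s + C * u s) = 2 * (r s * v s) - 2 * (C * r s) * v s + 2 * (C * r s) * u s" by (simp add: algebra_simps)
  then have B: "2 * r s * ((1 - C) * v s + C * u s) = 2 * (r s * v s) + 2 * v s - 2 * u s" unfolding cr by simp
  have "(2 - C) * v s * r s = 2 * (r s * v s) - (C * r s) * v s" by (simp add: algebra_simps)
  then have A: "(2 - C) * v s * r s = 2 * (r s * v s) + v s" unfolding cr by simp
  have "r s * ((3 * (- C) * E s - (2 - C)) * v s * r s) = r s * (3 * E s * v s * (- C * r s) - (2 - C) * v s * r s)"
    by (simp add: algebra_simps)
  also have "\<dots> = fr C (u s) (v s) (r s)" unfolding fr_def r1 A B using Ev by (simp add: algebra_simps)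
  finally show ?thesis by simp
qed

text \<open>The image of \<open>bad1_invariant\<close> under the exchange of planes: the threshold
  for \<open>E\<close> is (2 - C) / (- 3 C), which is \<open>d0\<close> at 1/C. Here
  \<open>E_push\<close> takes the place of \<open>d_push\<close> and \<open>r_push\<close> that of
  \<open>y_push\<close>.\<close>

lemma bad2_invariant:
  assumes C0: "C < 0" and s: "0 < s" "s \<le> t" "t < S" and y: "1 < - C * r s" and d: "2 - C < 3 * (- C) * E s"
  shows "1 < - C * r t" "2 - C < 3 * (- C) * E t"
proof -
  let ?r' = "\<lambda>s. - C * (e * fr C (u s) (v s) (r s))"
  let ?E' = "\<lambda>s. 3 * (- C) * (e * (E s * (- 4 * u s - 4 + 4 * v s - 2 * r s * u s * C) + 2 * r s * u s * (2 - C)))"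
  have "0 < - C * r t - 1 \<and> 0 < 3 * (- C) * E t - (2 - C) \<and> 0 < 3 * (- C) * E t - (2 - C)"
  proof (rule barrier3[where s=t and a=s and b=t and f="\<lambda>s. - C * r s - 1" and g="\<lambda>s. 3 * (- C) * E s - (2 - C)"
        and h="\<lambda>s. 3 * (- C) * E s - (2 - C)" and f'="?r'" and g'="?E'" and h'="?E'"])
    fix x assume x: "s < x" "x \<le> t" "0 \<le> - C * r x - 1" "0 \<le> 3 * (- C) * E x - (2 - C)"
      "- C * r x - 1 = 0 \<or> 3 * (- C) * E x - (2 - C) = 0 \<or> 3 * (- C) * E x - (2 - C) = 0"
    have xx: "0 < x" "x < S" using x s by auto
    show "- C * r x - 1 = 0 \<and> 0 < ?r' x \<or> 3 * (- C) * E x - (2 - C) = 0 \<and> 0 < ?E' x \<or> 3 * (- C) * E x - (2 - C) = 0 \<and> 0 < ?E' x"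
    proof (cases "3 * (- C) * E x = 2 - C")
      case True
      have "0 < ?E' x" by (rule mult_pos_pos[OF _ E_push[OF C0 xx True]]) (use C0 x in auto)
      then show ?thesis using True by simp
    next
      case False
      then have r1: "- C * r x = 1" and E1: "2 - C < 3 * (- C) * E x" using x by linarith+
      have "0 < fr C (u x) (v x) (r x)" unfolding r_push[OF xx r1] using E1 pos[OF xx] by simp
      then have "0 < - C * (e * fr C (u x) (v x) (r x))" by (intro mult_pos_pos) (use C0 e in auto)
      moreover have "- C * r x - 1 = 0" by (simp only: r1)
      ultimately show ?thesis by blast
    qed
  next
    fix x assume x: "s \<le> x" "x \<le> t"
    then have "0 < x" "x < S" using s by auto
    note E' = E_deriv[OF this] and r' = r_deriv[OF this]
    show "((\<lambda>s. - C * r s - 1) has_real_derivative ?r' x) (at x)"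
      using DERIV_diff[OF DERIV_cmult[OF r', of "- C"] DERIV_const[of 1]] by simp
    show E'': "((\<lambda>s. 3 * (- C) * E s - (2 - C)) has_real_derivative ?E' x) (at x)"
      using DERIV_diff[OF DERIV_cmult[OF E', of "3 * (- C)"] DERIV_const[of "2 - C"]] by simp
    show "((\<lambda>s. 3 * (- C) * E s - (2 - C)) has_real_derivative ?E' x) (at x)" by (rule E'')
  qed (use s y d in simp_all)
  then show "1 < - C * r t" "2 - C < 3 * (- C) * E t" by linarith+
qed

end

lemma stays_above_right:
  fixes f :: "real \<Rightarrow> real"
  assumes der: "(f has_real_derivative D) (at x)" and c: "c < f x \<or> (f x = c \<and> 0 < D)"
  obtains \<delta> where "0 < \<delta>" "\<And>t. x < t \<Longrightarrow> t < x + \<delta> \<Longrightarrow> c < f t"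
proof (cases "c < f x")
  case True
  have "(f \<longlongrightarrow> f x) (at_right x)"
    using DERIV_isCont[OF der] by (auto simp: isCont_def intro: tendsto_mono[OF at_le, rotated])
  then have "\<forall>\<^sub>F t in at_right x. c < f t" using True by (rule order_tendstoD(1))
  then obtain b where b: "x < b" "\<And>t. x < t \<Longrightarrow> t < b \<Longrightarrow> c < f t"
    unfolding eventually_at_right_field by auto
  show ?thesis by (rule that[of "b - x"]) (use b in auto)
next
  case False
  then have "f x = c" "0 < D" using c by auto
  then obtain \<delta> where \<delta>: "0 < \<delta>" "\<And>h. 0 < h \<Longrightarrow> h < \<delta> \<Longrightarrow> c < f (x + h)"
    using DERIV_pos_inc_right[OF der] by auto
  show ?thesis by (rule that[OF \<delta>(1)]) (use \<delta>(2)[of "t - x" for t] in auto)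
qed

text \<open>Suppose f > 0 at some time and take the last zero of f before it. There f' \<ge> 0, so g
  becomes positive immediately afterwards while f is positive as well, which \<open>excl\<close>
  forbids.\<close>

lemma no_crossing:
  fixes f g f' g' :: "real \<Rightarrow> real"
  assumes b: "0 < b" "\<And>s. 0 < s \<Longrightarrow> s \<le> b \<Longrightarrow> f s \<le> 0"
    and f: "\<And>s. 0 < s \<Longrightarrow> s < S \<Longrightarrow> (f has_real_derivative f' s) (at s)"
    and g: "\<And>s. 0 < s \<Longrightarrow> s < S \<Longrightarrow> (g has_real_derivative g' s) (at s)"
    and excl: "\<And>s. 0 < s \<Longrightarrow> s < S \<Longrightarrow> \<not> (0 < f s \<and> 0 < g s)"
    and cross: "\<And>s. 0 < s \<Longrightarrow> s < S \<Longrightarrow> f s = 0 \<Longrightarrow> 0 \<le> f' s \<Longrightarrow> 0 < g s \<or> (g s = 0 \<and> 0 < g' s)"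
    and s: "0 < s" "s < S"
  shows "f s \<le> 0"
proof (rule ccontr)
  assume no: "\<not> f s \<le> 0"
  then have bs: "b < s" using b(2)[of s] s by force
  have "continuous_on {b..s} f" using f b s by (intro deriv_imp_continuous_on[of b s f f']) auto
  then obtain x where x: "b \<le> x" "x < s" "f x = 0" "\<And>t. x < t \<Longrightarrow> t \<le> s \<Longrightarrow> 0 < f t"
    using last_zero[of b s f] b(2)[of b] b(1) no bs by auto
  have x0: "0 < x" "x < S" using x b s by auto
  have "0 \<le> f' x"
  proof (rule ccontr)
    assume "\<not> 0 \<le> f' x"
    then obtain \<delta> where \<delta>: "0 < \<delta>" "\<And>h. 0 < h \<Longrightarrow> h < \<delta> \<Longrightarrow> f (x + h) < f x"
      using DERIV_neg_dec_right[OF f[OF x0]] by auto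
    define h where "h = min (\<delta> / 2) (s - x)"
    have "0 < h" "h < \<delta>" "x + h \<le> s" using \<delta>(1) x by (auto simp: h_def)
    then show False using \<delta>(2)[of h] x(3) x(4)[of "x + h"] by auto
  qed
  then have "0 < g x \<or> (g x = 0 \<and> 0 < g' x)" by (rule cross[OF x0 x(3)])
  then obtain \<delta> where \<delta>: "0 < \<delta>" "\<And>t. x < t \<Longrightarrow> t < x + \<delta> \<Longrightarrow> 0 < g t"
    using stays_above_right[OF g[OF x0]] by metis
  define t where "t = min (x + \<delta> / 2) s"
  have t: "x < t" "t < x + \<delta>" "t \<le> s" using \<delta>(1) x by (auto simp: t_def)
  then show False using excl[of t] \<delta>(2)[of t] x(4)[of t] x0 s by auto
qed

text \<open>Chosen to have eta \<le> 1/40 and eta |C| \<le> 1/60 at the same time, the two bounds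
  with which the good region is handled.\<close>

definition eta :: "real \<Rightarrow> real" where "eta C = 1 / (20 * (2 + 3 * \<bar>C\<bar>))"

lemma eta_bounds: "0 < eta C" "eta C \<le> 1 / 40" "eta C * \<bar>C\<bar> \<le> 1 / 60"
proof -
  have p: "0 < 20 * (2 + 3 * \<bar>C\<bar>)" by (simp add: add_pos_nonneg)
  then show "0 < eta C" by (simp add: eta_def)
  have "eta C * (20 * (2 + 3 * \<bar>C\<bar>)) = 1" using p unfolding eta_def by (simp del: mult_pos_pos)
  then have eq: "eta C * 40 + eta C * \<bar>C\<bar> * 60 = 1" by (simp add: algebra_simps)
  have "0 \<le> eta C * \<bar>C\<bar>" using \<open>0 < eta C\<close> by simp
  then show "eta C \<le> 1 / 40" using eq by linarith
  show "eta C * \<bar>C\<bar> \<le> 1 / 60" using eq \<open>0 < eta C\<close> by linarith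
qed

text \<open>Beyond 3 \<open>d0\<close> the damping of d beats its source, and beyond 6 the bound on
  u forces v \<ge> 1. \<open>Emax C\<close> is \<open>Dmax (1 / C)\<close>, because 3
  \<open>d0\<close> at 1/C is 1 - 2/C. The value of \<open>vmin\<close> for C < 0 is the one that
  closes the estimate in \<open>v_gt\<close>.\<close>

definition Dmax :: "real \<Rightarrow> real" where "Dmax C = max 6 (3 * d0 C) + 1"
definition Emax :: "real \<Rightarrow> real" where "Emax C = max 6 (1 - 2 / C) + 1"
definition vmin :: "real \<Rightarrow> real" where "vmin C = (if C < 0 then 1 / (2 * (2 + Emax C)) else 1 / 2)"

lemma bounds_pos: "7 \<le> Dmax C" "3 * d0 C < Dmax C" "7 \<le> Emax C" "1 - 2 / C < Emax C" "0 < vmin C"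
  by (auto simp: Dmax_def Emax_def vmin_def max_def)

context orbit
begin

definition "bad s \<longleftrightarrow> 1 < y s \<and> d0 C < d s \<or> C < 0 \<and> 1 < - C * r s \<and> 2 - C < 3 * (- C) * E s"
definition "good s \<longleftrightarrow> y s < eta C \<and> d s < v s / 10 \<and> 9 / 10 < v s"

lemma bad_invariant: "0 < s \<Longrightarrow> s \<le> t \<Longrightarrow> t < S \<Longrightarrow> bad s \<Longrightarrow> bad t"
  unfolding bad_def using bad1_invariant bad2_invariant by blast

lemma good_not_bad:
  assumes s: "0 < s" "s < S" and g: "good s"
  shows "\<not> bad s"
proof -
  note p = pos[OF s] and eb = eta_bounds[of C]
  have y: "y s < 1 / 40" using g eb by (auto simp: good_def)
  have "- C * r s < 1" if "C < 0"
  proof -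
    have "0 < - C * r s" using that p by (intro mult_pos_pos) auto
    then have "- C * r s * (9 / 10) \<le> - C * r s * v s" using g by (intro mult_left_mono) (auto simp: good_def)
    also have "\<dots> = y s * \<bar>C\<bar>" using that by (simp add: y_def)
    also have "\<dots> \<le> eta C * \<bar>C\<bar>" using g by (intro mult_right_mono) (auto simp: good_def)
    finally show ?thesis using eb by simp
  qed
  then show ?thesis using y by (auto simp: bad_def)
qed

text \<open>Here u \<le> 11/10 v, and the quadratic term contributes at most 11/200 v. The bracket
  is thus at most 1 - 1.845 v, which is below - 1/2 for v \<ge> 9/10.\<close>

lemma y_decay:
  assumes s: "0 < s" "s < S" and y: "y s \<le> eta C" and d: "d s \<le> v s / 10" and v: "9 / 10 \<le> v s"
  shows "e * (y s * (1 + u s - 3 * v s + 2 * y s * (u s - 1 + C))) \<le> - (e / 2) * y s"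
proof -
  note p = pos[OF s] and eb = eta_bounds[of C]
  have yp: "0 < y s" using p by (simp add: y_def)
  have u: "u s \<le> 11 / 10 * v s" using d u_eq[OF s(1)] by simp
  have "y s * (u s - 1 + C) \<le> y s * u s" using yp C by (intro mult_left_mono) auto
  also have "\<dots> \<le> 1 / 40 * (11 / 10 * v s)" using u yp y eb p by (intro mult_mono) auto
  finally have "2 * y s * (u s - 1 + C) \<le> 11 / 200 * v s" by simp
  then have "1 + u s - 3 * v s + 2 * y s * (u s - 1 + C) \<le> - (1 / 2)" using u v by linarith
  then have "(e * y s) * (1 + u s - 3 * v s + 2 * y s * (u s - 1 + C)) \<le> (e * y s) * (- (1 / 2))"
    using e yp by (intro mult_left_mono) auto
  then show ?thesis by (simp add: algebra_simps)
qed

text \<open>Each face has its own dominant term: on y = eta the decay of y; on d = v/10, where v =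
  10 d and u = 11 d, the term 2/5 u v; on v = 9/10 the logistic term 4 v (1 - v) = 9/25. The
  smallness of eta and eta |C| controls the rest.\<close>

lemma good_invariant:
  assumes s: "0 < s" "s \<le> t" "t < S" and g: "good s"
  shows "good t"
proof -
  let ?y' = "\<lambda>s. e * (y s * (1 + u s - 3 * v s + 2 * y s * (u s - 1 + C)))"
  let ?d' = "\<lambda>s. e * (d s * (4 - 4 * (u s + v s) + 2 * r s * u s * v s) + 2 * r s * u s * v s * (3 * d0 C))"
  let ?v' = "\<lambda>s. e * fv C (u s) (v s) (r s)"
  have "0 < eta C - y t \<and> 0 < v t / 10 - d t \<and> 0 < v t - 9 / 10"
  proof (rule barrier3[where s=t and a=s and b=t and f="\<lambda>s. eta C - y s" and g="\<lambda>s. v s / 10 - d s"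
        and h="\<lambda>s. v s - 9 / 10" and f'="\<lambda>s. - ?y' s" and g'="\<lambda>s. ?v' s / 10 - ?d' s" and h'="?v'"])
    fix x assume x: "s < x" "x \<le> t" "0 \<le> eta C - y x" "0 \<le> v x / 10 - d x" "0 \<le> v x - 9 / 10"
      "eta C - y x = 0 \<or> v x / 10 - d x = 0 \<or> v x - 9 / 10 = 0"
    have xx: "0 < x" "x < S" using x s by auto
    note p = pos[OF xx] and eb = eta_bounds[of C]
    have yp: "0 < y x" using p by (simp add: y_def)
    have yC: "y x * \<bar>C\<bar> \<le> 1 / 60"
      using x(3) eb(3) by (intro order_trans[OF mult_right_mono[of "y x" "eta C" "\<bar>C\<bar>"]]) auto
    have u: "u x \<le> 11 / 10 * v x" using x(4) u_eq[OF xx(1)] by simp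
    consider "y x = eta C" | "d x = v x / 10" | "v x = 9 / 10" using x(6) by auto
    then show "eta C - y x = 0 \<and> 0 < - ?y' x \<or> v x / 10 - d x = 0 \<and> 0 < ?v' x / 10 - ?d' x \<or> v x - 9 / 10 = 0 \<and> 0 < ?v' x"
    proof cases
      case 1
      have "?y' x \<le> - (e / 2) * y x" by (rule y_decay[OF xx]) (use x in auto)
      also have "\<dots> < 0" using e yp by simp
      finally show ?thesis using 1 by simp
    next
      case 2
      have "y x * (- \<bar>C\<bar>) \<le> y x * C" using yp by (intro mult_left_mono) auto
      then have "y x * C \<ge> - (1 / 60)" using yC by simp
      moreover have "6 * y x * d0 C = 2 * y x - 4 * (y x * C)" by (simp add: d0_def field_simps)
      ultimately have "0 < 2 / 5 * v x + 1 / 5 * (y x * C) - 6 * y x * d0 C" using x eb by linarith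
      then have "0 < e * (u x * (2 / 5 * v x + 1 / 5 * (y x * C) - 6 * y x * d0 C))" using e p by simp
      also have "\<dots> = ?v' x / 10 - ?d' x"
      proof -
        have vd: "v x = 10 * d x" "u x = 11 * d x" using 2 u_eq[OF xx(1)] by auto
        show ?thesis unfolding y_def fv_def vd by (simp add: field_simps)
      qed
      finally have "0 < ?v' x / 10 - ?d' x" .
      moreover have "v x / 10 - d x = 0" using 2 by simp
      ultimately show ?thesis by blast
    next
      case 3
      have "y x * u x * (- C) \<le> (y x * \<bar>C\<bar>) * (99 / 100)"
proof -
        have "y x * u x * (- C) \<le> y x * u x * \<bar>C\<bar>" using yp p by (intro mult_left_mono) auto
        also have "\<dots> \<le> y x * (99 / 100) * \<bar>C\<bar>" using u 3 yp by (intro mult_right_mono mult_left_mono) auto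
        finally show ?thesis by (simp add: algebra_simps)
      qed
      then have "- (y x * u x * C) \<le> 99 / 6000" using yC by simp
      moreover have "0 \<le> y x * u x * v x" using yp p by simp
      ultimately have "0 < 9 / 25 + 2 * (y x * u x * v x) + 2 * (y x * u x * C)" by linarith
      also have "\<dots> = fv C (u x) (v x) (r x)" unfolding fv_def y_def 3 by (simp add: field_simps)
      finally have "0 < e * fv C (u x) (v x) (r x)" using e by simp
      moreover have "v x - 9 / 10 = 0" using 3 by simp
      ultimately show ?thesis by blast
    qed
  next
    fix x assume x: "s \<le> x" "x \<le> t"
    then have xx: "0 < x" "x < S" using s by auto
    show "((\<lambda>s. eta C - y s) has_real_derivative - ?y' x) (at x)"
      using DERIV_diff[OF DERIV_const[of "eta C"] y_deriv[OF xx]] by simp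
    show "((\<lambda>s. v s / 10 - d s) has_real_derivative ?v' x / 10 - ?d' x) (at x)"
      by (intro DERIV_diff DERIV_cdivide v_deriv d_deriv' xx)
    show "((\<lambda>s. v s - 9 / 10) has_real_derivative ?v' x) (at x)"
      using DERIV_diff[OF v_deriv[OF xx] DERIV_const[of "9 / 10"]] by simp
  qed (use s g in \<open>auto simp: good_def\<close>)
  then show ?thesis by (auto simp: good_def)
qed

end

section \<open>A priori bounds for orbits that avoid the bad region\<close>

locale tame = orbit +
  assumes \<kappa>: "\<kappa> \<le> 0" and not_bad: "\<And>s. 0 < s \<Longrightarrow> s < S \<Longrightarrow> \<not> bad s"
begin

text \<open>The slope of y at 0 is \<kappa>. If it is negative the claim is immediate. If it is 0,
  then d starts with slope d0 e (1 + d0) > 0, so d > d0 for small s and y > 1 would be bad.\<close>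

lemma y_le_near_0: "\<exists>b>0. b < S \<and> (\<forall>s. 0 < s \<longrightarrow> s \<le> b \<longrightarrow> y s \<le> 1)"
proof -
  obtain p n \<delta> where z: "\<And>s. s \<in> {0..S} \<Longrightarrow> z s = (p s, n s, \<delta> s, e)"
    and i: "p 0 = \<kappa>" "n 0 = 0" "\<delta> 0 = 0"
    and c: "continuous_on {0..S} p" "continuous_on {0..S} n" "continuous_on {0..S} \<delta>"
    using components by metis
  show ?thesis
  proof (cases "\<kappa> = 0")
    case True
    obtain b where b: "0 < b" "b < S" "\<And>s. 0 < s \<Longrightarrow> s \<le> b \<Longrightarrow> 0 < de C (p s) (\<delta> s) e"
    proof (rule pos_near_0[of S "\<lambda>s. de C (p s) (\<delta> s) e"])
      show "continuous_on {0..S} (\<lambda>s. de C (p s) (\<delta> s) e)" unfolding de_def by (intro continuous_intros c)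
      show "0 < de C (p 0) (\<delta> 0) e" using d0_pos e by (simp add: de_def i True add_pos_pos)
    qed (use S in auto)
    have "y s \<le> 1" if s: "0 < s" "s \<le> b" for s
    proof -
      have "d s = d0 C + s * de C (p s) (\<delta> s) e" using z[of s] s b by (simp add: d_def df_def)
      then have "d0 C < d s" using b(3)[OF s] s by simp
      then show ?thesis using not_bad[of s] s b by (auto simp: bad_def)
    qed
    then show ?thesis using b by blast
  next
    case False
    let ?F = "\<lambda>s. - (p s + s * (om C (p s) (n s) e * et C (p s) (n s) e))"
    obtain b where b: "0 < b" "b < S" "\<And>s. 0 < s \<Longrightarrow> s \<le> b \<Longrightarrow> 0 < ?F s"
    proof (rule pos_near_0[of S ?F])
      show "continuous_on {0..S} ?F" unfolding om_def et_def by (intro continuous_intros c) auto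
      show "0 < ?F 0" using False \<kappa> by (simp add: i)
    qed (use S in auto)
    have "y s \<le> 1" if s: "0 < s" "s \<le> b" for s
    proof -
      have "y s = (1 + s * et C (p s) (n s) e) * (1 + s * om C (p s) (n s) e)"
        using z[of s] s b by (simp add: y_eq R_def Rf_def w_def wf_def)
      also have "\<dots> = 1 - s * ?F s" by (simp add: om_def et_def field_simps)
      also have "\<dots> \<le> 1" using b(3)[OF s] s by simp
      finally show ?thesis .
    qed
    then show ?thesis using b by blast
  qed
qed

text \<open>To rise through 1, y needs y' \<ge> 0, hence d \<ge> d0 by \<open>y_push\<close>; right
  after the crossing the orbit would be bad. In the borderline case d = d0, \<open>d_push\<close>
  makes d exceed d0 at once.\<close>

lemma y_le:
  assumes s: "0 < s" "s < S"
  shows "y s \<le> 1"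
proof -
  obtain b where b: "0 < b" "\<And>s. 0 < s \<Longrightarrow> s \<le> b \<Longrightarrow> y s \<le> 1" using y_le_near_0 by blast
  have "y s - 1 \<le> 0"
  proof (rule no_crossing[where g="\<lambda>s. d s - d0 C", OF b(1) _ _ _ _ _ s])
    fix x assume x: "0 < x" "x < S"
    show "((\<lambda>s. y s - 1) has_real_derivative e * (y x * (1 + u x - 3 * v x + 2 * y x * (u x - 1 + C)))) (at x)"
      using DERIV_diff[OF y_deriv[OF x] DERIV_const[of 1]] by simp
    show "((\<lambda>s. d s - d0 C) has_real_derivative
      e * (d x * (4 - 4 * (u x + v x) + 2 * r x * u x * v x) + 2 * r x * u x * v x * (3 * d0 C))) (at x)"
      using DERIV_diff[OF d_deriv'[OF x] DERIV_const[of "d0 C"]] by simp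
    show "\<not> (0 < y x - 1 \<and> 0 < d x - d0 C)" using not_bad[OF x] by (auto simp: bad_def)
    assume y: "y x - 1 = 0" "0 \<le> e * (y x * (1 + u x - 3 * v x + 2 * y x * (u x - 1 + C)))"
    then have y1: "y x = 1" by simp
    have "0 \<le> d x - d0 C" using y(2) e unfolding y_push[OF x y1] by (simp add: zero_le_mult_iff)
    then show "0 < d x - d0 C \<or> d x - d0 C = 0 \<and>
      0 < e * (d x * (4 - 4 * (u x + v x) + 2 * r x * u x * v x) + 2 * r x * u x * v x * (3 * d0 C))"
      using d_push[OF x] y1 by (cases "d x = d0 C") auto
  qed (use b in auto)
  then show ?thesis by simp
qed

text \<open>The counterpart of \<open>y_le\<close> under the exchange of planes. It starts more
  easily, since r vanishes at s = 0.\<close>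

lemma Cr_le:
  assumes C0: "C < 0" and s: "0 < s" "s < S"
  shows "- C * r s \<le> 1"
proof -
  obtain b where b: "0 < b" "b < S" "\<And>s. 0 < s \<Longrightarrow> s \<le> b \<Longrightarrow> 0 < 1 + C * (2 * e * s * R s)"
    by (rule pos_near_0[of S "\<lambda>s. 1 + C * (2 * e * s * R s)"]) (use S in \<open>auto intro!: continuous_intros wRd_cont\<close>)
  have "- C * r s - 1 \<le> 0"
  proof (rule no_crossing[where g="\<lambda>s. 3 * (- C) * E s - (2 - C)", OF b(1) _ _ _ _ _ s])
    fix x assume x: "0 < x" "x \<le> b"
    show "- C * r x - 1 \<le> 0" using b(3)[OF x] by (simp add: r_def)
  next
    fix x assume x: "0 < x" "x < S"
    show "((\<lambda>s. - C * r s - 1) has_real_derivative - C * (e * fr C (u x) (v x) (r x))) (at x)"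
      using DERIV_diff[OF DERIV_cmult[OF r_deriv[OF x], of "- C"] DERIV_const[of 1]] by simp
    show "((\<lambda>s. 3 * (- C) * E s - (2 - C)) has_real_derivative
      3 * (- C) * (e * (E x * (- 4 * u x - 4 + 4 * v x - 2 * r x * u x * C) + 2 * r x * u x * (2 - C)))) (at x)"
      using DERIV_diff[OF DERIV_cmult[OF E_deriv[OF x], of "3 * (- C)"] DERIV_const[of "2 - C"]] by simp
    show "\<not> (0 < - C * r x - 1 \<and> 0 < 3 * (- C) * E x - (2 - C))" using not_bad[OF x] C0 by (auto simp: bad_def)
    assume y: "- C * r x - 1 = 0" "0 \<le> - C * (e * fr C (u x) (v x) (r x))"
    have r1: "- C * r x = 1" using y by linarith
    have "0 < - C * e * r x * v x * r x" by (intro mult_pos_pos) (use C0 e pos[OF x] in auto)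
    moreover have "0 \<le> (- C * e * r x * v x * r x) * (3 * (- C) * E x - (2 - C))"
      using y(2) unfolding r_push[OF x r1] by (simp add: algebra_simps)
    ultimately have "0 \<le> 3 * (- C) * E x - (2 - C)" by (metis not_le mult_pos_neg)
    moreover have "0 < 3 * (- C) * (e * (E x * (- 4 * u x - 4 + 4 * v x - 2 * r x * u x * C) + 2 * r x * u x * (2 - C)))"
      if "3 * (- C) * E x = 2 - C"
      by (rule mult_pos_pos[OF _ E_push[OF C0 x that]]) (use C0 r1 in auto)
    ultimately show "0 < 3 * (- C) * E x - (2 - C) \<or> 3 * (- C) * E x - (2 - C) = 0 \<and>
        0 < 3 * (- C) * (e * (E x * (- 4 * u x - 4 + 4 * v x - 2 * r x * u x * C) + 2 * r x * u x * (2 - C)))"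
      by (cases "3 * (- C) * E x = 2 - C") linarith+
  qed
  then show ?thesis by linarith
qed

lemma ruv_le:
  assumes s: "0 < s" "s < S"
  shows "r s * u s * v s \<le> u s" "0 < r s * u s * v s"
proof -
  have "u s * y s \<le> u s * 1" using pos[OF s] y_le[OF s] by (intro mult_left_mono) auto
  then show "r s * u s * v s \<le> u s" by (simp add: y_def algebra_simps)
  show "0 < r s * u s * v s" using pos[OF s] by simp
qed

lemma u_gt_1:
  assumes s: "0 < s" "s < S"
  shows "1 < u s"
proof -
  have "0 < u s - 1"
  proof (rule barrier_from_0[where F="\<lambda>s. w s + 2 * e * s * d s - 2 * e * s", OF _ _ _ _ _ s])
    fix x assume x: "0 < x" "x < S"
    show "((\<lambda>s. u s - 1) has_real_derivative e * fu C (u x) (v x) (r x)) (at x)"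
      using DERIV_diff[OF u_deriv[OF x] DERIV_const[of 1]] by simp
    show "0 < e * fu C (u x) (v x) (r x)" if "u x - 1 = 0"
      using that pos[OF x] e C by (simp add: fu_def)
    show "0 < u x - 1" if "0 < w x + 2 * e * x * d x - 2 * e * x"
      using that x e by (simp add: u_def field_simps)
  qed (auto intro!: continuous_intros wRd_cont simp: wRd_0)
  then show ?thesis by simp
qed

text \<open>On u = 3 (1 + v) the bounds y \<le> 1 and - C r \<le> 1 leave a margin of 24 v. The
  inequality is invariant under u -> u/v, v -> 1/v, so it serves \<open>d_lt\<close> and its mirror
  image \<open>E_lt\<close> alike.\<close>

lemma u_lt:
  assumes C0: "C < 0" and s: "0 < s" "s < S"
  shows "u s < 3 * (1 + v s)"
proof -
  have "0 < 3 * (1 + v s) - u s"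
  proof (rule barrier_from_0[where F="\<lambda>s. 6 * e * s + 2 * w s - 2 * e * s * d s", OF _ _ _ _ _ s])
    fix x assume x: "0 < x" "x < S"
    note p = pos[OF x]
    show "((\<lambda>s. 3 * (1 + v s) - u s) has_real_derivative 3 * (0 + e * fv C (u x) (v x) (r x)) - e * fu C (u x) (v x) (r x)) (at x)"
      by (intro DERIV_diff DERIV_cmult DERIV_add DERIV_const v_deriv u_deriv x)
    show "0 < 3 * (0 + e * fv C (u x) (v x) (r x)) - e * fu C (u x) (v x) (r x)" if "3 * (1 + v x) - u x = 0"
    proof -
      have u: "u x = 3 + 3 * v x" using that by simp
      have "8 * u x * (y x + (- C * r x) * v x) \<le> 8 * u x * (1 + 1 * v x)"
        using p y_le[OF x] Cr_le[OF C0 x] by (intro mult_left_mono add_mono mult_right_mono) auto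
      then have "0 < 24 * v x + (8 * u x * (1 + v x) - 8 * u x * (y x + (- C * r x) * v x))"
        using p(1) by (smt (verit))
      also have "\<dots> = 3 * fv C (u x) (v x) (r x) - fu C (u x) (v x) (r x)"
        unfolding fv_def fu_def y_def u by (simp add: algebra_simps)
      finally have "0 < e * (3 * fv C (u x) (v x) (r x) - fu C (u x) (v x) (r x))" using e by simp
      then show ?thesis by (simp add: algebra_simps)
    qed
    show "0 < 3 * (1 + v x) - u x" if "0 < 6 * e * x + 2 * w x - 2 * e * x * d x"
    proof -
      have "6 * e * x + 2 * w x - 2 * e * x * d x = (2 * e * x) * (3 * (1 + v x) - u x)"
        by (simp add: wRd_eq[OF x(1)] algebra_simps)
      then show ?thesis using that zero_less_mult_pos[of "2 * e * x" "3 * (1 + v x) - u x"] x e by simp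
    qed
  qed (auto intro!: continuous_intros wRd_cont simp: wRd_0)
  then show ?thesis by simp
qed

lemma v_gt_1:
  assumes C0: "0 \<le> C" and s: "0 < s" "s < S"
  shows "1 < v s"
proof -
  have "0 < v s - 1"
  proof (rule barrier_from_0[where F="\<lambda>s. w s - 2 * e * s", OF _ _ _ _ _ s])
    fix x assume x: "0 < x" "x < S"
    show "((\<lambda>s. v s - 1) has_real_derivative e * fv C (u x) (v x) (r x)) (at x)"
      using DERIV_diff[OF v_deriv[OF x] DERIV_const[of 1]] by simp
    show "0 < e * fv C (u x) (v x) (r x)" if "v x - 1 = 0"
      using that pos[OF x] e C0 by (simp add: fv_def)
    show "0 < v x - 1" if "0 < w x - 2 * e * x"
      using that x e by (simp add: v_def field_simps)
  qed (auto intro!: continuous_intros wRd_cont simp: wRd_0)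
  then show ?thesis by simp
qed

text \<open>A large d forces v \<ge> 1: for C < 0 the bound u < 3 (1 + v) reads d < 3 + 2 v, and for
  C \<ge> 0 one has v > 1 anyway. Then d is damped at rate 2 u at least, while the source is at most
  6 d0 u, and Dmax > 3 d0.\<close>

lemma d_lt:
  assumes s: "0 < s" "s < S"
  shows "d s < Dmax C"
proof -
  have "0 < Dmax C - d s"
  proof (rule barrier_from_0[where F="\<lambda>s. Dmax C - d s", OF _ _ _ _ _ s])
    fix x assume x: "0 < x" "x < S"
    note p = pos[OF x] and B = bounds_pos[of C]
    let ?d' = "e * (d x * (4 - 4 * (u x + v x) + 2 * r x * u x * v x) + 2 * r x * u x * v x * (3 * d0 C))"
    show "((\<lambda>s. Dmax C - d s) has_real_derivative - ?d') (at x)"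
      using DERIV_diff[OF DERIV_const[of "Dmax C"] d_deriv'[OF x]] by simp
    show "0 < - ?d'" if "Dmax C - d x = 0"
    proof -
      have d: "d x = Dmax C" using that by simp
      have v1: "1 \<le> v x"
      proof (cases "C < 0")
        case True
        then show ?thesis using u_lt[OF True x] u_eq[OF x(1)] d B by auto
      qed (use v_gt_1 x in force)
      define X where "X = r x * u x * v x"
      have X: "X \<le> u x" using ruv_le[OF x] by (simp add: X_def)
      have "d x * (4 - 4 * (u x + v x) + 2 * X) \<le> Dmax C * (- 2 * u x)"
        unfolding d using X v1 B by (intro mult_left_mono) auto
      moreover have "2 * X * (3 * d0 C) \<le> 2 * u x * (3 * d0 C)" using X d0_pos by (intro mult_right_mono) auto
      moreover have "2 * u x * (3 * d0 C) < 2 * u x * Dmax C" using B p by (intro mult_strict_left_mono) auto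
      ultimately have "d x * (4 - 4 * (u x + v x) + 2 * X) + 2 * X * (3 * d0 C) < 0" by (simp add: algebra_simps)
      then have "0 < e * (- (d x * (4 - 4 * (u x + v x) + 2 * X) + 2 * X * (3 * d0 C)))" using e by simp
      then show ?thesis by (simp add: X_def algebra_simps)
    qed
  qed (use bounds_pos(2)[of C] d0_pos in \<open>auto intro!: continuous_intros wRd_cont simp: wRd_0\<close>)
  then show ?thesis by simp
qed

text \<open>The mirror image of \<open>d_lt\<close>: now E \<ge> 7 together with u < 3 (1 + v)
  forces v \<le> 1, and - C r \<le> 1 replaces y \<le> 1.\<close>

lemma E_lt:
  assumes C0: "C < 0" and s: "0 < s" "s < S"
  shows "E s < Emax C"
proof -
  have "0 < Emax C - E s"
  proof (rule barrier_from_0[where F="\<lambda>s. Emax C * w s - (w s + 2 * e * s * d s - 2 * e * s)", OF _ _ _ _ _ s])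
    fix x assume x: "0 < x" "x < S"
    note p = pos[OF x] and B = bounds_pos[of C]
    let ?E' = "e * (E x * (- 4 * u x - 4 + 4 * v x - 2 * r x * u x * C) + 2 * r x * u x * (2 - C))"
    show "((\<lambda>s. Emax C - E s) has_real_derivative - ?E') (at x)"
      using DERIV_diff[OF DERIV_const[of "Emax C"] E_deriv[OF x]] by simp
    show "0 < - ?E'" if "Emax C - E x = 0"
    proof -
      have E: "E x = Emax C" using that by simp
      have u: "u x = 1 + E x * v x" using p by (simp add: E_def)
      have v1: "v x \<le> 1"
      proof (rule ccontr)
        assume "\<not> v x \<le> 1"
        moreover have "7 * v x \<le> E x * v x" using B E p by (intro mult_right_mono) auto
        ultimately show False using u_lt[OF C0 x] u by (smt (verit))
      qed
      define X where "X = (- C * r x) * u x"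
      have X: "X \<le> u x" "0 < X" using mult_right_mono[OF Cr_le[OF C0 x], of "u x"] p C0 by (auto simp: X_def mult_neg_pos)
      have eq: "2 * r x * u x * (2 - C) = 2 * X * (1 - 2 / C)" using C0 by (simp add: X_def field_simps)
      have "E x * (- 4 * u x - 4 + 4 * v x + 2 * X) \<le> Emax C * (- 2 * u x)"
        unfolding E using X v1 B by (intro mult_left_mono) auto
      moreover have "2 * X * (1 - 2 / C) < 2 * X * Emax C" using B X by (intro mult_strict_left_mono) auto
      moreover have "2 * X * Emax C \<le> 2 * u x * Emax C" using B X by (intro mult_right_mono) auto
      ultimately have "E x * (- 4 * u x - 4 + 4 * v x + 2 * X) + 2 * X * (1 - 2 / C) < 0" by (simp add: algebra_simps)
      then have "0 < e * (- (E x * (- 4 * u x - 4 + 4 * v x + 2 * X) + 2 * r x * u x * (2 - C)))" using e unfolding eq by simp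
      then show ?thesis by (simp add: X_def algebra_simps)
    qed
    show "0 < Emax C - E x" if "0 < Emax C * w x - (w x + 2 * e * x * d x - 2 * e * x)"
    proof -
      have "Emax C * w x - (w x + 2 * e * x * d x - 2 * e * x) = (2 * e * x) * (Emax C * v x - (u x - 1))"
        by (simp add: wRd_eq[OF x(1)] algebra_simps)
      then have "0 < Emax C * v x - (u x - 1)"
        using that zero_less_mult_pos[of "2 * e * x" "Emax C * v x - (u x - 1)"] x e by simp
      then show ?thesis using p by (simp add: E_def divide_less_eq)
    qed
  qed (use bounds_pos(3)[of C] in \<open>auto intro!: continuous_intros wRd_cont simp: wRd_0\<close>)
  then show ?thesis by simp
qed

text \<open>The only negative contribution for C < 0 is - 2 (- C r) u, at least - 2 (1 + Emax v) by
  \<open>Cr_le\<close> and \<open>E_lt\<close>. On v = vmin the sum 4 (1 - v) - 2 (1 + Emax v)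
  equals 1.\<close>

lemma v_gt:
  assumes s: "0 < s" "s < S"
  shows "vmin C < v s"
proof (cases "C < 0")
  case False
  then show ?thesis using v_gt_1[OF _ s] by (simp add: vmin_def)
next
  case True
  have "0 < v s - vmin C"
  proof (rule barrier_from_0[where F="\<lambda>s. w s - vmin C * (2 * e * s)", OF _ _ _ _ _ s])
    fix x assume x: "0 < x" "x < S"
    note p = pos[OF x] and B = bounds_pos[of C]
    show "((\<lambda>s. v s - vmin C) has_real_derivative e * fv C (u x) (v x) (r x)) (at x)"
      using DERIV_diff[OF v_deriv[OF x] DERIV_const[of "vmin C"]] by simp
    show "0 < e * fv C (u x) (v x) (r x)" if "v x - vmin C = 0"
    proof -
      have v: "v x * (2 * (2 + Emax C)) = 1" using that B True by (simp add: vmin_def)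
      have "u x - 1 < Emax C * v x" using E_lt[OF True x] p by (simp add: E_def divide_less_eq)
      moreover have "(- C * r x) * u x \<le> 1 * u x" using Cr_le[OF True x] p by (intro mult_right_mono) auto
      moreover have "0 \<le> r x * u x * v x" using p by simp
      ultimately have "0 < 4 * (1 - v x) + 2 * (r x * u x * v x) - 2 * ((- C * r x) * u x)" using v by (simp add: algebra_simps)
      also have "\<dots> = 4 * (1 - v x) + 2 * r x * u x * (v x + C)" by (simp add: algebra_simps)
      finally show ?thesis using e p by (simp add: fv_def)
    qed
    show "0 < v x - vmin C" if "0 < w x - vmin C * (2 * e * x)"
      using that x e by (simp add: v_def field_simps)
  qed (auto intro!: continuous_intros wRd_cont simp: wRd_0)
  then show ?thesis by simp
qed

text \<open>The bound involves v a at a positive time because v is unbounded near 0. For large v the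
  term - 4 v wins: r u v \<le> u < v + Dmax, and 2 C r u is negative for C < 0 and at most 1 + Dmax
  otherwise.\<close>

lemma v_lt:
  assumes a: "0 < a" "a \<le> s" and s: "s < S"
  shows "v s < max (v a) (2 * Dmax C + 4) + 1"
proof -
  let ?M = "max (v a) (2 * Dmax C + 4) + 1"
  have "0 < ?M - v s"
  proof (rule barrier[where a=a and b=s and s=s and f'="\<lambda>x. - (e * fv C (u x) (v x) (r x))"])
    fix x assume x: "a \<le> x" "x \<le> s"
    then show "((\<lambda>s. ?M - v s) has_real_derivative - (e * fv C (u x) (v x) (r x))) (at x)"
      using DERIV_diff[OF DERIV_const[of ?M] v_deriv[of x]] a s by simp
  next
    fix x assume x: "a < x" "x \<le> s" "?M - v x = 0"
    have xx: "0 < x" "x < S" using x a s by auto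
    note p = pos[OF xx]
    have vM: "2 * Dmax C + 5 \<le> v x" using x(3) by linarith
    have u: "u x < v x + Dmax C" using u_eq[OF xx(1)] d_lt[OF xx] by simp
    have v1: "1 < v x" using vM bounds_pos[of C] by simp
    have "4 * (1 - v x) + 2 * r x * u x * (v x + C) < 0"
    proof (cases "C < 0")
      case True
      then have "r x * u x * C < 0" using p by (simp add: mult_pos_neg)
      then have "4 * (1 - v x) + 2 * (r x * u x * v x) + 2 * (r x * u x * C) < 0"
        using ruv_le[OF xx] u vM bounds_pos(1)[of C] by (smt (verit))
      then show ?thesis by (simp add: algebra_simps)
    next
      case False
      have rx: "r x * v x \<le> 1" using y_le[OF xx] by (simp add: y_def)
      have "r x * u x \<le> 1 + Dmax C"
      proof -
        have "r x * u x \<le> r x * (v x + Dmax C)" using u p by (intro mult_left_mono) auto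
        also have "\<dots> \<le> 1 + r x * Dmax C" using rx by (simp add: algebra_simps)
        also have "r x * 1 \<le> r x * v x" using v1 p by (intro mult_left_mono) auto
        then have "1 + r x * Dmax C \<le> 1 + 1 * Dmax C" using rx bounds_pos[of C] by (intro add_left_mono mult_right_mono) auto
        finally show ?thesis by simp
      qed
      then have "r x * u x * C \<le> (1 + Dmax C) * (1 / 2)" using False C p bounds_pos[of C] by (intro mult_mono) auto
      then have "4 * (1 - v x) + 2 * (r x * u x * v x) + 2 * (r x * u x * C) < 0"
        using ruv_le[OF xx] u vM bounds_pos[of C] by argo
      then show ?thesis by (simp add: algebra_simps)
    qed
    then show "0 < - (e * fv C (u x) (v x) (r x))" using e p by (simp add: fv_def mult_pos_neg)
  qed (use a bounds_pos[of C] in auto)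
  then show ?thesis by simp
qed

end

section \<open>Critical points\<close>

text \<open>The common zeros of \<open>fu\<close>, \<open>fv\<close> and \<open>fr\<close> in the
  positive octant. By \<open>crit_log_derivs\<close> all four coefficients then have the same
  logarithmic derivative, so that such a point represents a cone.\<close>

definition crit :: "real \<Rightarrow> real \<Rightarrow> real \<Rightarrow> real \<Rightarrow> bool" where
  "crit C u v r \<longleftrightarrow> 0 < u \<and> 0 < v \<and> 0 < r \<and> 2 * (u - 1) = r * v * (u + 1 - C) \<and>
     2 * (v - 1) = r * u * (v + C) \<and> u + v - 3 = 2 * r * ((1 - C) * v + C * u)"

definition crit_poly :: "real \<Rightarrow> real \<Rightarrow> real" where
  "crit_poly B u = 5 * u^4 - (15 + 6 * B) * u^3 + (9 + 10 * B + 9 * B\<^sup>2) * u\<^sup>2 - (6 * B + 15 * B\<^sup>2) * u + 5 * B\<^sup>2"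

text \<open>The second and third equations combine to 2 r v (u - B) = 3 v - u - 1. Together with r v
  (u + B) = 2 (u - 1) this eliminates r v and expresses v as a rational function of u; the second
  equation then becomes a quartic in u.\<close>

lemma crit_elimination:
  assumes c: "crit C u v r" and C: "C < 1 / 2"
  defines "B \<equiv> 1 - C"
  shows "1 < u" "3 * (u + B) * v = 5 * u\<^sup>2 - 3 * (1 + B) * u + 5 * B" "r * v * (u + B) = 2 * (u - 1)"
    "crit_poly B u = 0"
proof -
  have p: "0 < u" "0 < v" "0 < r" and e1: "r * v * (u + B) = 2 * (u - 1)" and e2: "2 * (v - 1) = r * u * (v + C)"
    and e3: "u + v - 3 = 2 * r * (B * v + C * u)"
    using c by (auto simp: crit_def B_def algebra_simps)
  have uB: "0 < u + B" using p C by (simp add: B_def)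
  have "0 < r * v * (u + B)" using p uB by simp
  then show u: "1 < u" using e1 by simp
  show "r * v * (u + B) = 2 * (u - 1)" by (rule e1)
  have CB: "C = 1 - B" by (simp add: B_def)
  have "2 * (r * v) * (u - B) = 3 * v - u - 1"
    using e2 e3 CB by algebra
  then have "2 * (r * v * (u + B)) * (u - B) = (3 * v - u - 1) * (u + B)" by (metis mult.assoc mult.commute)
  then have e4: "4 * (u - 1) * (u - B) = (3 * v - u - 1) * (u + B)" unfolding e1 by (simp add: algebra_simps)
  then show N: "3 * (u + B) * v = 5 * u\<^sup>2 - 3 * (1 + B) * u + 5 * B" by (simp add: algebra_simps power2_eq_square)
  have "2 * (v - 1) * v * (u + B) = (r * v * (u + B)) * (u * (v + C))" unfolding e2 by (simp add: algebra_simps)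
  then have "v * (v - 1) * (u + B) = u * (u - 1) * (v + C)" unfolding e1 by (simp add: algebra_simps)
  then have "(3 * (u + B) * v) * ((3 * (u + B) * v) - 3 * (u + B)) = 3 * u * (u - 1) * ((3 * (u + B) * v) + 3 * C * (u + B))"
    by algebra
  moreover have "C = 1 - B" by (simp add: B_def)
  ultimately have "2 * crit_poly B u = 0" unfolding N crit_poly_def
    by (simp add: algebra_simps power2_eq_square power3_eq_cube power4_eq_xxxx)
  then show "crit_poly B u = 0" by simp
qed

text \<open>Expanded at u = 1 and divided by t^3, the equation equates an increasing linear function
  of t with a sum of negative powers whose coefficients are positive, so there is at most one root t
  > 0.\<close>

lemma crit_poly_at_1:
  assumes B: "1 / 2 < B" "B \<le> 1" and z: "0 < x" "x < y" "crit_poly B (1 + x) = 0" "crit_poly B (1 + y) = 0"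
  shows False
proof -
  define c2 c1 c0 where "c2 = 6 + 8 * B - 9 * B\<^sup>2" and "c1 = 7 + 4 * B - 3 * B\<^sup>2" and "c0 = (1 + B)\<^sup>2"
  have B2: "B\<^sup>2 \<le> 1" using B by (simp add: power_le_one)
  have c: "0 < c2" "0 < c1" "0 < c0" using B B2 by (auto simp: c2_def c1_def c0_def)
  have P: "crit_poly B (1 + t) = t^3 * (5 * t + (5 - 6 * B)) - (c2 * t\<^sup>2 + c1 * t + c0)" for t
    by (simp add: crit_poly_def c2_def c1_def c0_def power2_eq_square power3_eq_cube power4_eq_xxxx algebra_simps)
  have g: "5 * t + (5 - 6 * B) = c2 / t + c1 / t\<^sup>2 + c0 / t^3" if "0 < t" "crit_poly B (1 + t) = 0" for t
  proof -
    have "t^3 * (5 * t + (5 - 6 * B)) = t^3 * (c2 / t + c1 / t\<^sup>2 + c0 / t^3)"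
      using that P[of t] by (simp add: algebra_simps power2_eq_square power3_eq_cube)
    then show ?thesis using that(1) by (simp only: mult_cancel_left) simp
  qed
  have y0: "0 < y" using z by simp
  have "c2 / y \<le> c2 / x" "c1 / y\<^sup>2 \<le> c1 / x\<^sup>2" "c0 / y^3 \<le> c0 / x^3"
    using c z y0 by (auto intro!: divide_left_mono power_mono)
  then show False using g[OF z(1,3)] g[OF y0 z(4)] z(2) by linarith
qed

text \<open>Regarded as a quadratic in B, the polynomial is negative at B = 1 and B = 2. If it is
  convex it stays negative in between; if it is concave, \<beta> < 0 keeps it below its value at B =
  1.\<close>

lemma crit_poly_neg:
  assumes B: "1 < B" "B \<le> 2" and u: "1 < u" "u < 2"
  shows "crit_poly B u < 0"
proof -
  define \<alpha> \<beta> \<gamma> where "\<alpha> = 9 * u\<^sup>2 - 15 * u + 5" and "\<beta> = - 6 * u^3 + 10 * u\<^sup>2 - 6 * u"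
    and "\<gamma> = 5 * u^4 - 15 * u^3 + 9 * u\<^sup>2"
  define q where "q b = \<alpha> * b\<^sup>2 + \<beta> * b + \<gamma>" for b
  have P: "crit_poly B u = q B"
    by (simp add: crit_poly_def q_def \<alpha>_def \<beta>_def \<gamma>_def power2_eq_square power3_eq_cube power4_eq_xxxx algebra_simps)
  have "0 < (u - 1) * (2 - u)" using u by simp
  then have s: "u\<^sup>2 < 3 * u - 2" by (simp add: power2_eq_square algebra_simps)
  have "5 * u\<^sup>2 - 6 * u + 5 = 5 * (u - 3 / 5)\<^sup>2 + 16 / 5" by (simp add: power2_eq_square algebra_simps)
  also have "0 < \<dots>" by (intro add_nonneg_pos) auto
  finally have s2: "0 < 5 * u\<^sup>2 - 6 * u + 5" .
  have "q 1 = (u\<^sup>2 - 3 * u + 1) * (5 * u\<^sup>2 - 6 * u + 5)"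
    by (simp add: q_def \<alpha>_def \<beta>_def \<gamma>_def power2_eq_square power3_eq_cube power4_eq_xxxx algebra_simps)
  also have "\<dots> < 0" using s s2 by (intro mult_neg_pos) auto
  finally have q1: "q 1 < 0" .
  have "5 * u\<^sup>2 - 17 * u + 31 = 5 * (u - 17 / 10)\<^sup>2 + 331 / 20" by (simp add: power2_eq_square algebra_simps)
  then have "16 \<le> 5 * u\<^sup>2 - 17 * u + 31" using zero_le_power2[of "u - 17 / 10"] by linarith
  then have "1 * 16 \<le> u * (5 * u\<^sup>2 - 17 * u + 31)" using u by (intro mult_mono) auto
  then have s3: "0 < u * (5 * u\<^sup>2 - 17 * u + 31) - 10" by simp
  have "q 2 = (u - 2) * (u * (5 * u\<^sup>2 - 17 * u + 31) - 10)"
    by (simp add: q_def \<alpha>_def \<beta>_def \<gamma>_def power2_eq_square power3_eq_cube power4_eq_xxxx algebra_simps)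
  also have "\<dots> < 0" using u s3 by (intro mult_neg_pos) auto
  finally have q2: "q 2 < 0" .
  show ?thesis
  proof (cases "0 \<le> \<alpha>")
    case True
    have "q B = (2 - B) * q 1 + (B - 1) * q 2 - \<alpha> * ((B - 1) * (2 - B))"
      by (simp add: q_def power2_eq_square algebra_simps)
    moreover have "0 \<le> \<alpha> * ((B - 1) * (2 - B))" using True B by simp
    moreover have "(2 - B) * q 1 + (B - 1) * q 2 < 0"
      using B q1 q2 by (intro add_nonpos_neg) (auto simp: mult_le_0_iff mult_less_0_iff)
    ultimately show ?thesis using P by simp
  next
    case False
    have "3 * u\<^sup>2 - 5 * u + 3 = 3 * (u - 5 / 6)\<^sup>2 + 11 / 12" by (simp add: power2_eq_square algebra_simps)
    then have "0 < 3 * u\<^sup>2 - 5 * u + 3" by (simp add: add_nonneg_pos)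
    then have "0 < 2 * u * (3 * u\<^sup>2 - 5 * u + 3)" using u by simp
    then have b: "\<beta> < 0" by (simp add: \<beta>_def power2_eq_square power3_eq_cube algebra_simps)
    have "\<alpha> * (B + 1) < 0" using False B by (intro mult_neg_pos) auto
    then have "(B - 1) * (\<alpha> * (B + 1) + \<beta>) < 0" using b B by (intro mult_pos_neg) auto
    moreover have "q B = q 1 + (B - 1) * (\<alpha> * (B + 1) + \<beta>)" by (simp add: q_def power2_eq_square algebra_simps)
    ultimately show ?thesis using P q1 by simp
  qed
qed

text \<open>Expanded at u = 2 the equation is t g(t) = c0 with c0 \<ge> 0 and g strictly increasing.
  Two roots x < y would give x g(x) < y g(y) because g(y) \<ge> 0.\<close>

lemma crit_poly_at_2:
  assumes B: "1 < B" "B \<le> 2" and z: "0 \<le> x" "x < y" "crit_poly B (2 + x) = 0" "crit_poly B (2 + y) = 0"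
  shows False
proof -
  define c3 c2 c1 c0 where "c3 = 25 - 6 * B" and "c2 = 39 - 26 * B + 9 * B\<^sup>2" and "c1 = 16 - 38 * B + 21 * B\<^sup>2"
    and "c0 = (11 * B + 2) * (2 - B)"
  have "c2 = 9 * (B - 13 / 9)\<^sup>2 + 182 / 9" by (simp add: c2_def power2_eq_square algebra_simps)
  then have c: "0 < c3" "0 < c2" "0 \<le> c0" using B by (auto simp: c3_def c0_def add_nonneg_pos)
  have P: "crit_poly B (2 + t) = t * (5 * t^3 + c3 * t\<^sup>2 + c2 * t + c1) - c0" for t
    by (simp add: crit_poly_def c3_def c2_def c1_def c0_def power2_eq_square power3_eq_cube power4_eq_xxxx algebra_simps)
  have "c3 * x\<^sup>2 \<le> c3 * y\<^sup>2" "x^3 \<le> y^3" "c2 * x < c2 * y"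
    using c z by (auto intro!: mult_left_mono power_mono)
  then have g: "5 * x^3 + c3 * x\<^sup>2 + c2 * x + c1 < 5 * y^3 + c3 * y\<^sup>2 + c2 * y + c1" by linarith
  define gx gy where "gx = 5 * x^3 + c3 * x\<^sup>2 + c2 * x + c1" and "gy = 5 * y^3 + c3 * y\<^sup>2 + c2 * y + c1"
  have xy: "x * gx = y * gy" "y * gy = c0" using z(3,4) P[of x] P[of y] by (auto simp: gx_def gy_def)
  have gg: "gx < gy" using g by (simp add: gx_def gy_def)
  have gy0: "0 \<le> gy" using xy(2) c(3) z by (metis le_less_trans mult_pos_neg not_less)
  show False
  proof (cases "x = 0")
    \<comment> \<open>A root at t = 0 means c0 = 0, hence B = 2; there c1 > 0, so g is positive and
      a second root is impossible.\<close>
    case True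
    then have "c0 = 0" using xy by simp
    then have "B = 2" using B by (auto simp: c0_def)
    then have "0 < c1" by (simp add: c1_def)
    then have "0 < gx" by (simp add: gx_def True)
    then have "0 < y * gy" using gg z by (intro mult_pos_pos) auto
    then show False using xy True by simp
  next
    case False
    then have "x * gx < x * gy" using gg z by simp
    also have "\<dots> \<le> y * gy" using z gy0 by (intro mult_right_mono) auto
    finally show False using xy by simp
  qed
qed

lemma crit_unique_aux:
  assumes C: "- 1 \<le> C" "C < 1 / 2" and c: "crit C u v r" "crit C u' v' r'"
  shows "u = u' \<and> v = v' \<and> r = r'"
proof -
  note e = crit_elimination[OF c(1) C(2)] and e' = crit_elimination[OF c(2) C(2)]
  have uu: "u = u'"
  proof (cases "0 \<le> C")
    case True
    have "\<not> x < y" if "1 < x" "1 < y" "crit_poly (1 - C) x = 0" "crit_poly (1 - C) y = 0" for x y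
      using crit_poly_at_1[of "1 - C" "x - 1" "y - 1"] that True C by auto
    then show ?thesis using e e' by (meson linorder_neqE)
  next
    case False
    then have B: "1 < 1 - C" "1 - C \<le> 2" using C by auto
    have "\<not> x < y" if "1 < x" "1 < y" "crit_poly (1 - C) x = 0" "crit_poly (1 - C) y = 0" for x y
    proof -
      have "2 \<le> x" "2 \<le> y" using crit_poly_neg[OF B] that by (metis less_irrefl not_le)+
      then show ?thesis using crit_poly_at_2[OF B, of "x - 2" "y - 2"] that by auto
    qed
    then show ?thesis using e e' by (meson linorder_neqE)
  qed
  have uB: "0 < u + (1 - C)" using e(1) C by simp
  have "3 * (u' + (1 - C)) * v = 3 * (u' + (1 - C)) * v'" by (rule trans[OF e(2)[unfolded uu] e'(2)[symmetric]])
  moreover have "3 * (u' + (1 - C)) \<noteq> 0" using uB unfolding uu by (metis less_irrefl mult_eq_0_iff zero_neq_numeral)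
  ultimately have vv: "v = v'" using mult_left_cancel by blast
  have "r * (v * (u + (1 - C))) = r' * (v * (u + (1 - C)))" using e(3) e'(3) uu vv by (simp add: mult.assoc)
  moreover have "v * (u + (1 - C)) \<noteq> 0" using uB c by (auto simp: crit_def)
  ultimately have "r = r'" using mult_right_cancel by blast
  then show ?thesis using uu vv by simp
qed

text \<open>The exchange of the first and third planes, with the fibre rescaled by - C so that the
  new collapsing plane again has coefficient 1; this factor is positive since C < 0. The map sends C
  < -1 into (-1, 0), which leaves -1 \<le> C < 1/2 to the quartic.\<close>

lemma crit_transform:
  assumes C: "C < 0" and c: "crit C u v r"
  shows "crit (1 / C) (u / v) (1 / v) (- C * r * v)"
proof -
  have p: "0 < u" "0 < v" "0 < r" and e1: "2 * (u - 1) = r * v * (u + 1 - C)" and e2: "2 * (v - 1) = r * u * (v + C)"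
    and e3: "u + v - 3 = 2 * r * ((1 - C) * v + C * u)"
    using c by (auto simp: crit_def)
  have "2 * (u - v) = r * (v - C * v - C * u)" using e1 e2 by algebra
  then have a: "2 * (u / v - 1) = - C * r * v * (1 / v) * (u / v + 1 - 1 / C)"
    using p C by (simp add: divide_simps) (simp add: algebra_simps)?
  have b: "2 * (1 / v - 1) = - C * r * v * (u / v) * (1 / v + 1 / C)"
    using p C e2 by (simp add: divide_simps) (simp add: algebra_simps)?
  have y: "u + 1 - 3 * v = - 2 * r * v * (u - 1 + C)"
    using e2 e3 by algebra
  have "u / v + 1 / v - 3 = (u + 1 - 3 * v) / v" using p by (simp add: field_simps)
  also have "\<dots> = 2 * (- C * r * v) * ((1 - 1 / C) * (1 / v) + 1 / C * (u / v))"
    unfolding y using p C by (simp add: field_simps)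
  finally have d: "u / v + 1 / v - 3 = 2 * (- C * r * v) * ((1 - 1 / C) * (1 / v) + 1 / C * (u / v))" .
  have "0 < - C * r * v" using p C by (intro mult_pos_pos) auto
  then show ?thesis using p a b d by (simp add: crit_def)
qed

lemma crit_unique:
  assumes C: "C < 1 / 2" and c: "crit C u v r" "crit C u' v' r'"
  shows "u = u' \<and> v = v' \<and> r = r'"
proof (cases "- 1 \<le> C")
  case True
  then show ?thesis using crit_unique_aux C c by blast
next
  case False
  then have C1: "C < 0" "- 1 \<le> 1 / C" "1 / C < 1 / 2" by (auto simp: divide_simps)
  note t = crit_unique_aux[OF C1(2,3) crit_transform[OF C1(1) c(1)] crit_transform[OF C1(1) c(2)]]
  have p: "0 < v" "0 < v'" using c by (auto simp: crit_def)
  then have "v = v'" using t by (auto simp: field_simps)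
  then show ?thesis using t p C1 by auto
qed

section \<open>Global behaviour\<close>

text \<open>The bounds on u, v, r, d have to be turned into bounds on the desingularised
  coordinates, at the cost of dividing by s. For s \<ge> a this is harmless. On [0, a] every
  solution coincides, by uniqueness, with one fixed local solution, so the resulting bound
  \<open>M\<close> is the same for all S.\<close>

lemma tame_extends:
  assumes C: "C < 1 / 2" and e: "0 < e" and \<kappa>: "\<kappa> \<le> 0" and S0: "0 \<le> S0"
    and nb: "\<And>S z s. 0 < S \<Longrightarrow> K4.ksol (field4 C) S (\<kappa>, 0, 0, e) z \<Longrightarrow> 0 < s \<Longrightarrow> s < S \<Longrightarrow> \<not> orbit.bad C e z s"
  shows "\<exists>z. K4.ksol (field4 C) S0 (\<kappa>, 0, 0, e) z"
proof -
  obtain S1 z1 where S1: "0 < S1" and z1: "K4.ksol (field4 C) S1 (\<kappa>, 0, 0, e) z1"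
    using ivp.ksol_local by blast
  interpret T1: orbit C \<kappa> e S1 z1 by unfold_locales (use C e S1 z1 in auto)
  obtain M1 where M1: "0 < M1" "\<And>s. s \<in> {0..S1} \<Longrightarrow> norm (z1 s) \<le> M1" using ivp.ksol_bounded[OF z1] by blast
  define a where "a = S1 / 2"
  have a: "0 < a" "a < S1" using S1 by (auto simp: a_def)
  define V where "V = max (T1.v a) (2 * Dmax C + 4) + 1"
  \<comment> \<open>\<open>o1\<close>, \<open>o2\<close>, \<open>o3\<close> bound \<open>om\<close>,
    \<open>et\<close> and \<open>de\<close> from time a on; \<open>M\<close> adds the cost of the
    linear change back to the state.\<close>
  define o1 where "o1 = (2 * e * S0 * V + 1) / a"
  define o2 where "o2 = (1 / (vmin C * (2 * e * a)) + 1) / a"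
  define o3 where "o3 = (Dmax C + d0 C) / a"
  define M where "M = M1 + ((o1 + o2) + (o1 + o2 + \<bar>e * ((9 + d0 C + 2 * C) / 2)\<bar>)
      + (o3 + d0 C * (o1 + o2 + \<bar>e * (1 + d0 C)\<bar>)) + \<bar>e\<bar>)"
  have nn: "0 \<le> o1" "0 \<le> o2" "0 \<le> o3" "0 < d0 C"
    using e a S0 bounds_pos[of C] T1.d0_pos by (auto simp: o1_def o2_def o3_def V_def intro!: divide_nonneg_pos add_nonneg_nonneg mult_nonneg_nonneg)
  have M1M: "M1 \<le> M" using nn by (auto simp: M_def intro!: add_nonneg_nonneg mult_nonneg_nonneg)
  show ?thesis
  proof (rule ivp.ksol_extends[of _ M])
    show "norm (\<kappa>, 0::real, 0::real, e) \<le> M" using M1(2)[of 0] T1.z_0 S1 M1M by auto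
    fix S z s assume S: "0 < S" "S \<le> S0" and z: "K4.ksol (field4 C) S (\<kappa>, 0, 0, e) z" and s: "0 < s" "s < S"
    interpret T: tame C \<kappa> e S z by unfold_locales (use C e S z \<kappa> nb in auto)
    have same: "z x = z1 x" if "0 \<le> x" "x \<le> S1" "x \<le> S" for x
      by (rule ivp.ksol_unique[OF K4.ksol_mono[OF z, of "min S S1"] K4.ksol_mono[OF z1, of "min S S1"]]) (use that in auto)
    show "norm (z s) \<le> M"
    proof (cases "s \<le> a")
      case True
      then show ?thesis using M1(2)[of s] same[of s] s a M1M by auto
    next
      case False
      have za: "z a = z1 a" using same[of a] a False s by simp
      then have "T.v a = T1.v a" by (simp add: T.v_def T1.v_def T.w_def T1.w_def)
      then have v: "T.v s < V" using T.v_lt[OF a(1) _ s(2)] False by (simp add: V_def)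
      note p = T.pos[OF s] and B = bounds_pos[of C]
      obtain p n \<delta> where zs: "z s = (p, n, \<delta>, e)" using T.components s by (metis atLeastAtMost_iff less_imp_le)
      have W: "1 + s * om C p n e = 2 * e * s * T.v s" using T.wRd_eq(1)[OF s(1)] by (simp add: T.w_def wf_def zs)
      have R: "1 + s * et C p n e = T.r s / (2 * e * s)" using T.wRd_eq(2)[OF s(1)] by (simp add: T.R_def Rf_def zs)
      have D: "d0 C + s * de C p \<delta> e = T.d s" by (simp add: T.d_def df_def zs)
      have b1: "\<bar>om C p n e\<bar> \<le> o1"
      proof -
        have "2 * e * s * T.v s \<le> 2 * e * S0 * V" using v p e s S by (intro mult_mono) auto
        moreover have "0 \<le> 2 * e * s * T.v s" using p e s by simp
        ultimately have "\<bar>s * om C p n e\<bar> \<le> 2 * e * S0 * V + 1" using W by linarith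
        then have "\<bar>om C p n e\<bar> \<le> (2 * e * S0 * V + 1) / s" using s by (simp add: abs_mult field_simps)
        also have "\<dots> \<le> o1" unfolding o1_def using e S S0 a False nn
          by (intro divide_left_mono) (auto simp: V_def intro!: add_nonneg_nonneg mult_nonneg_nonneg max.coboundedI2 bounds_pos(1)[THEN order_trans[rotated]] simp: le_max_iff_disj)
        finally show ?thesis .
      qed
      have b2: "\<bar>et C p n e\<bar> \<le> o2"
      proof -
        have "T.r s * vmin C \<le> T.r s * T.v s" using T.v_gt[OF s] p by (intro mult_left_mono) auto
        also have "\<dots> \<le> 1" using T.y_le[OF s] by (simp add: T.y_def)
        finally have "T.r s \<le> 1 / vmin C" using B by (simp add: field_simps)
        then have "T.r s / (2 * e * s) \<le> (1 / vmin C) / (2 * e * a)"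
          using B e a False by (intro frac_le) auto
        moreover have "0 \<le> T.r s / (2 * e * s)" using p e s by simp
        ultimately have "\<bar>s * et C p n e\<bar> \<le> 1 / (vmin C * (2 * e * a)) + 1" using R by simp
        then have "\<bar>et C p n e\<bar> \<le> (1 / (vmin C * (2 * e * a)) + 1) / s" using s by (simp add: abs_mult field_simps)
        also have "\<dots> \<le> o2" unfolding o2_def using e a False B by (intro divide_left_mono) auto
        finally show ?thesis .
      qed
      have b3: "\<bar>de C p \<delta> e\<bar> \<le> o3"
      proof -
        have "\<bar>s * de C p \<delta> e\<bar> \<le> Dmax C + d0 C" using D T.d_lt[OF s] p nn by simp
        then have "\<bar>de C p \<delta> e\<bar> \<le> (Dmax C + d0 C) / s" using s by (simp add: abs_mult field_simps)
        also have "\<dots> \<le> o3" unfolding o3_def using a False B nn by (intro divide_left_mono) auto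
        finally show ?thesis .
      qed
      have pp: "p = om C p n e + et C p n e" "n = om C p n e - et C p n e - e * ((9 + d0 C + 2 * C) / 2)"
        by (simp_all add: om_def et_def field_simps)
      have \<delta>: "\<delta> = de C p \<delta> e - d0 C * (p + e * (1 + d0 C))" by (simp add: de_def)
      have c1: "\<bar>p\<bar> \<le> o1 + o2" using pp(1) b1 b2 by linarith
      have c2: "\<bar>n\<bar> \<le> o1 + o2 + \<bar>e * ((9 + d0 C + 2 * C) / 2)\<bar>" using pp(2) b1 b2 by linarith
      have "\<bar>p + e * (1 + d0 C)\<bar> \<le> o1 + o2 + \<bar>e * (1 + d0 C)\<bar>" using c1 by linarith
      then have "d0 C * \<bar>p + e * (1 + d0 C)\<bar> \<le> d0 C * (o1 + o2 + \<bar>e * (1 + d0 C)\<bar>)"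
        using nn by (intro mult_left_mono) auto
      then have "\<bar>d0 C * (p + e * (1 + d0 C))\<bar> \<le> d0 C * (o1 + o2 + \<bar>e * (1 + d0 C)\<bar>)"
        using nn by (simp only: abs_mult abs_of_pos)
      then have c3: "\<bar>\<delta>\<bar> \<le> o3 + d0 C * (o1 + o2 + \<bar>e * (1 + d0 C)\<bar>)" using \<delta> b3 by linarith
      have "norm (p, n, \<delta>, e) \<le> \<bar>p\<bar> + (\<bar>n\<bar> + (\<bar>\<delta>\<bar> + \<bar>e\<bar>))"
        by (auto intro!: norm_Pair_le[THEN order_trans])
      then show ?thesis using c1 c2 c3 M1(1) by (simp add: zs M_def)
    qed
  qed (use S0 in auto)
qed

section \<open>Logarithmic derivatives of the coefficients and the Lyapunov function\<close>

definition lp :: "real \<Rightarrow> real \<Rightarrow> real \<Rightarrow> real \<Rightarrow> real" where "lp C u v r = u + v - 1 - r * u * v"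
definition lq :: "real \<Rightarrow> real \<Rightarrow> real \<Rightarrow> real \<Rightarrow> real" where "lq C u v r = 1 + v - u + (1 - C) * r * v"
definition lw :: "real \<Rightarrow> real \<Rightarrow> real \<Rightarrow> real \<Rightarrow> real" where "lw C u v r = 1 + u - v + C * r * u"
definition lf :: "real \<Rightarrow> real \<Rightarrow> real \<Rightarrow> real \<Rightarrow> real" where "lf C u v r = r * u * v - r * ((1 - C) * v + C * u)"
definition Hf :: "real \<Rightarrow> real \<Rightarrow> real \<Rightarrow> real \<Rightarrow> real" where
  "Hf C u v r = 2 * (1 + u + v) - r * u * v + r * ((1 - C) * v + C * u)"
text \<open>The sum of squared differences over all pairs among seven principal curvatures. Here
  \<open>lp\<close>, \<open>lq\<close>, \<open>lw\<close> have multiplicity two and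
  \<open>lf\<close> one, whence the weights 4 and 2. It equals 7 times the sum of their squares
  minus \<open>Hf\<close> squared, the Cauchy-Schwarz deficit.\<close>

definition Qf :: "real \<Rightarrow> real \<Rightarrow> real \<Rightarrow> real \<Rightarrow> real" where
  "Qf C u v r = 4 * (lp C u v r - lq C u v r)\<^sup>2 + 4 * (lp C u v r - lw C u v r)\<^sup>2 + 4 * (lq C u v r - lw C u v r)\<^sup>2
     + 2 * (lp C u v r - lf C u v r)\<^sup>2 + 2 * (lq C u v r - lf C u v r)\<^sup>2 + 2 * (lw C u v r - lf C u v r)\<^sup>2"

lemma Qf_nonneg: "0 \<le> Qf C u v r"
  by (simp add: Qf_def)

lemma crit_if_Qf_zero:
  assumes p: "0 < u" "0 < v" "0 < r" and Q: "Qf C u v r = 0"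
  shows "crit C u v r"
proof -
  have "(lp C u v r - lq C u v r)\<^sup>2 = 0" "(lp C u v r - lw C u v r)\<^sup>2 = 0" "(lp C u v r - lf C u v r)\<^sup>2 = 0"
    using Q unfolding Qf_def
    by (smt (verit) zero_le_power2)+
  then have eq: "lp C u v r = lq C u v r" "lp C u v r = lw C u v r" "lp C u v r = lf C u v r" by auto
  have "2 * (u - 1) = r * v * (u + 1 - C)" using eq(1) unfolding lp_def lq_def by algebra
  moreover have "2 * (v - 1) = r * u * (v + C)" using eq(2) unfolding lp_def lw_def by algebra
  moreover have "u + v - 3 = 2 * r * ((1 - C) * v + C * u)"
    using eq unfolding lp_def lq_def lw_def lf_def by algebra
  ultimately show ?thesis using p by (simp add: crit_def)
qed

text \<open>\<open>A1\<close>, \<open>A2\<close>, \<open>A3\<close> are the logarithmic derivatives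
  of u, v, r, so the left side is H times the derivative of ln r - 2 ln u - 2 ln v + 7 ln H, up to
  the factor e. This single identity is the Riccati equation in the present variables.\<close>

lemma lyapunov_identity:
  fixes C u v r :: real
  defines "A1 \<equiv> 4 * (1 - u) + 2 * r * v * (u + 1 - C)" and "A2 \<equiv> 4 * (1 - v) + 2 * r * u * (v + C)"
    and "A3 \<equiv> u + v - 3 - 2 * r * ((1 - C) * v + C * u)"
  shows "(A3 - 2 * A1 - 2 * A2) * Hf C u v r + 7 * (2 * (u * A1 + v * A2) - (r * A3 * u * v + r * (u * A1) * v + r * u * (v * A2))
      + (r * A3 * ((1 - C) * v + C * u) + r * ((1 - C) * (v * A2) + C * (u * A1)))) = - Qf C u v r"
  unfolding A1_def A2_def A3_def Hf_def Qf_def lp_def lq_def lw_def lf_def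
  by (simp add: algebra_simps power2_eq_square)

lemma lyapunov_quotient:
  fixes u v :: real
  assumes "u \<noteq> 0" "v \<noteq> 0"
  shows "((r' * h^7 + r * (7 * h^6 * h')) * (u\<^sup>2 * v\<^sup>2) - r * h^7 * (2 * u * (u * a) * v\<^sup>2 + u\<^sup>2 * (2 * v * (v * b))))
      / ((u\<^sup>2 * v\<^sup>2) * (u\<^sup>2 * v\<^sup>2)) = (r' * h^7 + r * h^6 * (7 * h' - 2 * (a + b) * h)) / (u\<^sup>2 * v\<^sup>2)"
proof -
  have "(r' * h^7 + r * (7 * h^6 * h')) * (u\<^sup>2 * v\<^sup>2) - r * h^7 * (2 * u * (u * a) * v\<^sup>2 + u\<^sup>2 * (2 * v * (v * b)))
    = (u\<^sup>2 * v\<^sup>2) * (r' * h^7 + r * h^6 * (7 * h' - 2 * (a + b) * h))"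
    by (simp add: algebra_simps power2_eq_square eval_nat_numeral)
  then show ?thesis using assms by (simp only: nonzero_mult_divide_mult_cancel_left) simp
qed

lemma bounded_deriv_lipschitz:
  fixes f f' :: "real \<Rightarrow> real"
  assumes "\<And>s. a \<le> s \<Longrightarrow> (f has_real_derivative f' s) (at s)" "\<And>s. a \<le> s \<Longrightarrow> \<bar>f' s\<bar> \<le> B" "0 \<le> B"
  shows "B-lipschitz_on {a..} f"
proof (rule lipschitz_onI)
  fix x y assume "x \<in> {a..}" "y \<in> {a..}"
  then show "dist (f x) (f y) \<le> B * dist x y"
    using field_differentiable_bound[of "{a..}" f f' B x y] assms
    by (auto simp: dist_norm intro: has_field_derivative_at_within)
qed (use assms in auto)

section \<open>Long-time behaviour of global orbits\<close>

locale glob =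
  fixes C \<kappa> e :: real and z :: "real \<Rightarrow> state"
  assumes tame: "\<And>S. 0 < S \<Longrightarrow> tame C \<kappa> e S z"
begin

abbreviation "v \<equiv> orbit.v C e z"
abbreviation "u \<equiv> orbit.u C e z"
abbreviation "r \<equiv> orbit.r C e z"
abbreviation "y \<equiv> orbit.y C e z"
abbreviation "d \<equiv> orbit0.d C z"
abbreviation "good \<equiv> orbit.good C e z"

lemma orb: "0 < S \<Longrightarrow> orbit C \<kappa> e S z"
  using tame tame.axioms(1) by blast

lemma C: "C < 1 / 2" and e: "0 < e"
  using orb[of 1] by (auto simp: orbit_def orbit_axioms_def orbit0_def)

lemma
  assumes s: "0 < s"
  shows v_deriv: "(v has_real_derivative e * fv C (u s) (v s) (r s)) (at s)"
    and u_deriv: "(u has_real_derivative e * fu C (u s) (v s) (r s)) (at s)"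
    and r_deriv: "(r has_real_derivative e * fr C (u s) (v s) (r s)) (at s)"
    and y_deriv: "(y has_real_derivative e * (y s * (1 + u s - 3 * v s + 2 * y s * (u s - 1 + C)))) (at s)"
    and pos: "0 < v s" "0 < r s" "0 < u s" "0 < d s"
    and u_eq: "u s = v s + d s" and y_eq: "y s = r s * v s"
    and y_le: "y s \<le> 1" and u_gt_1: "1 < u s" and d_lt: "d s < Dmax C" and v_gt: "vmin C < v s"
    and ruv_le: "r s * u s * v s \<le> u s"
    and Cr_le: "C < 0 \<Longrightarrow> - C * r s \<le> 1"
proof -
  interpret T: tame C \<kappa> e "s + 1" z by (rule tame) (use s in simp)
  have s1: "s < s + 1" by simp
  show "(v has_real_derivative e * fv C (u s) (v s) (r s)) (at s)" "(u has_real_derivative e * fu C (u s) (v s) (r s)) (at s)"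
    "(r has_real_derivative e * fr C (u s) (v s) (r s)) (at s)"
    "(y has_real_derivative e * (y s * (1 + u s - 3 * v s + 2 * y s * (u s - 1 + C)))) (at s)"
    "0 < v s" "0 < r s" "0 < u s" "0 < d s" "u s = v s + d s" "y s = r s * v s" "y s \<le> 1" "1 < u s" "d s < Dmax C" "vmin C < v s"
    "r s * u s * v s \<le> u s" "C < 0 \<Longrightarrow> - C * r s \<le> 1"
    using T.v_deriv[OF s s1] T.u_deriv[OF s s1] T.r_deriv[OF s s1] T.y_deriv[OF s s1] T.pos[OF s s1] T.u_eq[OF s] T.y_def
      T.y_le[OF s s1] T.u_gt_1[OF s s1] T.d_lt[OF s s1] T.v_gt[OF s s1] T.ruv_le[OF s s1] T.Cr_le[OF _ s s1] by blast+
qed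

definition "Vb = max (v 1) (2 * Dmax C + 4) + 1"
definition "Ub = Vb + Dmax C"

lemma bounds:
  assumes s: "1 \<le> s"
  shows "v s \<le> Vb" "u s \<le> Ub" "r s \<le> 1 / vmin C" "vmin C \<le> v s" "1 \<le> u s" "0 \<le> r s"
proof -
  interpret T: tame C \<kappa> e "s + 1" z by (rule tame) (use s in simp)
  have s0: "0 < s" using s by simp
  show v: "v s \<le> Vb" using T.v_lt[of 1 s] s by (simp add: Vb_def)
  then show "u s \<le> Ub" using u_eq[OF s0] d_lt[OF s0] by (simp add: Ub_def)
  show "vmin C \<le> v s" "1 \<le> u s" "0 \<le> r s" using v_gt[OF s0] u_gt_1[OF s0] pos[OF s0] by auto
  have "r s * vmin C \<le> r s * v s" using v_gt[OF s0] pos[OF s0] by (intro mult_left_mono) auto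
  also have "\<dots> \<le> 1" using y_le[OF s0] y_eq[OF s0] by simp
  finally show "r s \<le> 1 / vmin C" using bounds_pos[of C] by (simp add: field_simps)
qed

text \<open>The negative terms are r u v \<le> u and, for C < 0, - C r u \<le> u; together they take
  at most 2 u away from 2 (1 + u + v).\<close>

lemma H_ge: "0 < s \<Longrightarrow> 2 \<le> Hf C (u s) (v s) (r s)"
proof -
  assume s: "0 < s"
  note p = pos[OF s]
  have "- u s \<le> C * r s * u s"
  proof (cases "C < 0")
    case True
    have "- C * r s * u s \<le> 1 * u s" using Cr_le[OF s True] p by (intro mult_right_mono) auto
    then show ?thesis by simp
  next
    case False
    then have "0 \<le> C * r s * u s" using p by simp
    then show ?thesis using p by linarith
  qed
  moreover have "0 \<le> r s * ((1 - C) * v s)" using p C by simp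
  moreover have "r s * ((1 - C) * v s + C * u s) = r s * ((1 - C) * v s) + C * r s * u s" by (simp add: algebra_simps)
  ultimately show "2 \<le> Hf C (u s) (v s) (r s)" using ruv_le[OF s] p unfolding Hf_def by (smt (verit))
qed

text \<open>The exponential of the Lyapunov function. Its limit exists also when r tends to 0, where
  the logarithm would tend to minus infinity.\<close>

definition Lam :: "real \<Rightarrow> real" where "Lam s = r s * Hf C (u s) (v s) (r s)^7 / ((u s)\<^sup>2 * (v s)\<^sup>2)"
definition Gf :: "real \<times> real \<times> real \<Rightarrow> real" where
  "Gf x = (case x of (a, b, c) \<Rightarrow> e * (c * Hf C a b c^6 * Qf C a b c) / (a\<^sup>2 * b\<^sup>2))"
definition box :: "(real \<times> real \<times> real) set" where "box = {1..Ub} \<times> {vmin C..Vb} \<times> {0..1 / vmin C}"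

lemma path_in_box: "1 \<le> s \<Longrightarrow> (u s, v s, r s) \<in> box"
  using bounds by (simp add: box_def)

lemma box_compact: "compact box"
  unfolding box_def by (intro compact_Times compact_Icc)

lemma Lam_deriv:
  assumes s: "0 < s"
  shows "(Lam has_real_derivative - Gf (u s, v s, r s)) (at s)"
proof -
  note p = pos[OF s]
  let ?A1 = "4 * (1 - u s) + 2 * r s * v s * (u s + 1 - C)" and ?A2 = "4 * (1 - v s) + 2 * r s * u s * (v s + C)"
    and ?A3 = "u s + v s - 3 - 2 * r s * ((1 - C) * v s + C * u s)"
  let ?h = "Hf C (u s) (v s) (r s)"
  define A1 A2 A3 where "A1 = e * ?A1" and "A2 = e * ?A2" and "A3 = e * ?A3"
  have u': "(u has_real_derivative u s * A1) (at s)" and v': "(v has_real_derivative v s * A2) (at s)"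
    and r': "(r has_real_derivative r s * A3) (at s)"
    using u_deriv[OF s] v_deriv[OF s] r_deriv[OF s] by (simp_all add: fu_def fv_def fr_def A1_def A2_def A3_def mult.left_commute)
  define h' where "h' = 2 * (u s * A1 + v s * A2) - (r s * A3 * u s * v s + r s * (u s * A1) * v s + r s * u s * (v s * A2))
      + (r s * A3 * ((1 - C) * v s + C * u s) + r s * ((1 - C) * (v s * A2) + C * (u s * A1)))"
  have h: "((\<lambda>s. Hf C (u s) (v s) (r s)) has_real_derivative h') (at s)"
    unfolding Hf_def h'_def by (rule derivative_eq_intros u' v' r' refl)+ (simp add: algebra_simps)
  have D: "(Lam has_real_derivative ((r s * A3 * ?h^7 + r s * (7 * ?h^6 * h')) * ((u s)\<^sup>2 * (v s)\<^sup>2)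
      - r s * ?h^7 * (2 * u s * (u s * A1) * (v s)\<^sup>2 + (u s)\<^sup>2 * (2 * v s * (v s * A2))))
      / (((u s)\<^sup>2 * (v s)\<^sup>2) * ((u s)\<^sup>2 * (v s)\<^sup>2))) (at s)"
  proof -
    have n: "((\<lambda>s. r s * Hf C (u s) (v s) (r s)^7) has_real_derivative r s * A3 * ?h^7 + r s * (7 * ?h^6 * h')) (at s)"
      using DERIV_mult[OF r' DERIV_power[OF h, of 7]] by (simp add: algebra_simps)
    have m: "((\<lambda>s. (u s)\<^sup>2 * (v s)\<^sup>2) has_real_derivative 2 * u s * (u s * A1) * (v s)\<^sup>2 + (u s)\<^sup>2 * (2 * v s * (v s * A2))) (at s)"
      using DERIV_mult[OF DERIV_power[OF u', of 2] DERIV_power[OF v', of 2]] by (simp add: algebra_simps)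
    show ?thesis unfolding Lam_def[abs_def] by (rule DERIV_divide[OF n m]) (use p in auto)
  qed
  have 1: "r s * A3 * ?h^7 + r s * ?h^6 * (7 * h' - 2 * (A1 + A2) * ?h) = r s * ?h^6 * ((A3 - 2 * A1 - 2 * A2) * ?h + 7 * h')"
    by (simp add: algebra_simps eval_nat_numeral)
  have 2: "(A3 - 2 * A1 - 2 * A2) * ?h + 7 * h' = e * (- Qf C (u s) (v s) (r s))"
    unfolding lyapunov_identity[symmetric] h'_def A1_def A2_def A3_def by (simp add: algebra_simps)
  have uv: "u s \<noteq> 0" "v s \<noteq> 0" using p by auto
  show ?thesis
    by (rule DERIV_cong[OF D], unfold lyapunov_quotient[OF uv] 1 2) (simp add: Gf_def mult.commute mult.left_commute)
qed

lemma Gf_continuous: "continuous_on box Gf"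
  unfolding Gf_def Hf_def Qf_def lp_def lq_def lw_def lf_def case_prod_beta
  by (intro continuous_intros) (use bounds_pos[of C] in \<open>auto simp: box_def\<close>)

lemma path_lipschitz: "\<exists>L. L-lipschitz_on {1..} (\<lambda>s. (u s, v s, r s))"
proof -
  have bd: "\<exists>B\<ge>0. \<forall>x\<in>box. \<bar>g x\<bar> \<le> B" if "continuous_on box g" for g :: "real \<times> real \<times> real \<Rightarrow> real"
  proof -
    have "bounded (g ` box)" by (intro compact_imp_bounded compact_continuous_image that box_compact)
    then show ?thesis unfolding bounded_pos by (metis image_eqI less_imp_le real_norm_def)
  qed
  have c: "continuous_on box (\<lambda>x. e * fu C (fst x) (fst (snd x)) (snd (snd x)))"
    "continuous_on box (\<lambda>x. e * fv C (fst x) (fst (snd x)) (snd (snd x)))"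
    "continuous_on box (\<lambda>x. e * fr C (fst x) (fst (snd x)) (snd (snd x)))"
    unfolding fu_def fv_def fr_def by (intro continuous_intros)+
  obtain B1 where B1: "0 \<le> B1" "\<And>x. x \<in> box \<Longrightarrow> \<bar>e * fu C (fst x) (fst (snd x)) (snd (snd x))\<bar> \<le> B1" using bd[OF c(1)] by blast
  obtain B2 where B2: "0 \<le> B2" "\<And>x. x \<in> box \<Longrightarrow> \<bar>e * fv C (fst x) (fst (snd x)) (snd (snd x))\<bar> \<le> B2" using bd[OF c(2)] by blast
  obtain B3 where B3: "0 \<le> B3" "\<And>x. x \<in> box \<Longrightarrow> \<bar>e * fr C (fst x) (fst (snd x)) (snd (snd x))\<bar> \<le> B3" using bd[OF c(3)] by blast
  have l1: "B1-lipschitz_on {1..} u"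
    by (rule bounded_deriv_lipschitz[where f'="\<lambda>s. e * fu C (u s) (v s) (r s)"])
      (use u_deriv B1 path_in_box in force)+
  have l2: "B2-lipschitz_on {1..} v"
    by (rule bounded_deriv_lipschitz[where f'="\<lambda>s. e * fv C (u s) (v s) (r s)"])
      (use v_deriv B2 path_in_box in force)+
  have l3: "B3-lipschitz_on {1..} r"
    by (rule bounded_deriv_lipschitz[where f'="\<lambda>s. e * fr C (u s) (v s) (r s)"])
      (use r_deriv B3 path_in_box in force)+
  show ?thesis using lipschitz_on_Pair[OF l1 lipschitz_on_Pair[OF l2 l3]] by blast
qed

lemma Gf_uniformly_continuous: "uniformly_continuous_on {1..} (\<lambda>s. Gf (u s, v s, r s))"
proof -
  have "uniformly_continuous_on {1..} (\<lambda>s. (u s, v s, r s))"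
    using path_lipschitz lipschitz_on_uniformly_continuous by blast
  moreover have "uniformly_continuous_on ((\<lambda>s. (u s, v s, r s)) ` {1..}) Gf"
  proof -
    have sub: "(\<lambda>s. (u s, v s, r s)) ` {1..} \<subseteq> box" using path_in_box by auto
    show ?thesis
      using compact_uniformly_continuous[OF Gf_continuous box_compact] sub
      unfolding uniformly_continuous_on_def by (meson subsetD)
  qed
  ultimately show ?thesis by (rule uniformly_continuous_on_compose)
qed

text \<open>For r -> 0 the equations of u and v are logistic equations with a perturbation that
  tends to 0, because its other factors are bounded.\<close>

lemma logistic_limits:
  assumes r0: "(r \<longlongrightarrow> 0) at_top"
  shows "(v \<longlongrightarrow> 1) at_top" "(u \<longlongrightarrow> 1) at_top"
proof -
  have small: "((\<lambda>s. e * (2 * r s * g s)) \<longlongrightarrow> 0) at_top" if "\<And>s. 1 \<le> s \<Longrightarrow> \<bar>g s\<bar> \<le> B" for g B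
  proof (rule Lim_null_comparison)
    show "\<forall>\<^sub>F s in at_top. norm (e * (2 * r s * g s)) \<le> r s * (2 * e * B)"
      using eventually_ge_at_top[of 1]
    proof eventually_elim
      case (elim s)
      have "\<bar>e * (2 * r s * g s)\<bar> = 2 * e * (r s * \<bar>g s\<bar>)" using e bounds[OF elim] by (simp add: abs_mult)
      also have "\<dots> \<le> 2 * e * (r s * B)" using that[OF elim] e bounds[OF elim] by (intro mult_left_mono) auto
      finally show ?case by (simp add: algebra_simps)
    qed
    show "((\<lambda>s. r s * (2 * e * B)) \<longlongrightarrow> 0) at_top" using tendsto_mult_left_zero[OF r0] by simp
  qed
  have g1: "\<bar>u s * (v s + C)\<bar> \<le> Ub * (Vb + \<bar>C\<bar>)" if "1 \<le> s" for s
  proof -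
    have "\<bar>v s + C\<bar> \<le> Vb + \<bar>C\<bar>" using bounds[OF that] bounds_pos[of C] by linarith
    then have "\<bar>u s\<bar> * \<bar>v s + C\<bar> \<le> Ub * (Vb + \<bar>C\<bar>)" using bounds[OF that] by (intro mult_mono) auto
    then show ?thesis by (simp add: abs_mult)
  qed
  have g2: "\<bar>v s * (u s + 1 - C)\<bar> \<le> Vb * (Ub + 1 + \<bar>C\<bar>)" if "1 \<le> s" for s
  proof -
    have "\<bar>u s + 1 - C\<bar> \<le> Ub + 1 + \<bar>C\<bar>" using bounds[OF that] by linarith
    then have "\<bar>v s\<bar> * \<bar>u s + 1 - C\<bar> \<le> Vb * (Ub + 1 + \<bar>C\<bar>)" using bounds[OF that] bounds_pos[of C] by (intro mult_mono) auto
    then show ?thesis by (simp add: abs_mult)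
  qed
  show "(v \<longlongrightarrow> 1) at_top"
  proof (rule logistic_tendsto[of 1 v "4 * e" "\<lambda>s. e * (2 * r s * (u s * (v s + C)))" "vmin C"])
    show "(v has_real_derivative v s * (4 * e * (1 - v s) + e * (2 * r s * (u s * (v s + C))))) (at s)" if "1 \<le> s" for s
      using v_deriv[of s] that by (simp add: fv_def algebra_simps)
  qed (use e bounds_pos[of C] bounds small[OF g1] in auto)
  show "(u \<longlongrightarrow> 1) at_top"
  proof (rule logistic_tendsto[of 1 u "4 * e" "\<lambda>s. e * (2 * r s * (v s * (u s + 1 - C)))" 1])
    show "(u has_real_derivative u s * (4 * e * (1 - u s) + e * (2 * r s * (v s * (u s + 1 - C))))) (at s)" if "1 \<le> s" for s
      using u_deriv[of s] that by (simp add: fu_def algebra_simps)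
  qed (use e bounds small[OF g2] in auto)
qed

lemma good_if_r_tendsto_0:
  assumes r0: "(r \<longlongrightarrow> 0) at_top"
  shows "\<exists>s>0. good s"
proof -
  note lim = logistic_limits[OF r0]
  have eta0: "0 < eta C" by (rule eta_bounds)
  have l1: "((\<lambda>s. r s * v s) \<longlongrightarrow> 0 * 1) at_top" "((\<lambda>s. u s - v s - v s / 10) \<longlongrightarrow> 1 - 1 - 1 / 10) at_top"
    by (intro tendsto_intros r0 lim; simp)+
  have "\<forall>\<^sub>F s in at_top. r s * v s < eta C" by (rule order_tendstoD(2)[OF l1(1)]) (use eta0 in simp)
  moreover have "\<forall>\<^sub>F s in at_top. u s - v s - v s / 10 < 0" by (rule order_tendstoD(2)[OF l1(2)]) simp
  moreover have "\<forall>\<^sub>F s in at_top. 9 / 10 < v s" by (rule order_tendstoD(1)[OF lim(1)]) simp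
  moreover have "\<forall>\<^sub>F s in at_top. (1::real) \<le> s" by (rule eventually_ge_at_top)
  ultimately have "\<forall>\<^sub>F s in at_top. 0 < s \<and> good s"
  proof eventually_elim
    case (elim s)
    then have s: "0 < s" by simp
    interpret T: tame C \<kappa> e "s + 1" z by (rule tame) (use s in simp)
    show ?case using elim s u_eq[OF s] y_eq[OF s] by (simp add: T.good_def)
  qed
  then show ?thesis unfolding eventually_at_top_linorder by (meson order_refl)
qed

text \<open>\<open>Lam\<close> decreases to some L \<ge> 0. If L = 0 then r -> 0, hence u, v -> 1
  and the orbit becomes good. If L > 0 then r stays away from 0 and the path lives in a compact set;
  Barbalat's lemma gives Qf -> 0, and on this set \<open>Qf\<close> has at most one zero because the
  critical point is unique.\<close>

lemma dichotomy:
  "(\<exists>s>0. good s) \<or> (\<exists>a b c. crit C a b c \<and> (u \<longlongrightarrow> a) at_top \<and> (v \<longlongrightarrow> b) at_top \<and> (r \<longlongrightarrow> c) at_top)"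
proof (cases "\<exists>s>0. good s")
  case False
  have G0: "0 \<le> Gf (u s, v s, r s)" if "0 < s" for s
    using pos[OF that] e H_ge[OF that] Qf_nonneg by (simp add: Gf_def)
  have L0: "0 \<le> Lam s" if "1 \<le> s" for s
    using pos[of s] H_ge[of s] that by (simp add: Lam_def)
  have dec: "Lam t \<le> Lam s" if "1 \<le> s" "s \<le> t" for s t
    using decrease_bound[of s t Lam "\<lambda>s. - Gf (u s, v s, r s)" 0] that Lam_deriv G0 by auto
  obtain L where L: "(Lam \<longlongrightarrow> L) at_top" "\<And>s. 1 \<le> s \<Longrightarrow> L \<le> Lam s"
    using decreasing_tendsto[of 1 Lam 0] dec L0 by blast
  have UV: "(u s)\<^sup>2 * (v s)\<^sup>2 \<le> Ub\<^sup>2 * Vb\<^sup>2" if "1 \<le> s" for s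
    using bounds[OF that] bounds_pos[of C] by (intro mult_mono power_mono) auto
  have LH: "r s * Hf C (u s) (v s) (r s)^7 = Lam s * ((u s)\<^sup>2 * (v s)\<^sup>2)" if "1 \<le> s" for s
    using pos[of s] that by (simp add: Lam_def)
  have Lnn: "0 \<le> L"
    by (rule tendsto_lowerbound[OF L(1) eventually_mono[OF eventually_ge_at_top[of 1] L0]]) simp_all
  have Lpos: "0 < L"
  proof (rule ccontr)
    assume "\<not> 0 < L"
    then have Lz: "L = 0" using Lnn by simp
    have "(r \<longlongrightarrow> 0) at_top"
    proof (rule Lim_null_comparison)
      show "\<forall>\<^sub>F s in at_top. norm (r s) \<le> Lam s * (Ub\<^sup>2 * Vb\<^sup>2)"
        using eventually_ge_at_top[of 1]
      proof eventually_elim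
        case (elim s)
        have "1 \<le> Hf C (u s) (v s) (r s)^7" using H_ge[of s] elim by (intro one_le_power) auto
        then have "r s * 1 \<le> r s * Hf C (u s) (v s) (r s)^7" using bounds[OF elim] by (intro mult_left_mono) auto
        also have "\<dots> \<le> Lam s * (Ub\<^sup>2 * Vb\<^sup>2)" unfolding LH[OF elim] using UV[OF elim] L0[OF elim] by (intro mult_left_mono)
        finally show ?case using bounds[OF elim] by simp
      qed
      show "((\<lambda>s. Lam s * (Ub\<^sup>2 * Vb\<^sup>2)) \<longlongrightarrow> 0) at_top" using tendsto_mult_left_zero[OF L(1)[unfolded Lz]] by simp
    qed
    then show False using good_if_r_tendsto_0 False by blast
  qed
  have G: "((\<lambda>s. Gf (u s, v s, r s)) \<longlongrightarrow> 0) at_top"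
    by (rule barbalat[OF _ _ L(1) Gf_uniformly_continuous]) (use Lam_deriv G0 in auto)
  have Hc: "continuous_on box (\<lambda>x. Hf C (fst x) (fst (snd x)) (snd (snd x)))"
    unfolding Hf_def by (intro continuous_intros)
  have "bounded ((\<lambda>x. Hf C (fst x) (fst (snd x)) (snd (snd x))) ` box)"
    by (intro compact_imp_bounded compact_continuous_image Hc box_compact)
  then obtain Hm where Hm: "0 < Hm" "\<And>x. x \<in> box \<Longrightarrow> \<bar>Hf C (fst x) (fst (snd x)) (snd (snd x))\<bar> \<le> Hm"
    unfolding bounded_pos by force
  define rm where "rm = L * (vmin C)\<^sup>2 / Hm^7"
  have rm: "0 < rm" using Lpos Hm bounds_pos[of C] by (simp add: rm_def)
  have rge: "rm \<le> r s" if s: "1 \<le> s" for s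
  proof -
    have H: "0 \<le> Hf C (u s) (v s) (r s)" "Hf C (u s) (v s) (r s) \<le> Hm"
      using H_ge[of s] s Hm(2)[OF path_in_box[OF s]] by auto
    have "1 * (vmin C)\<^sup>2 \<le> (u s)\<^sup>2 * (v s)\<^sup>2"
      using bounds[OF s] bounds_pos[of C] by (intro mult_mono power_mono one_le_power) auto
    then have "L * (vmin C)\<^sup>2 \<le> Lam s * ((u s)\<^sup>2 * (v s)\<^sup>2)"
      using L(2)[OF s] Lpos by (intro mult_mono) auto
    also have "\<dots> \<le> r s * Hm^7" unfolding LH[OF s, symmetric] using H bounds[OF s] by (intro mult_left_mono power_mono) auto
    finally show ?thesis using Hm(1) by (simp add: rm_def field_simps)
  qed
  have Q: "((\<lambda>s. Qf C (u s) (v s) (r s)) \<longlongrightarrow> 0) at_top"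
  proof (rule Lim_null_comparison)
    show "\<forall>\<^sub>F s in at_top. norm (Qf C (u s) (v s) (r s)) \<le> Gf (u s, v s, r s) * (Ub\<^sup>2 * Vb\<^sup>2 / (e * rm))"
      using eventually_ge_at_top[of 1]
    proof eventually_elim
      case (elim s)
      let ?Q = "Qf C (u s) (v s) (r s)" and ?G = "Gf (u s, v s, r s)" and ?H = "Hf C (u s) (v s) (r s)"
      have p: "0 < u s" "0 < v s" "0 < r s" using pos[of s] elim by auto
      have "1 \<le> ?H^6" using H_ge[of s] elim by (intro one_le_power) auto
      then have "rm * 1 * ?Q \<le> r s * ?H^6 * ?Q" using rge[OF elim] rm Qf_nonneg p by (intro mult_right_mono mult_mono) auto
      then have "e * (rm * 1 * ?Q) \<le> e * (r s * ?H^6 * ?Q)" using e by (intro mult_left_mono) auto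
      also have "\<dots> = ?G * ((u s)\<^sup>2 * (v s)\<^sup>2)" using p by (simp add: Gf_def)
      also have "\<dots> \<le> ?G * (Ub\<^sup>2 * Vb\<^sup>2)" using UV[OF elim] G0[of s] elim by (intro mult_left_mono) auto
      finally show ?case using e rm Qf_nonneg by (simp add: field_simps)
    qed
    show "((\<lambda>s. Gf (u s, v s, r s) * (Ub\<^sup>2 * Vb\<^sup>2 / (e * rm))) \<longlongrightarrow> 0) at_top" by (rule tendsto_mult_left_zero[OF G])
  qed
  define K where "K = {1..Ub} \<times> {vmin C..Vb} \<times> {rm..1 / vmin C}"
  have K: "compact K" unfolding K_def by (intro compact_Times compact_Icc)
  have path: "(u s, v s, r s) \<in> K" if "1 \<le> s" for s using bounds[OF that] rge[OF that] by (simp add: K_def)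
  have Kc: "crit C (fst x) (fst (snd x)) (snd (snd x))" if "x \<in> K" "Qf C (fst x) (fst (snd x)) (snd (snd x)) = 0" for x
    by (rule crit_if_Qf_zero) (use that rm bounds_pos[of C] in \<open>auto simp: K_def\<close>)
  have Qc: "continuous_on K (\<lambda>x. Qf C (fst x) (fst (snd x)) (snd (snd x)))"
    unfolding Qf_def lp_def lq_def lw_def lf_def by (intro continuous_intros)
  obtain q where q: "q \<in> K" "Qf C (fst q) (fst (snd q)) (snd (snd q)) = 0" "((\<lambda>s. (u s, v s, r s)) \<longlongrightarrow> q) at_top"
  proof (rule compact_unique_zero_tendsto[OF K path Qc])
    fix x x' assume x: "x \<in> K" "x' \<in> K" "Qf C (fst x) (fst (snd x)) (snd (snd x)) = 0" "Qf C (fst x') (fst (snd x')) (snd (snd x')) = 0"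
    show "x = x'" using crit_unique[OF C Kc[OF x(1,3)] Kc[OF x(2,4)]] by (auto simp: prod_eq_iff)
  qed (use Q Qf_nonneg in auto)
  have "(u \<longlongrightarrow> fst q) at_top" "(v \<longlongrightarrow> fst (snd q)) at_top" "(r \<longlongrightarrow> snd (snd q)) at_top"
    using tendsto_fst[OF q(3)] tendsto_fst[OF tendsto_snd[OF q(3)]] tendsto_snd[OF tendsto_snd[OF q(3)]] by simp_all
  then show ?thesis using Kc[OF q(1,2)] by blast
qed blast

lemma good_limits:
  assumes g: "0 < a" "good a"
  shows "(u \<longlongrightarrow> 1) at_top" "(v \<longlongrightarrow> 1) at_top" "(r \<longlongrightarrow> 0) at_top" "(y \<longlongrightarrow> 0) at_top"
    "\<And>s. a \<le> s \<Longrightarrow> e * (y s * (1 + u s - 3 * v s + 2 * y s * (u s - 1 + C))) \<le> - (e / 2) * y s"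
    "\<And>s. a \<le> s \<Longrightarrow> 9 / 10 < v s"
proof -
  have good: "good s" if "a \<le> s" for s
    using orbit.good_invariant[OF orb[of "s + 1"] g(1) that _ g(2)] g that by simp
  show dec: "e * (y s * (1 + u s - 3 * v s + 2 * y s * (u s - 1 + C))) \<le> - (e / 2) * y s"
    and v9: "9 / 10 < v s" if s: "a \<le> s" for s
  proof -
    have s0: "0 < s" using s g by simp
    interpret T: tame C \<kappa> e "s + 1" z by (rule tame) (use s0 in simp)
    show "e * (y s * (1 + u s - 3 * v s + 2 * y s * (u s - 1 + C))) \<le> - (e / 2) * y s" "9 / 10 < v s"
      using T.y_decay[of s] good[OF s] s0 by (auto simp: T.good_def)
  qed
  have y0: "0 < y s" if "0 < s" for s using pos[OF that] y_eq[OF that] by simp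
  show yl: "(y \<longlongrightarrow> 0) at_top"
  proof (rule tendstoI)
    fix \<eta> :: real assume \<eta>: "0 < \<eta>"
    have "\<forall>\<^sub>F s in at_top. y s \<le> \<eta> / 2"
    proof (rule eventually_le_of_deriv[where a=a and c="e / 2 * (\<eta> / 2)"])
      fix s assume s: "a \<le> s" "\<eta> / 2 \<le> y s"
      have "e / 2 * (\<eta> / 2) \<le> e / 2 * y s" using s e by (intro mult_left_mono) auto
      then have q: "- (e / 2) * y s \<le> - (e / 2 * (\<eta> / 2))" by simp
      show "e * (y s * (1 + u s - 3 * v s + 2 * y s * (u s - 1 + C))) \<le> - (e / 2 * (\<eta> / 2))"
        by (rule order_trans[OF dec[OF s(1)] q])
    qed (use y_deriv g e \<eta> in auto)
    with eventually_gt_at_top[of 0] show "\<forall>\<^sub>F s in at_top. dist (y s) 0 < \<eta>"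
      by eventually_elim (use y0 \<eta> in \<open>force simp: dist_real_def\<close>)
  qed
  show rl: "(r \<longlongrightarrow> 0) at_top"
  proof (rule Lim_null_comparison)
    show "\<forall>\<^sub>F s in at_top. norm (r s) \<le> y s * (10 / 9)"
      using eventually_ge_at_top[of a]
    proof eventually_elim
      case (elim s)
      have s0: "0 < s" using elim g by simp
      have "r s * (9 / 10) \<le> r s * v s" using v9[OF elim] pos[OF s0] by (intro mult_left_mono) auto
      then show ?case using y_eq[OF s0] pos[OF s0] by simp
    qed
    show "((\<lambda>s. y s * (10 / 9)) \<longlongrightarrow> 0) at_top" by (rule tendsto_mult_left_zero[OF yl])
  qed
  show "(u \<longlongrightarrow> 1) at_top" "(v \<longlongrightarrow> 1) at_top" using logistic_limits[OF rl] by auto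
qed

text \<open>In the good region the logarithmic derivative of F is at most - k y' in absolute value.
  Hence ln F + k y decreases, ln F - k y increases, and with y -> 0 the function ln F converges to a
  finite limit.\<close>

lemma good_fibre_limit:
  assumes g: "0 < a" "good a"
    and F: "\<And>s. 0 < s \<Longrightarrow> (F has_real_derivative F s * (e * lf C (u s) (v s) (r s))) (at s)" "\<And>s. 0 < s \<Longrightarrow> 0 < F s"
  shows "\<exists>f0>0. (F \<longlongrightarrow> f0) at_top"
proof -
  note gl = good_limits[OF g]
  define b where "b = max a 1"
  have b: "a \<le> b" "1 \<le> b" "0 < b" using g by (auto simp: b_def)
  \<comment> \<open>Here |lf| \<le> k / 2 * y, and \<open>good_limits\<close> gives (e / 2) y \<le>
    - y'; multiplied together, e |lf| \<le> - k y'.\<close>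
  define k where "k = 2 * (Ub + (1 - C) + 2 * \<bar>C\<bar> * Ub)"
  let ?y' = "\<lambda>s. e * (y s * (1 + u s - 3 * v s + 2 * y s * (u s - 1 + C)))"
  have bnd: "\<bar>e * lf C (u s) (v s) (r s)\<bar> \<le> - k * ?y' s" if s: "b \<le> s" for s
  proof -
    have s0: "0 < s" "1 \<le> s" "a \<le> s" using s b by auto
    note p = pos[OF s0(1)] and bb = bounds[OF s0(2)]
    have y0: "0 < y s" using p y_eq[OF s0(1)] by simp
    have "r s * (9 / 10) \<le> r s * v s" using gl(6)[OF s0(3)] p by (intro mult_left_mono) auto
    then have r2: "r s \<le> 2 * y s" using y_eq[OF s0(1)] p by simp
    have "lf C (u s) (v s) (r s) = y s * u s - (1 - C) * y s - C * (r s * u s)"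
      using y_eq[OF s0(1)] by (simp add: lf_def algebra_simps)
    moreover have "y s * u s \<le> y s * Ub" "0 \<le> y s * u s" using bb y0 p by (auto intro: mult_left_mono)
    moreover have "0 \<le> (1 - C) * y s" using C y0 by simp
    moreover have "\<bar>C * (r s * u s)\<bar> \<le> \<bar>C\<bar> * (2 * y s * Ub)"
      unfolding abs_mult using r2 bb p y0 by (intro mult_left_mono mult_mono) auto
    ultimately have "\<bar>lf C (u s) (v s) (r s)\<bar> \<le> y s * Ub + (1 - C) * y s + \<bar>C\<bar> * (2 * y s * Ub)" by linarith
    also have "\<dots> = k / 2 * y s" by (simp add: k_def algebra_simps)
    finally have "e * \<bar>lf C (u s) (v s) (r s)\<bar> \<le> e * (k / 2 * y s)" using e by (intro mult_left_mono) auto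
    also have "\<dots> = k * (e / 2 * y s)" by simp
    also have "\<dots> \<le> k * (- ?y' s)"
    proof (rule mult_left_mono)
      show "0 \<le> k" using C bb by (auto simp: k_def intro!: add_nonneg_nonneg mult_nonneg_nonneg)
    qed (use gl(5)[OF s0(3)] in linarith)
    finally show ?thesis using e by (simp add: abs_mult)
  qed
  have lnF: "((\<lambda>s. ln (F s)) has_real_derivative e * lf C (u s) (v s) (r s)) (at s)" if "0 < s" for s
    using F[OF that] by (auto intro!: derivative_eq_intros)
  define A where "A s = ln (F s) + k * y s" for s
  define B where "B s = ln (F s) - k * y s" for s
  have A': "(A has_real_derivative e * lf C (u s) (v s) (r s) + k * ?y' s) (at s)"
    and B': "(B has_real_derivative e * lf C (u s) (v s) (r s) - k * ?y' s) (at s)" if "0 < s" for s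
    unfolding A_def B_def by (intro DERIV_add DERIV_diff DERIV_cmult lnF y_deriv that)+
  have Adec: "A t \<le> A s" if "b \<le> s" "s \<le> t" for s t
  proof -
    have "A t \<le> A s - 0 * (t - s)"
    proof (rule decrease_bound[OF that(2) A'])
      fix x assume "s < x" "x < t"
      then have "\<bar>e * lf C (u x) (v x) (r x)\<bar> \<le> - k * ?y' x" using bnd[of x] that by simp
      then show "e * lf C (u x) (v x) (r x) + k * ?y' x \<le> - 0" by linarith
    qed (use b that in auto)
    then show ?thesis by simp
  qed
  have Binc: "B b \<le> B s" if "b \<le> s" for s
  proof -
    have "- B s \<le> - B b - 0 * (s - b)"
    proof (rule decrease_bound[OF that DERIV_minus[OF B']])
      fix x assume "b < x" "x < s"
      then have "\<bar>e * lf C (u x) (v x) (r x)\<bar> \<le> - k * ?y' x" using bnd[of x] by simp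
      then show "- (e * lf C (u x) (v x) (r x) - k * ?y' x) \<le> - 0" by linarith
    qed (use b in auto)
    then show ?thesis by simp
  qed
  have k0: "0 \<le> k" using C bounds(5)[OF b(2)] bounds(2)[OF b(2)] by (auto simp: k_def intro!: add_nonneg_nonneg mult_nonneg_nonneg)
  have lb: "B b \<le> A s" if "b \<le> s" for s
  proof -
    have "0 < y s" using pos[of s] y_eq[of s] that b by simp
    then have "B s \<le> A s" using k0 by (simp add: A_def B_def)
    then show ?thesis using Binc[OF that] by simp
  qed
  obtain l where l: "(A \<longlongrightarrow> l) at_top" using decreasing_tendsto[of b A "B b"] Adec lb by blast
  have "((\<lambda>s. A s - k * y s) \<longlongrightarrow> l - k * 0) at_top" by (intro tendsto_intros l gl)
  then have "((\<lambda>s. ln (F s)) \<longlongrightarrow> l) at_top" by (simp add: A_def)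
  then have "((\<lambda>s. exp (ln (F s))) \<longlongrightarrow> exp l) at_top" by (intro tendsto_intros)
  moreover have "\<forall>\<^sub>F s in at_top. exp (ln (F s)) = F s"
    using eventually_gt_at_top[of 0] by eventually_elim (use F(2) in simp)
  ultimately have "(F \<longlongrightarrow> exp l) at_top" by (rule Lim_transform_eventually)
  then show ?thesis by (intro exI[of _ "exp l"]) simp
qed

end

section \<open>The shooting argument\<close>

context kernel
begin

lemma ksol_transfer:
  assumes z1: "ksol F S z0 z1" and eq: "\<And>s. s \<in> {0..S} \<Longrightarrow> z s = z1 s"
  shows "ksol F S z0 z"
proof -
  have "volterra F z s = volterra F z1 s" if "s \<in> {0..S}" for s
    unfolding volterra_def
  proof (rule arg_cong[where f="\<lambda>x. s *\<^sub>R x"], rule integral_cong)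
    fix \<tau> :: real assume "\<tau> \<in> {0..1}"
    then show "K \<tau> (F (s * \<tau>) (z (s * \<tau>))) = K \<tau> (F (s * \<tau>) (z1 (s * \<tau>)))"
      using eq[of "s * \<tau>"] mult_unit_mem[OF that] by simp
  qed
  moreover have "continuous_on {0..S} z \<longleftrightarrow> continuous_on {0..S} z1"
    by (rule continuous_on_cong[OF refl eq])
  ultimately show ?thesis using z1 eq unfolding ksol_def by metis
qed

end

lemma ksol_glue:
  assumes ex: "\<And>S. 0 \<le> S \<Longrightarrow> \<exists>z. K4.ksol (field4 C) S z0 z"
  shows "\<exists>z. \<forall>S. K4.ksol (field4 C) S z0 z"
proof -
  obtain Z where Z: "\<And>S. 0 \<le> S \<Longrightarrow> K4.ksol (field4 C) S z0 (Z S)" using ex by metis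
  define z where "z s = Z s s" for s
  have "K4.ksol (field4 C) S z0 z" for S
  proof (cases "0 \<le> S")
    case True
    show ?thesis
    proof (rule K4.ksol_transfer[OF Z[OF True]])
      fix s assume s: "s \<in> {0..S}"
      show "z s = Z S s" unfolding z_def
        by (rule ivp.ksol_unique[OF Z K4.ksol_mono[OF Z[OF True]]]) (use s in auto)
    qed
  qed (simp add: K4.ksol_def)
  then show ?thesis by blast
qed

section \<open>Open conditions on the shooting parameter\<close>

definition ini :: "real \<Rightarrow> state" where "ini \<theta> = (\<theta> - 1, 0, 0, \<theta>)"

lemma ini_dist: "norm (ini a - ini b) \<le> 2 * \<bar>a - b\<bar>"
proof -
  have "norm (ini a - ini b) = sqrt (2 * (a - b)\<^sup>2)" by (simp add: ini_def norm_state)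
  also have "\<dots> \<le> sqrt (4 * (a - b)\<^sup>2)" by (rule real_sqrt_le_mono) simp
  also have "\<dots> = 2 * \<bar>a - b\<bar>" by (simp add: real_sqrt_mult)
  finally show ?thesis .
qed

text \<open>Continuous dependence transfers a strict inequality at one time to nearby parameters,
  together with the existence of the nearby solution up to the same S.\<close>

lemma open_condition:
  fixes f :: "real \<times> state \<Rightarrow> real"
  assumes f: "continuous_on UNIV f" and z: "K4.ksol (field4 C) S (ini \<theta>0) z" and s: "s \<in> {0..S}"
    and pos: "0 < f (\<theta>0, z s)"
  obtains \<delta> where "0 < \<delta>" "\<And>\<theta>. \<bar>\<theta> - \<theta>0\<bar> < \<delta> \<Longrightarrow> \<exists>z'. K4.ksol (field4 C) S (ini \<theta>) z' \<and> 0 < f (\<theta>, z' s)"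
proof -
  have "open {x. 0 < f x}" by (intro open_Collect_less f continuous_intros)
  then obtain \<rho> where \<rho>: "0 < \<rho>" "\<And>x. dist x (\<theta>0, z s) < \<rho> \<Longrightarrow> 0 < f x"
    using pos unfolding open_dist by (metis mem_Collect_eq)
  obtain \<delta> where \<delta>: "0 < \<delta>" "\<And>z1. norm (ini \<theta>0 - z1) < \<delta> \<Longrightarrow>
      \<exists>z'. K4.ksol (field4 C) S z1 z' \<and> (\<forall>s\<in>{0..S}. norm (z s - z' s) < \<rho> / 2)"
    using ivp.ksol_continuous[OF z, of "\<rho> / 2"] \<rho>(1) by auto
  show ?thesis
  proof (rule that[of "min (\<delta> / 2) (\<rho> / 2)"])
    fix \<theta> assume t: "\<bar>\<theta> - \<theta>0\<bar> < min (\<delta> / 2) (\<rho> / 2)"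
    then have "2 * \<bar>\<theta>0 - \<theta>\<bar> < \<delta>" by (simp add: abs_minus_commute)
    then have "norm (ini \<theta>0 - ini \<theta>) < \<delta>" using ini_dist[of \<theta>0 \<theta>] by linarith
    then obtain z' where z': "K4.ksol (field4 C) S (ini \<theta>) z'" "\<And>s. s \<in> {0..S} \<Longrightarrow> norm (z s - z' s) < \<rho> / 2"
      using \<delta>(2) by blast
    have "dist (\<theta>, z' s) (\<theta>0, z s) \<le> dist \<theta> \<theta>0 + dist (z' s) (z s)"
      unfolding dist_Pair_Pair by (rule sqrt_sum_squares_le_sum) auto
    also have "\<dots> < \<rho> / 2 + \<rho> / 2" using z'(2)[OF s] t by (intro add_strict_mono) (auto simp: dist_norm norm_minus_commute)
    finally have "dist (\<theta>, z' s) (\<theta>0, z s) < \<rho>" by simp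
    then show "\<exists>z'. K4.ksol (field4 C) S (ini \<theta>) z' \<and> 0 < f (\<theta>, z' s)" using z'(1) \<rho>(2) by blast
  qed (use \<delta>(1) \<rho>(1) in auto)
qed

definition good_fun :: "real \<Rightarrow> real \<Rightarrow> real \<times> state \<Rightarrow> real" where
  "good_fun C s x = min (eta C - Rf C s (snd x) * wf C s (snd x))
     (min (wf C s (snd x) / 10 - 2 * fst x * s * df C s (snd x)) (wf C s (snd x) - 9 / 5 * fst x * s))"
definition bad1_fun :: "real \<Rightarrow> real \<Rightarrow> real \<times> state \<Rightarrow> real" where
  "bad1_fun C s x = min (Rf C s (snd x) * wf C s (snd x) - 1) (df C s (snd x) - d0 C)"
definition bad2_fun :: "real \<Rightarrow> real \<Rightarrow> real \<times> state \<Rightarrow> real" where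
  "bad2_fun C s x = min (- C * (2 * fst x * s * Rf C s (snd x)) - 1)
     (3 * (- C) * (wf C s (snd x) + 2 * fst x * s * df C s (snd x) - 2 * fst x * s) - (2 - C) * wf C s (snd x))"

lemma cond_continuous: "continuous_on UNIV (good_fun C s)" "continuous_on UNIV (bad1_fun C s)" "continuous_on UNIV (bad2_fun C s)"
  unfolding good_fun_def bad1_fun_def bad2_fun_def by (intro continuous_intros coords_continuous; simp)+

context orbit
begin

lemma good_iff:
  assumes s: "0 < s" "s < S"
  shows "good s \<longleftrightarrow> 0 < good_fun C s (e, z s)"
proof -
  have "d s < v s / 10 \<longleftrightarrow> 0 < w s / 10 - 2 * e * s * d s" "9 / 10 < v s \<longleftrightarrow> 0 < w s - 9 / 5 * e * s"
    using s e by (auto simp: v_def field_simps)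
  then show ?thesis unfolding good_def good_fun_def y_eq[OF s(1)] w_def R_def d_def by simp
qed

lemma bad_iff:
  assumes s: "0 < s" "s < S"
  shows "bad s \<longleftrightarrow> 0 < bad1_fun C s (e, z s) \<or> C < 0 \<and> 0 < bad2_fun C s (e, z s)"
proof -
  have E: "2 - C < 3 * (- C) * E s \<longleftrightarrow> 0 < 3 * (- C) * (w s + 2 * e * s * d s - 2 * e * s) - (2 - C) * w s"
  proof -
    have k: "0 < 2 * e * s" using s e by simp
    have "u s = 1 + E s * v s" using pos[OF s] by (simp add: E_def)
    then have 1: "w s + 2 * e * s * d s - 2 * e * s = 2 * e * s * (E s * v s)"
      by (simp add: wRd_eq[OF s(1)] algebra_simps)
    have 2: "3 * (- C) * (w s + 2 * e * s * d s - 2 * e * s) - (2 - C) * w s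
        = (2 * e * s) * (v s * (3 * (- C) * E s - (2 - C)))"
      unfolding 1 by (simp add: wRd_eq(1)[OF s(1)] algebra_simps)
    have iff: "0 < a * b \<longleftrightarrow> 0 < b" if "0 < a" for a b :: real using that by (simp add: zero_less_mult_iff)
    show ?thesis unfolding 2 iff[OF k] iff[OF pos(1)[OF s]] by auto
  qed
  show ?thesis unfolding bad_def E bad1_fun_def bad2_fun_def y_eq[OF s(1)] r_def w_def R_def d_def by auto
qed

text \<open>Near 0 one has y = 1 + s (\<kappa> + o(1)), while d - d0 starts with slope d0 (\<kappa>
  + e (1 + d0)) > 0. Both inequalities of the first bad region hold for all small s > 0.\<close>

lemma bad_if_\<kappa>_pos:
  assumes \<kappa>: "0 < \<kappa>"
  shows "\<exists>s>0. s < S \<and> bad s"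
proof -
  obtain p n \<delta> where z: "\<And>s. s \<in> {0..S} \<Longrightarrow> z s = (p s, n s, \<delta> s, e)"
    and i: "p 0 = \<kappa>" "n 0 = 0" "\<delta> 0 = 0"
    and c: "continuous_on {0..S} p" "continuous_on {0..S} n" "continuous_on {0..S} \<delta>"
    using components by metis
  let ?F = "\<lambda>s. min (p s + s * (om C (p s) (n s) e * et C (p s) (n s) e)) (de C (p s) (\<delta> s) e)"
  obtain b where b: "0 < b" "b < S" "\<And>s. 0 < s \<Longrightarrow> s \<le> b \<Longrightarrow> 0 < ?F s"
  proof (rule pos_near_0[of S ?F])
    show "continuous_on {0..S} ?F" unfolding om_def et_def de_def by (intro continuous_intros c) auto
    show "0 < ?F 0" using \<kappa> d0_pos e by (simp add: i de_def add_pos_pos)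
  qed (use S in auto)
  have zb: "z b = (p b, n b, \<delta> b, e)" using z b by auto
  have F: "0 < p b + b * (om C (p b) (n b) e * et C (p b) (n b) e)" "0 < de C (p b) (\<delta> b) e" using b(3)[of b] b(1) by auto
  have "y b = (1 + b * et C (p b) (n b) e) * (1 + b * om C (p b) (n b) e)"
    using b by (simp add: y_eq R_def Rf_def w_def wf_def zb)
  also have "\<dots> = 1 + b * (p b + b * (om C (p b) (n b) e * et C (p b) (n b) e))" by (simp add: om_def et_def field_simps)
  finally have "1 < y b" using F(1) b(1) by simp
  moreover have "d0 C < d b" using F(2) b(1) by (simp add: d_def df_def zb)
  ultimately show ?thesis using b by (auto simp: bad_def)
qed

end

text \<open>A solution is required only up to some time beyond s. The predicates are therefore open
  in \<theta> and can be used before global existence is known, which itself rests on the absence of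
  bad times.\<close>

definition GOOD :: "real \<Rightarrow> real \<Rightarrow> bool" where
  "GOOD C \<theta> \<longleftrightarrow> (\<exists>S z s. 0 < s \<and> s < S \<and> K4.ksol (field4 C) S (ini \<theta>) z \<and> 0 < good_fun C s (\<theta>, z s))"
definition BAD :: "real \<Rightarrow> real \<Rightarrow> bool" where
  "BAD C \<theta> \<longleftrightarrow> (\<exists>S z s. 0 < s \<and> s < S \<and> K4.ksol (field4 C) S (ini \<theta>) z \<and>
     (0 < bad1_fun C s (\<theta>, z s) \<or> C < 0 \<and> 0 < bad2_fun C s (\<theta>, z s)))"

lemma orbitI:
  assumes "C < 1 / 2" "0 < \<theta>" "0 < S" "K4.ksol (field4 C) S (ini \<theta>) z"
  shows "orbit C (\<theta> - 1) \<theta> S z"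
  by unfold_locales (use assms in \<open>auto simp: ini_def\<close>)

lemma GOOD_open:
  assumes "GOOD C \<theta>0"
  obtains \<delta> where "0 < \<delta>" "\<And>\<theta>. \<bar>\<theta> - \<theta>0\<bar> < \<delta> \<Longrightarrow> GOOD C \<theta>"
proof -
  obtain S z s where s: "0 < s" "s < S" and z: "K4.ksol (field4 C) S (ini \<theta>0) z" and g: "0 < good_fun C s (\<theta>0, z s)"
    using assms unfolding GOOD_def by blast
  obtain \<delta> where "0 < \<delta>" "\<And>\<theta>. \<bar>\<theta> - \<theta>0\<bar> < \<delta> \<Longrightarrow> \<exists>z'. K4.ksol (field4 C) S (ini \<theta>) z' \<and> 0 < good_fun C s (\<theta>, z' s)"
    by (rule open_condition[OF cond_continuous(1) z _ g]) (use s in auto)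
  then show ?thesis using that s unfolding GOOD_def by meson
qed

lemma BAD_open:
  assumes "BAD C \<theta>0"
  obtains \<delta> where "0 < \<delta>" "\<And>\<theta>. \<bar>\<theta> - \<theta>0\<bar> < \<delta> \<Longrightarrow> BAD C \<theta>"
proof -
  obtain S z s where s: "0 < s" "s < S" and z: "K4.ksol (field4 C) S (ini \<theta>0) z"
    and g: "0 < bad1_fun C s (\<theta>0, z s) \<or> C < 0 \<and> 0 < bad2_fun C s (\<theta>0, z s)"
    using assms unfolding BAD_def by blast
  from g show ?thesis
  proof
    assume g: "0 < bad1_fun C s (\<theta>0, z s)"
    obtain \<delta> where "0 < \<delta>" "\<And>\<theta>. \<bar>\<theta> - \<theta>0\<bar> < \<delta> \<Longrightarrow> \<exists>z'. K4.ksol (field4 C) S (ini \<theta>) z' \<and> 0 < bad1_fun C s (\<theta>, z' s)"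
      by (rule open_condition[OF cond_continuous(2) z _ g]) (use s in auto)
    then show ?thesis using that s unfolding BAD_def by meson
  next
    assume g: "C < 0 \<and> 0 < bad2_fun C s (\<theta>0, z s)"
    obtain \<delta> where "0 < \<delta>" "\<And>\<theta>. \<bar>\<theta> - \<theta>0\<bar> < \<delta> \<Longrightarrow> \<exists>z'. K4.ksol (field4 C) S (ini \<theta>) z' \<and> 0 < bad2_fun C s (\<theta>, z' s)"
      by (rule open_condition[OF cond_continuous(3) z _ conjunct2[OF g]]) (use s in auto)
    then show ?thesis using that s g unfolding BAD_def by meson
  qed
qed

text \<open>The two witnesses agree as long as both exist. Whichever condition occurs first
  persists, by invariance, to the time of the other, where \<open>good_not_bad\<close> excludes
  it.\<close>

lemma GOOD_BAD_disjoint: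
  assumes C: "C < 1 / 2" and \<theta>: "0 < \<theta>" and g: "GOOD C \<theta>" and b: "BAD C \<theta>"
  shows False
proof -
  obtain S z s where s: "0 < s" "s < S" and z: "K4.ksol (field4 C) S (ini \<theta>) z" and g: "0 < good_fun C s (\<theta>, z s)"
    using g unfolding GOOD_def by blast
  obtain S' z' s' where s': "0 < s'" "s' < S'" and z': "K4.ksol (field4 C) S' (ini \<theta>) z'"
    and b: "0 < bad1_fun C s' (\<theta>, z' s') \<or> C < 0 \<and> 0 < bad2_fun C s' (\<theta>, z' s')"
    using b unfolding BAD_def by blast
  interpret O: orbit C "\<theta> - 1" \<theta> S z by (rule orbitI) (use C \<theta> s z in auto)
  interpret O': orbit C "\<theta> - 1" \<theta> S' z' by (rule orbitI) (use C \<theta> s' z' in auto)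
  have same: "z x = z' x" if "0 \<le> x" "x \<le> S" "x \<le> S'" for x
    by (rule ivp.ksol_unique[OF K4.ksol_mono[OF z, of "min S S'"] K4.ksol_mono[OF z', of "min S S'"]]) (use that in auto)
  show False
  proof (cases "s \<le> s'")
    case True
    have "O'.good s" using g same[of s] s s' True O'.good_iff[of s] by simp
    then have "O'.good s'" using O'.good_invariant s s' True by blast
    then show False using O'.good_not_bad[OF s'] O'.bad_iff[OF s'] b by blast
  next
    case False
    have "O.bad s'" using b same[of s'] s s' False O.bad_iff[of s'] by simp
    then have "O.bad s" using O.bad_invariant[of s' s] s s' False by simp
    then show False using O.good_not_bad[OF s] O.good_iff[OF s] g by blast
  qed
qed

lemma BAD_if_gt_1:
  assumes C: "C < 1 / 2" and \<theta>: "1 < \<theta>"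
  shows "BAD C \<theta>"
proof -
  obtain S z where S: "0 < S" and z: "K4.ksol (field4 C) S (ini \<theta>) z" using ivp.ksol_local by blast
  interpret O: orbit C "\<theta> - 1" \<theta> S z by (rule orbitI) (use C \<theta> S z in auto)
  show ?thesis using O.bad_if_\<kappa>_pos O.bad_iff \<theta> z unfolding BAD_def by (metis diff_gt_0_iff_gt)
qed

section \<open>The degenerate case \<theta> = 0\<close>

locale orbit_degenerate = orbit0 C "-1" 0 S z for C S z
begin

definition "y s = R s * w s"

lemma w'_: "0 < s \<Longrightarrow> s < S \<Longrightarrow> (w has_real_derivative w s * ((1 - 2 * w s + y s * w s) / s)) (at s)"
  using w_deriv[of s] by (simp add: y_def algebra_simps)
lemma R'_: "0 < s \<Longrightarrow> s < S \<Longrightarrow> (R has_real_derivative R s * ((w s - 1) / s)) (at s)"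
  using R_deriv[of s] by simp
lemma d'_: "0 < s \<Longrightarrow> s < S \<Longrightarrow> (d has_real_derivative w s * (d s * (y s - 4) + 3 * d0 C * y s) / s) (at s)"
  using d_deriv[of s] by (simp add: y_def algebra_simps)
lemma y'_: "0 < s \<Longrightarrow> s < S \<Longrightarrow> (y has_real_derivative - (y s * w s * (1 - y s) / s)) (at s)"
  unfolding y_def[abs_def]
  by (rule DERIV_cong[OF DERIV_mult[OF R'_[of s] w'_[of s]]]) (auto simp: y_def field_simps)

text \<open>For e = 0 the pair (w, y) satisfies a closed system, and 1 - y keeps its sign since its
  equation is linear in 1 - y. The quotient s / w has derivative 2 - y, between 1 and 2, and the
  mean value theorem gives 1/2 \<le> w \<le> 1.\<close>

lemma bounds:
  assumes s: "0 < s" "s < S"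
  shows "0 < y s" "y s < 1" "1 / 2 \<le> w s" "w s \<le> 1" "0 < R s" "R s \<le> 2" "-1 < d s" "d s < d0 C + 1"
proof -
  obtain p n \<delta> where zz: "\<And>s. s \<in> {0..S} \<Longrightarrow> z s = (p s, n s, \<delta> s, 0)" and i: "p 0 = - 1" "n 0 = 0"
    and c: "continuous_on {0..S} p" "continuous_on {0..S} n"
    using components by metis
  let ?F = "\<lambda>s. min (w s) (min (R s) (- (p s + s * (om C (p s) (n s) 0 * et C (p s) (n s) 0))))"
  obtain b where b: "0 < b" "b < S" "\<And>s. 0 < s \<Longrightarrow> s \<le> b \<Longrightarrow> 0 < ?F s"
  proof (rule pos_near_0[of S ?F])
    show "continuous_on {0..S} ?F" unfolding om_def et_def by (intro continuous_intros c wRd_cont) auto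
  qed (use S in \<open>auto simp: wRd_0 i\<close>)
  have wR: "0 < w s \<and> 0 < R s \<and> y s < 1" if s: "0 < s" "s < S" for s
  proof -
    define a where "a = min b s"
    have a: "0 < a" "a \<le> b" "a \<le> s" using b s by (auto simp: a_def)
    have "y a = (1 + a * et C (p a) (n a) 0) * (1 + a * om C (p a) (n a) 0)"
      using zz[of a] a b by (simp add: y_def R_def Rf_def w_def wf_def)
    also have "\<dots> = 1 - a * - (p a + a * (om C (p a) (n a) 0 * et C (p a) (n a) 0))" by (simp add: om_def et_def field_simps)
    also have "\<dots> < 1" using b(3)[of a] a by (auto simp: mult_less_0_iff)
    finally have ya: "0 < 1 - y a" by simp
    have wa: "0 < w a" "0 < R a" using b(3)[of a] a by auto
    have cont: "continuous_on {a..s} w" "continuous_on {a..s} R"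
      using a s by (auto intro: continuous_on_subset[OF wRd_cont(1)] continuous_on_subset[OF wRd_cont(2)])
    have "0 < w s"
      by (rule linear_ode_pos[OF wa(1) w'_]) (use a s in \<open>auto intro!: continuous_intros cont simp: y_def\<close>)
    moreover have "0 < R s"
      by (rule linear_ode_pos[OF wa(2) R'_]) (use a s in \<open>auto intro!: continuous_intros cont\<close>)
    moreover have "0 < 1 - y s"
    proof (rule linear_ode_pos[where x="\<lambda>s. 1 - y s" and s=s and a=a and b=s and g="\<lambda>s. y s * w s / s"])
      fix t assume t: "a \<le> t" "t \<le> s"
      show "((\<lambda>s. 1 - y s) has_real_derivative (1 - y t) * (y t * w t / t)) (at t)"
        using DERIV_diff[OF DERIV_const[of 1] y'_[of t]] t a s by (simp add: algebra_simps)
    qed (use ya a s in \<open>auto intro!: continuous_intros cont simp: y_def\<close>)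
    ultimately show ?thesis by simp
  qed
  then show y0: "0 < y s" and y1: "y s < 1" and R0: "0 < R s" using s by (auto simp: y_def)
  have w0: "0 < w x" if "x \<in> {0..s}" for x using wR[of x] that s wRd_0 by (cases "x = 0") auto
  have cw: "continuous_on {0..s} w" by (rule continuous_on_subset[OF wRd_cont(1)]) (use s in auto)
  then have cg: "continuous_on {0..s} (\<lambda>x. x / w x)" using w0 by (intro continuous_intros) (auto simp: less_imp_neq[symmetric])
  have der: "((\<lambda>x. x / w x) has_real_derivative 2 - y x) (at x)" if x: "0 < x" "x < S" for x
  proof -
    have w0: "0 < w x" using wR[OF x] by simp
    have "((\<lambda>x. x / w x) has_real_derivative (1 * w x - x * (w x * ((1 - 2 * w x + y x * w x) / x))) / (w x * w x)) (at x)"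
      by (rule DERIV_divide[OF DERIV_ident w'_[OF x]]) (use w0 in simp)
    moreover have "(1 * w x - x * (w x * ((1 - 2 * w x + y x * w x) / x))) / (w x * w x) = 2 - y x"
      using w0 x by (simp add: field_simps)
    ultimately show ?thesis by simp
  qed
  have "\<exists>l x. 0 < x \<and> x < s \<and> ((\<lambda>x. x / w x) has_real_derivative l) (at x) \<and> s / w s - 0 / w 0 = (s - 0) * l"
  proof (rule MVT[OF s(1) cg])
    fix x assume "0 < x" "x < s"
    then show "(\<lambda>x. x / w x) differentiable at x" using der[of x] s unfolding real_differentiable_def by auto
  qed
  then obtain l x where x: "0 < x" "x < s" "((\<lambda>x. x / w x) has_real_derivative l) (at x)" "s / w s - 0 / w 0 = (s - 0) * l"
    by blast
  have "l = 2 - y x" using DERIV_unique[OF x(3) der] x s by auto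
  then have "s / w s = s * (2 - y x)" using x by simp
  moreover have "1 < 2 - y x" "2 - y x < 2" using wR[of x] x s by (auto simp: y_def)
  ultimately have "s * 1 \<le> s / w s" "s / w s \<le> s * 2" using s by auto
  then show wl: "1 / 2 \<le> w s" "w s \<le> 1" using wR[OF s] s by (auto simp: field_simps)
  have "R s * (1 / 2) \<le> R s * w s" using wl R0 by (intro mult_left_mono) auto
  then show "R s \<le> 2" using y1 by (simp add: y_def)
  have "0 < 1 + d s"
  proof (rule barrier_from_0[where F="\<lambda>s. 1 + d s", OF _ _ _ _ _ s])
    fix x assume x: "0 < x" "x < S"
    show "((\<lambda>s. 1 + d s) has_real_derivative w x * (d x * (y x - 4) + 3 * d0 C * y x) / x) (at x)"
      using DERIV_add[OF DERIV_const[of 1] d'_[OF x]] by simp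
    assume "1 + d x = 0"
    then have d: "d x = - 1" by simp
    have "0 < y x" "y x < 1" using wR[OF x] by (auto simp: y_def)
    then have "0 < d x * (y x - 4) + 3 * d0 C * y x" unfolding d using d0_pos by (intro add_pos_pos) auto
    then show "0 < w x * (d x * (y x - 4) + 3 * d0 C * y x) / x" using wR[OF x] x by simp
  qed (use d0_pos in \<open>auto intro!: continuous_intros wRd_cont simp: wRd_0\<close>)
  then show "-1 < d s" by simp
  have "0 < d0 C + 1 - d s"
  proof (rule barrier_from_0[where F="\<lambda>s. d0 C + 1 - d s", OF _ _ _ _ _ s])
    fix x assume x: "0 < x" "x < S"
    show "((\<lambda>s. d0 C + 1 - d s) has_real_derivative - (w x * (d x * (y x - 4) + 3 * d0 C * y x) / x)) (at x)"
      using DERIV_diff[OF DERIV_const[of "d0 C + 1"] d'_[OF x]] by simp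
    assume "d0 C + 1 - d x = 0"
    then have d: "d x = d0 C + 1" by simp
    have yx: "0 < y x" "y x < 1" using wR[OF x] by (auto simp: y_def)
    have "(d0 C + 1) * (y x - 4) \<le> (d0 C + 1) * (- 3)" using yx d0_pos by (intro mult_left_mono) auto
    moreover have "3 * d0 C * y x \<le> 3 * d0 C * 1" using yx d0_pos by (intro mult_left_mono) auto
    ultimately have "(d0 C + 1) * (y x - 4) + 3 * d0 C * y x \<le> (d0 C + 1) * (- 3) + 3 * d0 C * 1" by (rule add_mono)
    also have "\<dots> < 0" by simp
    finally have "d x * (y x - 4) + 3 * d0 C * y x < 0" unfolding d .
    then show "0 < - (w x * (d x * (y x - 4) + 3 * d0 C * y x) / x)" using wR[OF x] x by (simp add: divide_neg_pos mult_pos_neg)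
  qed (use d0_pos in \<open>auto intro!: continuous_intros wRd_cont simp: wRd_0\<close>)
  then show "d s < d0 C + 1" by simp
qed

end

lemma degenerate_global:
  assumes C: "C < 1 / 2" and S0: "0 \<le> S0"
  shows "\<exists>z. K4.ksol (field4 C) S0 (-1, 0, 0, 0) z"
proof -
  obtain S1 z1 where S1: "0 < S1" and z1: "K4.ksol (field4 C) S1 (-1, 0, 0, 0) z1"
    using ivp.ksol_local by blast
  obtain M1 where M1: "0 < M1" "\<And>s. s \<in> {0..S1} \<Longrightarrow> norm (z1 s) \<le> M1" using ivp.ksol_bounded[OF z1] by blast
  have d00: "0 < d0 C" using C by (simp add: d0_def)
  define q where "q = (d0 C + 3) / S1"
  define q' where "q' = (2 * d0 C + 3) / S1"
  define M where "M = M1 + (2 * q + 2 * q + (q' + d0 C * (2 * q)))"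
  have nn: "0 \<le> q" "0 \<le> q'" using S1 d00 by (auto simp: q_def q'_def)
  have M1M: "M1 \<le> M" using nn d00 by (auto simp: M_def intro!: add_nonneg_nonneg mult_nonneg_nonneg)
  show ?thesis
  proof (rule ivp.ksol_extends[of _ M])
    have "z1 0 = (-1, 0, 0, 0)" by (rule K4.ksol_init[OF z1]) (use S1 in simp)
    then show "norm (-1::real, 0::real, 0::real, 0::real) \<le> M" using M1(2)[of 0] S1 M1M by auto
    fix S z s assume S: "0 < S" "S \<le> S0" and z: "K4.ksol (field4 C) S (-1, 0, 0, 0) z" and s: "0 < s" "s < S"
    interpret T: orbit_degenerate C S z by unfold_locales (use C S z in auto)
    show "norm (z s) \<le> M"
    proof (cases "s \<le> S1")
      case True
      have "z s = z1 s"
        by (rule ivp.ksol_unique[OF K4.ksol_mono[OF z, of "min S S1"] K4.ksol_mono[OF z1, of "min S S1"]]) (use True s in auto)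
      then show ?thesis using M1(2)[of s] True s M1M by auto
    next
      case False
      note b = T.bounds[OF s]
      obtain p n \<delta> where zs: "z s = (p, n, \<delta>, 0)" using T.components s by (metis atLeastAtMost_iff less_imp_le)
      have W: "1 + s * om C p n 0 = T.w s" by (simp add: T.w_def wf_def zs)
      have R: "1 + s * et C p n 0 = T.R s" by (simp add: T.R_def Rf_def zs)
      have D: "d0 C + s * de C p \<delta> 0 = T.d s" by (simp add: T.d_def df_def zs)
      have div: "\<bar>x\<bar> \<le> c / S1" if "\<bar>s * x\<bar> \<le> c" "0 \<le> c" for x c
      proof -
        have "\<bar>x\<bar> \<le> c / s" using that s by (simp add: abs_mult field_simps)
        also have "\<dots> \<le> c / S1" using that False S1 by (intro divide_left_mono) auto
        finally show ?thesis .
      qed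
      have b1: "\<bar>om C p n 0\<bar> \<le> q" unfolding q_def by (rule div) (use W b d00 in auto)
      have b2: "\<bar>et C p n 0\<bar> \<le> q" unfolding q_def by (rule div) (use R b d00 in auto)
      have b3: "\<bar>de C p \<delta> 0\<bar> \<le> q'" unfolding q'_def by (rule div) (use D b d00 in auto)
      have pp: "p = om C p n 0 + et C p n 0" "n = om C p n 0 - et C p n 0" "\<delta> = de C p \<delta> 0 - d0 C * p"
        by (simp_all add: om_def et_def de_def field_simps)
      have c1: "\<bar>p\<bar> \<le> 2 * q" using pp(1) b1 b2 by linarith
      have c2: "\<bar>n\<bar> \<le> 2 * q" using pp(2) b1 b2 by linarith
      have "\<bar>d0 C * p\<bar> \<le> d0 C * (2 * q)" unfolding abs_mult using c1 d00 by (intro mult_mono) auto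
      then have c3: "\<bar>\<delta>\<bar> \<le> q' + d0 C * (2 * q)" using pp(3) b3 by linarith
      have "norm (p, n, \<delta>, 0::real) \<le> \<bar>p\<bar> + (\<bar>n\<bar> + \<bar>\<delta>\<bar>)"
        by (auto intro!: norm_Pair_le[THEN order_trans])
      then show ?thesis using c1 c2 c3 M1(1) by (simp add: zs M_def)
    qed
  qed (use S0 in auto)
qed

text \<open>At e = 0 two of the three conditions in \<open>good_fun\<close> reduce to w > 0, so only
  y < eta has to be reached. As long as y \<ge> eta, its derivative is at most - c / s, whose
  integral diverges.\<close>

lemma GOOD_0:
  assumes C: "C < 1 / 2"
  shows "GOOD C 0"
proof -
  obtain z where z: "\<And>S. K4.ksol (field4 C) S (-1, 0, 0, 0) z" using ksol_glue[OF degenerate_global[OF C]] by blast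
  have T: "orbit_degenerate C S z" if "0 < S" for S by unfold_locales (use C z that in auto)
  define y where "y = orbit_degenerate.y C z"
  define w where "w = orbit0.w C z"
  have y': "(y has_real_derivative - (y s * w s * (1 - y s) / s)) (at s)" if "0 < s" for s
    using orbit_degenerate.y'_[OF T[of "s + 1"], of s] that by (simp add: y_def w_def)
  have b: "0 < y s" "y s < 1" "1 / 2 \<le> w s" if "0 < s" for s
    using orbit_degenerate.bounds[OF T[of "s + 1"], of s] that by (simp_all add: y_def w_def)
  have eta0: "0 < eta C" by (rule eta_bounds)
  define c where "c = eta C * (1 - y 1) / 2"
  have c: "0 < c" using eta0 b(2)[of 1] by (simp add: c_def)
  have mono: "y s \<le> y 1" if "1 \<le> s" for s
  proof -
    have "y s \<le> y 1 - 0 * (s - 1)"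
    proof (rule decrease_bound[OF that y'])
      fix x :: real assume "1 < x" "x < s"
      then have "0 < y x" "y x < 1" "1 / 2 \<le> w x" using b[of x] by auto
      then have "0 \<le> y x * w x * (1 - y x) / x" using \<open>1 < x\<close> by (intro divide_nonneg_pos mult_nonneg_nonneg) auto
      then show "- (y x * w x * (1 - y x) / x) \<le> - 0" by simp
    qed auto
    then show ?thesis by simp
  qed
  have "\<exists>s\<ge>1. y s < eta C"
  proof (rule ccontr)
    assume "\<not> ?thesis"
    then have no: "eta C \<le> y s" if "1 \<le> s" for s using that by force
    \<comment> \<open>Then c ln L = 1, so y would fall by at least 1 between times 1 and L, although
      it stays in (0, 1).\<close>
    define L where "L = exp (1 / c)"
    have L: "1 \<le> L" using c by (simp add: L_def)
    have "y L + c * ln L \<le> y 1 + c * ln 1 - 0 * (L - 1)"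
    proof (rule decrease_bound[OF L, where f="\<lambda>s. y s + c * ln s" and f'="\<lambda>s. - (y s * w s * (1 - y s) / s) + c * (1 / s)"])
      fix s assume s: "1 \<le> s" "s \<le> L"
      show "((\<lambda>s. y s + c * ln s) has_real_derivative - (y s * w s * (1 - y s) / s) + c * (1 / s)) (at s)"
        by (intro DERIV_add y' DERIV_cmult) (use s in \<open>auto intro!: derivative_eq_intros\<close>)
    next
      fix s assume s: "1 < s" "s < L"
      have bs: "0 < y s" "y s < 1" "1 / 2 \<le> w s" using b[of s] s by auto
      have "eta C * (1 / 2) * (1 - y 1) \<le> y s * w s * (1 - y s)"
        using no[of s] mono[of s] s bs eta0 b[of 1] by (intro mult_mono) auto
      then have "c \<le> y s * w s * (1 - y s)" by (simp add: c_def)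
      then have "c / s \<le> y s * w s * (1 - y s) / s" using s by (intro divide_right_mono) auto
      then show "- (y s * w s * (1 - y s) / s) + c * (1 / s) \<le> - 0" by simp
    qed
    then have "y L + 1 \<le> y 1" using c by (simp add: L_def)
    then show False using b(1)[of L] b(2)[of 1] L by simp
  qed
  then obtain s where s: "1 \<le> s" "y s < eta C" by blast
  interpret O: orbit_degenerate C "s + 1" z by (rule T) (use s in simp)
  have "0 < good_fun C s (0, z s)"
    using s b(3)[of s] unfolding good_fun_def y_def O.y_def w_def O.w_def O.R_def by simp
  then show ?thesis unfolding GOOD_def ini_def using s z[of "s + 1"] by (intro exI[of _ "s + 1"] exI[of _ z] exI[of _ s]) auto
qed

theorem shooting:
  assumes C: "C < 1 / 2"
  obtains \<theta>m Z where "0 < \<theta>m" "\<And>\<theta>. \<theta> \<in> {0<..\<theta>m} \<Longrightarrow> glob C (\<theta> - 1) \<theta> (Z \<theta>)"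
    "\<And>\<theta>. \<theta> \<in> {0<..<\<theta>m} \<Longrightarrow> \<exists>s>0. orbit.good C \<theta> (Z \<theta>) s" "\<not> (\<exists>s>0. orbit.good C \<theta>m (Z \<theta>m) s)"
    "continuous_on ({0<..\<theta>m} \<times> {0..}) (\<lambda>(\<theta>, s). Z \<theta> s)"
proof -
  define T where "T = {\<theta>. 0 < \<theta> \<and> \<not> GOOD C \<theta>}"
  obtain \<delta> where \<delta>: "0 < \<delta>" "\<And>\<theta>. \<bar>\<theta> - 0\<bar> < \<delta> \<Longrightarrow> GOOD C \<theta>" using GOOD_open[OF GOOD_0[OF C]] by blast
  have T1: "\<theta> \<in> T" if "1 < \<theta>" for \<theta>
    using GOOD_BAD_disjoint[OF C _ _ BAD_if_gt_1[OF C that]] that by (auto simp: T_def)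
  have ne: "T \<noteq> {}" using T1[of 2] by auto
  have lb: "\<delta> \<le> x" if "x \<in> T" for x using \<delta>(2)[of x] that by (force simp: T_def)
  then have bdd: "bdd_below T" by (rule bdd_belowI)
  define m where "m = Inf T"
  have m0: "0 < m" using cInf_greatest[OF ne lb] \<delta>(1) by (simp add: m_def)
  \<comment> \<open>This keeps \<kappa> = m - 1 nonpositive, as \<open>tame\<close> demands; it
    rests on every parameter above 1 being bad.\<close>
  have m1: "m \<le> 1"
  proof (rule dense_ge)
    fix x :: real assume "1 < x"
    then show "m \<le> x" unfolding m_def using T1 bdd by (intro cInf_lower)
  qed
  have below: "GOOD C \<theta>" if "0 < \<theta>" "\<theta> < m" for \<theta>
    using cInf_lower[of \<theta> T] bdd that by (force simp: T_def m_def)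
  have notgood: "\<not> GOOD C m"
  proof
    assume "GOOD C m"
    then obtain \<epsilon> where \<epsilon>: "0 < \<epsilon>" "\<And>\<theta>. \<bar>\<theta> - m\<bar> < \<epsilon> \<Longrightarrow> GOOD C \<theta>" using GOOD_open by blast
    have "m + \<epsilon> \<le> x" if "x \<in> T" for x
    proof (rule ccontr)
      assume "\<not> m + \<epsilon> \<le> x"
      moreover have "m \<le> x" unfolding m_def by (rule cInf_lower[OF that bdd])
      ultimately have "GOOD C x" using \<epsilon> by auto
      then show False using that by (simp add: T_def)
    qed
    then have "m + \<epsilon> \<le> m" unfolding m_def by (intro cInf_greatest[OF ne]) auto
    then show False using \<epsilon> by simp
  qed
  have notbad: "\<not> BAD C \<theta>" if \<theta>: "\<theta> \<in> {0<..m}" for \<theta>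
  proof (cases "\<theta> < m")
    case True
    then show ?thesis using GOOD_BAD_disjoint[OF C] below[of \<theta>] \<theta> by auto
  next
    case False
    then have \<theta>m: "\<theta> = m" using \<theta> by simp
    show ?thesis
    proof
      assume "BAD C \<theta>"
      then obtain \<epsilon> where \<epsilon>: "0 < \<epsilon>" "\<And>\<theta>. \<bar>\<theta> - m\<bar> < \<epsilon> \<Longrightarrow> BAD C \<theta>" using BAD_open \<theta>m by blast
      \<comment> \<open>A parameter slightly below m, close enough to be bad by openness, yet good
        because it is smaller than m.\<close>
      define x where "x = max (m / 2) (m - \<epsilon> / 2)"
      have x: "0 < x" "x < m" "\<bar>x - m\<bar> < \<epsilon>" using m0 \<epsilon>(1) by (auto simp: x_def)
      show False by (rule GOOD_BAD_disjoint[OF C x(1) below[OF x(1,2)] \<epsilon>(2)[OF x(3)]])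
    qed
  qed
  have nb: "\<not> orbit.bad C \<theta> z s" if \<theta>: "\<theta> \<in> {0<..m}" and "K4.ksol (field4 C) S (ini \<theta>) z" "0 < s" "s < S" for \<theta> S z s
  proof -
    interpret O: orbit C "\<theta> - 1" \<theta> S z by (rule orbitI) (use C that in auto)
    show ?thesis using notbad[OF \<theta>] O.bad_iff[OF that(3,4)] that unfolding BAD_def by blast
  qed
  have "\<exists>z. \<forall>S. K4.ksol (field4 C) S (ini \<theta>) z" if \<theta>: "\<theta> \<in> {0<..m}" for \<theta>
  proof (rule ksol_glue)
    fix S :: real assume "0 \<le> S"
    then show "\<exists>z. K4.ksol (field4 C) S (ini \<theta>) z"
      unfolding ini_def by (intro tame_extends[OF C]) (use \<theta> m1 nb[OF \<theta>] in \<open>auto simp: ini_def\<close>)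
  qed
  then obtain Z where Z: "\<And>\<theta> S. \<theta> \<in> {0<..m} \<Longrightarrow> K4.ksol (field4 C) S (ini \<theta>) (Z \<theta>)" by metis
  show ?thesis
  proof (rule that[OF m0])
    fix \<theta> assume \<theta>: "\<theta> \<in> {0<..m}"
    show "glob C (\<theta> - 1) \<theta> (Z \<theta>)"
      by unfold_locales (use C \<theta> m1 Z[OF \<theta>] nb[OF \<theta> Z[OF \<theta>]] in \<open>auto simp: ini_def\<close>)
  next
    fix \<theta> assume \<theta>: "\<theta> \<in> {0<..<m}"
    then obtain S z s where s: "0 < s" "s < S" and z: "K4.ksol (field4 C) S (ini \<theta>) z" and g: "0 < good_fun C s (\<theta>, z s)"
      using below unfolding GOOD_def by force
    have ZZ: "K4.ksol (field4 C) S (ini \<theta>) (Z \<theta>)" using Z[of \<theta> S] \<theta> by simp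
    have eq: "Z \<theta> s = z s" by (rule ivp.ksol_unique[OF ZZ z]) (use s in auto)
    interpret O: orbit C "\<theta> - 1" \<theta> S "Z \<theta>" by (rule orbitI[OF C _ _ ZZ]) (use \<theta> s in auto)
    show "\<exists>s>0. orbit.good C \<theta> (Z \<theta>) s" using eq O.good_iff[OF s] g s by auto
  next
    show "\<not> (\<exists>s>0. orbit.good C m (Z m) s)"
    proof
      assume "\<exists>s>0. orbit.good C m (Z m) s"
      then obtain s where s: "0 < s" "orbit.good C m (Z m) s" by blast
      have ZZ: "K4.ksol (field4 C) (s + 1) (ini m) (Z m)" using Z[of m "s + 1"] m0 by simp
      interpret O: orbit C "m - 1" m "s + 1" "Z m" by (rule orbitI[OF C _ _ ZZ]) (use m0 s in auto)
      show False using notgood O.good_iff[of s] s ZZ unfolding GOOD_def by force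
    qed
  next
    show "continuous_on ({0<..m} \<times> {0..}) (\<lambda>(\<theta>, s). Z \<theta> s)"
      unfolding continuous_on_iff
    proof (intro ballI allI impI)
      fix x :: "real \<times> real" and \<epsilon> :: real assume x: "x \<in> {0<..m} \<times> {0..}" and \<epsilon>: "0 < \<epsilon>"
      obtain \<theta>0 s0 where x0: "x = (\<theta>0, s0)" by (cases x)
      have \<theta>0: "\<theta>0 \<in> {0<..m}" and s0: "0 \<le> s0" using x x0 by auto
      define S where "S = s0 + 1"
      note z = Z[OF \<theta>0, of S]
      have "continuous_on {0..S} (Z \<theta>0)" using z unfolding K4.ksol_def by blast
      then obtain \<delta>1 where \<delta>1: "0 < \<delta>1" "\<And>s. s \<in> {0..S} \<Longrightarrow> dist s s0 < \<delta>1 \<Longrightarrow> dist (Z \<theta>0 s) (Z \<theta>0 s0) < \<epsilon> / 2"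
        unfolding continuous_on_iff using s0 \<epsilon> by (metis S_def atLeastAtMost_iff half_gt_zero le_add_same_cancel1 zero_le_one)
      obtain \<delta>2 where \<delta>2: "0 < \<delta>2" "\<And>z1. norm (ini \<theta>0 - z1) < \<delta>2 \<Longrightarrow>
          \<exists>z'. K4.ksol (field4 C) S z1 z' \<and> (\<forall>s\<in>{0..S}. norm (Z \<theta>0 s - z' s) < \<epsilon> / 2)"
        using ivp.ksol_continuous[OF z, of "\<epsilon> / 2"] \<epsilon> by auto
      define \<delta> where "\<delta> = min (min \<delta>1 (\<delta>2 / 2)) 1"
      have \<delta>: "0 < \<delta>" using \<delta>1 \<delta>2 by (simp add: \<delta>_def)
      have "dist (Z \<theta> s) (Z \<theta>0 s0) < \<epsilon>" if t: "\<theta> \<in> {0<..m}" "0 \<le> s" "dist (\<theta>, s) (\<theta>0, s0) < \<delta>" for \<theta> s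
      proof -
        have d: "dist \<theta> \<theta>0 < \<delta>" "dist s s0 < \<delta>"
          using t(3) dist_fst_le[of "(\<theta>, s)" "(\<theta>0, s0)"] dist_snd_le[of "(\<theta>, s)" "(\<theta>0, s0)"] by auto
        have sS: "s \<in> {0..S}" using d t by (auto simp: \<delta>_def S_def dist_real_def)
        have "2 * \<bar>\<theta>0 - \<theta>\<bar> < \<delta>2" using d(1) by (simp add: \<delta>_def dist_real_def abs_minus_commute)
        then have "norm (ini \<theta>0 - ini \<theta>) < \<delta>2" using ini_dist[of \<theta>0 \<theta>] by linarith
        then obtain z' where z': "K4.ksol (field4 C) S (ini \<theta>) z'" "\<And>s. s \<in> {0..S} \<Longrightarrow> norm (Z \<theta>0 s - z' s) < \<epsilon> / 2"
          using \<delta>2(2) by blast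
        \<comment> \<open>\<open>Z\<close> was selected separately for each parameter; uniqueness
          identifies it with the nearby solution, and this makes the selection continuous.\<close>
        have "z' s = Z \<theta> s" by (rule ivp.ksol_unique[OF z'(1) Z[OF t(1)] sS])
        then have "dist (Z \<theta> s) (Z \<theta>0 s) < \<epsilon> / 2" using z'(2)[OF sS] by (simp add: dist_norm norm_minus_commute)
        moreover have "dist (Z \<theta>0 s) (Z \<theta>0 s0) < \<epsilon> / 2" using \<delta>1(2)[OF sS] d by (auto simp: \<delta>_def)
        ultimately show ?thesis using dist_triangle_half_l by (metis dist_commute)
      qed
      then show "\<exists>d>0. \<forall>x'\<in>{0<..m} \<times> {0..}. dist x' x < d \<longrightarrow>
          dist (case x' of (\<theta>, s) \<Rightarrow> Z \<theta> s) (case x of (\<theta>, s) \<Rightarrow> Z \<theta> s) < \<epsilon>"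
        using \<delta> by (intro exI[of _ \<delta>]) (auto simp: x0)
    qed
  qed
qed

section \<open>From orbits to metrics\<close>

text \<open>The Spin(7) equations with the planes in abstract order, collapsing plane first.
  Rescaling the fibre normalises its coefficient to A = 1; the weights satisfy A = B + C, which
  leaves B = 1 - C.\<close>

definition grhs :: "real \<Rightarrow> real \<Rightarrow> real \<Rightarrow> real \<times> real \<times> real \<times> real \<Rightarrow> real \<times> real \<times> real \<times> real" where
  "grhs A B C h = (case h of (p, q, w, f) \<Rightarrow>
     (p * (q/(p*w) + w/(p*q) - p/(q*w) - A * (f / p\<^sup>2)),
      q * (w/(p*q) + p/(q*w) - q/(p*w) + B * (f / q\<^sup>2)),
      w * (p/(q*w) + q/(p*w) - w/(p*q) + C * (f / w\<^sup>2)),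
      f * (A * (f / p\<^sup>2) - B * (f / q\<^sup>2) - C * (f / w\<^sup>2))))"

text \<open>The inverse of the passage to u, v, r, with the third coefficient w = k as the remaining
  scale: p = k / sqrt v, q = p sqrt u and f = r q w / p.\<close>

definition coeffs :: "real \<Rightarrow> real \<Rightarrow> real \<Rightarrow> real \<Rightarrow> real \<times> real \<times> real \<times> real" where
  "coeffs k u v r = (k / sqrt v, k * sqrt u / sqrt v, k, r * sqrt u * k)"

lemma grhs_coeffs:
  assumes "0 < u" "0 < v" "0 < k"
  shows "grhs 1 (1 - C) C (coeffs k u v r) =
    (k / sqrt v * (lp C u v r / (k * sqrt u)), k * sqrt u / sqrt v * (lq C u v r / (k * sqrt u)),
     k * (lw C u v r / (k * sqrt u)), r * sqrt u * k * (lf C u v r / (k * sqrt u)))"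
proof -
  define a b where "a = sqrt u" and "b = sqrt v"
  define j where "j = 1 / (k * a)"
  have ab: "0 < a" "0 < b" using assms by (auto simp: a_def b_def)
  have uv: "u = a\<^sup>2" "v = b\<^sup>2" using assms by (auto simp: a_def b_def)
  have co: "coeffs k u v r = (k / b, k * a / b, k, r * a * k)" by (simp add: coeffs_def a_def b_def)
  have 1: "(k * a / b) / ((k / b) * k) = a\<^sup>2 * j" "k / ((k / b) * (k * a / b)) = b\<^sup>2 * j"
    "(k / b) / ((k * a / b) * k) = j" "(r * a * k) / (k / b)\<^sup>2 = r * a\<^sup>2 * b\<^sup>2 * j"
    "(r * a * k) / (k * a / b)\<^sup>2 = r * b\<^sup>2 * j" "(r * a * k) / k\<^sup>2 = r * a\<^sup>2 * j"
    using ab assms(3) by (auto simp: j_def field_simps power2_eq_square)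
  have jj: "x / (k * a) = x * j" for x by (simp add: j_def)
  show ?thesis
    unfolding co a_def[symmetric] b_def[symmetric]
    unfolding grhs_def case_prod_conv 1 jj lp_def lq_def lw_def lf_def
    unfolding uv by (simp add: algebra_simps)
qed

text \<open>Written over the fixed interval [0, 1], a primitive is a parameter integral, so joint
  continuity in parameter and time holds down to time 0.\<close>

lemma primitive_continuous:
  fixes g :: "real \<Rightarrow> real \<Rightarrow> real"
  assumes g: "continuous_on (\<Theta> \<times> {0..}) (\<lambda>x. g (fst x) (snd x))"
  shows "continuous_on (\<Theta> \<times> {0..}) (\<lambda>x. snd x * integral {0..1} (\<lambda>\<tau>. g (fst x) (snd x * \<tau>)))"
proof -
  have "continuous_on ((\<Theta> \<times> {0..}) \<times> cbox 0 1) (\<lambda>(x, \<tau>). g (fst x) (snd x * \<tau>))"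
    unfolding case_prod_beta
    by (rule continuous_on_compose2[OF g, of _ "\<lambda>y. (fst (fst y), snd (fst y) * snd y)", simplified])
      (auto intro!: continuous_intros)
  from integral_continuous_on_param[OF this]
  show ?thesis by (auto intro!: continuous_intros)
qed

lemma primitive_deriv:
  fixes g :: "real \<Rightarrow> real"
  assumes g: "continuous_on {0..} g" and s: "0 < s"
  shows "((\<lambda>s. s * integral {0..1} (\<lambda>\<tau>. g (s * \<tau>))) has_real_derivative g s) (at s)"
  using regular_component_deriv[of "s + 1" g "\<lambda>s. s * integral {0..1} (\<lambda>\<tau>. g (s * \<tau>))" 0 0 s]
    continuous_on_subset[OF g, of "{0..s+1}"] s by auto

text \<open>By strict monotonicity the inverse is bracketed by comparing T at the two points y +
  \<epsilon> / 2 and y - \<epsilon> / 2 with t; continuity of T in the parameter at these two points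
  suffices. If the lower point is negative, the lower bound holds trivially.\<close>

lemma inverse_jointly_continuous:
  fixes T :: "real \<Rightarrow> real \<Rightarrow> real"
  assumes T: "continuous_on (\<Theta> \<times> {0..}) (\<lambda>x. T (fst x) (snd x))"
    and mono: "\<And>\<theta> x y. \<theta> \<in> \<Theta> \<Longrightarrow> 0 \<le> x \<Longrightarrow> x < y \<Longrightarrow> T \<theta> x < T \<theta> y"
    and I: "\<And>\<theta> t. \<theta> \<in> \<Theta> \<Longrightarrow> 0 \<le> t \<Longrightarrow> 0 \<le> I \<theta> t \<and> T \<theta> (I \<theta> t) = t"
  shows "continuous_on (\<Theta> \<times> {0..}) (\<lambda>x. I (fst x) (snd x))"
  unfolding continuous_on_iff
proof (intro ballI allI impI)
  fix x :: "real \<times> real" and \<epsilon> :: real assume x: "x \<in> \<Theta> \<times> {0..}" and \<epsilon>: "0 < \<epsilon>"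
  obtain \<theta>0 t0 where x0: "x = (\<theta>0, t0)" by (cases x)
  have \<theta>0: "\<theta>0 \<in> \<Theta>" and t0: "0 \<le> t0" using x x0 by auto
  define y where "y = I \<theta>0 t0"
  have y: "0 \<le> y" "T \<theta>0 y = t0" using I[OF \<theta>0 t0] by (auto simp: y_def)
  have cont: "\<exists>\<delta>>0. \<forall>\<theta>\<in>\<Theta>. dist \<theta> \<theta>0 < \<delta> \<longrightarrow> \<bar>T \<theta> b - T \<theta>0 b\<bar> < \<eta>" if b: "0 \<le> b" "0 < \<eta>" for b \<eta>
  proof -
    obtain \<delta> where \<delta>: "0 < \<delta>" "\<And>x'. x' \<in> \<Theta> \<times> {0..} \<Longrightarrow> dist x' (\<theta>0, b) < \<delta> \<Longrightarrow> dist (T (fst x') (snd x')) (T \<theta>0 b) < \<eta>"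
      using T[unfolded continuous_on_iff, rule_format, of "(\<theta>0, b)" \<eta>] b \<theta>0 by auto
    show ?thesis using \<delta>(1) \<delta>(2)[of "(\<theta>, b)" for \<theta>] b by (intro exI[of _ \<delta>]) (auto simp: dist_Pair_Pair dist_real_def)
  qed
  have less_iff: "x < z" if "\<theta> \<in> \<Theta>" "0 \<le> x" "0 \<le> z" "T \<theta> x < T \<theta> z" for \<theta> x z
    using mono[of \<theta> z x] that by (metis less_asym linorder_neqE_linordered_idom)
  define b where "b = y + \<epsilon> / 2"
  define \<eta>1 where "\<eta>1 = (T \<theta>0 b - t0) / 2"
  have b: "0 \<le> b" "0 < \<eta>1" using mono[OF \<theta>0 y(1), of b] y \<epsilon> by (auto simp: b_def \<eta>1_def)
  obtain \<delta>1 where \<delta>1: "0 < \<delta>1" "\<And>\<theta>. \<theta> \<in> \<Theta> \<Longrightarrow> dist \<theta> \<theta>0 < \<delta>1 \<Longrightarrow> \<bar>T \<theta> b - T \<theta>0 b\<bar> < \<eta>1" using cont[OF b] by blast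
  have up: "I \<theta> t < b" if "\<theta> \<in> \<Theta>" "0 \<le> t" "dist \<theta> \<theta>0 < \<delta>1" "\<bar>t - t0\<bar> < \<eta>1" for \<theta> t
  proof (rule less_iff[OF that(1)])
    have e1: "T \<theta>0 b = t0 + 2 * \<eta>1" by (simp add: \<eta>1_def field_simps)
    show "T \<theta> (I \<theta> t) < T \<theta> b" using I[OF that(1,2)] \<delta>1(2)[OF that(1,3)] that(4) e1 by linarith
  qed (use I[OF that(1,2)] b in auto)
  have "\<exists>\<delta>2>0. \<exists>\<eta>2>0. \<forall>\<theta>\<in>\<Theta>. \<forall>t\<ge>0. dist \<theta> \<theta>0 < \<delta>2 \<longrightarrow> \<bar>t - t0\<bar> < \<eta>2 \<longrightarrow> y - \<epsilon> < I \<theta> t"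
  proof (cases "0 \<le> y - \<epsilon> / 2")
    case False
    then have "y - \<epsilon> < I \<theta> t" if "\<theta> \<in> \<Theta>" "0 \<le> t" for \<theta> t using I[OF that] \<epsilon> by auto
    then show ?thesis by (intro exI[of _ 1] conjI) auto
  next
    case True
    define a where "a = y - \<epsilon> / 2"
    define \<eta>2 where "\<eta>2 = (t0 - T \<theta>0 a) / 2"
    have a: "0 \<le> a" "0 < \<eta>2" using mono[OF \<theta>0, of a y] y \<epsilon> True by (auto simp: a_def \<eta>2_def)
    obtain \<delta>2 where \<delta>2: "0 < \<delta>2" "\<And>\<theta>. \<theta> \<in> \<Theta> \<Longrightarrow> dist \<theta> \<theta>0 < \<delta>2 \<Longrightarrow> \<bar>T \<theta> a - T \<theta>0 a\<bar> < \<eta>2" using cont[OF a] by blast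
    have "a < I \<theta> t" if "\<theta> \<in> \<Theta>" "0 \<le> t" "dist \<theta> \<theta>0 < \<delta>2" "\<bar>t - t0\<bar> < \<eta>2" for \<theta> t
    proof (rule less_iff[OF that(1)])
      have e1: "T \<theta>0 a = t0 - 2 * \<eta>2" by (simp add: \<eta>2_def field_simps)
      show "T \<theta> a < T \<theta> (I \<theta> t)" using I[OF that(1,2)] \<delta>2(2)[OF that(1,3)] that(4) e1 by linarith
    qed (use I[OF that(1,2)] a in auto)
    then have "\<forall>\<theta>\<in>\<Theta>. \<forall>t\<ge>0. dist \<theta> \<theta>0 < \<delta>2 \<longrightarrow> \<bar>t - t0\<bar> < \<eta>2 \<longrightarrow> y - \<epsilon> < I \<theta> t" using \<epsilon> by (force simp: a_def)
    then show ?thesis using \<delta>2(1) a(2) by blast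
  qed
  then obtain \<delta>2 \<eta>2 where low: "0 < \<delta>2" "0 < \<eta>2"
    "\<And>\<theta> t. \<theta> \<in> \<Theta> \<Longrightarrow> 0 \<le> t \<Longrightarrow> dist \<theta> \<theta>0 < \<delta>2 \<Longrightarrow> \<bar>t - t0\<bar> < \<eta>2 \<Longrightarrow> y - \<epsilon> < I \<theta> t" by blast
  define \<delta> where "\<delta> = min (min \<delta>1 \<delta>2) (min \<eta>1 \<eta>2)"
  have "dist (I \<theta> t) y < \<epsilon>" if t: "\<theta> \<in> \<Theta>" "0 \<le> t" "dist (\<theta>, t) (\<theta>0, t0) < \<delta>" for \<theta> t
  proof -
    have d: "dist \<theta> \<theta>0 < \<delta>" "\<bar>t - t0\<bar> < \<delta>"
      using t(3) dist_fst_le[of "(\<theta>, t)" "(\<theta>0, t0)"] dist_snd_le[of "(\<theta>, t)" "(\<theta>0, t0)"] by (auto simp: dist_real_def)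
    show ?thesis using up[OF t(1,2)] low(3)[OF t(1,2)] d \<epsilon> by (auto simp: \<delta>_def b_def dist_real_def)
  qed
  then show "\<exists>d>0. \<forall>x'\<in>\<Theta> \<times> {0..}. dist x' x < d \<longrightarrow> dist (I (fst x') (snd x')) (I (fst x) (snd x)) < \<epsilon>"
    using \<delta>1(1) low(1,2) b(2) by (intro exI[of _ \<delta>]) (auto simp: x0 y_def \<delta>_def)
qed

lemma filterlim_at_top_of_deriv:
  fixes f f' :: "real \<Rightarrow> real"
  assumes der: "\<And>s. a \<le> s \<Longrightarrow> (f has_real_derivative f' s) (at s)" and k: "0 < k" and ev: "\<forall>\<^sub>F s in at_top. k \<le> f' s"
  shows "filterlim f at_top at_top"
proof -
  obtain b where b: "\<And>s. b \<le> s \<Longrightarrow> k \<le> f' s" using ev by (auto simp: eventually_at_top_linorder)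
  define c where "c = max a b"
  have le: "f c + k * (s - c) \<le> f s" if "c \<le> s" for s
  proof -
    have "- f s \<le> - f c - k * (s - c)"
      by (rule decrease_bound[OF that DERIV_minus[OF der]]) (use b in \<open>auto simp: c_def\<close>)
    then show ?thesis by simp
  qed
  have lin: "filterlim (\<lambda>s. (f c - k * c) + k * s) at_top at_top"
    by (intro filterlim_tendsto_add_at_top[OF tendsto_const] filterlim_tendsto_pos_mult_at_top[OF tendsto_const k] filterlim_ident)
  show ?thesis
    by (rule filterlim_at_top_mono[OF lin eventually_mono[OF eventually_ge_at_top[of c]]])
      (use le in \<open>auto simp: algebra_simps\<close>)
qed

section \<open>Reconstruction of the metric from an orbit\<close>

locale family =
  fixes C m :: real and Z :: "real \<Rightarrow> real \<Rightarrow> state"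
  assumes m: "0 < m" and glob: "\<And>\<theta>. \<theta> \<in> {0<..m} \<Longrightarrow> glob C (\<theta> - 1) \<theta> (Z \<theta>)"
    and Z_cont: "continuous_on ({0<..m} \<times> {0..}) (\<lambda>(\<theta>, s). Z \<theta> s)"
begin

abbreviation "\<Theta> \<equiv> {0<..m}"

definition "W \<theta> s = wf C s (Z \<theta> s)"
definition "R \<theta> s = Rf C s (Z \<theta> s)"
definition "D \<theta> s = df C s (Z \<theta> s)"
definition "U \<theta> s = W \<theta> s + 2 * \<theta> * s * D \<theta> s"
text \<open>The logarithmic s-derivative of the third coefficient, free of poles at s = 0. One
  integration yields this coefficient, and the other three follow algebraically.\<close>

definition "gL \<theta> s = \<theta> * (1 + D \<theta> s + C * R \<theta> s * U \<theta> s)"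
definition "L \<theta> s = s * integral {0..1} (\<lambda>\<tau>. gL \<theta> (s * \<tau>))"
definition "c \<theta> s = exp (L \<theta> s)"
text \<open>Near the singular orbit the arc length t behaves like sqrt (2 \<theta> s), so it is
  treated as a function of x = sqrt s. This is dt/dx, in a form that is regular and positive at x =
  0.\<close>

definition "gT \<theta> x = sqrt (2 * \<theta>) * c \<theta> (x\<^sup>2) * sqrt (U \<theta> (x\<^sup>2))"
definition "T \<theta> x = x * integral {0..1} (\<lambda>\<tau>. gT \<theta> (x * \<tau>))"
definition "Tinv \<theta> t = (SOME x. 0 \<le> x \<and> T \<theta> x = t)"
text \<open>\<open>traj\<close> and \<open>vel\<close> are the metric coefficients and their
  t-derivatives as functions of x, written in W, U, R, D. These are regular at x = 0, where u and v
  are infinite, and so yield the initial condition on the singular orbit.\<close>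

definition "traj \<theta> x = (c \<theta> (x\<^sup>2) * x * sqrt (2 * \<theta> / W \<theta> (x\<^sup>2)), c \<theta> (x\<^sup>2) * sqrt (U \<theta> (x\<^sup>2) / W \<theta> (x\<^sup>2)), c \<theta> (x\<^sup>2),
  c \<theta> (x\<^sup>2) * R \<theta> (x\<^sup>2) * x * sqrt (2 * \<theta>) * sqrt (U \<theta> (x\<^sup>2)))"
definition "vel \<theta> x = ((U \<theta> (x\<^sup>2) + W \<theta> (x\<^sup>2) - 2 * \<theta> * x\<^sup>2 - R \<theta> (x\<^sup>2) * W \<theta> (x\<^sup>2) * U \<theta> (x\<^sup>2)) / sqrt (W \<theta> (x\<^sup>2) * U \<theta> (x\<^sup>2)),
  (1 - D \<theta> (x\<^sup>2) + (1 - C) * R \<theta> (x\<^sup>2) * W \<theta> (x\<^sup>2)) * x * sqrt (2 * \<theta> / W \<theta> (x\<^sup>2)),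
  (1 + D \<theta> (x\<^sup>2) + C * R \<theta> (x\<^sup>2) * U \<theta> (x\<^sup>2)) * x * sqrt (2 * \<theta> / U \<theta> (x\<^sup>2)),
  (R \<theta> (x\<^sup>2))\<^sup>2 * (U \<theta> (x\<^sup>2) * W \<theta> (x\<^sup>2) - 2 * \<theta> * x\<^sup>2 * ((1 - C) * W \<theta> (x\<^sup>2) + C * U \<theta> (x\<^sup>2))))"
definition "gam \<theta> t = traj \<theta> (Tinv \<theta> t)"

abbreviation "u \<theta> \<equiv> orbit.u C \<theta> (Z \<theta>)"
abbreviation "v \<theta> \<equiv> orbit.v C \<theta> (Z \<theta>)"
abbreviation "r \<theta> \<equiv> orbit.r C \<theta> (Z \<theta>)"

lemma orb: "\<theta> \<in> \<Theta> \<Longrightarrow> orbit C (\<theta> - 1) \<theta> (s\<^sup>2 + 1) (Z \<theta>)"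
  by (rule glob.orb[OF glob]) (auto simp: add_nonneg_pos)

lemma at_0: "\<theta> \<in> \<Theta> \<Longrightarrow> W \<theta> 0 = 1 \<and> U \<theta> 0 = 1 \<and> R \<theta> 0 = 1 \<and> c \<theta> 0 = 1"
  using orbit0.wRd_0[OF orbit.axioms(1)[OF orb[of \<theta> 0]]]
  by (simp add: W_def R_def U_def c_def L_def orbit0.w_def[OF orbit.axioms(1)[OF orb[of \<theta> 0]]]
      orbit0.R_def[OF orbit.axioms(1)[OF orb[of \<theta> 0]]])

lemma uvr_eq:
  assumes \<theta>: "\<theta> \<in> \<Theta>" and s: "0 < s"
  shows "W \<theta> s = 2 * \<theta> * s * v \<theta> s" "U \<theta> s = 2 * \<theta> * s * u \<theta> s" "2 * \<theta> * s * R \<theta> s = r \<theta> s" "D \<theta> s = u \<theta> s - v \<theta> s"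
proof -
  interpret O: orbit C "\<theta> - 1" \<theta> "s\<^sup>2 + 1" "Z \<theta>" by (rule orb[OF \<theta>])
  have w: "W \<theta> s = O.w s" "R \<theta> s = O.R s" "D \<theta> s = O.d s" by (simp_all add: W_def R_def D_def O.w_def O.R_def O.d_def)
  show 1: "W \<theta> s = 2 * \<theta> * s * v \<theta> s" and 4: "D \<theta> s = u \<theta> s - v \<theta> s" using O.wRd_eq[OF s] w by auto
  show "2 * \<theta> * s * R \<theta> s = r \<theta> s" using w by (simp add: O.r_def)
  show "U \<theta> s = 2 * \<theta> * s * u \<theta> s" unfolding U_def 1 4 by (simp add: algebra_simps)
qed

lemma posit:
  assumes \<theta>: "\<theta> \<in> \<Theta>" and s: "0 < s"
  shows "0 < u \<theta> s" "0 < v \<theta> s" "0 < r \<theta> s"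
  using glob.pos[OF glob[OF \<theta>] s] by auto

lemma WU_pos:
  assumes \<theta>: "\<theta> \<in> \<Theta>" and s: "0 \<le> s"
  shows "0 < W \<theta> s" "0 < U \<theta> s"
  using at_0[OF \<theta>] uvr_eq[OF \<theta>, of s] posit[OF \<theta>, of s] s \<theta> by (cases "s = 0"; simp)+

lemma c_pos: "0 < c \<theta> s"
  by (simp add: c_def)

lemma comp_sq:
  fixes f :: "real \<Rightarrow> real \<Rightarrow> 'b::topological_space"
  assumes "continuous_on (\<Theta> \<times> {0..}) (\<lambda>x. f (fst x) (snd x))"
  shows "continuous_on (\<Theta> \<times> {0..}) (\<lambda>x. f (fst x) ((snd x)\<^sup>2))"
proof -
  have "continuous_on (\<Theta> \<times> {0..}) (\<lambda>x. (\<lambda>y. f (fst y) (snd y)) (fst x, (snd x)\<^sup>2))"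
    by (rule continuous_on_compose2[OF assms]) (intro continuous_intros, auto)
  then show ?thesis by simp
qed

lemma base_cont:
  "continuous_on (\<Theta> \<times> {0..}) (\<lambda>x. W (fst x) (snd x))" "continuous_on (\<Theta> \<times> {0..}) (\<lambda>x. R (fst x) (snd x))"
  "continuous_on (\<Theta> \<times> {0..}) (\<lambda>x. D (fst x) (snd x))" "continuous_on (\<Theta> \<times> {0..}) (\<lambda>x. U (fst x) (snd x))"
proof -
  have Z: "continuous_on (\<Theta> \<times> {0..}) (\<lambda>x. Z (fst x) (snd x))" using Z_cont by (simp add: case_prod_beta)
  show "continuous_on (\<Theta> \<times> {0..}) (\<lambda>x. W (fst x) (snd x))" "continuous_on (\<Theta> \<times> {0..}) (\<lambda>x. R (fst x) (snd x))"
    "continuous_on (\<Theta> \<times> {0..}) (\<lambda>x. D (fst x) (snd x))"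
    unfolding W_def R_def D_def by (intro coords_continuous Z continuous_intros)+
  then show "continuous_on (\<Theta> \<times> {0..}) (\<lambda>x. U (fst x) (snd x))"
    unfolding U_def by (intro continuous_intros)
qed

lemma gL_cont: "continuous_on (\<Theta> \<times> {0..}) (\<lambda>x. gL (fst x) (snd x))"
  unfolding gL_def by (intro continuous_intros base_cont)

lemma c_cont: "continuous_on (\<Theta> \<times> {0..}) (\<lambda>x. c (fst x) (snd x))"
  unfolding c_def L_def by (intro continuous_on_exp primitive_continuous gL_cont)

lemma gT_cont: "continuous_on (\<Theta> \<times> {0..}) (\<lambda>x. gT (fst x) (snd x))"
  unfolding gT_def by (intro continuous_intros comp_sq[of c] comp_sq[of U] c_cont base_cont)

lemma T_cont: "continuous_on (\<Theta> \<times> {0..}) (\<lambda>x. T (fst x) (snd x))"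
  unfolding T_def by (rule primitive_continuous[OF gT_cont])

lemma fix_cont:
  fixes f :: "real \<Rightarrow> real \<Rightarrow> 'b::topological_space"
  assumes "continuous_on (\<Theta> \<times> {0..}) (\<lambda>x. f (fst x) (snd x))" "\<theta> \<in> \<Theta>"
  shows "continuous_on {0..} (f \<theta>)"
  by (rule continuous_on_compose2[OF assms(1), of _ "\<lambda>s. (\<theta>, s)", simplified]) (use assms(2) in \<open>auto intro!: continuous_intros\<close>)

lemma traj_vel_cont: "continuous_on (\<Theta> \<times> {0..}) (\<lambda>x. (traj (fst x) (snd x), vel (fst x) (snd x)))"
proof -
  have sq: "continuous_on (\<Theta> \<times> {0..}) (\<lambda>x. W (fst x) ((snd x)\<^sup>2))" "continuous_on (\<Theta> \<times> {0..}) (\<lambda>x. R (fst x) ((snd x)\<^sup>2))"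
    "continuous_on (\<Theta> \<times> {0..}) (\<lambda>x. D (fst x) ((snd x)\<^sup>2))" "continuous_on (\<Theta> \<times> {0..}) (\<lambda>x. U (fst x) ((snd x)\<^sup>2))"
    "continuous_on (\<Theta> \<times> {0..}) (\<lambda>x. c (fst x) ((snd x)\<^sup>2))"
    by (intro comp_sq[of W] comp_sq[of R] comp_sq[of D] comp_sq[of U] comp_sq[of c] base_cont c_cont)+
  have nz: "\<forall>x\<in>\<Theta> \<times> {0..}. W (fst x) ((snd x)\<^sup>2) \<noteq> 0" "\<forall>x\<in>\<Theta> \<times> {0..}. U (fst x) ((snd x)\<^sup>2) \<noteq> 0"
    "\<forall>x\<in>\<Theta> \<times> {0..}. sqrt (W (fst x) ((snd x)\<^sup>2) * U (fst x) ((snd x)\<^sup>2)) \<noteq> 0"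
    using WU_pos by (auto simp: less_imp_neq[symmetric])
  show ?thesis unfolding traj_def vel_def
    by (intro continuous_intros sq nz)
qed

lemma c_deriv: "\<theta> \<in> \<Theta> \<Longrightarrow> 0 < s \<Longrightarrow> (c \<theta> has_real_derivative c \<theta> s * (\<theta> * lw C (u \<theta> s) (v \<theta> s) (r \<theta> s))) (at s)"
proof -
  assume \<theta>: "\<theta> \<in> \<Theta>" and s: "0 < s"
  have "(L \<theta> has_real_derivative gL \<theta> s) (at s)"
    unfolding L_def[abs_def] by (rule primitive_deriv[OF fix_cont[OF gL_cont \<theta>] s])
  then have "(c \<theta> has_real_derivative c \<theta> s * gL \<theta> s) (at s)"
    unfolding c_def[abs_def] by (auto intro!: derivative_eq_intros)
  moreover have "gL \<theta> s = \<theta> * lw C (u \<theta> s) (v \<theta> s) (r \<theta> s)"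
  proof -
    have "R \<theta> s * U \<theta> s = r \<theta> s * u \<theta> s" unfolding uvr_eq(2)[OF \<theta> s] uvr_eq(3)[OF \<theta> s, symmetric] by simp
    then show ?thesis using uvr_eq(4)[OF \<theta> s] by (simp add: gL_def lw_def mult.assoc)
  qed
  ultimately show ?thesis by simp
qed

text \<open>For x > 0 the regular expressions agree with the geometric ones. Together with
  \<open>traj_vel_cont\<close> this carries the first derivatives continuously to the singular
  orbit, as the jet in the boundary condition requires.\<close>

lemma traj_eq:
  assumes \<theta>: "\<theta> \<in> \<Theta>" and x: "0 < x"
  shows "traj \<theta> x = coeffs (c \<theta> (x\<^sup>2)) (u \<theta> (x\<^sup>2)) (v \<theta> (x\<^sup>2)) (r \<theta> (x\<^sup>2))"
    and "gT \<theta> x = 2 * x * (\<theta> * c \<theta> (x\<^sup>2) * sqrt (u \<theta> (x\<^sup>2)))"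
    and "vel \<theta> x = grhs 1 (1 - C) C (traj \<theta> x)"
proof -
  define s where "s = x\<^sup>2"
  have s: "0 < s" using x by (simp add: s_def)
  note q = uvr_eq[OF \<theta> s] and p = posit[OF \<theta> s]
  have sx: "sqrt s = x" using x by (simp add: s_def)
  define k where "k = sqrt (2 * \<theta>)"
  have \<theta>p: "0 < \<theta>" using \<theta> by simp
  have k: "0 < k" "2 * \<theta> = k\<^sup>2" using \<theta>p by (auto simp: k_def)
  \<comment> \<open>With k, a, b as abbreviations for the square roots of 2 \<theta>, u and v, all
    other roots disappear: W = (k x b)^2 and U = (k x a)^2.\<close>
  define a b where "a = sqrt (u \<theta> s)" and "b = sqrt (v \<theta> s)"
  have ab: "0 < a" "0 < b" "u \<theta> s = a\<^sup>2" "v \<theta> s = b\<^sup>2" using p by (auto simp: a_def b_def)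
  have WU: "W \<theta> s = (k * x * b)\<^sup>2" "U \<theta> s = (k * x * a)\<^sup>2"
  proof -
    have "W \<theta> s = k\<^sup>2 * s * b\<^sup>2" "U \<theta> s = k\<^sup>2 * s * a\<^sup>2" by (simp_all only: q(1,2) k(2) ab(3,4))
    moreover have "k\<^sup>2 * s * b\<^sup>2 = (k * x * b)\<^sup>2" "k\<^sup>2 * s * a\<^sup>2 = (k * x * a)\<^sup>2" by (simp_all add: s_def power_mult_distrib)
    ultimately show "W \<theta> s = (k * x * b)\<^sup>2" "U \<theta> s = (k * x * a)\<^sup>2" by simp_all
  qed
  have th: "2 * \<theta> * s = (k * x)\<^sup>2" unfolding k(2) s_def by (simp add: power_mult_distrib)
  have kx: "0 < k * x" using k x by simp
  have R: "R \<theta> s = r \<theta> s / (k * x)\<^sup>2"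
  proof (rule eq_divide_imp)
    show "(k * x)\<^sup>2 \<noteq> 0" using k(1) x by simp
    show "R \<theta> s * (k * x)\<^sup>2 = r \<theta> s" using q(3) unfolding th by (simp only: mult.commute)
  qed
  have r1: "sqrt (2 * \<theta> / W \<theta> s) = 1 / (x * b)" "sqrt (U \<theta> s) = k * x * a" "sqrt (U \<theta> s / W \<theta> s) = a / b"
    "sqrt (W \<theta> s * U \<theta> s) = (k * x)\<^sup>2 * (a * b)" "sqrt (2 * \<theta> / U \<theta> s) = 1 / (x * a)"
  proof -
    have "2 * \<theta> / W \<theta> s = (1 / (x * b))\<^sup>2" "U \<theta> s / W \<theta> s = (a / b)\<^sup>2" "W \<theta> s * U \<theta> s = ((k * x)\<^sup>2 * (a * b))\<^sup>2"
      "2 * \<theta> / U \<theta> s = (1 / (x * a))\<^sup>2"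
      unfolding WU k(2) using k(1) x ab(1,2) by (auto simp: power_divide power_mult_distrib field_simps)
    moreover have "sqrt (U \<theta> s) = k * x * a" unfolding WU using kx ab(1) by simp
    moreover have "0 \<le> 1 / (x * b)" "0 \<le> a / b" "0 \<le> (k * x)\<^sup>2 * (a * b)" "0 \<le> 1 / (x * a)" using x ab(1,2) by auto
    ultimately show "sqrt (2 * \<theta> / W \<theta> s) = 1 / (x * b)" "sqrt (U \<theta> s) = k * x * a" "sqrt (U \<theta> s / W \<theta> s) = a / b"
      "sqrt (W \<theta> s * U \<theta> s) = (k * x)\<^sup>2 * (a * b)" "sqrt (2 * \<theta> / U \<theta> s) = 1 / (x * a)"
      by (simp_all only: real_sqrt_unique)
  qed
  have pe: "traj \<theta> x = (c \<theta> s / b, c \<theta> s * a / b, c \<theta> s, r \<theta> s * a * c \<theta> s)"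
  proof -
    have "traj \<theta> x = (c \<theta> s * x * sqrt (2 * \<theta> / W \<theta> s), c \<theta> s * sqrt (U \<theta> s / W \<theta> s), c \<theta> s,
        c \<theta> s * R \<theta> s * x * sqrt (2 * \<theta>) * sqrt (U \<theta> s))"
      by (simp add: traj_def s_def)
    also have "\<dots> = (c \<theta> s * x * (1 / (x * b)), c \<theta> s * (a / b), c \<theta> s, c \<theta> s * (r \<theta> s / (k * x)\<^sup>2) * x * k * (k * x * a))"
      by (simp only: r1 R k_def[symmetric])
    also have "\<dots> = (c \<theta> s / b, c \<theta> s * a / b, c \<theta> s, r \<theta> s * a * c \<theta> s)"
      using k(1) x ab(1,2) by (simp add: field_simps power2_eq_square)
    finally show ?thesis .
  qed
  show pc: "traj \<theta> x = coeffs (c \<theta> (x\<^sup>2)) (u \<theta> (x\<^sup>2)) (v \<theta> (x\<^sup>2)) (r \<theta> (x\<^sup>2))"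
    unfolding pe coeffs_def s_def[symmetric] a_def b_def by simp
  show "gT \<theta> x = 2 * x * (\<theta> * c \<theta> (x\<^sup>2) * sqrt (u \<theta> (x\<^sup>2)))"
    unfolding gT_def s_def[symmetric] r1 k_def[symmetric] a_def[symmetric] using k(2)
    by (simp add: power2_eq_square algebra_simps)
  have D: "D \<theta> s = a\<^sup>2 - b\<^sup>2" using q(4) ab by simp
  have ve: "vel \<theta> x = ((a\<^sup>2 + b\<^sup>2 - 1 - r \<theta> s * a\<^sup>2 * b\<^sup>2) / (a * b), (1 + b\<^sup>2 - a\<^sup>2 + (1 - C) * r \<theta> s * b\<^sup>2) / b,
      (1 + a\<^sup>2 - b\<^sup>2 + C * r \<theta> s * a\<^sup>2) / a, (r \<theta> s)\<^sup>2 * (a\<^sup>2 * b\<^sup>2 - (1 - C) * b\<^sup>2 - C * a\<^sup>2))"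
  proof -
    define K where "K = k * x"
    have K: "0 < K" using kx by (simp add: K_def)
    have "x * sqrt (2 * \<theta> / W \<theta> s) = 1 / b" "x * sqrt (2 * \<theta> / U \<theta> s) = 1 / a" using x by (auto simp: r1)
    then have e: "A * x * sqrt (2 * \<theta> / W \<theta> s) = A / b" "A * x * sqrt (2 * \<theta> / U \<theta> s) = A / a" for A
      by (simp_all add: mult.assoc)
    have K2: "2 * \<theta> * x\<^sup>2 = K\<^sup>2" using th by (simp add: s_def K_def)
    have "vel \<theta> x = ((U \<theta> s + W \<theta> s - 2 * \<theta> * x\<^sup>2 - R \<theta> s * W \<theta> s * U \<theta> s) / sqrt (W \<theta> s * U \<theta> s),
        (1 - D \<theta> s + (1 - C) * R \<theta> s * W \<theta> s) * x * sqrt (2 * \<theta> / W \<theta> s),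
        (1 + D \<theta> s + C * R \<theta> s * U \<theta> s) * x * sqrt (2 * \<theta> / U \<theta> s),
        (R \<theta> s)\<^sup>2 * (U \<theta> s * W \<theta> s - 2 * \<theta> * x\<^sup>2 * ((1 - C) * W \<theta> s + C * U \<theta> s)))"
      by (simp add: vel_def s_def)
    also have "\<dots> = ((U \<theta> s + W \<theta> s - K\<^sup>2 - R \<theta> s * W \<theta> s * U \<theta> s) / (K\<^sup>2 * (a * b)),
        (1 - D \<theta> s + (1 - C) * R \<theta> s * W \<theta> s) / b,
        (1 + D \<theta> s + C * R \<theta> s * U \<theta> s) / a,
        (R \<theta> s)\<^sup>2 * (U \<theta> s * W \<theta> s - K\<^sup>2 * ((1 - C) * W \<theta> s + C * U \<theta> s)))"
      by (simp only: e r1(4) K2 K_def)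
    also have "\<dots> = (((K * a)\<^sup>2 + (K * b)\<^sup>2 - K\<^sup>2 - r \<theta> s / K\<^sup>2 * (K * b)\<^sup>2 * (K * a)\<^sup>2) / (K\<^sup>2 * (a * b)),
        (1 - (a\<^sup>2 - b\<^sup>2) + (1 - C) * (r \<theta> s / K\<^sup>2) * (K * b)\<^sup>2) / b,
        (1 + (a\<^sup>2 - b\<^sup>2) + C * (r \<theta> s / K\<^sup>2) * (K * a)\<^sup>2) / a,
        (r \<theta> s / K\<^sup>2)\<^sup>2 * ((K * a)\<^sup>2 * (K * b)\<^sup>2 - K\<^sup>2 * ((1 - C) * (K * b)\<^sup>2 + C * (K * a)\<^sup>2)))"
      by (simp only: R WU D K_def)
    also have "\<dots> = ((a\<^sup>2 + b\<^sup>2 - 1 - r \<theta> s * a\<^sup>2 * b\<^sup>2) / (a * b), (1 + b\<^sup>2 - a\<^sup>2 + (1 - C) * r \<theta> s * b\<^sup>2) / b,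
      (1 + a\<^sup>2 - b\<^sup>2 + C * r \<theta> s * a\<^sup>2) / a, (r \<theta> s)\<^sup>2 * (a\<^sup>2 * b\<^sup>2 - (1 - C) * b\<^sup>2 - C * a\<^sup>2))"
    proof -
      have "\<forall>z. z / K\<^sup>2 * (K * b)\<^sup>2 = z * b\<^sup>2" "\<forall>z. z / K\<^sup>2 * (K * a)\<^sup>2 = z * a\<^sup>2"
        using K by (simp_all add: power_mult_distrib)
      moreover have "(K * a)\<^sup>2 + (K * b)\<^sup>2 - K\<^sup>2 - r \<theta> s / K\<^sup>2 * (K * b)\<^sup>2 * (K * a)\<^sup>2 = K\<^sup>2 * (a\<^sup>2 + b\<^sup>2 - 1 - r \<theta> s * a\<^sup>2 * b\<^sup>2)"
        using K by (simp add: power_mult_distrib algebra_simps)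
      moreover have "(r \<theta> s / K\<^sup>2)\<^sup>2 * ((K * a)\<^sup>2 * (K * b)\<^sup>2 - K\<^sup>2 * ((1 - C) * (K * b)\<^sup>2 + C * (K * a)\<^sup>2))
          = (r \<theta> s)\<^sup>2 * (a\<^sup>2 * b\<^sup>2 - (1 - C) * b\<^sup>2 - C * a\<^sup>2)"
      proof -
        have "(K * a)\<^sup>2 * (K * b)\<^sup>2 - K\<^sup>2 * ((1 - C) * (K * b)\<^sup>2 + C * (K * a)\<^sup>2)
            = (K\<^sup>2)\<^sup>2 * (a\<^sup>2 * b\<^sup>2 - (1 - C) * b\<^sup>2 - C * a\<^sup>2)"
          unfolding power_mult_distrib by algebra
        then show ?thesis using K by (simp add: power_divide)
      qed
      moreover have "K\<^sup>2 * z / (K\<^sup>2 * (a * b)) = z / (a * b)" for z using K by simp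
      ultimately show ?thesis by (simp add: mult.assoc[symmetric] del: times_divide_eq_left times_divide_eq_right) (simp add: mult.assoc)?
    qed
    finally show ?thesis .
  qed
  have c0: "0 < c \<theta> s" by (rule c_pos)
  have "vel \<theta> x = grhs 1 (1 - C) C (coeffs (c \<theta> s) (u \<theta> s) (v \<theta> s) (r \<theta> s))"
    unfolding grhs_coeffs[OF p(1,2) c0]
    unfolding a_def[symmetric] b_def[symmetric] ve lp_def lq_def lw_def lf_def ab(3,4)
    using ab(1,2) c0 by (simp add: divide_simps) (simp add: algebra_simps power2_eq_square)?
  then show "vel \<theta> x = grhs 1 (1 - C) C (traj \<theta> x)" by (simp only: pc s_def)
qed

end

lemma crit_log_derivs:
  assumes "crit C u v r"
  shows "lp C u v r = (u + v + 1) / 4" "lq C u v r = (u + v + 1) / 4" "lw C u v r = (u + v + 1) / 4" "lf C u v r = (u + v + 1) / 4"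
proof -
  have e: "2 * (u - 1) = r * v * (u + 1 - C)" "2 * (v - 1) = r * u * (v + C)" "u + v - 3 = 2 * r * ((1 - C) * v + C * u)"
    using assms by (auto simp: crit_def)
  have 1: "4 * lp C u v r = u + v + 1" unfolding lp_def using e by algebra
  have 2: "4 * lq C u v r = u + v + 1" unfolding lq_def using e by algebra
  have 3: "4 * lw C u v r = u + v + 1" unfolding lw_def using e by algebra
  have 4: "4 * lf C u v r = u + v + 1" unfolding lf_def using e by algebra
  show "lp C u v r = (u + v + 1) / 4" "lq C u v r = (u + v + 1) / 4" "lw C u v r = (u + v + 1) / 4" "lf C u v r = (u + v + 1) / 4"
    using 1 2 3 4 by auto
qed

lemma log_deriv_rules:
  fixes f g :: "real \<Rightarrow> real"
  assumes f: "(f has_real_derivative f s * a) (at s)" and g: "(g has_real_derivative g s * b) (at s)"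
  shows "((\<lambda>s. f s * g s) has_real_derivative (f s * g s) * (a + b)) (at s)"
    and "g s \<noteq> 0 \<Longrightarrow> ((\<lambda>s. f s / g s) has_real_derivative (f s / g s) * (a - b)) (at s)"
    and "0 < f s \<Longrightarrow> ((\<lambda>s. sqrt (f s)) has_real_derivative sqrt (f s) * (a / 2)) (at s)"
proof -
  show "((\<lambda>s. f s * g s) has_real_derivative (f s * g s) * (a + b)) (at s)"
    by (rule DERIV_cong[OF DERIV_mult[OF f g]]) (simp add: algebra_simps)
  show "((\<lambda>s. f s / g s) has_real_derivative (f s / g s) * (a - b)) (at s)" if "g s \<noteq> 0"
    by (rule DERIV_cong[OF DERIV_divide[OF f g that]]) (use that in \<open>simp add: field_simps\<close>)
  show "((\<lambda>s. sqrt (f s)) has_real_derivative sqrt (f s) * (a / 2)) (at s)" if "0 < f s"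
  proof (rule DERIV_cong[OF DERIV_chain2[OF DERIV_real_sqrt[OF that] f]])
    have *: "f s = sqrt (f s) * sqrt (f s)" using that by simp
    have "inverse S / 2 * ((S * S) * a) = S * (a / 2)" if "S \<noteq> 0" for S :: real using that by (simp add: field_simps)
    from this[of "sqrt (f s)"] that show "inverse (sqrt (f s)) / 2 * (f s * a) = sqrt (f s) * (a / 2)"
      by (simp only: *[symmetric]) simp
  qed
qed

context family
begin

lemma uvr_deriv:
  assumes \<theta>: "\<theta> \<in> \<Theta>" and s: "0 < s"
  shows "(u \<theta> has_real_derivative u \<theta> s * (\<theta> * (4 * (1 - u \<theta> s) + 2 * r \<theta> s * v \<theta> s * (u \<theta> s + 1 - C)))) (at s)"
    "(v \<theta> has_real_derivative v \<theta> s * (\<theta> * (4 * (1 - v \<theta> s) + 2 * r \<theta> s * u \<theta> s * (v \<theta> s + C)))) (at s)"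
    "(r \<theta> has_real_derivative r \<theta> s * (\<theta> * (u \<theta> s + v \<theta> s - 3 - 2 * r \<theta> s * ((1 - C) * v \<theta> s + C * u \<theta> s)))) (at s)"
  using glob.u_deriv[OF glob[OF \<theta>] s] glob.v_deriv[OF glob[OF \<theta>] s] glob.r_deriv[OF glob[OF \<theta>] s]
  by (simp_all add: fu_def fv_def fr_def mult.left_commute)

lemma coeffs_deriv:
  assumes \<theta>: "\<theta> \<in> \<Theta>" and s: "0 < s"
  defines "k \<equiv> c \<theta> s" and "a \<equiv> u \<theta> s" and "b \<equiv> v \<theta> s" and "\<rho> \<equiv> r \<theta> s"
  shows "((\<lambda>s. coeffs (c \<theta> s) (u \<theta> s) (v \<theta> s) (r \<theta> s)) has_vector_derivative
     (\<theta> * k * sqrt a) *\<^sub>R grhs 1 (1 - C) C (coeffs k a b \<rho>)) (at s)"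
    and "((\<lambda>s. r \<theta> s * sqrt (u \<theta> s) * c \<theta> s) has_real_derivative (\<rho> * sqrt a * k) * (\<theta> * lf C a b \<rho>)) (at s)"
proof -
  note p = posit[OF \<theta> s] c_pos[of \<theta> s]
  note d = uvr_deriv[OF \<theta> s] c_deriv[OF \<theta> s]
  note su = log_deriv_rules(3)[OF d(1) d(1) p(1)] and sv = log_deriv_rules(3)[OF d(2) d(2) p(2)]
  have nz: "sqrt (v \<theta> s) \<noteq> 0" using p by simp
  have e: "\<theta> * lw C a b \<rho> - \<theta> * (4 * (1 - b) + 2 * \<rho> * a * (b + C)) / 2 = \<theta> * lp C a b \<rho>"
    "\<theta> * lw C a b \<rho> + \<theta> * (4 * (1 - a) + 2 * \<rho> * b * (a + 1 - C)) / 2 - \<theta> * (4 * (1 - b) + 2 * \<rho> * a * (b + C)) / 2 = \<theta> * lq C a b \<rho>"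
    by (simp_all add: lp_def lq_def lw_def field_simps)
  have 1: "((\<lambda>s. c \<theta> s / sqrt (v \<theta> s)) has_real_derivative (k / sqrt b) * (\<theta> * lp C a b \<rho>)) (at s)"
    by (rule DERIV_cong[OF log_deriv_rules(2)[OF d(4) sv nz]])
      (simp only: k_def[symmetric] a_def[symmetric] b_def[symmetric] \<rho>_def[symmetric] e)
  have 2: "((\<lambda>s. c \<theta> s * sqrt (u \<theta> s) / sqrt (v \<theta> s)) has_real_derivative (k * sqrt a / sqrt b) * (\<theta> * lq C a b \<rho>)) (at s)"
    by (rule DERIV_cong[OF log_deriv_rules(2)[OF log_deriv_rules(1)[OF d(4) su] sv nz]])
      (simp only: k_def[symmetric] a_def[symmetric] b_def[symmetric] \<rho>_def[symmetric] e)
  have 3: "(c \<theta> has_real_derivative k * (\<theta> * lw C a b \<rho>)) (at s)" using d(4) by (simp add: k_def a_def b_def \<rho>_def)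
  show 4: "((\<lambda>s. r \<theta> s * sqrt (u \<theta> s) * c \<theta> s) has_real_derivative (\<rho> * sqrt a * k) * (\<theta> * lf C a b \<rho>)) (at s)"
    by (rule DERIV_cong[OF log_deriv_rules(1)[OF log_deriv_rules(1)[OF d(3) su] d(4)]])
      (simp add: k_def a_def b_def \<rho>_def lf_def lw_def field_simps)
  have ka: "k * sqrt a \<noteq> 0" using p by (simp add: k_def a_def)
  have e: "\<theta> * k * sqrt a * (x * (l / (k * sqrt a))) = x * (\<theta> * l)" for x l
    using ka by (simp add: field_simps)
  show "((\<lambda>s. coeffs (c \<theta> s) (u \<theta> s) (v \<theta> s) (r \<theta> s)) has_vector_derivative
     (\<theta> * k * sqrt a) *\<^sub>R grhs 1 (1 - C) C (coeffs k a b \<rho>)) (at s)"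
    unfolding grhs_coeffs[OF p(1,2,4), folded k_def a_def b_def] scaleR_Pair real_scaleR_def e
    unfolding coeffs_def
    by (intro has_vector_derivative_Pair; unfold has_real_derivative_iff_has_vector_derivative[symmetric]; rule 1 2 3 4)
qed

text \<open>Treats the good and the critical case together, so that growth and asymptotics are
  derived once; in both, the limit of \<open>lw\<close> is positive.\<close>

lemma limits:
  assumes \<theta>: "\<theta> \<in> \<Theta>"
  obtains a b \<rho> where "(u \<theta> \<longlongrightarrow> a) at_top" "(v \<theta> \<longlongrightarrow> b) at_top" "(r \<theta> \<longlongrightarrow> \<rho>) at_top"
    "0 < a" "0 < b" "0 < lw C a b \<rho>"
    "(\<exists>s>0. orbit.good C \<theta> (Z \<theta>) s) \<Longrightarrow> a = 1 \<and> b = 1 \<and> \<rho> = 0"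
    "\<not> (\<exists>s>0. orbit.good C \<theta> (Z \<theta>) s) \<Longrightarrow> crit C a b \<rho>"
proof (cases "\<exists>s>0. orbit.good C \<theta> (Z \<theta>) s")
  case True
  then obtain s where s: "0 < s" "orbit.good C \<theta> (Z \<theta>) s" by blast
  show ?thesis
    by (rule that[of 1 1 0]) (use glob.good_limits[OF glob[OF \<theta>] s] True in \<open>auto simp: lw_def\<close>)
next
  case False
  then obtain a b \<rho> where c: "crit C a b \<rho>" "(u \<theta> \<longlongrightarrow> a) at_top" "(v \<theta> \<longlongrightarrow> b) at_top" "(r \<theta> \<longlongrightarrow> \<rho>) at_top"
    using glob.dichotomy[OF glob[OF \<theta>]] by blast
  show ?thesis
    by (rule that[of a b \<rho>]) (use c crit_log_derivs[OF c(1)] False in \<open>auto simp: crit_def\<close>)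
qed

lemma c_at_top:
  assumes \<theta>: "\<theta> \<in> \<Theta>"
  shows "filterlim (c \<theta>) at_top at_top"
proof -
  obtain a b \<rho> where l: "(u \<theta> \<longlongrightarrow> a) at_top" "(v \<theta> \<longlongrightarrow> b) at_top" "(r \<theta> \<longlongrightarrow> \<rho>) at_top" and k: "0 < lw C a b \<rho>"
    using limits[OF \<theta>] by metis
  have th: "0 < \<theta>" using \<theta> by simp
  have "((\<lambda>s. \<theta> * lw C (u \<theta> s) (v \<theta> s) (r \<theta> s)) \<longlongrightarrow> \<theta> * lw C a b \<rho>) at_top"
    unfolding lw_def by (intro tendsto_intros l)
  then have ev: "\<forall>\<^sub>F s in at_top. \<theta> * lw C a b \<rho> / 2 < \<theta> * lw C (u \<theta> s) (v \<theta> s) (r \<theta> s)"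
    by (rule order_tendstoD(1)) (use k th in simp)
  have "filterlim (\<lambda>s. ln (c \<theta> s)) at_top at_top"
  proof (rule filterlim_at_top_of_deriv[where a = 1 and k = "\<theta> * lw C a b \<rho> / 2"])
    fix s :: real assume "1 \<le> s"
    then have d: "(c \<theta> has_real_derivative c \<theta> s * (\<theta> * lw C (u \<theta> s) (v \<theta> s) (r \<theta> s))) (at s)"
      by (intro c_deriv[OF \<theta>]) simp
    have "((\<lambda>s. ln (c \<theta> s)) has_real_derivative inverse (c \<theta> s) * (c \<theta> s * (\<theta> * lw C (u \<theta> s) (v \<theta> s) (r \<theta> s)))) (at s)"
      by (rule DERIV_chain2[where f = ln and g = "c \<theta>", OF DERIV_ln[OF c_pos[of \<theta> s]] d])
    moreover have "inverse (c \<theta> s) * (c \<theta> s * (\<theta> * lw C (u \<theta> s) (v \<theta> s) (r \<theta> s))) = \<theta> * lw C (u \<theta> s) (v \<theta> s) (r \<theta> s)"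
      using c_pos[of \<theta> s] by simp
    ultimately show "((\<lambda>s. ln (c \<theta> s)) has_real_derivative \<theta> * lw C (u \<theta> s) (v \<theta> s) (r \<theta> s)) (at s)" by (rule DERIV_cong)
  qed (use k th in simp, rule eventually_mono[OF ev], simp)
  then have "filterlim (\<lambda>s. exp (ln (c \<theta> s))) at_top at_top" by (rule filterlim_compose[OF exp_at_top])
  then show ?thesis by (simp add: c_pos)
qed

lemma T_deriv:
  assumes \<theta>: "\<theta> \<in> \<Theta>" and x: "0 < x"
  shows "(T \<theta> has_real_derivative gT \<theta> x) (at x)"
  unfolding T_def[abs_def] by (rule primitive_deriv[OF fix_cont[OF gT_cont \<theta>] x])

lemma gT_pos:
  assumes \<theta>: "\<theta> \<in> \<Theta>" and x: "0 < x"
  shows "0 < gT \<theta> x"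
  unfolding traj_eq(2)[OF \<theta> x] using \<theta> x posit[OF \<theta>, of "x\<^sup>2"] c_pos[of \<theta> "x\<^sup>2"] by simp

lemma T_mono:
  assumes \<theta>: "\<theta> \<in> \<Theta>" and x: "0 \<le> x" "x < y"
  shows "T \<theta> x < T \<theta> y"
proof (rule DERIV_pos_imp_increasing_open[OF x(2)])
  show "continuous_on {x..y} (T \<theta>)"
    by (rule continuous_on_subset[OF fix_cont[OF T_cont \<theta>]]) (use x in auto)
  fix t assume "x < t" "t < y"
  then show "\<exists>D. (T \<theta> has_real_derivative D) (at t) \<and> 0 < D" using T_deriv[OF \<theta>, of t] gT_pos[OF \<theta>, of t] x by auto
qed

lemma sq_at_top: "filterlim (\<lambda>x::real. x\<^sup>2) at_top at_top"
  by (rule filterlim_pow_at_top) (auto simp: filterlim_ident)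

lemma T_at_top:
  assumes \<theta>: "\<theta> \<in> \<Theta>"
  shows "filterlim (T \<theta>) at_top at_top"
proof -
  obtain a where l: "(u \<theta> \<longlongrightarrow> a) at_top" and a: "0 < a" using limits[OF \<theta>] by metis
  have th: "0 < \<theta>" using \<theta> by simp
  have "filterlim (\<lambda>s. \<theta> * sqrt (u \<theta> s) * c \<theta> s) at_top at_top"
    by (rule filterlim_tendsto_pos_mult_at_top[OF tendsto_mult[OF tendsto_const tendsto_real_sqrt[OF l]] _ c_at_top[OF \<theta>]])
      (use a th in simp)
  then have "filterlim (\<lambda>x. \<theta> * sqrt (u \<theta> (x\<^sup>2)) * c \<theta> (x\<^sup>2)) at_top at_top"
    by (rule filterlim_compose[OF _ sq_at_top])
  then have "\<forall>\<^sub>F x in at_top. 1 \<le> \<theta> * sqrt (u \<theta> (x\<^sup>2)) * c \<theta> (x\<^sup>2)"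
    unfolding filterlim_at_top by blast
  then have "\<forall>\<^sub>F x in at_top. 1 \<le> gT \<theta> x"
    using eventually_ge_at_top[of 1]
  proof eventually_elim
    case (elim x)
    have "1 * 1 \<le> (2 * x) * (\<theta> * sqrt (u \<theta> (x\<^sup>2)) * c \<theta> (x\<^sup>2))" using elim by (intro mult_mono) auto
    then show ?case using traj_eq(2)[OF \<theta>, of x] elim by (simp add: algebra_simps)
  qed
  then show ?thesis using filterlim_at_top_of_deriv[of 1 "T \<theta>" "gT \<theta>" 1] T_deriv[OF \<theta>] by auto
qed

lemma T_0: "T \<theta> 0 = 0"
  by (simp add: T_def)

lemma Tinv:
  assumes \<theta>: "\<theta> \<in> \<Theta>" and t: "0 \<le> t"
  shows "0 \<le> Tinv \<theta> t \<and> T \<theta> (Tinv \<theta> t) = t"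
proof -
  have "\<forall>\<^sub>F x in at_top. t \<le> T \<theta> x" using T_at_top[OF \<theta>] unfolding filterlim_at_top by blast
  then obtain y where y: "\<And>x. y \<le> x \<Longrightarrow> t \<le> T \<theta> x" by (auto simp: eventually_at_top_linorder)
  have "\<exists>x\<ge>0. x \<le> max y 0 \<and> T \<theta> x = t"
    by (rule IVT') (use y[of "max y 0"] t T_0 continuous_on_subset[OF fix_cont[OF T_cont \<theta>], of "{0..max y 0}"] in auto)
  then show ?thesis unfolding Tinv_def by (intro someI_ex[of "\<lambda>x. 0 \<le> x \<and> T \<theta> x = t"]) auto
qed

lemma Tinv_0: "\<theta> \<in> \<Theta> \<Longrightarrow> Tinv \<theta> 0 = 0"
  using Tinv[of \<theta> 0] T_mono[of \<theta> 0 "Tinv \<theta> 0"] T_0[of \<theta>] by force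

lemma Tinv_pos:
  assumes \<theta>: "\<theta> \<in> \<Theta>" and t: "0 < t"
  shows "0 < Tinv \<theta> t"
  using Tinv[OF \<theta>, of t] T_0[of \<theta>] t by (cases "Tinv \<theta> t = 0") auto

lemma Tinv_cont: "continuous_on (\<Theta> \<times> {0..}) (\<lambda>x. Tinv (fst x) (snd x))"
  by (rule inverse_jointly_continuous[OF T_cont]) (use T_mono Tinv in auto)

lemma Tinv_deriv:
  assumes \<theta>: "\<theta> \<in> \<Theta>" and t: "0 < t"
  shows "(Tinv \<theta> has_real_derivative inverse (gT \<theta> (Tinv \<theta> t))) (at t)"
proof (rule DERIV_inverse_function[where a=0 and b="t+1" and f="T \<theta>"])
  show "(T \<theta> has_real_derivative gT \<theta> (Tinv \<theta> t)) (at (Tinv \<theta> t))" by (rule T_deriv[OF \<theta> Tinv_pos[OF \<theta> t]])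
  show "gT \<theta> (Tinv \<theta> t) \<noteq> 0" using gT_pos[OF \<theta> Tinv_pos[OF \<theta> t]] by simp
  show "isCont (Tinv \<theta>) t"
    using fix_cont[OF Tinv_cont \<theta>] t by (intro continuous_on_interior) auto
qed (use t Tinv[OF \<theta>] in auto)

lemma Tinv_at_top:
  assumes \<theta>: "\<theta> \<in> \<Theta>"
  shows "filterlim (Tinv \<theta>) at_top at_top"
  unfolding filterlim_at_top
proof
  fix M :: real
  have "M \<le> Tinv \<theta> t" if t: "max 0 (T \<theta> (max M 0)) \<le> t" for t
  proof (rule ccontr)
    assume "\<not> M \<le> Tinv \<theta> t"
    then have "T \<theta> (Tinv \<theta> t) < T \<theta> (max M 0)" using T_mono[OF \<theta>, of "Tinv \<theta> t" "max M 0"] Tinv[OF \<theta>, of t] t by auto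
    then show False using Tinv[OF \<theta>, of t] t by auto
  qed
  then show "\<forall>\<^sub>F t in at_top. M \<le> Tinv \<theta> t" unfolding eventually_at_top_linorder by blast
qed

lemma gam_deriv:
  assumes \<theta>: "\<theta> \<in> \<Theta>" and t: "0 < t"
  shows "(gam \<theta> has_vector_derivative grhs 1 (1 - C) C (gam \<theta> t)) (at t)"
proof -
  define x where "x = Tinv \<theta> t"
  have x: "0 < x" using Tinv_pos[OF \<theta> t] by (simp add: x_def)
  have x2: "0 < x\<^sup>2" using x by simp
  let ?K = "\<theta> * c \<theta> (x\<^sup>2) * sqrt (u \<theta> (x\<^sup>2))"
  have K: "?K \<noteq> 0" using \<theta> posit[OF \<theta> x2] c_pos[of \<theta> "x\<^sup>2"] by simp
  have g: "gT \<theta> x = 2 * x * ?K" by (rule traj_eq(2)[OF \<theta> x])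
  have "((\<lambda>t. (Tinv \<theta> t)\<^sup>2) has_real_derivative 2 * x * inverse (gT \<theta> x)) (at t)"
    using DERIV_power[OF Tinv_deriv[OF \<theta> t], of 2] by (simp add: x_def mult_ac)
  also have "2 * x * inverse (gT \<theta> x) = inverse ?K" unfolding g using x K by (simp add: field_simps)
  finally have s': "((\<lambda>t. (Tinv \<theta> t)\<^sup>2) has_vector_derivative inverse ?K) (at t)"
    by (simp add: has_real_derivative_iff_has_vector_derivative)
  have "(((\<lambda>s. coeffs (c \<theta> s) (u \<theta> s) (v \<theta> s) (r \<theta> s)) \<circ> (\<lambda>t. (Tinv \<theta> t)\<^sup>2)) has_vector_derivative
      inverse ?K *\<^sub>R (?K *\<^sub>R grhs 1 (1 - C) C (coeffs (c \<theta> (x\<^sup>2)) (u \<theta> (x\<^sup>2)) (v \<theta> (x\<^sup>2)) (r \<theta> (x\<^sup>2))))) (at t)"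
    by (rule vector_diff_chain_at[OF s']) (use coeffs_deriv(1)[OF \<theta> x2] in \<open>simp add: x_def\<close>)
  then have "(((\<lambda>s. coeffs (c \<theta> s) (u \<theta> s) (v \<theta> s) (r \<theta> s)) \<circ> (\<lambda>t. (Tinv \<theta> t)\<^sup>2)) has_vector_derivative
      grhs 1 (1 - C) C (gam \<theta> t)) (at t)"
    unfolding scaleR_scaleR left_inverse[OF K] scaleR_one traj_eq(1)[OF \<theta> x, symmetric] by (simp add: gam_def x_def)
  then show ?thesis
  proof (rule has_vector_derivative_transform_within_open[where S="{0<..}"])
    fix t' :: real assume "t' \<in> {0<..}"
    then show "((\<lambda>s. coeffs (c \<theta> s) (u \<theta> s) (v \<theta> s) (r \<theta> s)) \<circ> (\<lambda>t. (Tinv \<theta> t)\<^sup>2)) t' = gam \<theta> t'"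
      using traj_eq(1)[OF \<theta> Tinv_pos[OF \<theta>, of t']] by (simp add: gam_def)
  qed (use t in auto)
qed

lemma gam_pos:
  assumes \<theta>: "\<theta> \<in> \<Theta>" and t: "0 < t"
  shows "case gam \<theta> t of (p, q, w, f) \<Rightarrow> 0 < p \<and> 0 < q \<and> 0 < w \<and> 0 < f"
proof -
  have x: "0 < Tinv \<theta> t" by (rule Tinv_pos[OF \<theta> t])
  then have "0 < (Tinv \<theta> t)\<^sup>2" by simp
  then show ?thesis using posit[OF \<theta>, of "(Tinv \<theta> t)\<^sup>2"] c_pos[of \<theta> "(Tinv \<theta> t)\<^sup>2"]
    unfolding gam_def traj_eq(1)[OF \<theta> x] coeffs_def by simp
qed

abbreviation "jt \<theta> t \<equiv> (gam \<theta> t, grhs 1 (1 - C) C (gam \<theta> t))"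

definition "jv \<theta> t = (traj \<theta> (Tinv \<theta> t), vel \<theta> (Tinv \<theta> t))"

lemma jv_eq: "\<theta> \<in> \<Theta> \<Longrightarrow> 0 < t \<Longrightarrow> jt \<theta> t = jv \<theta> t"
  using traj_eq(3)[OF _ Tinv_pos] by (simp add: jv_def gam_def)

lemma jv_cont: "continuous_on (\<Theta> \<times> {0..}) (\<lambda>x. jv (fst x) (snd x))"
proof -
  have "continuous_on (\<Theta> \<times> {0..}) (\<lambda>x. (\<lambda>y. (traj (fst y) (snd y), vel (fst y) (snd y))) (fst x, Tinv (fst x) (snd x)))"
    by (rule continuous_on_compose2[OF traj_vel_cont]) (use Tinv in \<open>auto intro!: continuous_intros Tinv_cont\<close>)
  then show ?thesis by (simp add: jv_def)
qed

text \<open>For t > 0 the jet equals \<open>jv\<close>, which is jointly continuous up to t = 0.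
  Compactness of [0, T0] turns joint continuity into uniform convergence.\<close>

lemma jt_uniform:
  assumes \<theta>0: "\<theta>0 \<in> \<Theta>" and T: "0 < T0"
  shows "uniform_limit {0<..T0} jt (jt \<theta>0) (at \<theta>0 within \<Theta>)"
proof (rule uniform_limitI)
  fix \<epsilon> :: real assume \<epsilon>: "0 < \<epsilon>"
  have "continuous_on (\<Theta> \<times> {0..T0}) (\<lambda>x. jv (fst x) (snd x))"
    by (rule continuous_on_subset[OF jv_cont]) auto
  then obtain X0 where X0: "\<theta>0 \<in> X0" "open X0"
    "\<forall>\<theta>\<in>X0 \<inter> \<Theta>. \<forall>t\<in>{0..T0}. dist (jv \<theta> t) (jv \<theta>0 t) \<le> \<epsilon> / 2"
    using continuous_on_prod_compactE[of \<Theta> "{0..T0}" "\<lambda>x. jv (fst x) (snd x)" \<theta>0 "\<epsilon> / 2"] \<theta>0 \<epsilon> by auto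
  have "\<forall>\<^sub>F \<theta> in at \<theta>0 within \<Theta>. \<theta> \<in> X0 \<and> \<theta> \<in> \<Theta>"
    using X0(1,2) unfolding eventually_at_topological by blast
  then show "\<forall>\<^sub>F \<theta> in at \<theta>0 within \<Theta>. \<forall>t\<in>{0<..T0}. dist (jt \<theta> t) (jt \<theta>0 t) < \<epsilon>"
  proof eventually_elim
    case (elim \<theta>)
    show ?case
    proof
      fix t assume t: "t \<in> {0<..T0}"
      have "dist (jv \<theta> t) (jv \<theta>0 t) \<le> \<epsilon> / 2" using X0(3) elim t by auto
      then have "dist (jv \<theta> t) (jv \<theta>0 t) < \<epsilon>" using \<epsilon> by simp
      then show "dist (jt \<theta> t) (jt \<theta>0 t) < \<epsilon>" using jv_eq[of \<theta> t] jv_eq[OF \<theta>0, of t] elim t by simp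
    qed
  qed
qed

lemma jt_0:
  assumes \<theta>: "\<theta> \<in> \<Theta>"
  shows "(jt \<theta> \<longlongrightarrow> ((0, 1, 1, 0), (1, 0, 0, 1))) (at_right 0)"
proof -
  have "continuous_on {0..1} (jv \<theta>)" by (rule continuous_on_subset[OF fix_cont[OF jv_cont \<theta>]]) auto
  then have "(jv \<theta> \<longlongrightarrow> jv \<theta> 0) (at_right 0)" using continuous_on_Icc_at_rightD[of 0 1 "jv \<theta>"] by simp
  moreover have "jv \<theta> 0 = ((0, 1, 1, 0), (1, 0, 0, 1))"
    using at_0[OF \<theta>] by (simp add: jv_def Tinv_0[OF \<theta>] traj_def vel_def)
  ultimately have l: "(jv \<theta> \<longlongrightarrow> ((0, 1, 1, 0), (1, 0, 0, 1))) (at_right 0)" by simp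
  show ?thesis
    by (rule Lim_transform_eventually[OF l]) (use jv_eq[OF \<theta>] in \<open>auto simp: eventually_at_right_field intro!: exI[of _ 1]\<close>)
qed

text \<open>By l'Hospital's rule, applied in x, the quotient of the third coefficient by t tends to
  the limit of lw / sqrt u. The remaining coefficients are this one times convergent
  factors.\<close>

lemma asymptotics:
  assumes \<theta>: "\<theta> \<in> \<Theta>" and l: "(u \<theta> \<longlongrightarrow> a) at_top" "(v \<theta> \<longlongrightarrow> b) at_top" "(r \<theta> \<longlongrightarrow> \<rho>) at_top"
    and p: "0 < a" "0 < b" "0 < lw C a b \<rho>"
  defines "k \<equiv> lw C a b \<rho> / sqrt a"
  shows "((\<lambda>t. case gam \<theta> t of (p, q, w, f) \<Rightarrow> (p / t, q / t, w / t, f / t)) \<longlongrightarrow> coeffs k a b \<rho>) at_top"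
    and "((\<lambda>t. case gam \<theta> t of (p, q, w, f) \<Rightarrow> (p / t, q / t, w / t)) \<longlongrightarrow> (k / sqrt b, k * sqrt a / sqrt b, k)) at_top"
proof -
  have th: "0 < \<theta>" using \<theta> by simp
  have ct: "((\<lambda>x. c \<theta> (x\<^sup>2) / T \<theta> x) \<longlongrightarrow> k) at_top"
  proof (rule lhospital_at_top_at_top[where f'="\<lambda>x. c \<theta> (x\<^sup>2) * (\<theta> * lw C (u \<theta> (x\<^sup>2)) (v \<theta> (x\<^sup>2)) (r \<theta> (x\<^sup>2))) * (2 * x)" and g'="gT \<theta>"])
    show "filterlim (T \<theta>) at_top at_top" by (rule T_at_top[OF \<theta>])
    show "\<forall>\<^sub>F x in at_top. gT \<theta> x \<noteq> 0"
      using eventually_gt_at_top[of 0] by eventually_elim (use gT_pos[OF \<theta>] in force)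
    show "\<forall>\<^sub>F x in at_top. (T \<theta> has_real_derivative gT \<theta> x) (at x)"
      using eventually_gt_at_top[of 0] by eventually_elim (rule T_deriv[OF \<theta>])
    show "\<forall>\<^sub>F x in at_top. ((\<lambda>x. c \<theta> (x\<^sup>2)) has_real_derivative
        c \<theta> (x\<^sup>2) * (\<theta> * lw C (u \<theta> (x\<^sup>2)) (v \<theta> (x\<^sup>2)) (r \<theta> (x\<^sup>2))) * (2 * x)) (at x)"
      using eventually_gt_at_top[of 0]
    proof eventually_elim
      case (elim x)
      have "((\<lambda>x::real. x\<^sup>2) has_real_derivative 2 * x) (at x)" by (auto intro!: derivative_eq_intros)
      then show ?case using elim by (intro DERIV_chain2[OF c_deriv[OF \<theta>]]) auto
    qed
    have ll: "((\<lambda>x. lw C (u \<theta> (x\<^sup>2)) (v \<theta> (x\<^sup>2)) (r \<theta> (x\<^sup>2)) / sqrt (u \<theta> (x\<^sup>2))) \<longlongrightarrow> k) at_top"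
      unfolding k_def lw_def
      by (intro tendsto_intros filterlim_compose[OF l(1) sq_at_top] filterlim_compose[OF l(2) sq_at_top] filterlim_compose[OF l(3) sq_at_top])
        (use p in auto)
    show "((\<lambda>x. c \<theta> (x\<^sup>2) * (\<theta> * lw C (u \<theta> (x\<^sup>2)) (v \<theta> (x\<^sup>2)) (r \<theta> (x\<^sup>2))) * (2 * x) / gT \<theta> x) \<longlongrightarrow> k) at_top"
    proof (rule Lim_transform_eventually[OF ll])
      show "\<forall>\<^sub>F x in at_top. lw C (u \<theta> (x\<^sup>2)) (v \<theta> (x\<^sup>2)) (r \<theta> (x\<^sup>2)) / sqrt (u \<theta> (x\<^sup>2)) =
          c \<theta> (x\<^sup>2) * (\<theta> * lw C (u \<theta> (x\<^sup>2)) (v \<theta> (x\<^sup>2)) (r \<theta> (x\<^sup>2))) * (2 * x) / gT \<theta> x"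
        using eventually_gt_at_top[of 0]
        by eventually_elim (use th c_pos[of \<theta>] in \<open>simp add: traj_eq(2)[OF \<theta>] less_imp_neq[symmetric]\<close>)
    qed
  qed
  have ct': "((\<lambda>t. c \<theta> ((Tinv \<theta> t)\<^sup>2) / t) \<longlongrightarrow> k) at_top"
    by (rule Lim_transform_eventually[OF filterlim_compose[OF ct Tinv_at_top[OF \<theta>]] eventually_mono[OF eventually_ge_at_top[of 0]]])
      (use Tinv[OF \<theta>] in simp)
  have sq: "filterlim (\<lambda>t. (Tinv \<theta> t)\<^sup>2) at_top at_top" by (rule filterlim_compose[OF sq_at_top Tinv_at_top[OF \<theta>]])
  note l' = filterlim_compose[OF l(1) sq] filterlim_compose[OF l(2) sq] filterlim_compose[OF l(3) sq]
  let ?s = "\<lambda>t. (Tinv \<theta> t)\<^sup>2"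
  have eq: "gam \<theta> t = coeffs (c \<theta> (?s t)) (u \<theta> (?s t)) (v \<theta> (?s t)) (r \<theta> (?s t))" if "0 < t" for t
    unfolding gam_def by (rule traj_eq(1)[OF \<theta> Tinv_pos[OF \<theta> that]])
  have L: "((\<lambda>t. ((c \<theta> (?s t) / t) / sqrt (v \<theta> (?s t)), (c \<theta> (?s t) / t) * sqrt (u \<theta> (?s t)) / sqrt (v \<theta> (?s t)), c \<theta> (?s t) / t))
      \<longlongrightarrow> (k / sqrt b, k * sqrt a / sqrt b, k)) at_top"
    by (intro tendsto_intros ct' l') (use p in auto)
  then show "((\<lambda>t. case gam \<theta> t of (p, q, w, f) \<Rightarrow> (p / t, q / t, w / t)) \<longlongrightarrow> (k / sqrt b, k * sqrt a / sqrt b, k)) at_top"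
    by (rule Lim_transform_eventually[OF _ eventually_mono[OF eventually_gt_at_top[of 0]]])
      (simp add: eq coeffs_def)
  have "((\<lambda>t. ((c \<theta> (?s t) / t) / sqrt (v \<theta> (?s t)), (c \<theta> (?s t) / t) * sqrt (u \<theta> (?s t)) / sqrt (v \<theta> (?s t)), c \<theta> (?s t) / t,
       r \<theta> (?s t) * sqrt (u \<theta> (?s t)) * (c \<theta> (?s t) / t))) \<longlongrightarrow> coeffs k a b \<rho>) at_top"
    unfolding coeffs_def by (intro tendsto_intros ct' l') (use p in auto)
  then show "((\<lambda>t. case gam \<theta> t of (p, q, w, f) \<Rightarrow> (p / t, q / t, w / t, f / t)) \<longlongrightarrow> coeffs k a b \<rho>) at_top"
    by (rule Lim_transform_eventually[OF _ eventually_mono[OF eventually_gt_at_top[of 0]]])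
      (simp add: eq coeffs_def)
qed

lemma good_asymptotics:
  assumes \<theta>: "\<theta> \<in> \<Theta>" and g: "\<exists>s>0. orbit.good C \<theta> (Z \<theta>) s"
  shows "\<exists>f0>0. ((\<lambda>t. case gam \<theta> t of (p, q, w, f) \<Rightarrow> (p / t, q / t, w / t, f)) \<longlongrightarrow> (1, 1, 1, f0)) at_top"
proof -
  obtain s where s: "0 < s" "orbit.good C \<theta> (Z \<theta>) s" using g by blast
  have l: "(u \<theta> \<longlongrightarrow> 1) at_top" "(v \<theta> \<longlongrightarrow> 1) at_top" "(r \<theta> \<longlongrightarrow> 0) at_top"
    using limits[OF \<theta>] g by metis+
  have A0: "((\<lambda>t. (fst (gam \<theta> t) / t, fst (snd (gam \<theta> t)) / t, fst (snd (snd (gam \<theta> t))) / t)) \<longlongrightarrow> (1, 1, 1)) at_top"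
    using asymptotics(2)[OF \<theta> l] by (simp add: lw_def case_prod_beta)
  note A = tendsto_fst[OF A0, unfolded fst_conv] tendsto_fst[OF tendsto_snd[OF A0], unfolded fst_conv snd_conv]
    tendsto_snd[OF tendsto_snd[OF A0], unfolded fst_conv snd_conv]
  have "\<exists>f0>0. ((\<lambda>s. r \<theta> s * sqrt (u \<theta> s) * c \<theta> s) \<longlongrightarrow> f0) at_top"
    by (rule glob.good_fibre_limit[OF glob[OF \<theta>] s])
      (use coeffs_deriv(2)[OF \<theta>] posit[OF \<theta>] c_pos[of \<theta>] in \<open>auto\<close>)
  then obtain f0 where f0: "0 < f0" "((\<lambda>s. r \<theta> s * sqrt (u \<theta> s) * c \<theta> s) \<longlongrightarrow> f0) at_top" by blast
  have sq: "filterlim (\<lambda>t. (Tinv \<theta> t)\<^sup>2) at_top at_top" by (rule filterlim_compose[OF sq_at_top Tinv_at_top[OF \<theta>]])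
  have "((\<lambda>t. snd (snd (snd (gam \<theta> t)))) \<longlongrightarrow> f0) at_top"
    by (rule Lim_transform_eventually[OF filterlim_compose[OF f0(2) sq] eventually_mono[OF eventually_gt_at_top[of 0]]])
      (simp add: gam_def traj_eq(1)[OF \<theta> Tinv_pos[OF \<theta>]] coeffs_def)
  then have "((\<lambda>t. (fst (gam \<theta> t) / t, fst (snd (gam \<theta> t)) / t, fst (snd (snd (gam \<theta> t))) / t, snd (snd (snd (gam \<theta> t))))) \<longlongrightarrow> (1, 1, 1, f0)) at_top"
    by (intro tendsto_Pair A)
  then show ?thesis using f0(1) by (auto simp: case_prod_beta)
qed

text \<open>At a critical point all logarithmic derivatives equal (a + b + 1) / 4, which is also k *
  sqrt a. The limit h is therefore a fixed point of the field, that is, t h solves the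
  equations.\<close>

lemma critical_asymptotics:
  assumes \<theta>: "\<theta> \<in> \<Theta>" and g: "\<not> (\<exists>s>0. orbit.good C \<theta> (Z \<theta>) s)"
  shows "\<exists>h. (case h of (p, q, w, f) \<Rightarrow> 0 < p \<and> 0 < q \<and> 0 < w \<and> 0 < f) \<and> grhs 1 (1 - C) C h = h \<and>
    ((\<lambda>t. case gam \<theta> t of (p, q, w, f) \<Rightarrow> (p / t, q / t, w / t, f / t)) \<longlongrightarrow> h) at_top"
proof -
  obtain a b \<rho> where l: "(u \<theta> \<longlongrightarrow> a) at_top" "(v \<theta> \<longlongrightarrow> b) at_top" "(r \<theta> \<longlongrightarrow> \<rho>) at_top"
    and p: "0 < a" "0 < b" "0 < lw C a b \<rho>" and c: "crit C a b \<rho>"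
    using limits[OF \<theta>] g by metis
  define k where "k = lw C a b \<rho> / sqrt a"
  have k: "0 < k" using p by (simp add: k_def)
  have \<rho>: "0 < \<rho>" using c by (simp add: crit_def)
  note cl = crit_log_derivs[OF c]
  have ka: "k * sqrt a = (a + b + 1) / 4" using p cl by (simp add: k_def)
  have "0 < (a + b + 1) / 4" using p by simp
  then have "grhs 1 (1 - C) C (coeffs k a b \<rho>) = coeffs k a b \<rho>"
    unfolding grhs_coeffs[OF p(1,2) k] cl by (simp add: coeffs_def ka)
  moreover have "case coeffs k a b \<rho> of (p, q, w, f) \<Rightarrow> 0 < p \<and> 0 < q \<and> 0 < w \<and> 0 < f"
    using p k \<rho> by (simp add: coeffs_def)
  ultimately show ?thesis using asymptotics(1)[OF \<theta> l p]
    by (intro exI[of _ "coeffs k a b \<rho>"]) (simp only: k_def)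
qed

end

section \<open>Ricci curvature\<close>

text \<open>A chart of \<open>su3\<close> by eight real numbers, the last two being the first two
  diagonal entries divided by i. It turns brackets, metrics and curvature into polynomial identities
  that simplification can decide.\<close>

definition sm :: "real \<Rightarrow> real \<Rightarrow> real \<Rightarrow> real \<Rightarrow> real \<Rightarrow> real \<Rightarrow> real \<Rightarrow> real \<Rightarrow> cmat3" where
  "sm x0 x1 x2 x3 x4 x5 p q = vector [vector [Complex 0 p, Complex x0 x1, Complex x2 x3],
     vector [Complex (- x0) x1, Complex 0 q, Complex x4 x5],
     vector [Complex (- x2) x3, Complex (- x4) x5, Complex 0 (- p - q)]]"

lemma sm_eq_iff: "sm x0 x1 x2 x3 x4 x5 p q = sm y0 y1 y2 y3 y4 y5 p' q' \<longleftrightarrow>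
    x0 = y0 \<and> x1 = y1 \<and> x2 = y2 \<and> x3 = y3 \<and> x4 = y4 \<and> x5 = y5 \<and> p = p' \<and> q = q'"
  by (auto simp: sm_def vec_eq_iff forall_3)

lemma sm_add: "sm x0 x1 x2 x3 x4 x5 p q + sm y0 y1 y2 y3 y4 y5 p' q' =
    sm (x0 + y0) (x1 + y1) (x2 + y2) (x3 + y3) (x4 + y4) (x5 + y5) (p + p') (q + q')"
  by (simp add: sm_def vec_eq_iff forall_3 complex_eq_iff)

lemma sm_scale: "c *\<^sub>R sm x0 x1 x2 x3 x4 x5 p q = sm (c * x0) (c * x1) (c * x2) (c * x3) (c * x4) (c * x5) (c * p) (c * q)"
  by (simp add: sm_def vec_eq_iff forall_3 complex_eq_iff algebra_simps)

lemma sm_su3: "sm x0 x1 x2 x3 x4 x5 p q \<in> su3"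
  by (simp add: sm_def su3_def trace_def sum_3 forall_3 complex_eq_iff)

lemma su3_sm:
  assumes "X \<in> su3" obtains x0 x1 x2 x3 x4 x5 p q where "X = sm x0 x1 x2 x3 x4 x5 p q"
proof -
  have s: "X $ i $ j = - cnj (X $ j $ i)" for i j using assms unfolding su3_def by blast
  have c: "Re (X $ i $ j) = - Re (X $ j $ i)" "Im (X $ i $ j) = Im (X $ j $ i)" for i j
    using arg_cong[OF s[of i j], of Re] arg_cong[OF s[of i j], of Im] by (simp_all only: uminus_complex.sel cnj.sel minus_minus)
  have "trace X = 0" using assms by (simp add: su3_def)
  then have t: "Im (X $ 3 $ 3) = - Im (X $ 1 $ 1) - Im (X $ 2 $ 2)" by (simp add: trace_def sum_3 complex_eq_iff)
  have d: "Re (X $ i $ i) = 0" for i using c(1)[of i i] by simp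
  have "X = sm (Re (X$1$2)) (Im (X$1$2)) (Re (X$1$3)) (Im (X$1$3)) (Re (X$2$3)) (Im (X$2$3)) (Im (X$1$1)) (Im (X$2$2))"
    using t d c(1)[of 2 1] c(2)[of 2 1] c(1)[of 3 1] c(2)[of 3 1] c(1)[of 3 2] c(2)[of 3 2]
    by (simp add: sm_def vec_eq_iff forall_3 complex_eq_iff)
  then show ?thesis by (rule that)
qed

lemma lie_sm: "lie (sm x0 x1 x2 x3 x4 x5 p q) (sm y0 y1 y2 y3 y4 y5 p' q') =
    sm ((p' - q') * x1 - (p - q) * y1 - (x2 * y4 + x3 * y5) + (y2 * x4 + y3 * x5))
       ((p - q) * y0 - (p' - q') * x0 - (x3 * y4 - x2 * y5) + (y3 * x4 - y2 * x5))
       ((2 * p' + q') * x3 - (2 * p + q) * y3 + (x0 * y4 - x1 * y5) - (y0 * x4 - y1 * x5))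
       ((2 * p + q) * y2 - (2 * p' + q') * x2 + (x0 * y5 + x1 * y4) - (y0 * x5 + y1 * x4))
       ((p' + 2 * q') * x5 - (p + 2 * q) * y5 - (x0 * y2 + x1 * y3) + (y0 * x2 + y1 * x3))
       ((p + 2 * q) * y4 - (p' + 2 * q') * x4 - (x0 * y3 - x1 * y2) + (y0 * x3 - y1 * x2))
       (2 * (x0 * y1 - x1 * y0 + x2 * y3 - x3 * y2))
       (2 * (x1 * y0 - x0 * y1 + x4 * y5 - x5 * y4))"
  by (simp add: sm_def lie_def vec_eq_iff forall_3 matrix_matrix_mult_def sum_3 complex_eq_iff algebra_simps)

lemma nth7: "[a0, a1, a2, a3, a4, a5, a6] ! 0 = a0" "[a0, a1, a2, a3, a4, a5, a6] ! 1 = a1" "[a0, a1, a2, a3, a4, a5, a6] ! 2 = a2"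
    "[a0, a1, a2, a3, a4, a5, a6] ! 3 = a3" "[a0, a1, a2, a3, a4, a5, a6] ! 4 = a4" "[a0, a1, a2, a3, a4, a5, a6] ! 5 = a5"
    "[a0, a1, a2, a3, a4, a5, a6] ! 6 = a6"
  by (simp_all add: nth_Cons numeral_eq_Suc)

lemma sum_lessThan_7: "(\<Sum>j<7. F j) = F 0 + F 1 + F 2 + F 3 + F 4 + F 5 + F (6::nat)" for F :: "nat \<Rightarrow> 'a::comm_monoid_add"
  by (simp add: numeral_eq_Suc lessThan_Suc add_ac)

lemma idiag_sm: "idiag x y z = sm 0 0 0 0 0 0 (of_int x) (of_int y)" if "x + y + z = 0"
proof -
  have "z = - x - y" using that by simp
  then show ?thesis
    by (simp add: idiag_def cscale_def elementary_def sm_def vec_eq_iff forall_3 complex_eq_iff)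
qed

lemma aw_basis_sm:
  "aw_basis k l 0 = sm 1 0 0 0 0 0 0 0" "aw_basis k l 1 = sm 0 1 0 0 0 0 0 0" "aw_basis k l 2 = sm 0 0 1 0 0 0 0 0"
  "aw_basis k l 3 = sm 0 0 0 1 0 0 0 0" "aw_basis k l 4 = sm 0 0 0 0 1 0 0 0" "aw_basis k l 5 = sm 0 0 0 0 0 1 0 0"
  "aw_basis k l 6 = sm 0 0 0 0 0 0 (of_int (k + 2 * l)) (of_int (- 2 * k - l))"
  unfolding aw_basis_def nth7
  by (simp_all add: idiag_sm) (simp_all add: cscale_def elementary_def sm_def vec_eq_iff forall_3 complex_eq_iff)

lemma trace_form_sm: "trace_form (sm x0 x1 x2 x3 x4 x5 p q) (sm y0 y1 y2 y3 y4 y5 p' q') =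
    2 * (x0 * y0 + x1 * y1 + x2 * y2 + x3 * y3 + x4 * y4 + x5 * y5) + p * p' + q * q' + (p + q) * (p' + q')"
  by (simp add: trace_form_def sm_def trace_def sum_3 matrix_matrix_mult_def algebra_simps)

definition tau :: "int \<Rightarrow> int \<Rightarrow> real \<Rightarrow> real \<Rightarrow> real" where
  "tau k l p q = (of_int l * p - of_int k * q) / (2 * of_int (aw_Delta k l))"

lemma aw_coord_sm:
  "aw_coord k l 0 (sm x0 x1 x2 x3 x4 x5 p q) = x0" "aw_coord k l 1 (sm x0 x1 x2 x3 x4 x5 p q) = x1"
  "aw_coord k l 2 (sm x0 x1 x2 x3 x4 x5 p q) = x2" "aw_coord k l 3 (sm x0 x1 x2 x3 x4 x5 p q) = x3"
  "aw_coord k l 4 (sm x0 x1 x2 x3 x4 x5 p q) = x4" "aw_coord k l 5 (sm x0 x1 x2 x3 x4 x5 p q) = x5"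
  "aw_coord k l 6 (sm x0 x1 x2 x3 x4 x5 p q) = tau k l p q"
proof -
  have "trace_form (aw_basis k l 6) (aw_basis k l 6) = 3 * (2 * of_int (aw_Delta k l))"
    "trace_form (sm x0 x1 x2 x3 x4 x5 p q) (aw_basis k l 6) = 3 * (of_int l * p - of_int k * q)"
    by (simp_all add: aw_basis_sm trace_form_sm aw_Delta_def power2_eq_square algebra_simps)
  then show "aw_coord k l 6 (sm x0 x1 x2 x3 x4 x5 p q) = tau k l p q" 
    unfolding aw_coord_def tau_def by (simp only: mult_divide_mult_cancel_left_if) simp
qed (simp_all only: aw_coord_def aw_basis_sm trace_form_sm, simp_all)

lemma metric_entry_simps:
  "metric_entry (a, b, c, f) 0 = a\<^sup>2" "metric_entry (a, b, c, f) 1 = a\<^sup>2" "metric_entry (a, b, c, f) 2 = b\<^sup>2"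
  "metric_entry (a, b, c, f) 3 = b\<^sup>2" "metric_entry (a, b, c, f) 4 = c\<^sup>2" "metric_entry (a, b, c, f) 5 = c\<^sup>2"
  "metric_entry (a, b, c, f) 6 = f\<^sup>2"
  by (simp_all add: metric_entry_def nth7)

lemma aw_metric_sm: "aw_metric k l (a, b, c, f) (sm x0 x1 x2 x3 x4 x5 p q) (sm y0 y1 y2 y3 y4 y5 p' q') =
    a\<^sup>2 * (x0 * y0 + x1 * y1) + b\<^sup>2 * (x2 * y2 + x3 * y3) + c\<^sup>2 * (x4 * y4 + x5 * y5) + f\<^sup>2 * (tau k l p q * tau k l p' q')"
  unfolding aw_metric_def sum_lessThan_7 aw_coord_sm metric_entry_simps by (simp add: algebra_simps)

lemma lie_add: "lie (X + Y) Z = lie X Z + lie Y Z" "lie X (Y + Z) = lie X Y + lie X Z"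
  by (simp_all add: lie_def vec_eq_iff matrix_matrix_mult_def sum_3 algebra_simps)

lemma lie_diff: "lie (X - Y) Z = lie X Z - lie Y Z"
  by (simp add: lie_def vec_eq_iff matrix_matrix_mult_def sum_3 algebra_simps)

lemma lie_scale: "lie (c *\<^sub>R X) Y = c *\<^sub>R lie X Y" "lie X (c *\<^sub>R Y) = c *\<^sub>R lie X Y"
  by (simp_all add: lie_def vec_eq_iff matrix_matrix_mult_def sum_3 algebra_simps)

lemma trace_form_linear: "trace_form (X + Y) Z = trace_form X Z + trace_form Y Z" "trace_form (c *\<^sub>R X) Z = c * trace_form X Z"
  by (simp_all add: trace_form_def trace_def sum_3 matrix_matrix_mult_def algebra_simps)

lemma aw_coord_linear: "aw_coord k l j (X + Y) = aw_coord k l j X + aw_coord k l j Y" "aw_coord k l j (c *\<^sub>R X) = c * aw_coord k l j X"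
  by (simp_all add: aw_coord_def trace_form_linear add_divide_distrib)

lemma proj_m_linear: "proj_m k l (X + Y) = proj_m k l X + proj_m k l Y" "proj_m k l (c *\<^sub>R X) = c *\<^sub>R proj_m k l X"
  by (simp_all add: proj_m_def aw_coord_linear scaleR_add_left sum.distrib scaleR_sum_right)

lemma aw_metric_linear:
  "aw_metric k l h (X + Y) Z = aw_metric k l h X Z + aw_metric k l h Y Z" "aw_metric k l h (c *\<^sub>R X) Z = c * aw_metric k l h X Z"
  "aw_metric k l h Z (X + Y) = aw_metric k l h Z X + aw_metric k l h Z Y" "aw_metric k l h Z (c *\<^sub>R X) = c * aw_metric k l h Z X"
  by (simp_all add: aw_metric_def aw_coord_linear sum.distrib[symmetric] sum_distrib_left algebra_simps)

lemma aw_U_linear: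
  "aw_U k l h (X + Y) Z = aw_U k l h X Z + aw_U k l h Y Z" "aw_U k l h (c *\<^sub>R X) Z = c *\<^sub>R aw_U k l h X Z"
  "aw_U k l h Z (X + Y) = aw_U k l h Z X + aw_U k l h Z Y" "aw_U k l h Z (c *\<^sub>R X) = c *\<^sub>R aw_U k l h Z X"
  unfolding aw_U_def scaleR_sum_right sum.distrib[symmetric]
  by (rule sum.cong[OF refl],
      simp add: aw_metric_linear lie_add lie_scale flip: scaleR_add_left add_divide_distrib distrib_left)+

lemma aw_nabla_linear:
  "aw_nabla k l h (X + Y) Z = aw_nabla k l h X Z + aw_nabla k l h Y Z" "aw_nabla k l h (c *\<^sub>R X) Z = c *\<^sub>R aw_nabla k l h X Z"
  "aw_nabla k l h Z (X + Y) = aw_nabla k l h Z X + aw_nabla k l h Z Y" "aw_nabla k l h Z (c *\<^sub>R X) = c *\<^sub>R aw_nabla k l h Z X"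
  by (simp_all add: aw_nabla_def aw_U_linear lie_add lie_scale proj_m_linear algebra_simps)

lemma aw_curvature_linear:
  "aw_curvature k l h V (X + Y) Z = aw_curvature k l h V X Z + aw_curvature k l h V Y Z"
  "aw_curvature k l h V (c *\<^sub>R X) Z = c *\<^sub>R aw_curvature k l h V X Z"
  "aw_curvature k l h V Z (X + Y) = aw_curvature k l h V Z X + aw_curvature k l h V Z Y"
  "aw_curvature k l h V Z (c *\<^sub>R X) = c *\<^sub>R aw_curvature k l h V Z X"
  by (simp_all add: aw_curvature_def aw_nabla_linear lie_add lie_diff lie_scale proj_m_linear algebra_simps)

lemma aw_ricci_linear:
  "aw_ricci k l h (X + Y) Z = aw_ricci k l h X Z + aw_ricci k l h Y Z" "aw_ricci k l h (c *\<^sub>R X) Z = c * aw_ricci k l h X Z"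
  "aw_ricci k l h Z (X + Y) = aw_ricci k l h Z X + aw_ricci k l h Z Y" "aw_ricci k l h Z (c *\<^sub>R X) = c * aw_ricci k l h Z X"
  by (simp_all add: aw_ricci_def aw_curvature_linear aw_coord_linear sum.distrib sum_distrib_left)

section \<open>Connection and Ricci tensor of an invariant metric\<close>

locale invariant_metric =
  fixes k l :: int and a b c f :: real
  assumes Delta: "aw_Delta k l \<noteq> 0" and pos: "0 < a" "0 < b" "0 < c" "0 < f"
begin

abbreviation "K \<equiv> real_of_int k"
abbreviation "L \<equiv> real_of_int l"

definition "be = L / (2 * of_int (aw_Delta k l))"
definition "ga = K / (2 * of_int (aw_Delta k l))"
text \<open>The \<open>u1\<close>-component of the diagonal matrix i diag(p, q, - p - q): its inner
  product with i diag(k, l, -(k + l)) divided by the squared norm 2 * Delta of the latter.\<close>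

definition "vert p q = (p * K + q * L + (p + q) * (K + L)) / (2 * of_int (aw_Delta k l))"

definition hs :: "real \<Rightarrow> real \<Rightarrow> real \<Rightarrow> real \<Rightarrow> real \<Rightarrow> real \<Rightarrow> real \<Rightarrow> cmat3" where
  "hs x0 x1 x2 x3 x4 x5 t = sm x0 x1 x2 x3 x4 x5 ((K + 2 * L) * t) (- (2 * K + L) * t)"

lemma hs_add: "hs x0 x1 x2 x3 x4 x5 t + hs y0 y1 y2 y3 y4 y5 u = hs (x0 + y0) (x1 + y1) (x2 + y2) (x3 + y3) (x4 + y4) (x5 + y5) (t + u)"
  by (simp add: hs_def sm_add algebra_simps)

lemma hs_scale: "r *\<^sub>R hs x0 x1 x2 x3 x4 x5 t = hs (r * x0) (r * x1) (r * x2) (r * x3) (r * x4) (r * x5) (r * t)"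
  by (simp add: hs_def sm_scale algebra_simps)

lemma hs_diff: "hs x0 x1 x2 x3 x4 x5 t - hs y0 y1 y2 y3 y4 y5 u = hs (x0 - y0) (x1 - y1) (x2 - y2) (x3 - y3) (x4 - y4) (x5 - y5) (t - u)"
proof -
  have n: "- hs y0 y1 y2 y3 y4 y5 u = hs (- y0) (- y1) (- y2) (- y3) (- y4) (- y5) (- u)"
    using hs_scale[of "- 1" y0 y1 y2 y3 y4 y5 u] by simp
  show ?thesis unfolding diff_conv_add_uminus n hs_add ..
qed

lemma basis_hs: "aw_basis k l 0 = hs 1 0 0 0 0 0 0" "aw_basis k l 1 = hs 0 1 0 0 0 0 0" "aw_basis k l 2 = hs 0 0 1 0 0 0 0"
  "aw_basis k l 3 = hs 0 0 0 1 0 0 0" "aw_basis k l 4 = hs 0 0 0 0 1 0 0" "aw_basis k l 5 = hs 0 0 0 0 0 1 0" "aw_basis k l 6 = hs 0 0 0 0 0 0 1"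
  by (simp_all only: aw_basis_sm hs_def) (simp_all add: sm_eq_iff)

lemma Delta_real: "real_of_int (aw_Delta k l) = K\<^sup>2 + K * L + L\<^sup>2" "K\<^sup>2 + K * L + L\<^sup>2 \<noteq> 0"
proof -
  show "real_of_int (aw_Delta k l) = K\<^sup>2 + K * L + L\<^sup>2" by (simp add: aw_Delta_def)
  then show "K\<^sup>2 + K * L + L\<^sup>2 \<noteq> 0" using Delta by (metis of_int_eq_0_iff)
qed

lemma tau_eq: "tau k l p q = be * p - ga * q"
  by (simp add: tau_def be_def ga_def diff_divide_distrib)

lemma coupling_1: "be * (K + 2 * L) + ga * (2 * K + L) = 1"
  unfolding be_def ga_def Delta_real(1) using Delta_real(2) by (simp add: divide_simps) (simp add: algebra_simps power2_eq_square)

lemma tau_hs: "tau k l ((K + 2 * L) * t) (- (2 * K + L) * t) = t"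
proof -
  have "tau k l ((K + 2 * L) * t) (- (2 * K + L) * t) = (be * (K + 2 * L) + ga * (2 * K + L)) * t"
    by (simp add: tau_eq algebra_simps)
  then show ?thesis by (simp add: coupling_1)
qed

lemma coord_hs: "aw_coord k l 0 (hs x0 x1 x2 x3 x4 x5 t) = x0" "aw_coord k l 1 (hs x0 x1 x2 x3 x4 x5 t) = x1"
  "aw_coord k l 2 (hs x0 x1 x2 x3 x4 x5 t) = x2" "aw_coord k l 3 (hs x0 x1 x2 x3 x4 x5 t) = x3"
  "aw_coord k l 4 (hs x0 x1 x2 x3 x4 x5 t) = x4" "aw_coord k l 5 (hs x0 x1 x2 x3 x4 x5 t) = x5"
  "aw_coord k l 6 (hs x0 x1 x2 x3 x4 x5 t) = t"
  by (simp_all only: hs_def aw_coord_sm tau_hs)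

lemma proj_m_sm: "proj_m k l (sm x0 x1 x2 x3 x4 x5 p q) = hs x0 x1 x2 x3 x4 x5 (be * p - ga * q)"
  unfolding proj_m_def sum_lessThan_7 aw_coord_sm basis_hs hs_scale hs_add tau_eq by simp

lemma metric_hs: "aw_metric k l (a, b, c, f) (sm x0 x1 x2 x3 x4 x5 p q) (hs y0 y1 y2 y3 y4 y5 u) =
    a\<^sup>2 * (x0 * y0 + x1 * y1) + b\<^sup>2 * (x2 * y2 + x3 * y3) + c\<^sup>2 * (x4 * y4 + x5 * y5) + f\<^sup>2 * ((be * p - ga * q) * u)"
  "aw_metric k l (a, b, c, f) (hs y0 y1 y2 y3 y4 y5 u) (sm x0 x1 x2 x3 x4 x5 p q) =
    a\<^sup>2 * (x0 * y0 + x1 * y1) + b\<^sup>2 * (x2 * y2 + x3 * y3) + c\<^sup>2 * (x4 * y4 + x5 * y5) + f\<^sup>2 * ((be * p - ga * q) * u)"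
  unfolding hs_def aw_metric_sm tau_hs unfolding tau_eq by (simp_all add: mult_ac)

lemma lie_hs: "lie (hs x0 x1 x2 x3 x4 x5 t) (hs y0 y1 y2 y3 y4 y5 u) =
    sm (3 * (K + L) * (u * x1 - t * y1) - (x2 * y4 + x3 * y5) + (y2 * x4 + y3 * x5))
       (3 * (K + L) * (t * y0 - u * x0) - (x3 * y4 - x2 * y5) + (y3 * x4 - y2 * x5))
       (3 * L * (u * x3 - t * y3) + (x0 * y4 - x1 * y5) - (y0 * x4 - y1 * x5))
       (3 * L * (t * y2 - u * x2) + (x0 * y5 + x1 * y4) - (y0 * x5 + y1 * x4))
       (3 * K * (t * y5 - u * x5) - (x0 * y2 + x1 * y3) + (y0 * x2 + y1 * x3))
       (3 * K * (u * x4 - t * y4) - (x0 * y3 - x1 * y2) + (y0 * x3 - y1 * x2))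
       (2 * (x0 * y1 - x1 * y0 + x2 * y3 - x3 * y2))
       (2 * (x1 * y0 - x0 * y1 + x4 * y5 - x5 * y4))"
  unfolding hs_def lie_sm sm_eq_iff by (simp add: algebra_simps)

text \<open>Coefficients of the Levi-Civita connection. \<open>na1\<close> to \<open>nc2\<close>
  couple the three planes with each other, \<open>fa\<close>, \<open>fb\<close>, \<open>fc\<close>
  come from differentiating the fibre direction along a plane, and \<open>n6a\<close>,
  \<open>n6b\<close>, \<open>n6c\<close> rotate the planes along the fibre. Keeping them opaque
  keeps the curvature terms small.\<close>

definition "na1 = (a\<^sup>2 + c\<^sup>2 - b\<^sup>2) / (2 * a\<^sup>2)"
definition "na2 = (a\<^sup>2 + b\<^sup>2 - c\<^sup>2) / (2 * a\<^sup>2)"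
definition "nb1 = (b\<^sup>2 + c\<^sup>2 - a\<^sup>2) / (2 * b\<^sup>2)"
definition "nb2 = (a\<^sup>2 + b\<^sup>2 - c\<^sup>2) / (2 * b\<^sup>2)"
definition "nc1 = (b\<^sup>2 + c\<^sup>2 - a\<^sup>2) / (2 * c\<^sup>2)"
definition "nc2 = (a\<^sup>2 + c\<^sup>2 - b\<^sup>2) / (2 * c\<^sup>2)"
definition "fa = (be + ga) * f\<^sup>2 / a\<^sup>2"
definition "fb = be * f\<^sup>2 / b\<^sup>2"
definition "fc = ga * f\<^sup>2 / c\<^sup>2"
definition "n6a = 3 * (K + L) - fa"
definition "n6b = 3 * L - fb"
definition "n6c = 3 * K - fc"

lemma nabla_hs: "aw_nabla k l (a, b, c, f) (hs x0 x1 x2 x3 x4 x5 t) (hs y0 y1 y2 y3 y4 y5 u) =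
    hs (fa * (x1 * u) - na1 * (x2 * y4 + x3 * y5) + na2 * (x4 * y2 + x5 * y3) - n6a * (t * y1))
       (- fa * (x0 * u) + na1 * (x2 * y5 - x3 * y4) + na2 * (x4 * y3 - x5 * y2) + n6a * (t * y0))
       (nb1 * (x0 * y4 - x1 * y5) + fb * (x3 * u) + nb2 * (x5 * y1 - x4 * y0) - n6b * (t * y3))
       (nb1 * (x0 * y5 + x1 * y4) - fb * (x2 * u) - nb2 * (x4 * y1 + x5 * y0) + n6b * (t * y2))
       (- nc1 * (x0 * y2 + x1 * y3) + nc2 * (x2 * y0 + x3 * y1) - fc * (x5 * u) + n6c * (t * y5))
       (nc1 * (x1 * y2 - x0 * y3) + nc2 * (x3 * y0 - x2 * y1) + fc * (x4 * u) - n6c * (t * y4))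
       ((be + ga) * (x0 * y1 - x1 * y0) + be * (x2 * y3 - x3 * y2) - ga * (x4 * y5 - x5 * y4))"
proof -
  have nz: "a \<noteq> 0" "b \<noteq> 0" "c \<noteq> 0" "f \<noteq> 0" using pos by auto
  have cong: "hs x0 x1 x2 x3 x4 x5 t = hs y0 y1 y2 y3 y4 y5 u"
    if "x0 = y0" "x1 = y1" "x2 = y2" "x3 = y3" "x4 = y4" "x5 = y5" "t = u" for x0 x1 x2 x3 x4 x5 t y0 y1 y2 y3 y4 y5 u
    using that by simp
  show ?thesis
    unfolding aw_nabla_def aw_U_def sum_lessThan_7 metric_entry_simps lie_hs proj_m_sm basis_hs metric_hs hs_scale hs_add
    by (rule cong; simp add: na1_def na2_def nb1_def nb2_def nc1_def nc2_def fa_def fb_def fc_def n6a_def n6b_def n6c_def nz power2_eq_square divide_simps;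
        simp add: algebra_simps)
qed

text \<open>The isotropy term of the curvature: the \<open>u1\<close>-part of a bracket rotates the
  three planes with the weights k - l, 2k + l, k + 2l and annihilates the fibre direction.\<close>

lemma lie_vertical:
  "lie (sm x0 x1 x2 x3 x4 x5 p q - hs x0 x1 x2 x3 x4 x5 (be * p - ga * q)) (hs y0 y1 y2 y3 y4 y5 u) =
    hs (- ((K - L) * vert p q * y1)) ((K - L) * vert p q * y0) (- ((2 * K + L) * vert p q * y3)) ((2 * K + L) * vert p q * y2)
      (- ((K + 2 * L) * vert p q * y5)) ((K + 2 * L) * vert p q * y4) 0"
proof -
  have d: "p - (K + 2 * L) * (be * p - ga * q) = vert p q * K" "q + (2 * K + L) * (be * p - ga * q) = vert p q * L"
    unfolding be_def ga_def vert_def Delta_real(1) using Delta_real(2)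
    by (simp_all add: divide_simps) (simp_all add: algebra_simps power2_eq_square)
  have m: "- X = (- 1) *\<^sub>R X" for X :: cmat3 by simp
  have "sm x0 x1 x2 x3 x4 x5 p q - hs x0 x1 x2 x3 x4 x5 (be * p - ga * q) =
      sm 0 0 0 0 0 0 (p - (K + 2 * L) * (be * p - ga * q)) (q + (2 * K + L) * (be * p - ga * q))"
    unfolding hs_def diff_conv_add_uminus m sm_scale sm_add sm_eq_iff by (simp add: algebra_simps)
  then have e: "sm x0 x1 x2 x3 x4 x5 p q - hs x0 x1 x2 x3 x4 x5 (be * p - ga * q) = sm 0 0 0 0 0 0 (vert p q * K) (vert p q * L)"
    unfolding d .
  show ?thesis unfolding e unfolding hs_def lie_sm sm_eq_iff by (simp add: algebra_simps)
qed

lemmas curvature_rules = aw_curvature_def nabla_hs lie_hs proj_m_sm lie_vertical hs_diff coord_hs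

lemma vert_simps: "vert 0 0 = 0" "vert (- 2) 2 = - vert 2 (- 2)" "vert (- 2) 0 = - vert 2 0" "vert 0 (- 2) = - vert 0 2"
proof -
  have "vert (- p) (- q) = - vert p q" for p q
  proof -
    have "- p * K + - q * L + (- p + - q) * (K + L) = - (p * K + q * L + (p + q) * (K + L))" by algebra
    then show ?thesis unfolding vert_def minus_divide_left by (rule arg_cong)
  qed
  from this[of 2 "- 2"] this[of 2 0] this[of 0 2]
  show "vert (- 2) 2 = - vert 2 (- 2)" "vert (- 2) 0 = - vert 2 0" "vert 0 (- 2) = - vert 0 2" by simp_all
qed (simp add: vert_def)

text \<open>For the basis e, e' of each plane [e, [e, e']] = - 4 e'. Splitting [e, e'] into its
  fibre and isotropy parts, the two contributions must add up to 4 whatever k and l are.\<close>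

lemma coupling_2: "6 * (be + ga) * (K + L) + (K - L) * vert 2 (- 2) = 4" "6 * be * L + (2 * K + L) * vert 2 0 = 4"
  "6 * ga * K + (K + 2 * L) * vert 0 2 = 4"
  unfolding be_def ga_def vert_def Delta_real(1) using Delta_real(2)
  by (simp_all add: divide_simps) (simp_all add: algebra_simps power2_eq_square)

text \<open>Ricci curvature on the basis vectors, not on unit vectors, so the Einstein condition
  reads ric_a = E a^2 and so on.\<close>

definition "ric_a = 2 * (nb2 + nc2 - nb2 * nc1 - nb1 * nc2) + 4 - 2 * (be + ga) * fa"
definition "ric_b = 2 * (na2 + nc1 - na1 * nc1 - na2 * nc2) + 4 - 2 * be * fb"
definition "ric_c = 2 * (na1 + nb1 - na1 * nb2 - na2 * nb1) + 4 - 2 * ga * fc"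
definition "ric_f = 2 * (fa\<^sup>2 + fb\<^sup>2 + fc\<^sup>2)"

lemma ricci_diagonal:
  "aw_ricci k l (a, b, c, f) (aw_basis k l 0) (aw_basis k l 0) = ric_a"
  "aw_ricci k l (a, b, c, f) (aw_basis k l 1) (aw_basis k l 1) = ric_a"
  "aw_ricci k l (a, b, c, f) (aw_basis k l 2) (aw_basis k l 2) = ric_b"
  "aw_ricci k l (a, b, c, f) (aw_basis k l 3) (aw_basis k l 3) = ric_b"
  "aw_ricci k l (a, b, c, f) (aw_basis k l 4) (aw_basis k l 4) = ric_c"
  "aw_ricci k l (a, b, c, f) (aw_basis k l 5) (aw_basis k l 5) = ric_c"
  "aw_ricci k l (a, b, c, f) (aw_basis k l 6) (aw_basis k l 6) = ric_f"
  unfolding aw_ricci_def sum_lessThan_7 basis_hs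
  by (simp_all only: curvature_rules, simp_all add: vert_simps)
    (use coupling_2 in \<open>simp_all add: ric_a_def ric_b_def ric_c_def ric_f_def n6a_def n6b_def n6c_def power2_eq_square algebra_simps\<close>)

text \<open>Obtained by direct evaluation in the basis, like the diagonal entries, rather than from
  the inequivalence of the isotropy summands.\<close>

lemma ricci_off_diagonal:
  "aw_ricci k l (a, b, c, f) (aw_basis k l 0) (aw_basis k l 1) = 0"
  "aw_ricci k l (a, b, c, f) (aw_basis k l 0) (aw_basis k l 2) = 0"
  "aw_ricci k l (a, b, c, f) (aw_basis k l 0) (aw_basis k l 3) = 0"
  "aw_ricci k l (a, b, c, f) (aw_basis k l 0) (aw_basis k l 4) = 0"
  "aw_ricci k l (a, b, c, f) (aw_basis k l 0) (aw_basis k l 5) = 0"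
  "aw_ricci k l (a, b, c, f) (aw_basis k l 0) (aw_basis k l 6) = 0"
  "aw_ricci k l (a, b, c, f) (aw_basis k l 1) (aw_basis k l 0) = 0"
  "aw_ricci k l (a, b, c, f) (aw_basis k l 1) (aw_basis k l 2) = 0"
  "aw_ricci k l (a, b, c, f) (aw_basis k l 1) (aw_basis k l 3) = 0"
  "aw_ricci k l (a, b, c, f) (aw_basis k l 1) (aw_basis k l 4) = 0"
  "aw_ricci k l (a, b, c, f) (aw_basis k l 1) (aw_basis k l 5) = 0"
  "aw_ricci k l (a, b, c, f) (aw_basis k l 1) (aw_basis k l 6) = 0"
  "aw_ricci k l (a, b, c, f) (aw_basis k l 2) (aw_basis k l 0) = 0"
  "aw_ricci k l (a, b, c, f) (aw_basis k l 2) (aw_basis k l 1) = 0"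
  "aw_ricci k l (a, b, c, f) (aw_basis k l 2) (aw_basis k l 3) = 0"
  "aw_ricci k l (a, b, c, f) (aw_basis k l 2) (aw_basis k l 4) = 0"
  "aw_ricci k l (a, b, c, f) (aw_basis k l 2) (aw_basis k l 5) = 0"
  "aw_ricci k l (a, b, c, f) (aw_basis k l 2) (aw_basis k l 6) = 0"
  "aw_ricci k l (a, b, c, f) (aw_basis k l 3) (aw_basis k l 0) = 0"
  "aw_ricci k l (a, b, c, f) (aw_basis k l 3) (aw_basis k l 1) = 0"
  "aw_ricci k l (a, b, c, f) (aw_basis k l 3) (aw_basis k l 2) = 0"
  "aw_ricci k l (a, b, c, f) (aw_basis k l 3) (aw_basis k l 4) = 0"
  "aw_ricci k l (a, b, c, f) (aw_basis k l 3) (aw_basis k l 5) = 0"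
  "aw_ricci k l (a, b, c, f) (aw_basis k l 3) (aw_basis k l 6) = 0"
  "aw_ricci k l (a, b, c, f) (aw_basis k l 4) (aw_basis k l 0) = 0"
  "aw_ricci k l (a, b, c, f) (aw_basis k l 4) (aw_basis k l 1) = 0"
  "aw_ricci k l (a, b, c, f) (aw_basis k l 4) (aw_basis k l 2) = 0"
  "aw_ricci k l (a, b, c, f) (aw_basis k l 4) (aw_basis k l 3) = 0"
  "aw_ricci k l (a, b, c, f) (aw_basis k l 4) (aw_basis k l 5) = 0"
  "aw_ricci k l (a, b, c, f) (aw_basis k l 4) (aw_basis k l 6) = 0"
  "aw_ricci k l (a, b, c, f) (aw_basis k l 5) (aw_basis k l 0) = 0"
  "aw_ricci k l (a, b, c, f) (aw_basis k l 5) (aw_basis k l 1) = 0"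
  "aw_ricci k l (a, b, c, f) (aw_basis k l 5) (aw_basis k l 2) = 0"
  "aw_ricci k l (a, b, c, f) (aw_basis k l 5) (aw_basis k l 3) = 0"
  "aw_ricci k l (a, b, c, f) (aw_basis k l 5) (aw_basis k l 4) = 0"
  "aw_ricci k l (a, b, c, f) (aw_basis k l 5) (aw_basis k l 6) = 0"
  "aw_ricci k l (a, b, c, f) (aw_basis k l 6) (aw_basis k l 0) = 0"
  "aw_ricci k l (a, b, c, f) (aw_basis k l 6) (aw_basis k l 1) = 0"
  "aw_ricci k l (a, b, c, f) (aw_basis k l 6) (aw_basis k l 2) = 0"
  "aw_ricci k l (a, b, c, f) (aw_basis k l 6) (aw_basis k l 3) = 0"
  "aw_ricci k l (a, b, c, f) (aw_basis k l 6) (aw_basis k l 4) = 0"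
  "aw_ricci k l (a, b, c, f) (aw_basis k l 6) (aw_basis k l 5) = 0"
  unfolding aw_ricci_def sum_lessThan_7 basis_hs
  by (simp_all only: curvature_rules, simp_all add: vert_simps)

lemma metric_basis:
  "aw_metric k l (a, b, c, f) (hs x0 x1 x2 x3 x4 x5 t) (hs y0 y1 y2 y3 y4 y5 u) =
    a\<^sup>2 * (x0 * y0 + x1 * y1) + b\<^sup>2 * (x2 * y2 + x3 * y3) + c\<^sup>2 * (x4 * y4 + x5 * y5) + f\<^sup>2 * (t * u)"
  by (simp only: hs_def aw_metric_sm tau_hs)

lemma einsteinI:
  assumes "ric_a = E * a\<^sup>2" "ric_b = E * b\<^sup>2" "ric_c = E * c\<^sup>2" "ric_f = E * f\<^sup>2"
  shows "einstein_with_constant k l E (a, b, c, f)"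
proof -
  define B where "B = aw_basis k l ` {..<7}"
  have basis: "B = {aw_basis k l 0, aw_basis k l 1, aw_basis k l 2, aw_basis k l 3, aw_basis k l 4, aw_basis k l 5, aw_basis k l 6}"
    by (auto simp: B_def numeral_eq_Suc lessThan_Suc)
  define F where "F X Y = aw_ricci k l (a, b, c, f) X Y - E * aw_metric k l (a, b, c, f) X Y" for X Y
  have lin: "F (X + Y) Z = F X Z + F Y Z" "F (r *\<^sub>R X) Z = r * F X Z" "F Z (X + Y) = F Z X + F Z Y" "F Z (r *\<^sub>R X) = r * F Z X" for X Y Z r
    by (simp_all add: F_def aw_ricci_linear aw_metric_linear algebra_simps)
  have zero: "F X 0 = 0" "F 0 X = 0" for X using lin(4)[of X 0 0] lin(2)[of 0 0 X] by simp_all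
  have 1: "F X Y = 0" if "X \<in> B" "Y \<in> B" for X Y
    using that unfolding basis F_def
    by (elim insertE emptyE; hypsubst; simp only: ricci_diagonal ricci_off_diagonal assms; simp only: basis_hs metric_basis; simp)
  have 2: "F X Y = 0" if "X \<in> span B" "Y \<in> B" for X Y
    using that(1) by (induction X rule: span_induct_alt) (use that(2) in \<open>simp_all add: lin zero 1\<close>)
  have "F X Y = 0" if "X \<in> span B" "Y \<in> span B" for X Y
    using that(2) by (induction Y rule: span_induct_alt) (use that(1) in \<open>simp_all add: lin zero 2\<close>)
  then show ?thesis using pos by (simp add: einstein_with_constant_def aw_m_def pos_coeffs_def F_def B_def)
qed

text \<open>In P, Q, W, A, B, C the cone equations are linear (\<open>l1\<close>), with the single
  quadratic relation A P = B Q + C W, which expresses that the weight of the first plane is the sum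
  of the other two. The four Einstein equations follow from these by polynomial algebra.\<close>

lemma spin7_cone_einstein:
  assumes \<epsilon>: "\<epsilon> \<in> {1, - 1}" and cone: "spin7_rhs k l \<epsilon> (a, b, c, f) = (a, b, c, f)"
  shows "einstein_with_constant k l 6 (a, b, c, f)"
proof -
  define P Q W where "P = a / (b * c)" and "Q = b / (a * c)" and "W = c / (a * b)"
  define A B C where "A = \<epsilon> * (be + ga) * (f / a\<^sup>2)" and "B = \<epsilon> * be * (f / b\<^sup>2)" and "C = \<epsilon> * ga * (f / c\<^sup>2)"
  have nz: "a \<noteq> 0" "b \<noteq> 0" "c \<noteq> 0" "f \<noteq> 0" using pos by auto
  have al: "real_of_int (k + l) / (2 * real_of_int (aw_Delta k l)) = be + ga"
    by (simp add: be_def ga_def add_divide_distrib)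
  have "a * (Q + W - P - A) = a * 1" "b * (W + P - Q + B) = b * 1" "c * (P + Q - W + C) = c * 1" "f * (A - B - C) = f * 1"
    using cone unfolding spin7_rhs_def al be_def[symmetric] ga_def[symmetric] P_def Q_def W_def A_def B_def C_def
    by (simp_all add: mult_ac)
  then have l1: "Q + W - P - A = 1" "W + P - Q + B = 1" "P + Q - W + C = 1" "A - B - C = 1" using nz by simp_all
  have s: "A * P = B * Q + C * W"
    using nz by (simp add: A_def B_def C_def P_def Q_def W_def field_simps power2_eq_square)
  \<comment> \<open>Curvature involves the fibre weights only through squares, so both chiralities
    give the same Einstein equations.\<close>
  have \<epsilon>2: "\<epsilon>\<^sup>2 = 1" using \<epsilon> by auto
  have x: "P\<^sup>2 - Q\<^sup>2 - W\<^sup>2 + 6 * (Q * W) - 2 * A\<^sup>2 = 6" "Q\<^sup>2 - P\<^sup>2 - W\<^sup>2 + 6 * (P * W) - 2 * B\<^sup>2 = 6"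
    "W\<^sup>2 - P\<^sup>2 - Q\<^sup>2 + 6 * (P * Q) - 2 * C\<^sup>2 = 6" "2 * (A\<^sup>2 + B\<^sup>2 + C\<^sup>2) = 6"
    using l1 s by algebra+
  have f2: "(be + ga) * fa = a\<^sup>2 * A\<^sup>2" "be * fb = b\<^sup>2 * B\<^sup>2" "ga * fc = c\<^sup>2 * C\<^sup>2"
    "fa\<^sup>2 = f\<^sup>2 * A\<^sup>2" "fb\<^sup>2 = f\<^sup>2 * B\<^sup>2" "fc\<^sup>2 = f\<^sup>2 * C\<^sup>2"
    using nz by (simp_all add: fa_def fb_def fc_def A_def B_def C_def power_mult_distrib power_divide \<epsilon>2) (simp_all add: field_simps eval_nat_numeral)
  have ra: "ric_a = a\<^sup>2 * (P\<^sup>2 - Q\<^sup>2 - W\<^sup>2 + 6 * (Q * W) - 2 * A\<^sup>2)"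
  proof -
    have "2 * (nb2 + nc2 - nb2 * nc1 - nb1 * nc2) + 4 = a\<^sup>2 * (P\<^sup>2 - Q\<^sup>2 - W\<^sup>2 + 6 * (Q * W))"
      using nz by (simp add: nb1_def nb2_def nc1_def nc2_def P_def Q_def W_def power_divide power_mult_distrib divide_simps)
        (simp add: algebra_simps eval_nat_numeral)
    then show ?thesis unfolding ric_a_def using f2(1) by (simp add: algebra_simps)
  qed
  have rb: "ric_b = b\<^sup>2 * (Q\<^sup>2 - P\<^sup>2 - W\<^sup>2 + 6 * (P * W) - 2 * B\<^sup>2)"
  proof -
    have "2 * (na2 + nc1 - na1 * nc1 - na2 * nc2) + 4 = b\<^sup>2 * (Q\<^sup>2 - P\<^sup>2 - W\<^sup>2 + 6 * (P * W))"
      using nz by (simp add: na1_def na2_def nc1_def nc2_def P_def Q_def W_def power_divide power_mult_distrib divide_simps)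
        (simp add: algebra_simps eval_nat_numeral)
    then show ?thesis unfolding ric_b_def using f2(2) by (simp add: algebra_simps)
  qed
  have rc: "ric_c = c\<^sup>2 * (W\<^sup>2 - P\<^sup>2 - Q\<^sup>2 + 6 * (P * Q) - 2 * C\<^sup>2)"
  proof -
    have "2 * (na1 + nb1 - na1 * nb2 - na2 * nb1) + 4 = c\<^sup>2 * (W\<^sup>2 - P\<^sup>2 - Q\<^sup>2 + 6 * (P * Q))"
      using nz by (simp add: na1_def na2_def nb1_def nb2_def P_def Q_def W_def power_divide power_mult_distrib divide_simps)
        (simp add: algebra_simps eval_nat_numeral)
    then show ?thesis unfolding ric_c_def using f2(3) by (simp add: algebra_simps)
  qed
  have rf: "ric_f = f\<^sup>2 * (2 * (A\<^sup>2 + B\<^sup>2 + C\<^sup>2))" unfolding ric_f_def f2(4-6) by (simp add: algebra_simps)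
  have "ric_a = 6 * a\<^sup>2" "ric_b = 6 * b\<^sup>2" "ric_c = 6 * c\<^sup>2" "ric_f = 6 * f\<^sup>2"
    unfolding ra rb rc rf x by simp_all
  then show ?thesis by (rule einsteinI)
qed

end

section \<open>Invariance of the cones\<close>

text \<open>With H spanning \<open>u1\<close> and \<phi> H = r H, the automorphism intertwines the
  square of ad H with itself up to the factor r^2. Its eigenvalues on the planes are - A, - B, - C,
  pairwise distinct with A smallest; this forces r^2 = 1, so that \<phi> preserves the planes. The
  bracket relations within a plane then fix the scale on it.\<close>

lemma not_equivariantly_homothetic:
  fixes k l :: int
  assumes kl: "0 < k" "0 < l" "k \<noteq> l" and pos: "pos_coeffs (a, b, c, f)" "pos_coeffs (a', b', c', f')"
    and ab: "b < a" "a' < b'"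
  shows "\<not> equivariantly_homothetic k l (a, b, c, f) (a', b', c', f')"
proof
  assume "equivariantly_homothetic k l (a, b, c, f) (a', b', c', f')"
  then obtain \<phi> s where *: "s > 0 \<and> linear \<phi> \<and> bij_betw \<phi> su3 su3 \<and>
      (\<forall>X\<in>su3. \<forall>Y\<in>su3. \<phi> (lie X Y) = lie (\<phi> X) (\<phi> Y)) \<and> \<phi> ` u1 k l = u1 k l \<and>
      (\<forall>X\<in>su3. \<forall>Y\<in>su3. aw_metric k l (a', b', c', f') (\<phi> X) (\<phi> Y) = s * aw_metric k l (a, b, c, f) X Y)"
    unfolding equivariantly_homothetic_def by (elim exE) (rule that)
  then have s: "0 < s" and lin: "linear \<phi>" and bij: "bij_betw \<phi> su3 su3" and u1: "\<phi> ` u1 k l = u1 k l" by simp_all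
  have br: "\<phi> (lie X Y) = lie (\<phi> X) (\<phi> Y)" if "X \<in> su3" "Y \<in> su3" for X Y using * that by blast
  have me: "aw_metric k l (a', b', c', f') (\<phi> X) (\<phi> Y) = s * aw_metric k l (a, b, c, f) X Y" if "X \<in> su3" "Y \<in> su3" for X Y
    using * that by blast
  have p: "0 < a" "0 < b" "0 < a'" "0 < b'" using pos by (auto simp: pos_coeffs_def)
  define K L where "K = real_of_int k" and "L = real_of_int l"
  have KL: "0 < K" "0 < L" "K \<noteq> L" using kl by (auto simp: K_def L_def)
  define A B C where "A = (K - L)\<^sup>2" and "B = (2 * K + L)\<^sup>2" and "C = (K + 2 * L)\<^sup>2"
  have ABC: "0 < A" "A < B" "A < C" "B \<noteq> C"
  proof -
    show "0 < A" using KL by (simp add: A_def)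
    have d: "B - A = 3 * (K * K) + 6 * (K * L)" "C - A = 3 * (L * L) + 6 * (K * L)" "B - C = 3 * ((K + L) * (K - L))"
      by (simp_all add: A_def B_def C_def power2_eq_square algebra_simps)
    have n: "0 < K * K" "0 < K * L" "0 < L * L" "(K + L) * (K - L) \<noteq> 0" using KL by auto
    show "A < B" using d(1) n(1,2) by linarith
    show "A < C" using d(2) n(2,3) by linarith
    show "B \<noteq> C"
    proof
      assume "B = C"
      then have "3 * ((K + L) * (K - L)) = 0" unfolding d(3)[symmetric] by simp
      then show False using n(4) by simp
    qed
  qed
  define H where "H = sm 0 0 0 0 0 0 K L"
  have Hs: "H \<in> su3" by (simp add: H_def sm_su3)
  have Hu: "u1 k l = span {H}" by (simp add: u1_def H_def idiag_sm K_def L_def)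
  have "\<phi> H \<in> span {H}" using u1 span_base[of H "{H}"] unfolding Hu by blast
  then obtain r where r: "\<phi> H = r *\<^sub>R H" by (auto simp: span_singleton)
  have scale: "\<phi> (z *\<^sub>R X) = z *\<^sub>R \<phi> X" for z X using lin by (rule linear_scale)
  have in_su3: "\<phi> X \<in> su3" if "X \<in> su3" for X using bij_betw_apply[OF bij that] .
  have su3_ex: "\<exists>x0 x1 x2 x3 x4 x5 p q. X = sm x0 x1 x2 x3 x4 x5 p q" if X: "X \<in> su3" for X
    by (rule su3_sm[OF X]) (intro exI)
  have lie_in: "lie X Y \<in> su3" if X: "X \<in> su3" and Y: "Y \<in> su3" for X Y
    by (rule su3_sm[OF X], rule su3_sm[OF Y]) (simp add: lie_sm sm_su3)
  have sc_in: "z *\<^sub>R X \<in> su3" if X: "X \<in> su3" for z X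
    by (rule su3_sm[OF X]) (simp add: sm_scale sm_su3)
  have adH: "lie H (lie H (sm x0 x1 x2 x3 x4 x5 p q)) =
      sm (- (A * x0)) (- (A * x1)) (- (B * x2)) (- (B * x3)) (- (C * x4)) (- (C * x5)) 0 0" for x0 x1 x2 x3 x4 x5 p q
    unfolding H_def lie_sm sm_eq_iff by (simp add: A_def B_def C_def power2_eq_square algebra_simps)
  have key: "(r * r) *\<^sub>R lie H (lie H (\<phi> X)) = \<phi> (lie H (lie H X))" if X: "X \<in> su3" for X
    by (simp add: br lie_in Hs X r lie_scale)
  have canc: "z = e" if "x * (- (a * y)) = - e * y" "y \<noteq> 0" "z = x * a" for x a y e z :: real
    using that by (simp add: mult.assoc[symmetric])
  \<comment> \<open>Coordinates of \<open>key\<close> are compared: a nonzero coordinate of \<phi> X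
    in a plane forces r^2 times the eigenvalue of that plane to be e, and e \<noteq> 0 excludes a
    diagonal part.\<close>
  have eig: "(y0 \<noteq> 0 \<longrightarrow> r * r * A = e) \<and> (y1 \<noteq> 0 \<longrightarrow> r * r * A = e) \<and> (y2 \<noteq> 0 \<longrightarrow> r * r * B = e) \<and> (y3 \<noteq> 0 \<longrightarrow> r * r * B = e) \<and>
      (y4 \<noteq> 0 \<longrightarrow> r * r * C = e) \<and> (y5 \<noteq> 0 \<longrightarrow> r * r * C = e) \<and> (e \<noteq> 0 \<longrightarrow> p = 0 \<and> q = 0)"
    if X: "X \<in> su3" and e: "lie H (lie H X) = (- e) *\<^sub>R X" and y: "\<phi> X = sm y0 y1 y2 y3 y4 y5 p q"
    for X e y0 y1 y2 y3 y4 y5 p q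
  proof -
    have E: "r * r * (- (A * y0)) = - e * y0 \<and> r * r * (- (A * y1)) = - e * y1 \<and> r * r * (- (B * y2)) = - e * y2 \<and> r * r * (- (B * y3)) = - e * y3 \<and>
      r * r * (- (C * y4)) = - e * y4 \<and> r * r * (- (C * y5)) = - e * y5 \<and> r * r * 0 = - e * p \<and> r * r * 0 = - e * q"
      using key[OF X] unfolding e scale y adH sm_scale sm_eq_iff .
    have "p = 0 \<and> q = 0" if "e \<noteq> 0"
    proof -
      have "- e * p = 0" "- e * q = 0" using E by (metis mult_zero_right)+
      then show ?thesis using that by simp
    qed
    then show ?thesis using E canc[of "r * r", OF _ _ refl] by blast
  qed
  have H0: "r \<noteq> 0"
  proof
    assume "r = 0"
    then have "\<phi> H = \<phi> (0 *\<^sub>R H)" by (simp only: scale r) simp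
    then have "H = 0 *\<^sub>R H" using bij Hs sc_in[OF Hs, of 0] unfolding bij_betw_def inj_on_def by blast
    then show False using KL by (simp add: H_def sm_scale sm_eq_iff)
  qed
  \<comment> \<open>The image of the first plane gives r^2 times one of A, B, C equal to A,
    impossible for r^2 > 1. Its preimage gives r^2 A equal to one of A, B, C, all of them at least
    A.\<close>
  have r1: "r * r = 1"
  proof (rule antisym)
    let ?X = "sm 1 0 0 0 0 0 0 0"
    obtain y0 y1 y2 y3 y4 y5 p q where y: "\<phi> ?X = sm y0 y1 y2 y3 y4 y5 p q" 
      using su3_ex[OF in_su3[OF sm_su3[of 1 0 0 0 0 0 0 0]]] by (elim exE) (rule that)
    have "lie H (lie H ?X) = (- A) *\<^sub>R ?X" by (simp add: adH sm_scale)
    note E = eig[OF sm_su3 this y]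
    have "A \<noteq> 0" using ABC(1) by simp
    then have pq: "p = 0" "q = 0" using E by blast+
    have "y0 \<noteq> 0 \<or> y1 \<noteq> 0 \<or> y2 \<noteq> 0 \<or> y3 \<noteq> 0 \<or> y4 \<noteq> 0 \<or> y5 \<noteq> 0"
    proof (rule ccontr)
      assume "\<not> ?thesis"
      then show False using me[OF sm_su3 sm_su3, of 1 0 0 0 0 0 0 0 1 0 0 0 0 0 0 0] s p(1)
        unfolding y pq aw_metric_sm by (simp add: tau_def)
    qed
    then have "r * r * A = A \<or> r * r * B = A \<or> r * r * C = A" using E by blast
    then show "r * r \<le> 1"
    proof (rule contrapos_pp)
      assume "\<not> r * r \<le> 1"
      then have g: "1 < r * r" by simp
      have "A < r * r * A" "A < r * r * B" "A < r * r * C"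
        using mult_strict_right_mono[OF g ABC(1)] less_trans[OF ABC(2) mult_strict_right_mono[OF g less_trans[OF ABC(1,2)], unfolded mult_1_left]]
          less_trans[OF ABC(3) mult_strict_right_mono[OF g less_trans[OF ABC(1,3)], unfolded mult_1_left]]
        by (simp_all only: mult_1_left)
      then show "\<not> (r * r * A = A \<or> r * r * B = A \<or> r * r * C = A)" by (metis less_irrefl)
    qed
  next
    let ?X = "sm 1 0 0 0 0 0 0 0"
    have "?X \<in> \<phi> ` su3" using bij sm_su3 by (simp add: bij_betw_def)
    then obtain X where X: "X \<in> su3" "\<phi> X = ?X" by (metis imageE)
    obtain x0 x1 x2 x3 x4 x5 p q where x: "X = sm x0 x1 x2 x3 x4 x5 p q" using su3_ex[OF X(1)] by (elim exE) (rule that)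
    have "\<phi> (lie H (lie H X)) = \<phi> ((- (r * r * A)) *\<^sub>R X)"
      unfolding key[OF X(1), symmetric] scale X(2) adH sm_scale by simp
    then have "lie H (lie H X) = (- (r * r * A)) *\<^sub>R X"
      using bij lie_in[OF Hs lie_in[OF Hs X(1)]] sc_in[OF X(1)] unfolding bij_betw_def inj_on_def by blast
    then have E: "- (A * x0) = - (r * r * A) * x0 \<and> - (A * x1) = - (r * r * A) * x1 \<and> - (B * x2) = - (r * r * A) * x2 \<and> - (B * x3) = - (r * r * A) * x3 \<and>
        - (C * x4) = - (r * r * A) * x4 \<and> - (C * x5) = - (r * r * A) * x5 \<and> 0 = - (r * r * A) * p \<and> 0 = - (r * r * A) * q"
      unfolding x adH sm_scale sm_eq_iff .
    have "r * r * A \<noteq> 0" using ABC(1) H0 by simp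
    moreover have "- (r * r * A) * p = 0" "- (r * r * A) * q = 0" using E by metis+
    ultimately have pq: "p = 0" "q = 0" by simp_all
    have canc2: "z = e" if "- (z * y) = - e * y" "y \<noteq> 0" for y e z :: real using that by simp
    have "x0 \<noteq> 0 \<or> x1 \<noteq> 0 \<or> x2 \<noteq> 0 \<or> x3 \<noteq> 0 \<or> x4 \<noteq> 0 \<or> x5 \<noteq> 0"
    proof (rule ccontr)
      assume "\<not> ?thesis"
      then show False using me[OF X(1) X(1)] p(3)
        unfolding X(2) unfolding x pq aw_metric_sm by (simp add: tau_def)
    qed
    then have "A = r * r * A \<or> B = r * r * A \<or> C = r * r * A" using E canc2 by blast
    then have "1 * A \<le> r * r * A" using ABC by auto
    then show "1 \<le> r * r" using ABC(1) by (rule mult_right_le_imp_le)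
  qed
  have V1: "\<exists>y0 y1. \<phi> (sm x0 x1 0 0 0 0 0 0) = sm y0 y1 0 0 0 0 0 0" for x0 x1
  proof -
    let ?X = "sm x0 x1 0 0 0 0 0 0"
    obtain y0 y1 y2 y3 y4 y5 p q where y: "\<phi> ?X = sm y0 y1 y2 y3 y4 y5 p q" 
      using su3_ex[OF in_su3[OF sm_su3[of x0 x1 0 0 0 0 0 0]]] by (elim exE) (rule that)
    have "lie H (lie H ?X) = (- A) *\<^sub>R ?X" by (simp add: adH sm_scale)
    note E = eig[OF sm_su3 this y, unfolded r1]
    have "y2 = 0" "y3 = 0" "y4 = 0" "y5 = 0" "p = 0" "q = 0" using E ABC by auto
    then show ?thesis using y by blast
  qed
  have V2: "\<exists>y0 y1. \<phi> (sm 0 0 x0 x1 0 0 0 0) = sm 0 0 y0 y1 0 0 0 0" for x0 x1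
  proof -
    let ?X = "sm 0 0 x0 x1 0 0 0 0"
    obtain y0 y1 y2 y3 y4 y5 p q where y: "\<phi> ?X = sm y0 y1 y2 y3 y4 y5 p q" 
      using su3_ex[OF in_su3[OF sm_su3[of 0 0 x0 x1 0 0 0 0]]] by (elim exE) (rule that)
    have "lie H (lie H ?X) = (- B) *\<^sub>R ?X" by (simp add: adH sm_scale)
    note E = eig[OF sm_su3 this y, unfolded r1]
    have "y0 = 0" "y1 = 0" "y4 = 0" "y5 = 0" "p = 0" "q = 0" using E ABC by auto
    then show ?thesis using y by blast
  qed
  \<comment> \<open>(y0, y1) and (z0, z1) are the images of the two basis vectors of a plane, and
    \<open>e\<close> is the image of [e0, [e0, e1]] = - 4 e1. It says that z is y rotated by a right
    angle and scaled by the determinant D, hence y has length 1 and the metric factor on the plane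
    is exactly s.\<close>
  have plane: "\<alpha>' = s * \<alpha>"
    if e: "- 4 * z0 = 4 * (y0 * z1 - y1 * z0) * y1" "- 4 * z1 = - (4 * (y0 * z1 - y1 * z0) * y0)"
      and m: "\<alpha>' * (y0 * y0 + y1 * y1) = s * \<alpha>" "\<alpha>' * (z0 * z0 + z1 * z1) = s * \<alpha>" and \<alpha>: "0 < \<alpha>"
    for \<alpha> \<alpha>' y0 y1 z0 z1 :: real
  proof -
    define D where "D = y0 * z1 - y1 * z0"
    have z: "z0 = - (D * y1)" "z1 = D * y0" using e unfolding D_def[symmetric] by linarith+
    have "D = D * (y0 * y0 + y1 * y1)" using D_def unfolding z by (simp add: algebra_simps)
    moreover have "D \<noteq> 0" using m(2) s \<alpha> unfolding z by auto
    ultimately have "y0 * y0 + y1 * y1 = 1" by simp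
    then show ?thesis using m(1) by simp
  qed
  have "a'\<^sup>2 = s * a\<^sup>2"
  proof -
    obtain y0 y1 where y: "\<phi> (sm 1 0 0 0 0 0 0 0) = sm y0 y1 0 0 0 0 0 0" using V1 by blast
    obtain z0 z1 where z: "\<phi> (sm 0 1 0 0 0 0 0 0) = sm z0 z1 0 0 0 0 0 0" using V1 by blast
    have "lie (sm 1 0 0 0 0 0 0 0) (lie (sm 1 0 0 0 0 0 0 0) (sm 0 1 0 0 0 0 0 0)) = (- 4) *\<^sub>R sm 0 1 0 0 0 0 0 0"
      unfolding lie_sm sm_scale sm_eq_iff by simp
    then have "(- 4) *\<^sub>R sm z0 z1 0 0 0 0 0 0 = lie (sm y0 y1 0 0 0 0 0 0) (lie (sm y0 y1 0 0 0 0 0 0) (sm z0 z1 0 0 0 0 0 0))"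
      using br[OF sm_su3 lie_in[OF sm_su3 sm_su3], of 1 0 0 0 0 0 0 0 1 0 0 0 0 0 0 0 0 1 0 0 0 0 0 0] br[OF sm_su3 sm_su3, of 1 0 0 0 0 0 0 0 0 1 0 0 0 0 0 0]
      by (simp only: scale y z)
    then have "- 4 * z0 = 4 * (y0 * z1 - y1 * z0) * y1 \<and> - 4 * z1 = - (4 * (y0 * z1 - y1 * z0) * y0)"
      unfolding lie_sm sm_scale sm_eq_iff by (simp add: algebra_simps)
    moreover have "a'\<^sup>2 * (y0 * y0 + y1 * y1) = s * a\<^sup>2" "a'\<^sup>2 * (z0 * z0 + z1 * z1) = s * a\<^sup>2"
      using me[OF sm_su3 sm_su3, of 1 0 0 0 0 0 0 0 1 0 0 0 0 0 0 0] me[OF sm_su3 sm_su3, of 0 1 0 0 0 0 0 0 0 1 0 0 0 0 0 0]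
      unfolding y z aw_metric_sm by (simp_all add: tau_def)
    ultimately show ?thesis using plane[of z0 y0 z1 y1 "a'\<^sup>2" "a\<^sup>2"] p(1) by auto
  qed
  moreover have "b'\<^sup>2 = s * b\<^sup>2"
  proof -
    obtain y0 y1 where y: "\<phi> (sm 0 0 1 0 0 0 0 0) = sm 0 0 y0 y1 0 0 0 0" using V2 by blast
    obtain z0 z1 where z: "\<phi> (sm 0 0 0 1 0 0 0 0) = sm 0 0 z0 z1 0 0 0 0" using V2 by blast
    have "lie (sm 0 0 1 0 0 0 0 0) (lie (sm 0 0 1 0 0 0 0 0) (sm 0 0 0 1 0 0 0 0)) = (- 4) *\<^sub>R sm 0 0 0 1 0 0 0 0"
      unfolding lie_sm sm_scale sm_eq_iff by simp
    then have "(- 4) *\<^sub>R sm 0 0 z0 z1 0 0 0 0 = lie (sm 0 0 y0 y1 0 0 0 0) (lie (sm 0 0 y0 y1 0 0 0 0) (sm 0 0 z0 z1 0 0 0 0))"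
      using br[OF sm_su3 lie_in[OF sm_su3 sm_su3], of 0 0 1 0 0 0 0 0 0 0 1 0 0 0 0 0 0 0 0 1 0 0 0 0] br[OF sm_su3 sm_su3, of 0 0 1 0 0 0 0 0 0 0 0 1 0 0 0 0]
      by (simp only: scale y z)
    then have "- 4 * z0 = 4 * (y0 * z1 - y1 * z0) * y1 \<and> - 4 * z1 = - (4 * (y0 * z1 - y1 * z0) * y0)"
      unfolding lie_sm sm_scale sm_eq_iff by (simp add: algebra_simps)
    moreover have "b'\<^sup>2 * (y0 * y0 + y1 * y1) = s * b\<^sup>2" "b'\<^sup>2 * (z0 * z0 + z1 * z1) = s * b\<^sup>2"
      using me[OF sm_su3 sm_su3, of 0 0 1 0 0 0 0 0 0 0 1 0 0 0 0 0] me[OF sm_su3 sm_su3, of 0 0 0 1 0 0 0 0 0 0 0 1 0 0 0 0]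
      unfolding y z aw_metric_sm by (simp_all add: tau_def)
    ultimately show ?thesis using plane[of z0 y0 z1 y1 "b'\<^sup>2" "b\<^sup>2"] p(2) by auto
  qed
  moreover have "b\<^sup>2 < a\<^sup>2" "a'\<^sup>2 < b'\<^sup>2" using ab p by (auto intro!: power_strict_mono)
  ultimately show False using mult_strict_left_mono[of "b\<^sup>2" "a\<^sup>2" s] s by simp
qed

section \<open>Cohomogeneity one metrics\<close>

lemma equal_growth_elimination:
  fixes u v X Y Z1 Z2 :: real
  assumes "u + v - 1 - Y = X" "1 + v - u + Z1 = X" "1 + u - v + Z2 = X" "Y - (Z1 + Z2) = X"
  shows "2 * (u - 1) = Y + Z1" "2 * (v - 1) = Y + Z2" "u + v - 3 = 2 * (Z1 + Z2)"
proof -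
  show 1: "2 * (u - 1) = Y + Z1" using assms(1,2) by (linarith | argo | algebra | smt (verit))
  show 2: "2 * (v - 1) = Y + Z2" using assms(1,3) by (linarith | argo | algebra | smt (verit))
  show "u + v - 3 = 2 * (Z1 + Z2)" using assms(1,4) 1 2 by (linarith | argo | algebra | smt (verit))
qed

text \<open>On a fixed point of the field the four t-logarithmic derivatives are 1, so
  \<open>lp\<close>, \<open>lq\<close>, \<open>lw\<close>, \<open>lf\<close> share one value X, and
  the critical equations follow by subtraction. The orderings p < q and p < w, from u > 1 and v > 1,
  will tell the two cones apart.\<close>

lemma cone_crit:
  assumes p: "0 < p" "0 < q" "0 < w" "0 < f" and C: "C < 1 / 2"
    and cone: "grhs 1 (1 - C) C (p, q, w, f) = (p, q, w, f)"
  defines "u \<equiv> q\<^sup>2 / p\<^sup>2" and "v \<equiv> w\<^sup>2 / p\<^sup>2" and "r \<equiv> f * p / (q * w)"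
  shows "crit C u v r" "(p, q, w, f) = coeffs (lw C u v r / sqrt u) u v r" "p < q" "0 < C \<Longrightarrow> p < w"
proof -
  have nz: "p \<noteq> 0" "q \<noteq> 0" "w \<noteq> 0" "f \<noteq> 0" using p by auto
  have uv: "0 < u" "0 < v" "0 < r" using p by (auto simp: u_def v_def r_def)
  have sq: "sqrt u = q / p" "sqrt v = w / p" using p by (auto simp: u_def v_def real_sqrt_divide)
  have co: "coeffs w u v r = (p, q, w, f)"
    unfolding coeffs_def sq r_def using nz by (simp add: field_simps)
  define X where "X = w * sqrt u"
  have X: "0 < X" using p by (simp add: X_def sq)
  have j: "w / sqrt v = p" "w * sqrt u / sqrt v = q" "r * sqrt u * w = f" using co by (simp_all add: coeffs_def)
  have "(p * (lp C u v r / X), q * (lq C u v r / X), w * (lw C u v r / X), f * (lf C u v r / X)) = (p, q, w, f)"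
    using grhs_coeffs[OF uv(1,2) p(3), of C r] unfolding co cone j unfolding X_def[symmetric] by (rule sym)
  then have "p * (lp C u v r / X) = p" "q * (lq C u v r / X) = q" "w * (lw C u v r / X) = w" "f * (lf C u v r / X) = f"
    unfolding prod.inject by blast+
  then have l: "lp C u v r = X" "lq C u v r = X" "lw C u v r = X" "lf C u v r = X"
    using nz X by (simp_all add: field_simps)
  define Y Z1 Z2 where "Y = r * u * v" and "Z1 = (1 - C) * r * v" and "Z2 = C * r * u"
  have e: "u + v - 1 - Y = X" "1 + v - u + Z1 = X" "1 + u - v + Z2 = X" "Y - (Z1 + Z2) = X"
    using l unfolding lp_def lq_def lw_def lf_def by (simp_all add: Y_def Z1_def Z2_def algebra_simps)
  have c: "crit C u v r"
  proof -
    have "r * v * (u + 1 - C) = Y + Z1" "r * u * (v + C) = Y + Z2" "2 * r * ((1 - C) * v + C * u) = 2 * (Z1 + Z2)"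
      by (simp_all add: Y_def Z1_def Z2_def algebra_simps)
    moreover have "2 * (u - 1) = Y + Z1" "2 * (v - 1) = Y + Z2" "u + v - 3 = 2 * (Z1 + Z2)" using equal_growth_elimination[OF e] by blast+
    ultimately show ?thesis unfolding crit_def using uv by simp
  qed
  then show "crit C u v r" .
  show "(p, q, w, f) = coeffs (lw C u v r / sqrt u) u v r"
  proof -
    have "lw C u v r / sqrt u = w" unfolding l X_def using uv by simp
    then show ?thesis using co by simp
  qed
  have "1 < u" by (rule crit_elimination(1)[OF c C])
  then have "p\<^sup>2 < q\<^sup>2" using p by (simp add: u_def)
  then show "p < q" using p by (simp add: power2_less_imp_less)
  show "p < w" if "0 < C"
  proof -
    have "2 * (v - 1) = r * u * (v + C)" using c by (simp add: crit_def)
    moreover have "0 < r * u * (v + C)" using uv that by simp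
    ultimately have "1 < v" by simp
    then have "p\<^sup>2 < w\<^sup>2" using p by (simp add: v_def)
    then show ?thesis using p by (simp add: power2_less_imp_less)
  qed
qed

lemma cone_unique:
  assumes C: "C < 1 / 2" and p: "0 < p" "0 < q" "0 < w" "0 < f" and cone: "grhs 1 (1 - C) C (p, q, w, f) = (p, q, w, f)"
    and p': "0 < p'" "0 < q'" "0 < w'" "0 < f'" and cone': "grhs 1 (1 - C) C (p', q', w', f') = (p', q', w', f')"
  shows "(p, q, w, f) = (p', q', w', f')"
  using crit_unique[OF C cone_crit(1)[OF p C cone] cone_crit(1)[OF p' C cone']] cone_crit(2)[OF p C cone] cone_crit(2)[OF p' C cone']
  by metis

text \<open>\<open>\<Phi>\<close> carries the abstract coefficients to (a, b, c, f) by permuting the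
  planes and rescaling the fibre; the assumptions \<open>fib\<close> and \<open>one\<close> state
  what that form implies for the ALC normalisation. Being linear, \<open>\<Phi>\<close> respects
  derivatives, limits and the scaling by 1/t.\<close>

lemma transported_family:
  fixes \<Phi> :: "real \<times> real \<times> real \<times> real \<Rightarrow> aw_coeffs"
  assumes C: "C < 1 / 2" and Delta: "aw_Delta k l \<noteq> 0" and eps: "\<epsilon> \<in> {1, - 1}" and lin: "linear \<Phi>"
    and rhs: "\<And>p q w f. spin7_rhs k l \<epsilon> (\<Phi> (p, q, w, f)) = \<Phi> (grhs 1 (1 - C) C (p, q, w, f))"
    and pos: "\<And>p q w f. 0 < p \<Longrightarrow> 0 < q \<Longrightarrow> 0 < w \<Longrightarrow> 0 < f \<Longrightarrow> pos_coeffs (\<Phi> (p, q, w, f))"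
    and ext: "\<And>g. (jet g \<longlongrightarrow> (\<Phi> (0, 1, 1, 0), \<Phi> (1, 0, 0, 1))) (at_right 0) \<Longrightarrow> extends_over_orbit k l i g"
    and fib: "\<And>t p q w f. (case \<Phi> (p, q, w, f) of (a, b, c, d) \<Rightarrow> (a / t, b / t, c / t, d)) = \<Phi> (p / t, q / t, w / t, f)"
    and one: "\<And>f0. 0 < f0 \<Longrightarrow> \<exists>f1>0. \<Phi> (1, 1, 1, f0) = (1, 1, 1, f1)"
  shows "\<exists>m \<gamma> p q w f. 0 < m \<and> continuous_family {0<..m} \<gamma> \<and>
    (\<forall>\<theta>\<in>{0<..m}. forward_complete_spin7_metric k l i (\<gamma> \<theta>)) \<and> (\<forall>\<theta>\<in>{0<..<m}. ALC_over_nearly_Kaehler (\<gamma> \<theta>)) \<and>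
    AC_with_limit k l (\<gamma> m) (\<Phi> (p, q, w, f)) \<and> 0 < p \<and> 0 < q \<and> 0 < w \<and> 0 < f \<and>
    grhs 1 (1 - C) C (p, q, w, f) = (p, q, w, f)"
proof -
  obtain m Z where m: "0 < m" and glob: "\<And>\<theta>. \<theta> \<in> {0<..m} \<Longrightarrow> glob C (\<theta> - 1) \<theta> (Z \<theta>)"
    and good: "\<And>\<theta>. \<theta> \<in> {0<..<m} \<Longrightarrow> \<exists>s>0. orbit.good C \<theta> (Z \<theta>) s" and bad: "\<not> (\<exists>s>0. orbit.good C m (Z m) s)"
    and cont: "continuous_on ({0<..m} \<times> {0..}) (\<lambda>(\<theta>, s). Z \<theta> s)"
    using shooting[OF C] by blast
  interpret F: family C m Z
    using m glob cont by (rule family.intro)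
  have bl: "bounded_linear \<Phi>" using lin by (simp add: linear_conv_bounded_linear)
  have bl2: "bounded_linear (\<lambda>z. (\<Phi> (fst z), \<Phi> (snd z)))"
    by (intro bounded_linear_Pair bounded_linear_compose[OF bl] bounded_linear_fst bounded_linear_snd)
  have rhs': "spin7_rhs k l \<epsilon> (\<Phi> h) = \<Phi> (grhs 1 (1 - C) C h)" for h
    using rhs by (cases h) auto
  define \<gamma> where "\<gamma> \<theta> t = \<Phi> (F.gam \<theta> t)" for \<theta> t
  have der: "(\<gamma> \<theta> has_vector_derivative spin7_rhs k l \<epsilon> (\<gamma> \<theta> t)) (at t)" if "\<theta> \<in> {0<..m}" "0 < t" for \<theta> t
    unfolding \<gamma>_def[abs_def] rhs' by (rule bounded_linear.has_vector_derivative[OF bl F.gam_deriv[OF that]])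
  have jet: "jet (\<gamma> \<theta>) t = (\<Phi> (F.gam \<theta> t), \<Phi> (grhs 1 (1 - C) C (F.gam \<theta> t)))" if "\<theta> \<in> {0<..m}" "0 < t" for \<theta> t
    using vector_derivative_at[OF der[OF that]] by (simp add: jet_def \<gamma>_def rhs')
  have P: "pos_coeffs (\<gamma> \<theta> t)" if "\<theta> \<in> {0<..m}" "0 < t" for \<theta> t
    using F.gam_pos[OF that] pos unfolding \<gamma>_def by (cases "F.gam \<theta> t") auto
  have cf: "continuous_family {0<..m} \<gamma>"
    unfolding continuous_family_def
  proof (intro ballI allI impI)
    fix \<theta>0 T :: real assume \<theta>0: "\<theta>0 \<in> {0<..m}" and T: "0 < T"
    have U: "uniform_limit {0<..T} (\<lambda>\<theta> t. (\<Phi> (F.gam \<theta> t), \<Phi> (grhs 1 (1 - C) C (F.gam \<theta> t))))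
        (\<lambda>t. (\<Phi> (F.gam \<theta>0 t), \<Phi> (grhs 1 (1 - C) C (F.gam \<theta>0 t)))) (at \<theta>0 within {0<..m})"
      using bounded_linear.uniform_limit[OF bl2 F.jt_uniform[OF \<theta>0 T]] by simp
    show "uniform_limit {0<..T} (\<lambda>\<theta>. jet (\<gamma> \<theta>)) (jet (\<gamma> \<theta>0)) (at \<theta>0 within {0<..m})"
    proof (rule uniform_limitI)
      fix e :: real assume "0 < e"
      from uniform_limitD[OF U this] have 1: "\<forall>\<^sub>F \<theta> in at \<theta>0 within {0<..m}. \<forall>t\<in>{0<..T}.
        dist (\<Phi> (F.gam \<theta> t), \<Phi> (grhs 1 (1 - C) C (F.gam \<theta> t))) (\<Phi> (F.gam \<theta>0 t), \<Phi> (grhs 1 (1 - C) C (F.gam \<theta>0 t))) < e" .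
      have 2: "\<forall>\<^sub>F \<theta> in at \<theta>0 within {0<..m}. \<theta> \<in> {0<..m}" by (simp add: eventually_at_filter)
      show "\<forall>\<^sub>F \<theta> in at \<theta>0 within {0<..m}. \<forall>t\<in>{0<..T}. dist (jet (\<gamma> \<theta>) t) (jet (\<gamma> \<theta>0) t) < e"
        using 1 2 by eventually_elim (use \<theta>0 in \<open>simp add: jet del: dist_Pair_Pair\<close>)
    qed
  qed
  have fc: "forward_complete_spin7_metric k l i (\<gamma> \<theta>)" if \<theta>: "\<theta> \<in> {0<..m}" for \<theta>
  proof -
    have "spin7_solution_on k l {0<..} (\<gamma> \<theta>)"
      unfolding spin7_solution_on_def using P[OF \<theta>] der[OF \<theta>] eps by blast
    moreover have "((\<lambda>t. (\<Phi> (F.gam \<theta> t), \<Phi> (grhs 1 (1 - C) C (F.gam \<theta> t)))) \<longlongrightarrow> (\<Phi> (0, 1, 1, 0), \<Phi> (1, 0, 0, 1))) (at_right 0)"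
      using bounded_linear.tendsto[OF bl2 F.jt_0[OF \<theta>]] by simp
    then have "(jet (\<gamma> \<theta>) \<longlongrightarrow> (\<Phi> (0, 1, 1, 0), \<Phi> (1, 0, 0, 1))) (at_right 0)"
      by (rule Lim_transform_eventually) (use jet[OF \<theta>] in \<open>simp add: eventually_at_filter\<close>)
    ultimately show ?thesis using ext by (simp add: forward_complete_spin7_metric_def)
  qed
  have alc: "ALC_over_nearly_Kaehler (\<gamma> \<theta>)" if \<theta>: "\<theta> \<in> {0<..<m}" for \<theta>
  proof -
    have \<theta>': "\<theta> \<in> {0<..m}" using \<theta> by simp
    obtain f0 where f0: "0 < f0" "((\<lambda>t. case F.gam \<theta> t of (p, q, w, f) \<Rightarrow> (p / t, q / t, w / t, f)) \<longlongrightarrow> (1, 1, 1, f0)) at_top"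
      using F.good_asymptotics[OF \<theta>' good[OF \<theta>]] by blast
    obtain f1 where f1: "0 < f1" "\<Phi> (1, 1, 1, f0) = (1, 1, 1, f1)" using one[OF f0(1)] by blast
    have "((\<lambda>t. \<Phi> (case F.gam \<theta> t of (p, q, w, f) \<Rightarrow> (p / t, q / t, w / t, f))) \<longlongrightarrow> (1, 1, 1, f1)) at_top"
      using bounded_linear.tendsto[OF bl f0(2)] unfolding f1(2) .
    moreover have "\<Phi> (case F.gam \<theta> t of (p, q, w, f) \<Rightarrow> (p / t, q / t, w / t, f)) = (case \<gamma> \<theta> t of (a, b, c, d) \<Rightarrow> (a / t, b / t, c / t, d))" for t
      unfolding \<gamma>_def by (cases "F.gam \<theta> t") (simp only: fib prod.case)
    ultimately show ?thesis unfolding ALC_over_nearly_Kaehler_def using f1(1) by auto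
  qed
  have mm: "m \<in> {0<..m}" using m by simp
  obtain h where h: "case h of (p, q, w, f) \<Rightarrow> 0 < p \<and> 0 < q \<and> 0 < w \<and> 0 < f" "grhs 1 (1 - C) C h = h"
    "((\<lambda>t. case F.gam m t of (p, q, w, f) \<Rightarrow> (p / t, q / t, w / t, f / t)) \<longlongrightarrow> h) at_top"
    using F.critical_asymptotics[OF mm bad] by blast
  obtain p q w f where hh: "h = (p, q, w, f)" by (cases h)
  have hp: "0 < p" "0 < q" "0 < w" "0 < f" using h(1) by (auto simp: hh)
  obtain a b c d where \<Phi>h: "\<Phi> h = (a, b, c, d)" by (cases "\<Phi> h")
  have abcd: "0 < a" "0 < b" "0 < c" "0 < d" using pos[OF hp] unfolding hh[symmetric] \<Phi>h by (auto simp: pos_coeffs_def)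
  interpret I: invariant_metric k l a b c d by unfold_locales (use Delta abcd in auto)
  have "einstein_with_constant k l 6 (\<Phi> h)"
    unfolding \<Phi>h by (rule I.spin7_cone_einstein[OF eps]) (use rhs'[of h] in \<open>simp add: h(2) \<Phi>h\<close>)
  moreover have "((\<lambda>t. case \<gamma> m t of (a, b, c, f) \<Rightarrow> (a / t, b / t, c / t, f / t)) \<longlongrightarrow> \<Phi> h) at_top"
  proof -
    have "(case \<gamma> m t of (a, b, c, f) \<Rightarrow> (a / t, b / t, c / t, f / t)) =
        \<Phi> (case F.gam m t of (p, q, w, f) \<Rightarrow> (p / t, q / t, w / t, f / t))" for t
    proof -
      have "(case \<gamma> m t of (a, b, c, f) \<Rightarrow> (a / t, b / t, c / t, f / t)) = inverse t *\<^sub>R \<gamma> m t"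
        by (cases "\<gamma> m t") (simp add: divide_inverse mult.commute)
      also have "\<dots> = \<Phi> (inverse t *\<^sub>R F.gam m t)" unfolding \<gamma>_def by (simp add: linear_scale[OF lin])
      also have "inverse t *\<^sub>R F.gam m t = (case F.gam m t of (p, q, w, f) \<Rightarrow> (p / t, q / t, w / t, f / t))"
        by (cases "F.gam m t") (simp add: divide_inverse mult.commute)
      finally show ?thesis .
    qed
    then show ?thesis using bounded_linear.tendsto[OF bl h(3)] by (simp only:)
  qed
  ultimately have "AC_with_limit k l (\<gamma> m) (\<Phi> (p, q, w, f))" by (simp add: AC_with_limit_def hh)
  then show ?thesis using m cf fc alc hp h(2) unfolding hh by blast
qed

section \<open>The three bundles\<close>

locale generic_weights =
  fixes k l :: int
  assumes kl: "0 < k" "0 < l" "k \<noteq> l"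
begin

definition "al = real_of_int (k + l) / (2 * real_of_int (aw_Delta k l))"
definition "be = real_of_int l / (2 * real_of_int (aw_Delta k l))"
definition "ga = real_of_int k / (2 * real_of_int (aw_Delta k l))"

lemma Delta: "0 < aw_Delta k l"
  using kl by (simp add: aw_Delta_def add_pos_pos)

lemma weights: "0 < be" "0 < ga" "al = be + ga" "be < ga \<longleftrightarrow> l < k" "ga < be \<longleftrightarrow> k < l"
  using kl Delta by (auto simp: al_def be_def ga_def add_divide_distrib divide_less_cancel)

text \<open>Since f is rescaled by the weight of the collapsing plane, the slope 1 of the normalised
  fibre becomes the slope prescribed on the singular orbit.\<close>

lemma inverse_weights: "1 / al = 2 * real_of_int (aw_Delta k l) / real_of_int (k + l)"
  "1 / be = 2 * real_of_int (aw_Delta k l) / real_of_int l" "1 / ga = 2 * real_of_int (aw_Delta k l) / real_of_int k"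
  by (simp_all add: al_def be_def ga_def)

lemma spin7_rhs_weights: "spin7_rhs k l \<epsilon> (a, b, c, f) =
     (a * (b/(a*c) + c/(a*b) - a/(b*c) + (- \<epsilon> * al) * (f / a^2)), b * (c/(a*b) + a/(b*c) - b/(a*c) + (\<epsilon> * be) * (f / b^2)),
      c * (a/(b*c) + b/(a*c) - c/(a*b) + (\<epsilon> * ga) * (f / c^2)), f * ((\<epsilon> * al) * (f / a^2) + (- \<epsilon> * be) * (f / b^2) + (- \<epsilon> * ga) * (f / c^2)))"
  unfolding spin7_rhs_def al_def[symmetric] be_def[symmetric] ga_def[symmetric] by simp

lemma rescale: "x * (f / A / z) = (x / A) * (f / z)" for x f A z :: real
  by simp

lemma grhs_weights: "grhs 1 (1 - C) C (p, q, w, f) =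
     (p * (q/(p*w) + w/(p*q) - p/(q*w) + (- 1) * (f / p\<^sup>2)), q * (w/(p*q) + p/(q*w) - q/(p*w) + (1 - C) * (f / q\<^sup>2)),
      w * (p/(q*w) + q/(p*w) - w/(p*q) + C * (f / w\<^sup>2)), f * (1 * (f / p\<^sup>2) + (- (1 - C)) * (f / q\<^sup>2) + (- C) * (f / w\<^sup>2)))"
  unfolding grhs_def prod.case
  by (simp only: mult_minus_left diff_conv_add_uminus mult_1_left prod.inject simp_thms add.assoc)

text \<open>The sign \<epsilon> and the cone equation for h are recorded because they identify the
  limits for the indices k and l later.\<close>

definition "outcome i \<epsilon> = (\<lambda>h m \<gamma>. 0 < (m::real) \<and> continuous_family {0<..m} \<gamma> \<and>
    (\<forall>\<theta>\<in>{0<..m}. forward_complete_spin7_metric k l i (\<gamma> \<theta>)) \<and> (\<forall>\<theta>\<in>{0<..<m}. ALC_over_nearly_Kaehler (\<gamma> \<theta>)) \<and>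
    AC_with_limit k l (\<gamma> m) h \<and> pos_coeffs h \<and> spin7_rhs k l \<epsilon> h = h)"

lemma outcome_exists:
  fixes \<Phi> :: "real \<times> real \<times> real \<times> real \<Rightarrow> aw_coeffs"
  assumes C: "C < 1 / 2" and eps: "\<epsilon> \<in> {1, - 1}" and lin: "linear \<Phi>"
    and rhs: "\<And>p q w f. spin7_rhs k l \<epsilon> (\<Phi> (p, q, w, f)) = \<Phi> (grhs 1 (1 - C) C (p, q, w, f))"
    and pos: "\<And>p q w f. 0 < p \<Longrightarrow> 0 < q \<Longrightarrow> 0 < w \<Longrightarrow> 0 < f \<Longrightarrow> pos_coeffs (\<Phi> (p, q, w, f))"
    and ext: "\<And>g. (jet g \<longlongrightarrow> (\<Phi> (0, 1, 1, 0), \<Phi> (1, 0, 0, 1))) (at_right 0) \<Longrightarrow> extends_over_orbit k l i g"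
    and fib: "\<And>t p q w f. (case \<Phi> (p, q, w, f) of (a, b, c, d) \<Rightarrow> (a / t, b / t, c / t, d)) = \<Phi> (p / t, q / t, w / t, f)"
    and one: "\<And>f0. 0 < f0 \<Longrightarrow> \<exists>f1>0. \<Phi> (1, 1, 1, f0) = (1, 1, 1, f1)"
  shows "\<exists>m \<gamma> p q w f. outcome i \<epsilon> (\<Phi> (p, q, w, f)) m \<gamma> \<and> 0 < p \<and> 0 < q \<and> 0 < w \<and> 0 < f \<and> p < q \<and> (0 < C \<longrightarrow> p < w)"
proof -
  have D: "aw_Delta k l \<noteq> 0" using Delta by simp
  obtain m \<gamma> p q w f where *: "0 < m" "continuous_family {0<..m} \<gamma>"
    "\<forall>\<theta>\<in>{0<..m}. forward_complete_spin7_metric k l i (\<gamma> \<theta>)" "\<forall>\<theta>\<in>{0<..<m}. ALC_over_nearly_Kaehler (\<gamma> \<theta>)"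
    "AC_with_limit k l (\<gamma> m) (\<Phi> (p, q, w, f))" and p: "0 < p" "0 < q" "0 < w" "0 < f"
    and g: "grhs 1 (1 - C) C (p, q, w, f) = (p, q, w, f)"
    using transported_family[OF C D eps lin rhs pos ext fib one] by blast
  have "outcome i \<epsilon> (\<Phi> (p, q, w, f)) m \<gamma>" using * pos[OF p] rhs[of p q w f] g by (simp add: outcome_def)
  then show ?thesis using p cone_crit(3,4)[OF p C g] by blast
qed

text \<open>With the upper sign the first plane has the negative fibre term, so it can collapse. To
  have C < 1/2, the smaller of the weights \<open>be\<close> and \<open>ga\<close> goes to the third
  abstract plane. Depending on the case, a < b is p < q or p < w.\<close>

lemma outcome_k_plus_l: "\<exists>m \<gamma> a b c f. outcome (k + l) 1 (a, b, c, f) m \<gamma> \<and> a < b"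
proof (cases "k < l")
  case True
  define C where "C = ga / al"
  have nz: "al \<noteq> 0" "0 < al" using weights by auto
  have C: "0 < C" "C < 1 / 2" "be / al = 1 - C"
    using weights True kl nz by (auto simp: C_def field_simps)
  let ?\<Phi> = "\<lambda>h :: real \<times> real \<times> real \<times> real. (fst h, fst (snd h), fst (snd (snd h)), snd (snd (snd h)) / al)"
  have co: "(- 1 * al) / al = - 1" "(1 * al) / al = 1" "(1 * be) / al = 1 - C" "(1 * ga) / al = C" "(- 1 * be) / al = - (1 - C)" "(- 1 * ga) / al = - C"
    using nz C(3) by (simp_all add: C_def)
  have "\<exists>m \<gamma> p q w f. outcome (k + l) 1 (?\<Phi> (p, q, w, f)) m \<gamma> \<and> 0 < p \<and> 0 < q \<and> 0 < w \<and> 0 < f \<and> p < q \<and> (0 < C \<longrightarrow> p < w)"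
  proof (rule outcome_exists[where \<Phi> = ?\<Phi>, OF C(2)])
    show "linear ?\<Phi>" by (rule linearI) (auto simp: add_divide_distrib)
    show "spin7_rhs k l 1 (?\<Phi> (p, q, w, f)) = ?\<Phi> (grhs 1 (1 - C) C (p, q, w, f))" for p q w f
      unfolding fst_conv snd_conv spin7_rhs_weights rescale co grhs_weights by (simp add: mult.commute add.commute)
    fix g :: aw_path assume "(jet g \<longlongrightarrow> (?\<Phi> (0, 1, 1, 0), ?\<Phi> (1, 0, 0, 1))) (at_right 0)"
    then show "extends_over_orbit k l (k + l) g" unfolding extends_over_orbit_def
      by (intro disjI1 conjI exI[of _ 1]) (simp_all only: fst_conv snd_conv inverse_weights div_0 zero_less_one simp_thms)
  qed (use nz in \<open>auto simp: pos_coeffs_def\<close>)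
  then show ?thesis by (simp only: fst_conv snd_conv) blast
next
  case False
  define C where "C = be / al"
  have nz: "al \<noteq> 0" "0 < al" using weights by auto
  have C: "0 < C" "C < 1 / 2" "ga / al = 1 - C"
    using weights False kl nz by (auto simp: C_def field_simps)
  let ?\<Phi> = "\<lambda>h :: real \<times> real \<times> real \<times> real. (fst h, fst (snd (snd h)), fst (snd h), snd (snd (snd h)) / al)"
  have co: "(- 1 * al) / al = - 1" "(1 * al) / al = 1" "(1 * ga) / al = 1 - C" "(1 * be) / al = C" "(- 1 * ga) / al = - (1 - C)" "(- 1 * be) / al = - C"
    using nz C(3) by (simp_all add: C_def)
  have "\<exists>m \<gamma> p q w f. outcome (k + l) 1 (?\<Phi> (p, q, w, f)) m \<gamma> \<and> 0 < p \<and> 0 < q \<and> 0 < w \<and> 0 < f \<and> p < q \<and> (0 < C \<longrightarrow> p < w)"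
  proof (rule outcome_exists[where \<Phi> = ?\<Phi>, OF C(2)])
    show "linear ?\<Phi>" by (rule linearI) (auto simp: add_divide_distrib)
    show "spin7_rhs k l 1 (?\<Phi> (p, q, w, f)) = ?\<Phi> (grhs 1 (1 - C) C (p, q, w, f))" for p q w f
      unfolding fst_conv snd_conv spin7_rhs_weights rescale co grhs_weights by (simp add: mult.commute add.commute)
    fix g :: aw_path assume "(jet g \<longlongrightarrow> (?\<Phi> (0, 1, 1, 0), ?\<Phi> (1, 0, 0, 1))) (at_right 0)"
    then show "extends_over_orbit k l (k + l) g" unfolding extends_over_orbit_def
      by (intro disjI1 conjI exI[of _ 1]) (simp_all only: fst_conv snd_conv inverse_weights div_0 zero_less_one simp_thms)
  qed (use nz in \<open>auto simp: pos_coeffs_def\<close>)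
  then show ?thesis using C(1) by (simp only: fst_conv snd_conv) blast
qed

text \<open>The lower sign makes the fibre terms of the second and third planes negative. With the
  second one collapsing, C = - ga / be < 0, and the first plane takes the place of q, so b < a is p
  < q.\<close>

lemma outcome_l: "\<exists>m \<gamma> a b c f. outcome l (- 1) (a, b, c, f) m \<gamma> \<and> b < a"
proof -
  define C where "C = - ga / be"
  have nz: "be \<noteq> 0" "0 < be" "0 < ga" using weights by auto
  have C: "C < 1 / 2" "al / be = 1 - C"
    using nz by (simp_all add: C_def weights(3) field_simps add_pos_pos)
  let ?\<Phi> = "\<lambda>h :: real \<times> real \<times> real \<times> real. (fst (snd h), fst h, fst (snd (snd h)), snd (snd (snd h)) / be)"
  have co: "(- (- 1) * al) / be = 1 - C" "(- 1 * al) / be = - (1 - C)" "(- 1 * be) / be = - 1" "(- 1 * ga) / be = C" "(- (- 1) * be) / be = 1" "(- (- 1) * ga) / be = - C"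
    using nz C(2) by (simp_all add: C_def)
  have "\<exists>m \<gamma> p q w f. outcome l (- 1) (?\<Phi> (p, q, w, f)) m \<gamma> \<and> 0 < p \<and> 0 < q \<and> 0 < w \<and> 0 < f \<and> p < q \<and> (0 < C \<longrightarrow> p < w)"
  proof (rule outcome_exists[where \<Phi> = ?\<Phi>, OF C(1)])
    show "linear ?\<Phi>" by (rule linearI) (auto simp: add_divide_distrib)
    show "spin7_rhs k l (- 1) (?\<Phi> (p, q, w, f)) = ?\<Phi> (grhs 1 (1 - C) C (p, q, w, f))" for p q w f
      unfolding fst_conv snd_conv spin7_rhs_weights rescale co grhs_weights by (simp add: mult.commute add.commute)
    fix g :: aw_path assume "(jet g \<longlongrightarrow> (?\<Phi> (0, 1, 1, 0), ?\<Phi> (1, 0, 0, 1))) (at_right 0)"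
    then have "\<exists>b0>0. (jet g \<longlongrightarrow> ((b0, 0, b0, 0), (0, 1, 0, 2 * real_of_int (aw_Delta k l) / real_of_int l))) (at_right 0)"
      by (intro exI[of _ 1] conjI) (simp_all only: fst_conv snd_conv inverse_weights div_0 zero_less_one simp_thms)
    then show "extends_over_orbit k l l g" unfolding extends_over_orbit_def by blast
  qed (use nz in \<open>auto simp: pos_coeffs_def\<close>)
  then show ?thesis by (simp only: fst_conv snd_conv) blast
qed

lemma outcome_k: "\<exists>m \<gamma> h. outcome k (- 1) h m \<gamma>"
proof -
  define C where "C = - be / ga"
  have nz: "ga \<noteq> 0" "0 < ga" "0 < be" using weights by auto
  have C: "C < 1 / 2" "al / ga = 1 - C"
    using nz by (simp_all add: C_def weights(3) field_simps add_pos_pos)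
  let ?\<Phi> = "\<lambda>h :: real \<times> real \<times> real \<times> real. (fst (snd h), fst (snd (snd h)), fst h, snd (snd (snd h)) / ga)"
  have co: "(- (- 1) * al) / ga = 1 - C" "(- 1 * al) / ga = - (1 - C)" "(- 1 * ga) / ga = - 1" "(- 1 * be) / ga = C" "(- (- 1) * ga) / ga = 1" "(- (- 1) * be) / ga = - C"
    using nz C(2) by (simp_all add: C_def)
  have "\<exists>m \<gamma> p q w f. outcome k (- 1) (?\<Phi> (p, q, w, f)) m \<gamma> \<and> 0 < p \<and> 0 < q \<and> 0 < w \<and> 0 < f \<and> p < q \<and> (0 < C \<longrightarrow> p < w)"
  proof (rule outcome_exists[where \<Phi> = ?\<Phi>, OF C(1)])
    show "linear ?\<Phi>" by (rule linearI) (auto simp: add_divide_distrib)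
    show "spin7_rhs k l (- 1) (?\<Phi> (p, q, w, f)) = ?\<Phi> (grhs 1 (1 - C) C (p, q, w, f))" for p q w f
      unfolding fst_conv snd_conv spin7_rhs_weights rescale co grhs_weights by (simp add: mult.commute add.commute)
    fix g :: aw_path assume "(jet g \<longlongrightarrow> (?\<Phi> (0, 1, 1, 0), ?\<Phi> (1, 0, 0, 1))) (at_right 0)"
    then show "extends_over_orbit k l k g" unfolding extends_over_orbit_def
      by (intro disjI2, intro conjI exI[of _ 1]) (simp_all only: fst_conv snd_conv inverse_weights div_0 zero_less_one simp_thms)
  qed (use nz in \<open>auto simp: pos_coeffs_def\<close>)
  then show ?thesis by blast
qed

text \<open>The cone equation does not see which plane collapses. Every cone for the lower sign can
  thus be brought into the normal form with C = - ga / be, where \<open>cone_unique\<close>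
  applies.\<close>

lemma negative_cone_unique:
  assumes h: "pos_coeffs h" "spin7_rhs k l (- 1) h = h" and h': "pos_coeffs h'" "spin7_rhs k l (- 1) h' = h'"
  shows "h = h'"
proof -
  define C where "C = - ga / be"
  have nz: "be \<noteq> 0" "0 < be" "0 < ga" using weights by auto
  have C: "C < 1 / 2" "al / be = 1 - C"
    using nz by (simp_all add: C_def weights(3) field_simps add_pos_pos)
  have co: "(- (- 1) * al) / be = 1 - C" "(- 1 * al) / be = - (1 - C)" "(- 1 * be) / be = - 1" "(- 1 * ga) / be = C" "(- (- 1) * be) / be = 1" "(- (- 1) * ga) / be = - C"
    using nz C(2) by (simp_all add: C_def)
  have red: "0 < a \<and> 0 < b \<and> 0 < c \<and> 0 < f * be \<and> grhs 1 (1 - C) C (b, a, c, f * be) = (b, a, c, f * be)"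
    if p: "pos_coeffs (a, b, c, f)" and e: "spin7_rhs k l (- 1) (a, b, c, f) = (a, b, c, f)" for a b c f
  proof -
    have f: "f = f * be / be" using nz by simp
    have g: "spin7_rhs k l (- 1) (a, b, c, F / be) = (case grhs 1 (1 - C) C (b, a, c, F) of (p, q, w, f) \<Rightarrow> (q, p, w, f / be))" for F
      unfolding spin7_rhs_weights rescale co grhs_weights by (simp add: mult.commute add.commute)
    obtain x y z t where xyz: "grhs 1 (1 - C) C (b, a, c, f * be) = (x, y, z, t)" by (cases "grhs 1 (1 - C) C (b, a, c, f * be)")
    have "(y, x, z, t / be) = (a, b, c, f)" using g[of "f * be"] e unfolding f[symmetric] xyz by simp
    then have "x = b" "y = a" "z = c" "t = f * be" using nz by (auto simp: field_simps)
    then show ?thesis using xyz p nz by (simp add: pos_coeffs_def)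
  qed
  obtain a b c f a' b' c' f' where e: "h = (a, b, c, f)" "h' = (a', b', c', f')" by (cases h, cases h') auto
  have r: "0 < a \<and> 0 < b \<and> 0 < c \<and> 0 < f * be \<and> grhs 1 (1 - C) C (b, a, c, f * be) = (b, a, c, f * be)"
    "0 < a' \<and> 0 < b' \<and> 0 < c' \<and> 0 < f' * be \<and> grhs 1 (1 - C) C (b', a', c', f' * be) = (b', a', c', f' * be)"
    using red h h' unfolding e by blast+
  then have "(b, a, c, f * be) = (b', a', c', f' * be)" by (intro cone_unique[OF C(1)]) blast+
  then show ?thesis using nz by (simp add: e)
qed

end

theorem theorem1p1:
  fixes k l :: int
  assumes "0 \<le> k" and "0 \<le> l" and "coprime k l" and "k * l * (k - l) \<noteq> 0"
  shows "\<exists>(\<theta>max :: int \<Rightarrow> real) (\<gamma> :: int \<Rightarrow> real \<Rightarrow> aw_path).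
    (\<forall>i\<in>{k + l, l, k}.
       \<theta>max i > 0 \<and>
       continuous_family {0<..\<theta>max i} (\<gamma> i) \<and>
       (\<forall>\<theta>\<in>{0<..\<theta>max i}. forward_complete_spin7_metric k l i (\<gamma> i \<theta>)) \<and>
       (\<forall>\<theta>\<in>{0<..<\<theta>max i}. ALC_over_nearly_Kaehler (\<gamma> i \<theta>)) \<and>
       (\<exists>h. AC_with_limit k l (\<gamma> i (\<theta>max i)) h)) \<and>
    (\<exists>h h'.
       AC_with_limit k l (\<gamma> k (\<theta>max k)) h \<and>
       AC_with_limit k l (\<gamma> l (\<theta>max l)) h \<and>
       AC_with_limit k l (\<gamma> (k + l) (\<theta>max (k + l))) h' \<and>
       \<not> equivariantly_homothetic k l h h')"
proof -
  have kl: "0 < k" "0 < l" "k \<noteq> l" using assms by (auto simp: less_le)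
  interpret G: generic_weights k l using kl by (rule generic_weights.intro)
  obtain m1 \<gamma>1 a' b' c' f' where 1: "G.outcome (k + l) 1 (a', b', c', f') m1 \<gamma>1" "a' < b'"
    using G.outcome_k_plus_l by (elim exE conjE) (rule that)
  obtain m2 \<gamma>2 a b c f where 2: "G.outcome l (- 1) (a, b, c, f) m2 \<gamma>2" "b < a"
    using G.outcome_l by (elim exE conjE) (rule that)
  obtain m3 \<gamma>3 h3 where 3: "G.outcome k (- 1) h3 m3 \<gamma>3" using G.outcome_k by (elim exE) (rule that)
  note o1 = 1(1)[unfolded G.outcome_def] and o2 = 2(1)[unfolded G.outcome_def] and o3 = 3[unfolded G.outcome_def]
  have h3: "h3 = (a, b, c, f)" by (rule G.negative_cone_unique) (use o2 o3 in blast)+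
  define \<theta>max where "\<theta>max i = (if i = k + l then m1 else if i = l then m2 else m3)" for i
  define \<gamma> where "\<gamma> i = (if i = k + l then \<gamma>1 else if i = l then \<gamma>2 else \<gamma>3)" for i
  have v: "\<theta>max (k + l) = m1" "\<theta>max l = m2" "\<theta>max k = m3" "\<gamma> (k + l) = \<gamma>1" "\<gamma> l = \<gamma>2" "\<gamma> k = \<gamma>3"
    using kl by (auto simp: \<theta>max_def \<gamma>_def)
  let ?P = "\<lambda>i. \<theta>max i > 0 \<and> continuous_family {0<..\<theta>max i} (\<gamma> i) \<and>
       (\<forall>\<theta>\<in>{0<..\<theta>max i}. forward_complete_spin7_metric k l i (\<gamma> i \<theta>)) \<and>
       (\<forall>\<theta>\<in>{0<..<\<theta>max i}. ALC_over_nearly_Kaehler (\<gamma> i \<theta>)) \<and>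
       (\<exists>h. AC_with_limit k l (\<gamma> i (\<theta>max i)) h)"
  have "?P (k + l)" "?P l" "?P k" unfolding v using o1 o2 o3 by blast+
  then have "\<forall>i\<in>{k + l, l, k}. ?P i" by blast
  moreover have "\<not> equivariantly_homothetic k l (a, b, c, f) (a', b', c', f')"
    by (rule not_equivariantly_homothetic[OF kl]) (use o1 o2 1(2) 2(2) in blast)+
  then have "\<exists>h h'. AC_with_limit k l (\<gamma> k (\<theta>max k)) h \<and> AC_with_limit k l (\<gamma> l (\<theta>max l)) h \<and>
       AC_with_limit k l (\<gamma> (k + l) (\<theta>max (k + l))) h' \<and> \<not> equivariantly_homothetic k l h h'"
    unfolding v using o1 o2 o3[unfolded h3] by blast
  ultimately show ?thesis by (intro exI[of _ \<theta>max] exI[of _ \<gamma>] conjI)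
qed

end
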